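(* Let $\gamma_\pm>1$, $\mu>0$, and let $R_0,Q_0,u_0$ satisfy $$0<\underline{R_0}\le R_0\le\overline{R_0}<\infty,\qquad 0<\underline{Q_0}\le Q_0\le\overline{Q_0}<\infty,\qquad u_0\in L^2$$ (with constants $\underline{R_0},\overline{R_0},\underline{Q_0},\overline{Q_0}$, a.e. on $(0,1)$). Let $(R,Q,u)$ be the unique global-in-time weak solution to problem (P) with initial data $(R_0,Q_0,u_0)$, and let $(R_\infty,Q_\infty,u_\infty)$ be the unique steady state associated with the data. Then there exist positive constants $C_1,C_2$ independent of time such that for any $t\ge0$ $$\|(R-R_\infty,\;Q-Q_\infty,\;u-u_\infty)(\cdot,t)\|_{L^2}\le C_1\exp(-C_2t).$$
   Context: Notation: $L^p=L^p((0,1))$; functions depend on $(y,t)$ with $y\in[0,1]$, $t\ge0$. Put $\gamma:=\gamma_+/\gamma_-$. For given positive numbers $R,Q$, $Z=Z(R,Q)$ denotes the unique number with $$Q=\left(1-\frac RZ\right)Z^\gamma,\qquad R\le Z.$$ Put $\tau:=(R+Q)^{-1}$, $\tau_0:=(R_0+Q_0)^{-1}$. Problem (P) (one-dimensional compressible two-fluid system in Lagrangian coordinates), for unknowns $R,Q>0$ and $u$: $$\partial_t\tau=\partial_yu,\qquad \partial_t(Q\tau)=0,\qquad \partial_tu=\partial_y\left(\mu\tau^{-1}\partial_yu-Z(R,Q)^{\gamma_+}\right),$$ with $(R,Q,u)(y,0)=(R_0,Q_0,u_0)(y)$ for $y\in[0,1]$ and $u(0,t)=u(1,t)=0$ for $t\ge0$.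 Weak solution: a triple $(R,Q,u)$ is a weak solution of (P) on $[0,1]\times[0,T]$ if (i) $\partial_tR,\partial_tQ,\partial_yu\in L^2(0,T;L^2)$ and $u\in L^\infty(0,T;L^2)$, with $u(0,t)=u(1,t)=0$ for a.e. $t$; (ii) $0<R(y,t),Q(y,t)<\infty$ a.e. in $(0,1)\times(0,T)$; (iii) $\partial_t\tau=\partial_yu$, $R=R_0\tau_0\tau^{-1}$, $Q=Q_0\tau_0\tau^{-1}$ a.e. in $(0,1)\times(0,T)$, with $\tau(\cdot,0)=\tau_0$; (iv) with $Z=Z(R,Q)$ (and $Z^{\gamma_+}$ locally integrable on $(0,1)\times[0,T)$, so that the integral makes sense), $$\int_0^T\int_0^1\left(u\,\partial_t\phi-\left(\mu\frac{\partial_yu}{\tau}-Z^{\gamma_+}\right)\partial_y\phi\right)dy\,ds+\int_0^1u_0\,\phi(\cdot,0)\,dy=0$$ for every $\phi\in C_c^\infty((0,1)\times[0,T))$. A global-in-time weak solution is a triple defined for all $t\ge0$ that is a weak solution on $[0,1]\times[0,T]$ for every $0<T<\infty$. Under the stated hypotheses on the data it exists and is unique. Its values at a time $t$ are those of the representative continuous in time with values in $L^2$. Steady state: $(R_\infty,Q_\infty,u_\infty)$ is given implicitly (as functions of $y$) by $$Q_\infty=Q_0\tau_0\tau_\infty^{-1},\quad R_\infty=R_0\tau_0\tau_\infty^{-1},\quad \tau_\infty:=(R_\infty+Q_\infty)^{-1},\quad u_\infty=0,\quad Z_\infty^{\gamma_+}=C_\star,$$ $$Q_\infty=\left(1-\frac{R_\infty}{Z_\infty}\right)Z_\infty^\gamma,\quad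 R_\infty\le Z_\infty,\quad \int_0^1\tau_\infty\,dy=\int_0^1\tau_0\,dy,$$ where $C_\star$ is the positive constant uniquely determined by $R_0,Q_0,\gamma_\pm$ and the last condition. *)

theory Defs
  imports "HOL-Analysis.Analysis"
begin

definition in_L2 :: "'a measure \<Rightarrow> ('a \<Rightarrow> real) \<Rightarrow> bool" where
  "in_L2 M f \<longleftrightarrow> f \<in> borel_measurable M \<and> integrable M (\<lambda>x. (f x)\<^sup>2)"

definition L2_norm :: "'a measure \<Rightarrow> ('a \<Rightarrow> real) \<Rightarrow> real" where
  "L2_norm M f = sqrt (\<integral>x. (f x)\<^sup>2 \<partial>M)"

definition locally_integrable :: "'a::euclidean_space set \<Rightarrow> ('a \<Rightarrow> real) \<Rightarrow> bool" where
  "locally_integrable S f \<longleftrightarrow>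
     (\<forall>K. compact K \<and> K \<subseteq> S \<longrightarrow> integrable (lebesgue_on K) f)"

abbreviation dir_deriv :: "'a::euclidean_space \<Rightarrow> ('a \<Rightarrow> real) \<Rightarrow> 'a \<Rightarrow> real" where
  "dir_deriv v f x \<equiv> frechet_derivative f (at x) v"

primrec C_order :: "nat \<Rightarrow> ('a::euclidean_space \<Rightarrow> real) \<Rightarrow> bool" where
  "C_order 0 f \<longleftrightarrow> continuous_on UNIV f"
| "C_order (Suc k) f \<longleftrightarrow>
     f differentiable_on UNIV \<and> (\<forall>b\<in>Basis. C_order k (dir_deriv b f))"

definition test_function :: "'a::euclidean_space set \<Rightarrow> ('a \<Rightarrow> real) \<Rightarrow> bool" where
  "test_function U \<phi> \<longleftrightarrow>
     (\<forall>k. C_order k \<phi>) \<and> compact (closure {x. \<phi> x \<noteq> 0}) \<and> closure {x. \<phi> x \<noteq> 0} \<subseteq> U"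

definition weak_deriv ::
  "'a::euclidean_space set \<Rightarrow> 'a \<Rightarrow> ('a \<Rightarrow> real) \<Rightarrow> ('a \<Rightarrow> real) \<Rightarrow> bool" where
  "weak_deriv U v f g \<longleftrightarrow>
     locally_integrable U f \<and> locally_integrable U g \<and>
     (\<forall>\<phi>. test_function U \<phi> \<longrightarrow>
        (\<integral>x. f x * dir_deriv v \<phi> x \<partial>lebesgue_on U) = - (\<integral>x. g x * \<phi> x \<partial>lebesgue_on U))"

text \<open>Functions of \<open>(y, t)\<close> are curried, with \<open>y\<close> first; \<open>(1, 0)\<close> and \<open>(0, 1)\<close> are the
  directions of \<open>\<partial>\<^sub>y\<close> and \<open>\<partial>\<^sub>t\<close>.\<close>

abbreviation unit_space :: "real measure" where
  "unit_space \<equiv> lebesgue_on {0<..<1}"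

abbreviation cylinder :: "real \<Rightarrow> (real \<times> real) set" where
  "cylinder T \<equiv> {0<..<1} \<times> {0<..<T}"

text \<open>\<open>L\<^sup>2(0,T;L\<^sup>2)\<close> is identified with the square-integrable functions on the cylinder.\<close>

definition in_Linf_L2 :: "real \<Rightarrow> (real \<Rightarrow> real \<Rightarrow> real) \<Rightarrow> bool" where
  "in_Linf_L2 T f \<longleftrightarrow>
     case_prod f \<in> borel_measurable (lebesgue_on (cylinder T)) \<and>
     (\<exists>B. AE t in lebesgue_on {0<..<T}.
        in_L2 unit_space (\<lambda>y. f y t) \<and> L2_norm unit_space (\<lambda>y. f y t) \<le> B)"

definition L2_continuous_in_time :: "real set \<Rightarrow> (real \<Rightarrow> real \<Rightarrow> real) \<Rightarrow> bool" where
  "L2_continuous_in_time I f \<longleftrightarrow>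
     (\<forall>t\<in>I. in_L2 unit_space (\<lambda>y. f y t)) \<and>
     (\<forall>t\<in>I. ((\<lambda>s. L2_norm unit_space (\<lambda>y. f y s - f y t)) \<longlongrightarrow> 0) (at t within I))"

text \<open>The value at time 0 of a function determined only almost everywhere on the cylinder is
  that of its representative in \<open>C([0,T];L\<^sup>2)\<close>.\<close>

definition has_initial_value ::
  "real \<Rightarrow> (real \<Rightarrow> real \<Rightarrow> real) \<Rightarrow> (real \<Rightarrow> real) \<Rightarrow> bool" where
  "has_initial_value T f f0 \<longleftrightarrow>
     (\<exists>F. (AE (y, t) in lebesgue_on (cylinder T). F y t = f y t) \<and>
          L2_continuous_in_time {0..T} F \<and> (AE y in unit_space. F y 0 = f0 y))"

text \<open>For a.e. \<open>t\<close> the slice of a function with \<open>\<partial>\<^sub>y f \<in> L\<^sup>2(0,T;L\<^sup>2)\<close> has a unique representative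
  continuous on \<open>[0,1]\<close>; its boundary values are those of this representative.\<close>

definition zero_boundary_values :: "real \<Rightarrow> (real \<Rightarrow> real \<Rightarrow> real) \<Rightarrow> bool" where
  "zero_boundary_values T f \<longleftrightarrow>
     (AE t in lebesgue_on {0<..<T}. \<exists>v. continuous_on {0..1} v \<and>
        (AE y in unit_space. f y t = v y) \<and> v 0 = 0 \<and> v 1 = 0)"

definition Zfun :: "real \<Rightarrow> real \<Rightarrow> real \<Rightarrow> real" where
  "Zfun \<gamma> r q = (THE Z. q = (1 - r / Z) * Z powr \<gamma> \<and> r \<le> Z)"

lemma Zfun_unique:
  fixes \<gamma> r q :: real
  assumes "0 < \<gamma>" "0 < r" "0 < q"
  shows "\<exists>!Z. q = (1 - r / Z) * Z powr \<gamma> \<and> r \<le> Z"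
proof -
  let ?f = "\<lambda>Z::real. (1 - r / Z) * Z powr \<gamma>"
  have less: "?f a < ?f b" if "r \<le> a" "a < b" for a b
  proof -
    have "r / b < r / a" using that assms by (simp add: divide_strict_left_mono)
    moreover have "r / a \<le> 1" using that assms by simp
    moreover have "a powr \<gamma> < b powr \<gamma>"
      using that assms by (intro powr_less_mono2) auto
    moreover have "0 < a powr \<gamma>" using that assms by simp
    ultimately show ?thesis by (intro mult_strict_mono') auto
  qed
  define b where "b = max (2 * r) ((2 * q) powr (1 / \<gamma>))"
  have b: "2 * r \<le> b" "0 < b" "r \<le> b" using assms by (auto simp: b_def)
  have "2 * q = ((2 * q) powr (1 / \<gamma>)) powr \<gamma>" using assms by (simp add: powr_powr)
  also have "\<dots> \<le> b powr \<gamma>" using assms by (intro powr_mono2) (auto simp: b_def)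
  finally have "2 * q \<le> b powr \<gamma>" .
  moreover have "1 / 2 \<le> 1 - r / b" using b by (simp add: field_simps)
  ultimately have "1 / 2 * (2 * q) \<le> ?f b" using assms b by (intro mult_mono) auto
  then have "q \<le> ?f b" by simp
  moreover have "?f r \<le> q" using assms by simp
  moreover have "continuous_on {r..b} ?f" using assms by (intro continuous_intros) auto
  ultimately obtain Z where "r \<le> Z" "?f Z = q" using IVT'[of ?f r q b] b by auto
  then show ?thesis using less by (intro ex1I[of _ Z]) (auto, metis linorder_neqE_linordered_idom less_irrefl)
qed

abbreviation spec_vol :: "real \<Rightarrow> real \<Rightarrow> real" where
  "spec_vol r q \<equiv> 1 / (r + q)"

text \<open>The smooth functions with compact support in \<open>(0,1) \<times> [0,T)\<close> are the restrictions to
  \<open>t \<ge> 0\<close> of those with compact support in the open set \<open>(0,1) \<times> (-\<infinity>,T)\<close>.\<close>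

definition weak_solution ::
  "real \<Rightarrow> real \<Rightarrow> real \<Rightarrow> (real \<Rightarrow> real) \<Rightarrow> (real \<Rightarrow> real) \<Rightarrow> (real \<Rightarrow> real) \<Rightarrow> real \<Rightarrow>
   (real \<Rightarrow> real \<Rightarrow> real) \<Rightarrow> (real \<Rightarrow> real \<Rightarrow> real) \<Rightarrow> (real \<Rightarrow> real \<Rightarrow> real) \<Rightarrow> bool" where
  "weak_solution \<gamma>p \<gamma>m \<mu> R0 Q0 u0 T R Q u \<longleftrightarrow>
    (let \<tau>0 = (\<lambda>y. spec_vol (R0 y) (Q0 y));
         \<tau> = (\<lambda>y t. spec_vol (R y t) (Q y t));
         p = (\<lambda>y t. Zfun (\<gamma>p / \<gamma>m) (R y t) (Q y t) powr \<gamma>p)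
     in
     (\<exists>Rt. weak_deriv (cylinder T) (0, 1) (case_prod R) Rt \<and> in_L2 (lebesgue_on (cylinder T)) Rt) \<and>
     (\<exists>Qt. weak_deriv (cylinder T) (0, 1) (case_prod Q) Qt \<and> in_L2 (lebesgue_on (cylinder T)) Qt) \<and>
     in_Linf_L2 T u \<and>
     (\<exists>uy. weak_deriv (cylinder T) (1, 0) (case_prod u) (case_prod uy) \<and>
           in_L2 (lebesgue_on (cylinder T)) (case_prod uy) \<and>
           zero_boundary_values T u \<and>
           (AE (y, t) in lebesgue_on (cylinder T). 0 < R y t \<and> 0 < Q y t) \<and>
           weak_deriv (cylinder T) (0, 1) (case_prod \<tau>) (case_prod uy) \<and>
           (AE (y, t) in lebesgue_on (cylinder T).
              R y t = R0 y * \<tau>0 y / \<tau> y t \<and> Q y t = Q0 y * \<tau>0 y / \<tau> y t) \<and>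
           has_initial_value T \<tau> \<tau>0 \<and>
           locally_integrable ({0<..<1} \<times> {0..<T}) (case_prod p) \<and>
           (\<forall>\<phi>. test_function ({0<..<1} \<times> {..<T}) \<phi> \<longrightarrow>
              (\<integral>(y, t). u y t * dir_deriv (0, 1) \<phi> (y, t)
                  - (\<mu> * uy y t / \<tau> y t - p y t) * dir_deriv (1, 0) \<phi> (y, t)
                \<partial>lebesgue_on (cylinder T))
              + (\<integral>y. u0 y * \<phi> (y, 0) \<partial>unit_space) = 0)))"

text \<open>The solution is identified with its representative that is continuous in time with values
  in \<open>L\<^sup>2\<close>, so that its values at every single time are meaningful.\<close>

definition global_weak_solution ::
  "real \<Rightarrow> real \<Rightarrow> real \<Rightarrow> (real \<Rightarrow> real) \<Rightarrow> (real \<Rightarrow> real) \<Rightarrow> (real \<Rightarrow> real) \<Rightarrow>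
   (real \<Rightarrow> real \<Rightarrow> real) \<Rightarrow> (real \<Rightarrow> real \<Rightarrow> real) \<Rightarrow> (real \<Rightarrow> real \<Rightarrow> real) \<Rightarrow> bool" where
  "global_weak_solution \<gamma>p \<gamma>m \<mu> R0 Q0 u0 R Q u \<longleftrightarrow>
     (\<forall>T>0. weak_solution \<gamma>p \<gamma>m \<mu> R0 Q0 u0 T R Q u) \<and>
     L2_continuous_in_time {0..} R \<and> L2_continuous_in_time {0..} Q \<and>
     L2_continuous_in_time {0..} u"

definition steady_state ::
  "real \<Rightarrow> real \<Rightarrow> (real \<Rightarrow> real) \<Rightarrow> (real \<Rightarrow> real) \<Rightarrow>
   (real \<Rightarrow> real) \<Rightarrow> (real \<Rightarrow> real) \<Rightarrow> (real \<Rightarrow> real) \<Rightarrow> bool" where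
  "steady_state \<gamma>p \<gamma>m R0 Q0 Rinf Qinf uinf \<longleftrightarrow>
    (let \<tau>0 = (\<lambda>y. spec_vol (R0 y) (Q0 y));
         \<tau>inf = (\<lambda>y. spec_vol (Rinf y) (Qinf y))
     in
     (\<exists>Zinf :: real \<Rightarrow> real. \<exists>C>0.
        AE y in unit_space.
          0 < Rinf y \<and> 0 < Qinf y \<and>
          Qinf y = Q0 y * \<tau>0 y / \<tau>inf y \<and> Rinf y = R0 y * \<tau>0 y / \<tau>inf y \<and>
          uinf y = 0 \<and> Zinf y powr \<gamma>p = C \<and>
          Qinf y = (1 - Rinf y / Zinf y) * Zinf y powr (\<gamma>p / \<gamma>m) \<and> Rinf y \<le> Zinf y) \<and>
     (\<integral>y. \<tau>inf y \<partial>unit_space) = (\<integral>y. \<tau>0 y \<partial>unit_space))"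

end

theory Submission
 imports Defs
begin

text \<open>The mass fraction \<open>\<theta> = R \<tau>\<close> does not depend on time, so the pressure is a decreasing function
 \<open>P \<theta>\<close> of the specific volume \<open>\<tau>\<close>, and \<open>\<partial>\<^sub>t \<tau> = \<partial>\<^sub>y u\<close>, \<open>\<partial>\<^sub>t u = \<partial>\<^sub>y (\<mu> \<partial>\<^sub>y u / \<tau> - P \<theta> \<tau>)\<close>. Testing the weak
 formulation with products shows that for almost every \<open>y\<close> the volume is absolutely continuous in
 time, and that \<open>\<mu> ln (\<tau>(y,t) / \<tau>\<^sub>0(y)) - \<integral>\<^sub>0\<^sup>t P \<theta> \<tau> ds = c(t) + \<integral>\<^sub>0\<^sup>y (u(x,t) - u\<^sub>0(x)) dx\<close>. This identity and
 the energy balance, obtained by regularising in time, bound \<open>\<tau>\<close> from below and above uniformly in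
 time: along the interval where \<open>\<tau>\<close> is small (large) the monotone pressure pushes it back. In view of
 these bounds the functional \<open>\<parallel>u\<parallel>\<^sup>2 / 2 + \<integral> H \<theta> \<tau>\<^sub>\<infinity> \<tau> dy - \<epsilon> \<integral> (\<integral>\<^sub>0\<^sup>y u) (\<tau> - \<tau>\<^sub>\<infinity>) dy\<close>, with \<open>H\<close> the
 relative potential energy and \<open>\<epsilon>\<close> small, is comparable to the squared distance to the steady state
 and is dissipated at a rate proportional to itself, hence decays exponentially.\<close>

section \<open>Measures on intervals and square integrability\<close>


text \<open>Viscosity dissipates only the velocity gradient, so the energy alone gives no decay of
  the volume; the term with factor \<epsilon> supplies the missing coercive quantity \<open>(P
  \<theta> \<tau>\<^sub>\<infinity> - P \<theta> \<tau>) (\<tau> -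
  \<tau>\<^sub>\<infinity>)\<close>. Its strength is uniform only if \<open>\<tau>\<close> stays in
  a compact interval, and the obstacle there is the unknown function \<open>c\<close>, formally the
  accumulated stress at the wall. Pairing the integrated momentum balance with \<open>\<tau>\<close>
  itself shows that, up to bounded terms, \<open>c\<close> falls at the rate of
  \<open>\<integral> P \<tau> dy + \<parallel>u\<parallel>\<^sup>2\<close> divided by the total
  volume. The energy bounds this rate from above, and the pressure at small volume exceeds that
  bound; a lower bound of \<open>\<tau>\<close> then keeps the rate away from zero, and the pressure
  at large volume lies below it. Hence the lower bound has to come first. A second obstacle is
  regularity: neither \<open>u\<close> nor \<open>c\<close> is known to be differentiable in time.
  The identities are therefore obtained from increments over short intervals or from averages in
  time.\<close>

text \<open>A density on the whole line rather than a restricted space: measurability is plain Borel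
  measurability, also for products, and for \<open>b \<le> a\<close> the measure is null, so
  integrals over reversed intervals are 0 and not negative.\<close>

definition ivl :: "real => real => real measure" where
 "ivl a b = density lborel (indicator {a<..<b})"

abbreviation slab :: "real => real => (real \<times> real) measure" where "slab s t \<equiv> ivl 0 1 \<Otimes>\<^sub>M ivl s t"
abbreviation cyl :: "real => (real \<times> real) measure" where "cyl T \<equiv> slab 0 T"
abbreviation borel1 :: "('a::topological_space => 'b::topological_space) set" where "borel1 \<equiv> borel_measurable borel"
abbreviation borel2 :: "('a::topological_space \<times> 'b::topological_space => 'c::topological_space) set" where
 "borel2 \<equiv> borel_measurable (borel \<Otimes>\<^sub>M borel)"

lemma sets_ivl [simp, measurable_cong]: "sets (ivl a b) = sets borel"
 by (simp add: ivl_def)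

lemma space_ivl [simp]: "space (ivl a b) = UNIV"
 by (simp add: ivl_def)

lemma AE_ivl: "(AE x in ivl a b. P x) \<longleftrightarrow> (AE x in lborel. a < x \<and> x < b --> P x)"
proof -
 have "0 < (indicator {a<..<b} x :: ennreal) \<longleftrightarrow> a < x \<and> x < b" for x by (simp add: indicator_def)
 then show ?thesis unfolding ivl_def by (subst AE_density) auto
qed

lemma AE_ivl_I: "(\<And>x. a < x ==> x < b ==> P x) ==> AE x in ivl a b. P x"
 by (simp add: AE_ivl)

lemma AE_ivl_subset: "AE x in ivl a b. P x ==> a \<le> c ==> d \<le> b ==> AE x in ivl c d. P x"
 unfolding AE_ivl by (auto elim!: eventually_mono)

lemma AE_ivl_mem: "AE x in ivl a b. a < x \<and> x < b"
 by (simp add: AE_ivl)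

lemma emeasure_ivl: "emeasure (ivl a b) UNIV = ennreal (b - a)"
proof -
 have "emeasure (ivl a b) UNIV = emeasure lborel {a<..<b}"
  by (simp add: ivl_def emeasure_density)
 then show ?thesis by (cases "a \<le> b") (auto simp: ennreal_neg)
qed

lemma measure_ivl: "a \<le> b ==> measure (ivl a b) UNIV = b - a"
 by (simp add: measure_def emeasure_ivl)

lemma finite_measure_ivl: "finite_measure (ivl a b)"
 by (rule finite_measureI) (simp add: emeasure_ivl)

interpretation ivl: finite_measure "ivl a b" for a b
 by (rule finite_measure_ivl)

interpretation ivl2: pair_sigma_finite "ivl a b" "ivl c d" for a b c d
 by (simp add: pair_sigma_finite_def ivl.sigma_finite_measure_axioms)

lemma finite_measure_ivl2: "finite_measure (ivl a b \<Otimes>\<^sub>M ivl c d)"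
 by (intro finite_measure_pair_measure finite_measure_ivl)

interpretation ivl2: finite_measure "ivl a b \<Otimes>\<^sub>M ivl c d" for a b c d
 by (rule finite_measure_ivl2)

lemma borel_measurable_ivl2 [simp]:
 "borel_measurable (ivl a b \<Otimes>\<^sub>M ivl c d) = borel2"
 by (intro measurable_cong_sets sets_pair_measure_cong) auto

lemma ivl_trivial: "b \<le> a ==> ivl a b = null_measure borel"
 by (rule measure_eqI) (auto simp: ivl_def emeasure_density)

lemma integral_ivl_trivial [simp]: "b \<le> a ==> integral\<^sup>L (ivl a b) f = 0"
 by (simp add: ivl_trivial)

lemma integral_ivl:
 fixes f :: "real => real"
 assumes "f \<in> borel1"
 shows "integral\<^sup>L (ivl a b) f = (\<integral>x. indicator {a<..<b} x * f x \<partial>lborel)"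
proof -
 have "ivl a b = density lborel (%x. ennreal (indicator {a<..<b} x))"
  by (simp add: ivl_def ennreal_indicator)
 then show ?thesis using assms by (simp add: integral_density)
qed

lemma integrable_ivl:
 fixes f :: "real => real"
 assumes "f \<in> borel1"
 shows "integrable (ivl a b) f \<longleftrightarrow> integrable lborel (%x. indicator {a<..<b} x * f x)"
proof -
 have "ivl a b = density lborel (%x. ennreal (indicator {a<..<b} x))"
  by (simp add: ivl_def ennreal_indicator)
 then show ?thesis using assms by (simp add: integrable_density)
qed

lemma integrable_ivl_subset:
 fixes f :: "real => real"
 assumes "integrable (ivl a b) f" "a \<le> c" "d \<le> b"
 shows "integrable (ivl c d) f"
proof -
 have [measurable]: "f \<in> borel1" using assms(1) borel_measurable_integrable by force
 show ?thesis
  using assms unfolding integrable_ivl[OF \<open>f \<in> _\<close>]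
  by (elim Bochner_Integration.integrable_bound) (auto simp: indicator_def)
qed

lemma integral_ivl_split:
 fixes f :: "real => real"
 assumes "integrable (ivl a c) f" "a \<le> b" "b \<le> c"
 shows "integral\<^sup>L (ivl a c) f = integral\<^sup>L (ivl a b) f + integral\<^sup>L (ivl b c) f"
proof -
 have [measurable]: "f \<in> borel1" using assms(1) borel_measurable_integrable by force
 have "integrable lborel (%x. indicator {a<..<b} x * f x)" "integrable lborel (%x. indicator {b<..<c} x * f x)"
  using integrable_ivl_subset[OF assms(1), of a b] integrable_ivl_subset[OF assms(1), of b c] assms
  by (auto simp: integrable_ivl)
 then have "integral\<^sup>L (ivl a b) f + integral\<^sup>L (ivl b c) f
  = (\<integral>x. indicator {a<..<b} x * f x + indicator {b<..<c} x * f x \<partial>lborel)"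
  by (simp add: integral_ivl)
 also have "\<dots> = integral\<^sup>L (ivl a c) f"
  unfolding integral_ivl[OF \<open>f \<in> _\<close>]
  by (rule integral_cong_AE, measurable)
   (use AE_lborel_singleton[of b] assms in \<open>auto simp: indicator_def elim!: eventually_mono\<close>)
 finally show ?thesis by simp
qed


lemma integral_ivl_nonneg_mono:
 fixes f :: "real => real"
 assumes "integrable (ivl a b) f" "a \<le> c" "d \<le> b" "AE x in ivl a b. 0 \<le> f x"
 shows "integral\<^sup>L (ivl c d) f \<le> integral\<^sup>L (ivl a b) f"
proof -
 have [measurable]: "f \<in> borel1" using assms(1) borel_measurable_integrable by force
 show ?thesis
  using assms integrable_ivl_subset[OF assms(1-3)]
  unfolding integral_ivl[OF \<open>f \<in> _\<close>] integrable_ivl[OF \<open>f \<in> _\<close>] AE_ivl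
  by (intro integral_mono_AE) (auto simp: indicator_def elim!: eventually_mono)
qed

lemma integrable_ivl_continuous:
 fixes f :: "real => real"
 assumes "f \<in> borel1" "continuous_on {a..b} f"
 shows "integrable (ivl a b) f"
proof -
 have "bounded (f ` {a..b})" using assms by (intro compact_imp_bounded compact_continuous_image) auto
 then obtain B where B: "\<And>x. x \<in> {a..b} ==> \<bar>f x\<bar> \<le> B" unfolding bounded_iff real_norm_def by blast
 show ?thesis
  by (rule ivl.integrable_const_bound[of _ B]) (use B assms in \<open>auto intro!: AE_ivl_I\<close>)
qed

text \<open>Dominated convergence: the indicators of \<open>{a<..<s}\<close> converge at every point
  except \<open>t\<close>, from whichever side \<open>s\<close> approaches.\<close>

lemma tendsto_indefinite:
 fixes f :: "real => real"
 assumes "integrable (ivl a b) f" "t \<in> {a..b}"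
 shows "((%s. integral\<^sup>L (ivl a s) f) \<longlongrightarrow> integral\<^sup>L (ivl a t) f) (at t within {a..b})"
proof -
 have f[measurable]: "f \<in> borel1" using assms(1) borel_measurable_integrable by force
 have i: "integrable lborel (%x. indicator {a<..<b} x * f x)" using assms by (simp add: integrable_ivl)
 have "((%s. \<integral>x. indicator {a<..<s} x * f x \<partial>lborel) \<longlongrightarrow> (\<integral>x. indicator {a<..<t} x * f x \<partial>lborel)) (at t within {a..b})"
 proof (rule tendsto_within_subset[where S="{a..b}"], subst tendsto_at_iff_sequentially, safe)
  fix X :: "nat => real" assume X: "\<forall>i. X i \<in> {a..b} - {t}" "X \<longlonglongrightarrow> t"
  show "((%s. \<integral>x. indicator {a<..<s} x * f x \<partial>lborel) \<circ> X) \<longlonglongrightarrow> (\<integral>x. indicator {a<..<t} x * f x \<partial>lborel)"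
   unfolding o_def
  proof (rule integral_dominated_convergence[where w="%x. norm (indicator {a<..<b} x * f x)"])
   show "AE x in lborel. (%i. indicator {a<..<X i} x * f x) \<longlonglongrightarrow> indicator {a<..<t} x * f x"
    using AE_lborel_singleton[of t]
   proof eventually_elim
    case (elim x)
    have "\<forall>\<^sub>F i in sequentially. indicator {a<..<X i} x * f x = indicator {a<..<t} x * f x"
    proof (cases "x < t")
     case True
     then have "\<forall>\<^sub>F i in sequentially. x < X i" using X(2) order_tendstoD(1) by blast
     then show ?thesis by eventually_elim (use True in \<open>auto simp: indicator_def\<close>)
    next
     case False
     then have "\<forall>\<^sub>F i in sequentially. x > X i" using X(2) order_tendstoD(2)[of X t] elim by force
     then show ?thesis by eventually_elim (use False in \<open>auto simp: indicator_def\<close>)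
    qed
    then show ?case by (rule tendsto_eventually)
   qed
   show "AE x in lborel. norm (indicator {a<..<X i} x * f x) \<le> norm (indicator {a<..<b} x * f x)" for i
   proof -
    have "X i \<le> b" using X(1) by auto
    then show ?thesis by (auto simp: indicator_def)
   qed
  qed (use i in auto)
 qed
 then show ?thesis by (simp add: integral_ivl)
qed

lemma continuous_on_indefinite:
 fixes f :: "real => real"
 assumes "integrable (ivl a b) f"
 shows "continuous_on {a..b} (%s. integral\<^sup>L (ivl a s) f)"
 using tendsto_indefinite[OF assms] by (simp add: continuous_on)

text \<open>Continuity is local, so it is checked on an increasing family of open intervals; to the
  left of \<open>a\<close> the integral is 0 because \<open>ivl a s\<close> is null there.\<close>

lemma continuous_on_indefinite_Ici:
 fixes f :: "real => real"
 assumes "\<And>b. integrable (ivl a b) f"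
 shows "continuous_on {a..} (%s. integral\<^sup>L (ivl a s) f)"
proof -
 show ?thesis
 proof (rule continuous_on_subset[OF continuous_on_open_UN[of UNIV "%n::nat. {a - 1 <..< a + real n}", folded atLeast_def]])
  fix n :: nat
  have *: "continuous_on {a..a+n} (%s. integral\<^sup>L (ivl a s) f)"
   using assms continuous_on_indefinite by blast
  have "continuous_on ({a-1..a} \<union> {a..a+n}) (%s. integral\<^sup>L (ivl a s) f)"
   by (rule continuous_on_closed_Un) (use * in \<open>auto intro: continuous_on_eq[OF continuous_on_const[of _ 0]]\<close>)
  then show "continuous_on {a - 1<..<a + real n} (%s. integral\<^sup>L (ivl a s) f)"
   by (rule continuous_on_subset) auto
 next
  show "{a..} \<subseteq> (\<Union>n. {a - 1<..<a + real n})"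
  proof
   fix x assume "x \<in> {a..}"
   moreover obtain n :: nat where "x - a < n" using reals_Archimedean2 by blast
   ultimately show "x \<in> (\<Union>n. {a - 1<..<a + real n})" by (auto intro!: exI[of _ n])
  qed
 qed auto
qed

section \<open>Square-integrable functions\<close>

lemma in_L2_measurable: "in_L2 M f ==> f \<in> borel_measurable M"
 by (simp add: in_L2_def)

lemma in_L2_integrable_sq: "in_L2 M f ==> integrable M (%x. (f x)\<^sup>2)"
 by (simp add: in_L2_def)

lemma L2_norm_nonneg [simp]: "0 \<le> L2_norm M f"
 by (simp add: L2_norm_def)

lemma L2_norm_sq: "(L2_norm M f)\<^sup>2 = (\<integral>x. (f x)\<^sup>2 \<partial>M)"
 by (simp add: L2_norm_def)

lemma in_L2_mult_integrable:
 assumes "in_L2 M f" "in_L2 M g"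
 shows "integrable M (%x. f x * g x)"
proof (rule Bochner_Integration.integrable_bound)
 show "integrable M (%x. (f x)\<^sup>2 + (g x)\<^sup>2)" using assms by (auto simp: in_L2_def)
 show "(%x. f x * g x) \<in> borel_measurable M" using assms by (auto simp: in_L2_def)
 show "AE x in M. norm (f x * g x) \<le> norm ((f x)\<^sup>2 + (g x)\<^sup>2)"
 proof (rule AE_I2)
  fix x
  have "2 * (\<bar>f x\<bar> * \<bar>g x\<bar>) \<le> (f x)\<^sup>2 + (g x)\<^sup>2"
   using sum_squares_bound[of "\<bar>f x\<bar>" "\<bar>g x\<bar>"] by (simp add: mult.assoc)
  moreover have "0 \<le> \<bar>f x\<bar> * \<bar>g x\<bar>" by simp
  ultimately have "\<bar>f x\<bar> * \<bar>g x\<bar> \<le> (f x)\<^sup>2 + (g x)\<^sup>2" by linarith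
  then show "norm (f x * g x) \<le> norm ((f x)\<^sup>2 + (g x)\<^sup>2)" by (simp add: abs_mult)
 qed
qed

lemma in_L2_bound:
 assumes "in_L2 M f" "g \<in> borel_measurable M" "AE x in M. \<bar>g x\<bar> \<le> C * \<bar>f x\<bar>"
 shows "in_L2 M g"
 unfolding in_L2_def
proof (intro conjI, fact, rule Bochner_Integration.integrable_bound)
 show "integrable M (%x. C\<^sup>2 * (f x)\<^sup>2)" using assms by (auto simp: in_L2_def)
 show "AE x in M. norm ((g x)\<^sup>2) \<le> norm (C\<^sup>2 * (f x)\<^sup>2)"
  using assms(3)
 proof eventually_elim
  case (elim x)
  then have "\<bar>g x\<bar>\<^sup>2 \<le> (C * \<bar>f x\<bar>)\<^sup>2" by (intro power_mono) auto
  then show ?case by (simp add: power_mult_distrib)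
 qed
qed (use assms in auto)

lemma in_L2_add: "in_L2 M f ==> in_L2 M g ==> in_L2 M (%x. f x + g x)"
 using in_L2_mult_integrable[of M f g] unfolding in_L2_def
 by (auto simp: power2_sum mult.assoc)

lemma in_L2_cmult: "in_L2 M f ==> in_L2 M (%x. c * f x)"
 unfolding in_L2_def by (auto simp: power_mult_distrib)

lemma in_L2_uminus: "in_L2 M f ==> in_L2 M (%x. - f x)"
 unfolding in_L2_def by auto

lemma in_L2_diff: "in_L2 M f ==> in_L2 M g ==> in_L2 M (%x. f x - g x)"
 using in_L2_add[of M f "%x. - g x"] in_L2_uminus[of M g] by simp

lemma in_L2_mult_bounded:
 assumes "in_L2 M f" "g \<in> borel_measurable M" "AE x in M. \<bar>g x\<bar> \<le> C"
 shows "in_L2 M (%x. g x * f x)"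
proof (rule in_L2_bound[OF assms(1), where C=C])
 show "AE x in M. \<bar>g x * f x\<bar> \<le> C * \<bar>f x\<bar>"
  using assms(3) by eventually_elim (auto simp: abs_mult mult_right_mono)
qed (use assms in \<open>auto simp: in_L2_def\<close>)

lemma in_L2_cong_AE:
 assumes "in_L2 M f" "g \<in> borel_measurable M" "AE x in M. f x = g x"
 shows "in_L2 M g"
 by (rule in_L2_bound[OF assms(1,2), where C=1]) (use assms(3) in \<open>auto elim: eventually_mono\<close>)

lemma (in finite_measure) in_L2_const: "in_L2 M (%x. c)"
 by (simp add: in_L2_def)

lemma (in finite_measure) in_L2_bounded:
 assumes "g \<in> borel_measurable M" "AE x in M. \<bar>g x\<bar> \<le> C"
 shows "in_L2 M g"
 using in_L2_mult_bounded[OF in_L2_const[of 1] assms] by simp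

lemma (in finite_measure) in_L2_integrable: "in_L2 M f ==> integrable M f"
 using in_L2_mult_integrable[OF _ in_L2_const[of 1]] by simp

text \<open>The polynomial \<open>l\<^sup>2 * A + 2 * l * C + B\<close> is nonnegative for every
  \<open>l\<close>. Its minimum at \<open>- C / A\<close> gives the claim; if \<open>A = 0\<close>
  and \<open>C \<noteq> 0\<close>, the value \<open>- (B + 1) / (2 * C)\<close> would make it equal
  to -1.\<close>

lemma Cauchy_Schwarz_integral:
 assumes f: "in_L2 M f" and g: "in_L2 M g"
 shows "(\<integral>x. f x * g x \<partial>M)\<^sup>2 \<le> (\<integral>x. (f x)\<^sup>2 \<partial>M) * (\<integral>x. (g x)\<^sup>2 \<partial>M)"
proof -
 define A B C where "A = (\<integral>x. (f x)\<^sup>2 \<partial>M)" and "B = (\<integral>x. (g x)\<^sup>2 \<partial>M)" and "C = (\<integral>x. f x * g x \<partial>M)"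
 have A0: "0 \<le> A" "0 \<le> B" by (auto simp: A_def B_def)
 have *: "0 \<le> l\<^sup>2 * A + 2 * l * C + B" for l
 proof -
  have "0 \<le> (\<integral>x. (l * f x + g x)\<^sup>2 \<partial>M)" by simp
  also have "\<dots> = (\<integral>x. l\<^sup>2 * (f x)\<^sup>2 + (2 * l) * (f x * g x) + (g x)\<^sup>2 \<partial>M)"
   by (rule Bochner_Integration.integral_cong) (auto simp: power2_eq_square algebra_simps)
  also have "\<dots> = l\<^sup>2 * A + 2 * l * C + B"
   using f g in_L2_mult_integrable[OF f g] by (simp add: A_def B_def C_def in_L2_def)
  finally show ?thesis .
 qed
 have "C\<^sup>2 \<le> A * B"
 proof (cases "A = 0")
  case True
  have "C = 0"
  proof (rule ccontr)
   assume "C \<noteq> 0"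
   then have "2 * (- (B + 1) / (2 * C)) * C = - (B + 1)" by (simp add: field_simps)
   then show False using *[of "- (B + 1) / (2 * C)"] True by simp
  qed
  then show ?thesis using True by simp
 next
  case False
  have "(- C / A)\<^sup>2 * A + 2 * (- C / A) * C + B = B - C\<^sup>2 / A"
   using False by (simp add: field_simps power2_eq_square)
  then have "C\<^sup>2 / A \<le> B" using *[of "- C / A"] by simp
  then show ?thesis using False A0 by (simp add: field_simps)
 qed
 then show ?thesis by (simp add: A_def B_def C_def)
qed

lemma Cauchy_Schwarz_L2:
 assumes f: "in_L2 M f" and g: "in_L2 M g"
 shows "\<bar>\<integral>x. f x * g x \<partial>M\<bar> \<le> L2_norm M f * L2_norm M g"
 using real_sqrt_le_mono[OF Cauchy_Schwarz_integral[OF f g]]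
 by (simp add: L2_norm_def real_sqrt_mult)

lemma L2_norm_mono:
 assumes "AE x in M. \<bar>f x\<bar> \<le> \<bar>g x\<bar>" "in_L2 M g" "f \<in> borel_measurable M"
 shows "L2_norm M f \<le> L2_norm M g"
 unfolding L2_norm_def
proof (intro real_sqrt_le_mono integral_mono_AE)
 show "integrable M (%x. (f x)\<^sup>2)"
  using in_L2_bound[OF assms(2,3), of 1] assms(1) by (simp add: in_L2_def)
 show "AE x in M. (f x)\<^sup>2 \<le> (g x)\<^sup>2" using assms(1) by eventually_elim (simp add: abs_le_square_iff)
qed (use assms in \<open>auto simp: in_L2_def\<close>)

lemma L2_norm_triangle:
 assumes f: "in_L2 M f" and g: "in_L2 M g"
 shows "L2_norm M (%x. f x + g x) \<le> L2_norm M f + L2_norm M g"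
proof (rule power2_le_imp_le)
 have "(L2_norm M (%x. f x + g x))\<^sup>2 = (\<integral>x. (f x)\<^sup>2 + 2 * (f x * g x) + (g x)\<^sup>2 \<partial>M)"
  unfolding L2_norm_sq by (rule Bochner_Integration.integral_cong) (auto simp: power2_eq_square algebra_simps)
 also have "\<dots> = (L2_norm M f)\<^sup>2 + 2 * (\<integral>x. f x * g x \<partial>M) + (L2_norm M g)\<^sup>2"
  using f g in_L2_mult_integrable[OF f g] by (simp add: L2_norm_sq in_L2_def)
 also have "\<dots> \<le> (L2_norm M f + L2_norm M g)\<^sup>2"
  using Cauchy_Schwarz_L2[OF f g] by (simp add: power2_sum)
 finally show "(L2_norm M (%x. f x + g x))\<^sup>2 \<le> (L2_norm M f + L2_norm M g)\<^sup>2" .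
qed simp

lemma L2_norm_diff_commute: "L2_norm M (%x. f x - g x) = L2_norm M (%x. g x - f x)"
 by (simp add: L2_norm_def power2_commute)

lemma L2_norm_triangle_diff:
 assumes f: "in_L2 M f" and g: "in_L2 M g"
 shows "\<bar>L2_norm M f - L2_norm M g\<bar> \<le> L2_norm M (%x. f x - g x)"
 using L2_norm_triangle[of M "%x. f x - g x" g] L2_norm_triangle[of M "%x. g x - f x" f]
  in_L2_diff[OF f g] in_L2_diff[OF g f] f g L2_norm_diff_commute[of M f g] by force


lemma (in finite_measure) integral_le_L2_norm:
 assumes f: "in_L2 M f" and 1: "measure M (space M) = 1"
 shows "(\<integral>x. \<bar>f x\<bar> \<partial>M) \<le> L2_norm M f"
proof -
 have "in_L2 M (%x. \<bar>f x\<bar>)" using f by (auto simp: in_L2_def)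
 from Cauchy_Schwarz_L2[OF this in_L2_const[of 1]] show ?thesis
  using 1 by (simp add: L2_norm_def)
qed

text \<open>Rational endpoints suffice, so that for a family of functions the hypothesis can be
 verified outside one null set.\<close>

lemma AE_zero_of_intervals:
 fixes f :: "real => real"
 assumes f: "f \<in> borel1"
  and int: "\<And>a b. A < a ==> a < b ==> b < B ==> integrable (ivl a b) f"
  and zero: "\<And>a b. a \<in> \<rat> ==> b \<in> \<rat> ==> A < a ==> a < b ==> b < B ==> integral\<^sup>L (ivl a b) f = 0"
 shows "AE x in ivl A B. f x = 0"
proof -
 have main: "AE x in ivl a b. f x = 0" if ab: "A < a" "a < b" "b < B" for a b
 proof -
  have i: "integrable (ivl a b) f" using int[OF ab] .
  \<comment> \<open>The indefinite integral takes one value at all rational points of the open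
    interval, hence by continuity on the whole closed interval.\<close>
  have const: "integral\<^sup>L (ivl a x) f = integral\<^sup>L (ivl a y) f" if "x \<in> {a..b}" "y \<in> {a..b}" for x y
  proof -
   obtain p where p: "p \<in> \<rat>" "a < p" "p < b" using Rats_dense_in_real[of a b] ab by blast
   have cl: "closure ({a<..<b} \<inter> \<rat>) = {a..b}" using closure_open_Int_superset[of "{a<..<b}" "\<rat>"] ab by (simp add: Rats_closure_real)
   have eq: "integral\<^sup>L (ivl a q) f = integral\<^sup>L (ivl a p) f" if q: "q \<in> {a<..<b} \<inter> \<rat>" for q
   proof -
    have "integral\<^sup>L (ivl a v) f = integral\<^sup>L (ivl a u) f" if "u \<in> \<rat>" "v \<in> \<rat>" "a < u" "u < v" "v < b" for u v
     using integral_ivl_split[OF integrable_ivl_subset[OF i], of a v u] zero[of u v] that ab by simp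
    then show ?thesis using p q by (cases p q rule: linorder_cases) auto
   qed
   have "integral\<^sup>L (ivl a z) f = integral\<^sup>L (ivl a p) f" if "z \<in> {a..b}" for z
    using continuous_constant_on_closure[of "{a<..<b} \<inter> \<rat>" "%z. integral\<^sup>L (ivl a z) f" "integral\<^sup>L (ivl a p) f"]
     continuous_on_indefinite[OF i] eq that unfolding cl by blast
   then show ?thesis using that by metis
  qed
  have rat: "integral\<^sup>L (ivl a d) f = 0" if "a \<le> d" "d \<le> b" for d
   using const[of d a] that by simp
  have sets: "set_lebesgue_integral (ivl a b) S f = 0" if "S \<in> sets (ivl a b)" for S
  proof -
   have S: "S \<in> sigma_sets UNIV (range lessThan)"
    using that unfolding sets_ivl borel_Iio by (simp add: sets_measure_of)
   have [measurable]: "T \<in> sets borel" if "T \<in> sigma_sets UNIV (range lessThan)" for T :: "real set"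
    using that unfolding borel_Iio by (simp add: sets_measure_of)
   have full: "integral\<^sup>L (ivl a b) f = 0" using rat[of b] ab by simp
   have st: "Int_stable (range (lessThan :: real => real set))"
   proof (rule Int_stableI_image)
    fix a b :: real
    have "{..<a} \<inter> {..<b} = {..<min a b}" by auto
    then show "\<exists>k\<in>UNIV. {..<a} \<inter> {..<b} = {..<k}" by blast
   qed
   have "range (lessThan :: real => real set) \<subseteq> Pow UNIV" by simp
   \<comment> \<open>Dynkin's argument: the half-lines form an intersection-stable generator of the
     Borel sets, and integrals over them reduce to \<open>rat\<close>.\<close>
   from st this S show ?thesis
   proof (induction rule: sigma_sets_induct_disjoint)
    case (basic T)
    then obtain c where T: "T = {..<c}" by auto
    have "set_lebesgue_integral (ivl a b) T f = integral\<^sup>L (ivl a (min b c)) f"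
    proof -
     have "set_lebesgue_integral (ivl a b) T f = (\<integral>x. indicator {a<..<b} x * (indicator T x * f x) \<partial>lborel)"
      unfolding set_lebesgue_integral_def T using f by (subst integral_ivl) auto
     also have "\<dots> = (\<integral>x. indicator {a<..<min b c} x * f x \<partial>lborel)"
      by (rule Bochner_Integration.integral_cong) (auto simp: T indicator_def)
     finally show ?thesis using f by (simp add: integral_ivl)
    qed
    also have "\<dots> = 0" using rat[of "min b c"] ab by (cases "a < min b c") auto
    finally show ?case .
   next
    case empty then show ?case by (simp add: set_lebesgue_integral_def)
   next
    case (compl T)
    have iT: "integrable (ivl a b) (%x. indicator T x * f x)"
     using integrable_mult_indicator[of T "ivl a b" f] compl i by simp
    have "set_lebesgue_integral (ivl a b) (UNIV - T) f = (\<integral>x. f x - indicator T x * f x \<partial>ivl a b)"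
     unfolding set_lebesgue_integral_def by (rule Bochner_Integration.integral_cong) (auto simp: indicator_def)
    also have "\<dots> = 0" using i iT compl(2) full by (simp add: set_lebesgue_integral_def)
    finally show ?case .
   next
    case (union T)
    have T[measurable]: "T n \<in> sets borel" for n using union(2) by (auto intro!: \<open>\<And>T. T \<in> sigma_sets _ _ ==> T \<in> sets borel\<close>)
    moreover have "\<Union>(range T) \<in> sets borel" by measurable
    moreover have "disjoint_family T" by fact
    moreover have "set_integrable (ivl a b) (\<Union>(range T)) f"
     unfolding set_integrable_def by (intro integrable_mult_indicator i) (use calculation in auto)
    ultimately show ?case
     using lebesgue_integral_countable_add[of T "ivl a b" f] union(3) by (auto simp: disjoint_family_on_def)
   qed
  qed
  show ?thesis using ivl.density_zero[OF i sets] .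
 qed
 \<comment> \<open>Every point of the open interval lies in one of countably many rational
   subintervals, so the null sets from \<open>main\<close> can be united although integrability is
   known only away from the endpoints.\<close>
 define X where "X = {p \<in> \<rat> \<times> \<rat>. A < fst p \<and> fst p < snd p \<and> snd p < B}"
 have "countable X" unfolding X_def
  by (rule countable_subset[of _ "\<rat> \<times> \<rat>"]) (auto intro: countable_rat)
 have "AE x in lborel. \<forall>p\<in>X. fst p < x \<and> x < snd p --> f x = 0"
  unfolding AE_ball_countable[OF \<open>countable X\<close>] using main by (auto simp: AE_ivl X_def)
 then show ?thesis unfolding AE_ivl
 proof eventually_elim
  case (elim x)
  show ?case
  proof
   assume x: "A < x \<and> x < B"
   then obtain a b where "a \<in> \<rat>" "A < a" "a < x" "b \<in> \<rat>" "x < b" "b < B"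
    by (meson Rats_dense_in_real)
   then show "f x = 0" using elim by (force simp: X_def)
  qed
 qed
qed

text \<open>One null set serves all rational times. Any time below \<open>T\<close> is a limit of
  rational times from the right that are still below \<open>T\<close>, and \<open>F\<close> is
  closed.\<close>

lemma AE_all_continuous:
 fixes f :: "'a => real => real"
 assumes cont: "AE y in M. continuous_on {0..} (f y)"
  and F: "closed F" and pt: "\<And>t. 0 \<le> t ==> t < T ==> AE y in M. f y t \<in> F"
 shows "AE y in M. \<forall>t. 0 \<le> t \<and> t < T --> f y t \<in> F"
proof -
 define X where "X = {t \<in> \<rat>. 0 \<le> t \<and> t < T}"
 have "countable X" unfolding X_def by (rule countable_subset[of _ "\<rat>"]) (auto intro: countable_rat)
 have "AE y in M. \<forall>t\<in>X. f y t \<in> F"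
  unfolding AE_ball_countable[OF \<open>countable X\<close>] using pt by (auto simp: X_def)
 with cont show ?thesis
 proof eventually_elim
  case (elim y)
  show ?case
  proof safe
   fix t :: real assume t: "0 \<le> t" "t < T"
   have "\<forall>n::nat. \<exists>q\<in>\<rat>. t < q \<and> q < min T (t + inverse (Suc n))"
    using t by (intro allI Rats_dense_in_real) auto
   then obtain q where q: "\<And>n. q n \<in> \<rat>" "\<And>n::nat. t < q n" "\<And>n. q n < min T (t + inverse (Suc n))" by metis
   have ql: "q \<longlonglongrightarrow> t"
    by (rule tendsto_sandwich[of "%_. t" _ _ "%n. t + inverse (Suc n)"])
     (use q LIMSEQ_inverse_real_of_nat_add in \<open>auto intro!: always_eventually less_imp_le\<close>)
   have "(%n. f y (q n)) \<longlonglongrightarrow> f y t"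
    using continuous_on_tendsto_compose[OF elim(1) ql] t q by (auto intro!: always_eventually less_imp_le[OF le_less_trans])
   moreover have "f y (q n) \<in> F" for n
    using elim(2) q[of n] t by (force simp: X_def)
   ultimately show "f y t \<in> F" using closed_sequentially[OF F, of "%n. f y (q n)"] by auto
  qed
 qed
qed

section \<open>Increments of higher order and the chain rule\<close>

text \<open>Telescoping over a fine partition gives
  \<open>\<bar>D b - D a\<bar> \<le> e * (M b - M a)\<close> for every \<open>e\<close>. This
  replaces "the derivative vanishes" for balance laws whose terms are not known to be
  differentiable: it is enough that the defect over a short interval is small compared with an
  additive quantity \<open>M\<close>.\<close>

lemma constant_if_small_increments:
 fixes D M :: "real => real"
 assumes "a \<le> b"
  and small: "\<And>e. 0 < e ==> \<exists>d>0. \<forall>s t. a \<le> s \<and> s < t \<and> t \<le> b \<and> t - s < d --> \<bar>D t - D s\<bar> \<le> e * (M t - M s)"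
 shows "D b = D a"
proof (cases "a = b")
 case False
 have "\<bar>D b - D a\<bar> \<le> e * (M b - M a)" if e: "0 < e" for e
 proof -
  obtain d where d: "0 < d" "\<And>s t. a \<le> s ==> s < t ==> t \<le> b ==> t - s < d ==> \<bar>D t - D s\<bar> \<le> e * (M t - M s)"
   using small[OF e] by blast
  obtain N :: nat where N: "(b - a) / d < N" using reals_Archimedean2 by blast
  have N0: "0 < N" using N d assms(1) False by (smt (verit) divide_pos_pos of_nat_0_less_iff of_nat_0)
  define p where "p = (%i::nat. a + (b - a) * i / N)"
  have step: "p (Suc i) - p i = (b - a) / N" for i by (simp add: p_def field_simps flip: add_divide_distrib)
  have "(b - a) / N < d" using N N0 d by (simp add: field_simps)
  have "\<bar>D (p i) - D a\<bar> \<le> e * (M (p i) - M a)" if "i \<le> N" for i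
   using that
  proof (induction i)
   case (Suc i)
   have "p (Suc i) \<le> b"
   proof -
    have "(b - a) * real (Suc i) \<le> (b - a) * N" using Suc.prems assms(1) by (intro mult_left_mono) auto
    then show ?thesis using N0 by (simp add: p_def field_simps)
   qed
   moreover have "a \<le> p i" using assms(1) by (simp add: p_def)
   moreover have "p i < p (Suc i)" using step[of i] assms(1) False N0 by (smt (verit) divide_pos_pos of_nat_0_less_iff)
   ultimately have "\<bar>D (p (Suc i)) - D (p i)\<bar> \<le> e * (M (p (Suc i)) - M (p i))"
    using d(2) step[of i] \<open>(b - a) / N < d\<close> by auto
   then show ?case using Suc by (simp add: algebra_simps)
  qed (simp add: p_def)
  from this[of N] show ?thesis using N0 by (simp add: p_def)
 qed
 then have *: "\<bar>D b - D a\<bar> \<le> e * (M b - M a)" if "0 < e" for e using that by blast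
 show ?thesis
 proof (rule ccontr)
  assume "D b \<noteq> D a"
  then have pos: "0 < \<bar>D b - D a\<bar>" by simp
  have M: "0 < M b - M a" using *[of 1] pos by simp
  have "\<bar>D b - D a\<bar> \<le> \<bar>D b - D a\<bar> / (2 * (M b - M a)) * (M b - M a)" by (rule *) (use pos M in simp)
  also have "\<dots> = \<bar>D b - D a\<bar> / 2" using M by (simp add: divide_simps)
  finally show False using pos by simp
 qed
qed simp

text \<open>\<open>\<tau>\<close> is merely an indefinite integral. The difference of the two sides
  has increments at most \<open>e\<close> times those of the integral of
  \<open>\<bar>g\<bar>\<close>, because \<open>\<phi>' (\<tau> r)\<close> is uniformly continuous in
  \<open>r\<close>.\<close>

lemma indefinite_chain_rule:
 fixes g \<phi> \<phi>' \<tau> :: "real => real"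
 assumes g: "integrable (ivl a b) g" and "a \<le> b"
  and \<tau>: "\<And>t. t \<in> {a..b} ==> \<tau> t = \<tau> a + integral\<^sup>L (ivl a t) g"
  and \<phi>: "\<And>x. x \<in> \<tau> ` {a..b} ==> (\<phi> has_real_derivative \<phi>' x) (at x)"
  and \<phi>': "continuous_on (\<tau> ` {a..b}) \<phi>'"
  and meas: "(%r. \<phi>' (\<tau> r) * g r) \<in> borel1"
 shows "integrable (ivl a b) (%r. \<phi>' (\<tau> r) * g r)" (is ?int)
  and "\<phi> (\<tau> b) - \<phi> (\<tau> a) = (\<integral>r. \<phi>' (\<tau> r) * g r \<partial>ivl a b)"
proof -
 have c\<tau>: "continuous_on {a..b} \<tau>"
  by (rule continuous_on_eq[OF continuous_on_add[OF continuous_on_const[of _ "\<tau> a"] continuous_on_indefinite[OF g]]])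
   (use \<tau> in metis)
 have c: "continuous_on {a..b} (%r. \<phi>' (\<tau> r))"
  using continuous_on_compose[OF c\<tau> \<phi>'] by (simp add: o_def)
 then have "bounded ((%r. \<phi>' (\<tau> r)) ` {a..b})"
  by (intro compact_imp_bounded compact_continuous_image) auto
 then obtain B where B: "\<And>r. r \<in> {a..b} ==> \<bar>\<phi>' (\<tau> r)\<bar> \<le> B" unfolding bounded_iff real_norm_def by blast
 show ?int
 proof (rule Bochner_Integration.integrable_bound)
  show "integrable (ivl a b) (%r. B * \<bar>g r\<bar>)" using g by auto
  show "AE r in ivl a b. norm (\<phi>' (\<tau> r) * g r) \<le> norm (B * \<bar>g r\<bar>)"
  proof (rule AE_ivl_I)
   fix r assume "a < r" "r < b"
   then have "\<bar>\<phi>' (\<tau> r)\<bar> * \<bar>g r\<bar> \<le> B * \<bar>g r\<bar>" using B[of r] by (intro mult_right_mono) auto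
   also have "\<dots> \<le> \<bar>B\<bar> * \<bar>g r\<bar>" by (intro mult_right_mono) auto
   finally show "norm (\<phi>' (\<tau> r) * g r) \<le> norm (B * \<bar>g r\<bar>)" by (simp add: abs_mult)
  qed
 qed (use meas in simp)
 then have int: "integrable (ivl s t) (%r. \<phi>' (\<tau> r) * g r)" if "a \<le> s" "t \<le> b" for s t
  using that integrable_ivl_subset by blast
 have gi: "integrable (ivl s t) g" if "a \<le> s" "t \<le> b" for s t
  using that integrable_ivl_subset[OF g] by blast
 define D where "D = (%t. \<phi> (\<tau> t) - (\<integral>r. \<phi>' (\<tau> r) * g r \<partial>ivl a t))"
 define M where "M = (%t. \<integral>r. \<bar>g r\<bar> \<partial>ivl a t)"
 have "D b = D a"
 proof (rule constant_if_small_increments[where M=M, OF \<open>a \<le> b\<close>])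
  fix e :: real assume e: "0 < e"
  have "uniformly_continuous_on {a..b} (%r. \<phi>' (\<tau> r))"
   using c by (rule compact_uniformly_continuous) auto
  then obtain d where d: "0 < d" "\<And>x y. x \<in> {a..b} ==> y \<in> {a..b} ==> \<bar>y - x\<bar> < d ==> \<bar>\<phi>' (\<tau> y) - \<phi>' (\<tau> x)\<bar> < e"
   using e unfolding uniformly_continuous_on_def dist_real_def by metis
  show "\<exists>d>0. \<forall>s t. a \<le> s \<and> s < t \<and> t \<le> b \<and> t - s < d --> \<bar>D t - D s\<bar> \<le> e * (M t - M s)"
  proof (intro exI[of _ d] conjI allI impI d(1))
   fix s t assume st: "a \<le> s \<and> s < t \<and> t \<le> b \<and> t - s < d"
   have "continuous_on {s..t} \<tau>" using c\<tau> st continuous_on_subset[of "{a..b}" \<tau> "{s..t}"] by auto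
   \<comment> \<open>The mean value theorem yields a point between \<open>\<tau> s\<close> and
     \<open>\<tau> t\<close>; by the intermediate value theorem it is a value of
     \<open>\<tau>\<close>, so \<open>\<phi>\<close> is only ever differentiated on the range of
     \<open>\<tau>\<close>.\<close>
   obtain x where x: "x \<in> {s..t}" "\<phi> (\<tau> t) - \<phi> (\<tau> s) = \<phi>' (\<tau> x) * (\<tau> t - \<tau> s)"
   proof -
    have ivt: "\<exists>r\<in>{s..t}. \<tau> r = z" if "min (\<tau> s) (\<tau> t) \<le> z" "z \<le> max (\<tau> s) (\<tau> t)" for z
     using IVT'[of \<tau> s z t] IVT2'[of \<tau> t z s] that st \<open>continuous_on {s..t} \<tau>\<close>
     by (cases "\<tau> s \<le> \<tau> t") (force simp: min_def max_def)+
    have der: "(\<phi> has_real_derivative \<phi>' z) (at z)" if "min (\<tau> s) (\<tau> t) \<le> z" "z \<le> max (\<tau> s) (\<tau> t)" for z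
     using ivt[OF that] st by (intro \<phi>) auto
    consider "\<tau> s = \<tau> t" | "\<tau> s < \<tau> t" | "\<tau> t < \<tau> s" by linarith
    then show ?thesis
    proof cases
     case 1 then show ?thesis using that[of s] st by auto
    next
     case 2
     then obtain z where z: "\<tau> s < z" "z < \<tau> t" "\<phi> (\<tau> t) - \<phi> (\<tau> s) = (\<tau> t - \<tau> s) * \<phi>' z"
      using MVT2[of "\<tau> s" "\<tau> t" \<phi> \<phi>'] der by auto
     then obtain r where "r \<in> {s..t}" "\<tau> r = z" using ivt[of z] by auto
     then show ?thesis using that[of r] z by (simp add: mult.commute)
    next
     case 3
     then obtain z where z: "\<tau> t < z" "z < \<tau> s" "\<phi> (\<tau> s) - \<phi> (\<tau> t) = (\<tau> s - \<tau> t) * \<phi>' z"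
      using MVT2[of "\<tau> t" "\<tau> s" \<phi> \<phi>'] der by auto
     then obtain r where "r \<in> {s..t}" "\<tau> r = z" using ivt[of z] by auto
     then show ?thesis using that[of r] z by (simp add: algebra_simps)
    qed
   qed
   have \<tau>ts: "\<tau> t - \<tau> s = integral\<^sup>L (ivl s t) g"
    using \<tau>[of s] \<tau>[of t] integral_ivl_split[OF gi, of a t s] st by auto
   have "D t - D s = \<phi>' (\<tau> x) * integral\<^sup>L (ivl s t) g - (\<integral>r. \<phi>' (\<tau> r) * g r \<partial>ivl s t)"
    using integral_ivl_split[OF int, of a t s] st x(2) \<tau>ts by (simp add: D_def)
   also have "\<dots> = (\<integral>r. (\<phi>' (\<tau> x) - \<phi>' (\<tau> r)) * g r \<partial>ivl s t)"
    using int[of s t] gi[of s t] st by (simp add: left_diff_distrib)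
   finally have "\<bar>D t - D s\<bar> \<le> (\<integral>r. \<bar>(\<phi>' (\<tau> x) - \<phi>' (\<tau> r)) * g r\<bar> \<partial>ivl s t)"
    by (simp add: integral_abs_bound)
   also have "\<dots> \<le> (\<integral>r. e * \<bar>g r\<bar> \<partial>ivl s t)"
   proof (rule integral_mono_AE)
    show "integrable (ivl s t) (%r. \<bar>(\<phi>' (\<tau> x) - \<phi>' (\<tau> r)) * g r\<bar>)"
     using int[of s t] gi[of s t] st by (simp add: left_diff_distrib)
    show "AE r in ivl s t. \<bar>(\<phi>' (\<tau> x) - \<phi>' (\<tau> r)) * g r\<bar> \<le> e * \<bar>g r\<bar>"
    proof (rule AE_ivl_I)
     fix r assume "s < r" "r < t"
     then have "\<bar>x - r\<bar> < d" using st x(1) by (simp add: abs_if)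
     then have "\<bar>\<phi>' (\<tau> x) - \<phi>' (\<tau> r)\<bar> \<le> e" using d(2)[of r x] st x(1) \<open>s < r\<close> \<open>r < t\<close> by auto
     then show "\<bar>(\<phi>' (\<tau> x) - \<phi>' (\<tau> r)) * g r\<bar> \<le> e * \<bar>g r\<bar>" by (auto simp: abs_mult intro: mult_right_mono)
    qed
   qed (use gi[of s t] st in auto)
   also have "\<dots> = e * (M t - M s)"
    using integral_ivl_split[of a t "%r. \<bar>g r\<bar>" s] gi[of a t] st by (simp add: M_def)
   finally show "\<bar>D t - D s\<bar> \<le> e * (M t - M s)" .
  qed
 qed
 then show "\<phi> (\<tau> b) - \<phi> (\<tau> a) = (\<integral>r. \<phi>' (\<tau> r) * g r \<partial>ivl a b)" by (simp add: D_def)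
qed

section \<open>Continuity of translations in the mean\<close>

lemma integral_lborel_shift:
 fixes f :: "'a::euclidean_space => real"
 assumes [measurable]: "f \<in> borel1"
 shows "(\<integral>x. f (x + h) \<partial>lborel) = integral\<^sup>L lborel f"
proof -
 have "integral\<^sup>L lborel f = integral\<^sup>L (distr lborel borel ((+) h)) f" by (simp add: lborel_distr_plus)
 also have "\<dots> = (\<integral>x. f (x + h) \<partial>lborel)" by (subst integral_distr) (auto simp: add.commute)
 finally show ?thesis by simp
qed

lemma integrable_lborel_shift:
 fixes f :: "'a::euclidean_space => real"
 assumes "integrable lborel f"
 shows "integrable lborel (%x. f (x + h))"
proof -
 have [measurable]: "f \<in> borel1" using assms borel_measurable_integrable by force
 have "integrable (distr lborel borel ((+) h)) f" using assms by (simp add: lborel_distr_plus)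
 then show ?thesis by (subst (asm) integrable_distr_eq) (auto simp: add.commute)
qed

lemma AE_lborel_shift:
 fixes h :: "'a::euclidean_space"
 assumes "AE x in lborel. P x"
 shows "AE x in lborel. P (x + h)"
proof -
 from assms obtain N where N: "N \<in> null_sets lborel" "{x. \<not> P x} \<subseteq> N" by (rule AE_E3) auto
 then have [measurable]: "N \<in> sets borel" by auto
 have "emeasure (distr lborel borel ((+) h)) N = 0" using N by (simp add: lborel_distr_plus null_setsD1)
 then have "emeasure lborel {x. x + h \<in> N} = 0"
  by (simp add: emeasure_distr vimage_def add.commute)
 moreover have "{x. x + h \<in> N} \<in> sets lborel" by measurable
 ultimately show ?thesis using N(2) by (intro AE_I[of _ _ "{x. x + h \<in> N}"]) auto
qed

text \<open>Translation preserves the measure of \<open>K\<close>, so the symmetric difference has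
  twice the measure of either half. On the half outside \<open>K\<close> the integrand tends to 0 at
  every point since \<open>K\<close> is closed; the boundary of \<open>K\<close> causes no
  trouble.\<close>

lemma translation_compact:
 fixes K :: "'a::euclidean_space set"
 assumes K: "compact K"
 shows "((%h. \<integral>x. \<bar>indicat_real K (x + h) - indicat_real K x\<bar> \<partial>lborel) \<longlongrightarrow> (0::real)) (at 0)"
proof (subst tendsto_at_iff_sequentially, safe)
 fix X :: "nat => 'a" assume X: "\<forall>i. X i \<in> UNIV - {0}" "X \<longlonglongrightarrow> 0"
 have [measurable]: "K \<in> sets borel" using compact_imp_closed[OF K] by auto
 have iK: "integrable lborel (indicat_real K)"
  using emeasure_compact_finite[OF K] by (intro integrable_real_indicator) auto
 have iKh: "integrable lborel (%x. indicat_real K (x + h))" for h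
  using integrable_lborel_shift[OF iK] by simp
 have iKK: "integrable lborel (%x. indicat_real K (x + h) * (1 - indicat_real K x))" for h
  by (rule Bochner_Integration.integrable_bound[OF iKh[of h]]) (auto simp: indicator_def)
 have eq: "(\<integral>x. \<bar>indicat_real K (x + h) - indicat_real K x\<bar> \<partial>lborel) = 2 * (\<integral>x. indicat_real K (x + h) * (1 - indicat_real K x) \<partial>lborel)" for h
 proof -
  have "(\<integral>x. \<bar>indicat_real K (x + h) - indicat_real K x\<bar> \<partial>lborel) =
   (\<integral>x. (indicat_real K x - indicat_real K (x + h)) + 2 * (indicat_real K (x + h) * (1 - indicat_real K x)) \<partial>lborel)"
   by (rule Bochner_Integration.integral_cong) (auto simp: indicator_def)
  also have "\<dots> = 2 * (\<integral>x. indicat_real K (x + h) * (1 - indicat_real K x) \<partial>lborel)"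
   using iK iKh[of h] iKK[of h] integral_lborel_shift[of "indicat_real K" h] by simp
  finally show ?thesis .
 qed
 obtain R where R: "\<And>x. x \<in> K ==> norm x \<le> R" using compact_imp_bounded[OF K] unfolding bounded_iff by blast
 have "\<forall>\<^sub>F i in sequentially. norm (X i) < 1"
  using X(2) order_tendstoD(2)[OF tendsto_norm[OF X(2)], of 1] by simp
 then obtain N where N: "\<And>i. i \<ge> N ==> norm (X i) < 1" unfolding eventually_sequentially by auto
 have "(%i. \<integral>x. indicat_real K (x + X (i + N)) * (1 - indicat_real K x) \<partial>lborel) \<longlonglongrightarrow> (\<integral>x. (0::real) \<partial>(lborel::'a measure))"
 proof (rule integral_dominated_convergence[where w="indicator (cball 0 (R + 1))"])
  show "integrable lborel (indicator (cball 0 (R + 1)) :: 'a => real)"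
   using emeasure_compact_finite[of "cball 0 (R + 1)"] by (intro integrable_real_indicator) auto
  have XN: "(%i. X (i + N)) \<longlonglongrightarrow> 0" using X(2) by (rule LIMSEQ_ignore_initial_segment)
  show "AE x in lborel. (%i. indicat_real K (x + X (i + N)) * (1 - indicat_real K x)) \<longlonglongrightarrow> (0::real)"
  proof (rule AE_I2)
   fix x :: 'a
   show "(%i. indicat_real K (x + X (i + N)) * (1 - indicat_real K x)) \<longlonglongrightarrow> (0::real)"
   proof (cases "x \<in> K")
    case False
    have "(%i. x + X (i + N)) \<longlonglongrightarrow> x + 0" by (intro tendsto_intros XN)
    then have "\<forall>\<^sub>F i in sequentially. x + X (i + N) \<in> - K"
     using False compact_imp_closed[OF K] by (intro topological_tendstoD) auto
    then have "\<forall>\<^sub>F i in sequentially. indicat_real K (x + X (i + N)) * (1 - indicat_real K x) = (0::real)"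
     by eventually_elim auto
    then show ?thesis by (rule tendsto_eventually)
   qed simp
  qed
  show "AE x in lborel. norm (indicat_real K (x + X (i + N)) * (1 - indicat_real K x)) \<le> indicator (cball 0 (R + 1)) x" for i
  proof (rule AE_I2)
   fix x :: 'a
   have "norm x \<le> R + 1" if "x + X (i + N) \<in> K"
    using R[OF that] N[of "i + N"] norm_triangle_ineq4[of "x + X (i + N)" "X (i + N)"] by simp
   then show "norm (indicat_real K (x + X (i + N)) * (1 - indicat_real K x)) \<le> indicator (cball 0 (R + 1)) x"
    by (auto simp: indicator_def)
  qed
 qed auto
 then have "(%i. 2 * (\<integral>x. indicat_real K (x + X (i + N)) * (1 - indicat_real K x) \<partial>lborel)) \<longlonglongrightarrow> 2 * 0"
  by (intro tendsto_mult tendsto_const) simp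
 then show "((%h. \<integral>x. \<bar>indicat_real K (x + h) - indicat_real K x\<bar> \<partial>lborel) \<circ> X) \<longlonglongrightarrow> (0::real)"
  unfolding o_def eq by - (rule LIMSEQ_offset[of _ N], simp)
qed

text \<open>The functions with this property are closed under sums and under approximation in the
  mean, because the error of a translate equals the error of the function. This reduces the claim to
  indicators of sets of finite measure, which are approximated from inside by compact sets.\<close>

lemma translation_L1:
 fixes f :: "'a::euclidean_space => real"
 assumes "integrable lborel f"
 shows "((%h. \<integral>x. \<bar>f (x + h) - f x\<bar> \<partial>lborel) \<longlongrightarrow> 0) (at 0)"
proof -
 define P where "P = (%f :: 'a => real. ((%h. \<integral>x. \<bar>f (x + h) - f x\<bar> \<partial>lborel) \<longlongrightarrow> 0) (at 0))"
 have approx: "P f" if f: "integrable lborel f"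
  and ap: "\<And>e. 0 < e ==> \<exists>k. integrable lborel k \<and> P k \<and> (\<integral>x. \<bar>f x - k x\<bar> \<partial>lborel) < e" for f
  unfolding P_def
 proof (rule tendstoI)
  fix e :: real assume e: "0 < e"
  obtain k where k: "integrable lborel k" "P k" "(\<integral>x. \<bar>f x - k x\<bar> \<partial>lborel) < e / 3" using ap[of "e/3"] e by auto
  have "\<forall>\<^sub>F h in at 0. dist (\<integral>x. \<bar>k (x + h) - k x\<bar> \<partial>lborel) 0 < e / 3"
   using k(2) e unfolding P_def by (intro tendstoD) auto
  then show "\<forall>\<^sub>F h in at 0. dist (\<integral>x. \<bar>f (x + h) - f x\<bar> \<partial>lborel) 0 < e"
  proof eventually_elim
   case (elim h)
   have fh: "integrable lborel (%x. f (x + h))" "integrable lborel (%x. k (x + h))"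
    using f k integrable_lborel_shift by auto
   have fm: "f \<in> borel1" "k \<in> borel1"
    using f k borel_measurable_integrable by force+
   have "(\<integral>x. \<bar>f (x + h) - f x\<bar> \<partial>lborel) \<le>
    (\<integral>x. \<bar>f (x + h) - k (x + h)\<bar> + \<bar>k (x + h) - k x\<bar> + \<bar>f x - k x\<bar> \<partial>lborel)"
    using f k fh by (intro integral_mono) auto
   also have "\<dots> = (\<integral>x. \<bar>f (x + h) - k (x + h)\<bar> \<partial>lborel) + (\<integral>x. \<bar>k (x + h) - k x\<bar> \<partial>lborel) + (\<integral>x. \<bar>f x - k x\<bar> \<partial>lborel)"
    using f k fh by simp
   also have "(\<integral>x. \<bar>f (x + h) - k (x + h)\<bar> \<partial>lborel) = (\<integral>x. \<bar>f x - k x\<bar> \<partial>lborel)"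
    using integral_lborel_shift[of "%x. \<bar>f x - k x\<bar>" h] fm by simp
   finally show ?case using k(3) elim by (simp add: dist_real_def)
  qed
 qed
 have P_add: "P (%x. f x + g x)" if f: "integrable lborel f" "P f" and g: "integrable lborel g" "P g" for f g
  unfolding P_def
 proof (rule tendsto_sandwich[where f="%_. 0"])
  show "((%h. (\<integral>x. \<bar>f (x + h) - f x\<bar> \<partial>lborel) + (\<integral>x. \<bar>g (x + h) - g x\<bar> \<partial>lborel)) \<longlongrightarrow> 0) (at 0)"
   using tendsto_add[OF f(2)[unfolded P_def] g(2)[unfolded P_def]] by simp
  show "\<forall>\<^sub>F h in at 0. (\<integral>x. \<bar>f (x + h) + g (x + h) - (f x + g x)\<bar> \<partial>lborel) \<le>
   (\<integral>x. \<bar>f (x + h) - f x\<bar> \<partial>lborel) + (\<integral>x. \<bar>g (x + h) - g x\<bar> \<partial>lborel)"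
  proof (rule always_eventually, rule allI)
   fix h
   have fh: "integrable lborel (%x. f (x + h))" "integrable lborel (%x. g (x + h))"
    using f g integrable_lborel_shift by auto
   have "(\<integral>x. \<bar>f (x + h) + g (x + h) - (f x + g x)\<bar> \<partial>lborel) \<le>
    (\<integral>x. \<bar>f (x + h) - f x\<bar> + \<bar>g (x + h) - g x\<bar> \<partial>lborel)"
    using f g fh by (intro integral_mono) auto
   also have "\<dots> = (\<integral>x. \<bar>f (x + h) - f x\<bar> \<partial>lborel) + (\<integral>x. \<bar>g (x + h) - g x\<bar> \<partial>lborel)"
    using f g fh by simp
   finally show "(\<integral>x. \<bar>f (x + h) + g (x + h) - (f x + g x)\<bar> \<partial>lborel) \<le>
    (\<integral>x. \<bar>f (x + h) - f x\<bar> \<partial>lborel) + (\<integral>x. \<bar>g (x + h) - g x\<bar> \<partial>lborel)" .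
  qed
 qed auto
 from assms have "P f"
 proof (induction rule: integrable_induct)
  case (base A c)
  have [measurable]: "A \<in> sets borel" using base by simp
  have A: "A \<in> lmeasurable" using base by (auto simp: fmeasurable_def)
  have iA: "integrable lborel (%x. indicator A x * c)" using base by simp
  show ?case unfolding real_scaleR_def
  proof (rule approx[OF iA])
   fix e :: real assume e: "0 < e"
   define d where "d = e / (\<bar>c\<bar> + 1)"
   have d: "0 < d" using e by (simp add: d_def add_nonneg_pos)
   obtain K where K: "compact K" "K \<subseteq> A" "measure lborel (A - K) < d"
   proof -
    \<comment> \<open>Inner regularity is applied to a finite measure, hence to Lebesgue measure
      restricted to \<open>A\<close>.\<close>
    define M where "M = density lborel (indicator A :: 'a => ennreal)"
    have eM: "emeasure M B = emeasure lborel (A \<inter> B)" if "B \<in> sets borel" for B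
     using that by (simp add: M_def emeasure_density indicator_inter_arith[symmetric])
    have sM: "sets M = sets borel" by (simp add: M_def)
    have fin: "emeasure M B \<noteq> \<infinity>" if "B \<in> sets borel" for B
     using eM[OF that] base emeasure_mono[of "A \<inter> B" A lborel] by (auto simp: top_unique)
    have spM: "space M = UNIV" by (simp add: M_def)
    have "emeasure M A = (SUP K\<in>{K. K \<subseteq> A \<and> compact K}. emeasure M K)"
     by (rule inner_regular[OF sM]) (use fin[of UNIV] spM in auto)
    moreover have mA: "emeasure M A = ennreal (measure lborel A)"
     using eM[of A] base by (simp add: emeasure_eq_ennreal_measure less_top)
    ultimately have SUP: "ennreal (measure lborel A) = (SUP K\<in>{K. K \<subseteq> A \<and> compact K}. emeasure M K)" by simp
    show ?thesis
    proof (cases "measure lborel A = 0")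
     case True
     then show ?thesis using that[of "{}"] d by simp
    next
     case False
     then have "0 < measure lborel A" by (simp add: zero_less_measure_iff)
     then have "ennreal (measure lborel A - d) < ennreal (measure lborel A)" using d by (intro ennreal_lessI) auto
     then obtain K where K: "K \<subseteq> A" "compact K" "ennreal (measure lborel A - d) < emeasure M K"
      unfolding SUP less_SUP_iff by auto
     have [measurable]: "K \<in> sets borel" using compact_imp_closed[OF K(2)] by auto
     have "emeasure M K = ennreal (measure lborel K)"
      using eM[of K] K(1) emeasure_compact_finite[OF K(2)] by (simp add: Int_absorb1 emeasure_eq_ennreal_measure less_top)
     then have "measure lborel A - d < measure lborel K"
      using K(3) by (metis ennreal_leI measure_nonneg not_le)
     moreover have "measure lborel (A - K) = measure lborel A - measure lborel K"
      using base K(1) emeasure_compact_finite[OF K(2)] by (intro measure_Diff) (auto simp: less_top)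
     ultimately show ?thesis using that K by auto
    qed
   qed
   have [measurable]: "K \<in> sets borel" using compact_imp_closed[OF K(1)] by auto
   have iK: "integrable lborel (indicator K :: 'a => real)"
    using emeasure_compact_finite[OF K(1)] by (intro integrable_real_indicator) auto
   have "P (%x. indicator K x * c)"
    using tendsto_mult_right_zero[OF translation_compact[OF K(1)], of "\<bar>c\<bar>"]
    unfolding P_def left_diff_distrib[symmetric] abs_mult by (simp add: mult.commute)
   moreover have "(\<integral>x. \<bar>indicator A x * c - indicator K x * c\<bar> \<partial>lborel) < e"
   proof -
    have "(\<integral>x. \<bar>indicator A x * c - indicator K x * c\<bar> \<partial>lborel) = (\<integral>x. \<bar>c\<bar> * indicator (A - K) x \<partial>lborel)"
     by (rule Bochner_Integration.integral_cong) (use K(2) in \<open>auto simp: indicator_def\<close>)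
    also have "\<dots> = \<bar>c\<bar> * measure lborel (A - K)" by simp
    also have "\<dots> \<le> \<bar>c\<bar> * d" using K(3) by (intro mult_left_mono) auto
    also have "\<dots> < (\<bar>c\<bar> + 1) * d" using d by (intro mult_strict_right_mono) auto
    also have "\<dots> = e" by (simp add: d_def add_nonneg_pos less_imp_neq[symmetric])
    finally show ?thesis .
   qed
   ultimately show "\<exists>k. integrable lborel k \<and> P k \<and> (\<integral>x. \<bar>indicator A x * c - k x\<bar> \<partial>lborel) < e"
    using iK by (intro exI[of _ "%x. indicator K x * c"]) auto
  qed
 next
  case (add f g)
  then show ?case using P_add by blast
 next
  case (lim f s)
  note b = \<open>\<And>i x. x \<in> space lborel ==> norm (s i x) \<le> 2 * norm (f x)\<close>
   and conv = \<open>\<And>x. x \<in> space lborel ==> (%i. s i x) \<longlonglongrightarrow> f x\<close>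
   and int = \<open>\<And>i. integrable lborel (s i)\<close> \<open>integrable lborel f\<close>
  show ?case
  proof (rule approx)
   fix e :: real assume e: "0 < e"
   have "(%i. \<integral>x. \<bar>f x - s i x\<bar> \<partial>lborel) \<longlonglongrightarrow> (\<integral>x. (0::real) \<partial>(lborel::'a measure))"
   proof (rule integral_dominated_convergence[where w="%x. 3 * \<bar>f x\<bar>"])
    show "AE x in lborel. (%i. \<bar>f x - s i x\<bar>) \<longlonglongrightarrow> 0"
    proof (rule AE_I2)
     fix x :: 'a
     have "(%i. \<bar>f x - s i x\<bar>) \<longlonglongrightarrow> \<bar>f x - f x\<bar>" using conv[of x] by (intro tendsto_intros) auto
     then show "(%i. \<bar>f x - s i x\<bar>) \<longlonglongrightarrow> 0" by simp
    qed
    show "AE x in lborel. norm \<bar>f x - s i x\<bar> \<le> 3 * \<bar>f x\<bar>" for i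
    proof (rule AE_I2)
     fix x :: 'a
     have "\<bar>s i x\<bar> \<le> 2 * \<bar>f x\<bar>" using b by simp
     then show "norm \<bar>f x - s i x\<bar> \<le> 3 * \<bar>f x\<bar>" by simp
    qed
   qed (use lim int borel_measurable_integrable[OF int(1)] borel_measurable_integrable[OF int(2)] in auto)
   then have "\<forall>\<^sub>F i in sequentially. (\<integral>x. \<bar>f x - s i x\<bar> \<partial>lborel) < e" using e by (intro order_tendstoD) auto
   then obtain i where "(\<integral>x. \<bar>f x - s i x\<bar> \<partial>lborel) < e" unfolding eventually_sequentially by blast
   then show "\<exists>k. integrable lborel k \<and> P k \<and> (\<integral>x. \<bar>f x - k x\<bar> \<partial>lborel) < e" using lim by blast
  qed fact
 qed
 then show ?thesis by (simp add: P_def)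
qed

text \<open>For nonnegative numbers
  \<open>(c - d)\<^sup>2 \<le> \<bar>c\<^sup>2 - d\<^sup>2\<bar>\<close>, so the claim follows from
  continuity in the mean of the squares of the positive and the negative part.\<close>

lemma translation_L2:
 fixes f :: "'a::euclidean_space => real"
 assumes f: "in_L2 lborel f"
 shows "((%h. \<integral>x. (f (x + h) - f x)\<^sup>2 \<partial>lborel) \<longlongrightarrow> 0) (at 0)"
proof -
 have fm[measurable]: "f \<in> borel1" using f by (simp add: in_L2_def)
 define p n where "p = (%x. (max 0 (f x))\<^sup>2)" and "n = (%x. (max 0 (- f x))\<^sup>2)"
 have [measurable]: "p \<in> borel1" "n \<in> borel1" unfolding p_def n_def by auto
 have pn: "integrable lborel p" "integrable lborel n"
  by (rule Bochner_Integration.integrable_bound[OF in_L2_integrable_sq[OF f]];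
   auto simp: p_def n_def max_def power2_eq_square)+
 have ineq: "(a - b)\<^sup>2 \<le> 2 * \<bar>(max 0 a)\<^sup>2 - (max 0 b)\<^sup>2\<bar> + 2 * \<bar>(max 0 (-a))\<^sup>2 - (max 0 (-b))\<^sup>2\<bar>" for a b :: real
 proof -
  have sq: "(c - d)\<^sup>2 \<le> \<bar>c\<^sup>2 - d\<^sup>2\<bar>" if "0 \<le> c" "0 \<le> d" for c d :: real
  proof -
   have "(c - d)\<^sup>2 = \<bar>c - d\<bar> * \<bar>c - d\<bar>" by (simp add: power2_eq_square)
   also have "\<dots> \<le> \<bar>c - d\<bar> * \<bar>c + d\<bar>" using that by (intro mult_left_mono) auto
   also have "\<dots> = \<bar>c\<^sup>2 - d\<^sup>2\<bar>" by (simp add: abs_mult[symmetric] power2_eq_square algebra_simps)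
   finally show ?thesis .
  qed
  have ab: "a - b = (max 0 a - max 0 b) - (max 0 (-a) - max 0 (-b))" by (auto simp: max_def)
  have two: "(c - d)\<^sup>2 \<le> 2 * c\<^sup>2 + 2 * d\<^sup>2" for c d :: real
   using zero_le_power2[of "c + d"] by (simp add: power2_sum power2_diff)
  have "(a - b)\<^sup>2 \<le> 2 * (max 0 a - max 0 b)\<^sup>2 + 2 * (max 0 (-a) - max 0 (-b))\<^sup>2"
   using two[of "max 0 a - max 0 b" "max 0 (-a) - max 0 (-b)"] by (simp only: ab[symmetric])
  also have "\<dots> \<le> 2 * \<bar>(max 0 a)\<^sup>2 - (max 0 b)\<^sup>2\<bar> + 2 * \<bar>(max 0 (-a))\<^sup>2 - (max 0 (-b))\<^sup>2\<bar>"
   using sq[of "max 0 a" "max 0 b", OF max.cobounded1 max.cobounded1]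
    sq[of "max 0 (-a)" "max 0 (-b)", OF max.cobounded1 max.cobounded1] by linarith
  finally show ?thesis .
 qed
 show ?thesis
 proof (rule tendsto_sandwich[where f="%_. 0"])
  show "((%h. 2 * (\<integral>x. \<bar>p (x + h) - p x\<bar> \<partial>lborel) + 2 * (\<integral>x. \<bar>n (x + h) - n x\<bar> \<partial>lborel)) \<longlongrightarrow> 0) (at 0)"
   using tendsto_add[OF tendsto_mult_right_zero[OF translation_L1[OF pn(1)], of 2] tendsto_mult_right_zero[OF translation_L1[OF pn(2)], of 2]] by simp
  show "\<forall>\<^sub>F h in at 0. (\<integral>x. (f (x + h) - f x)\<^sup>2 \<partial>lborel) \<le>
   2 * (\<integral>x. \<bar>p (x + h) - p x\<bar> \<partial>lborel) + 2 * (\<integral>x. \<bar>n (x + h) - n x\<bar> \<partial>lborel)"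
  proof (rule always_eventually, rule allI)
   fix h
   have i: "integrable lborel (%x. p (x + h))" "integrable lborel (%x. n (x + h))"
    using pn integrable_lborel_shift by auto
   have i2: "integrable lborel (%x. 2 * \<bar>p (x + h) - p x\<bar> + 2 * \<bar>n (x + h) - n x\<bar>)"
    using pn i by auto
   have "(\<integral>x. (f (x + h) - f x)\<^sup>2 \<partial>lborel) \<le> (\<integral>x. 2 * \<bar>p (x + h) - p x\<bar> + 2 * \<bar>n (x + h) - n x\<bar> \<partial>lborel)"
   proof (rule integral_mono'[OF i2])
    show "(f (x + h) - f x)\<^sup>2 \<le> 2 * \<bar>p (x + h) - p x\<bar> + 2 * \<bar>n (x + h) - n x\<bar>" for x
     unfolding p_def n_def by (rule ineq)
   qed simp
   then show "(\<integral>x. (f (x + h) - f x)\<^sup>2 \<partial>lborel) \<le>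
    2 * (\<integral>x. \<bar>p (x + h) - p x\<bar> \<partial>lborel) + 2 * (\<integral>x. \<bar>n (x + h) - n x\<bar> \<partial>lborel)"
    using pn i by simp
  qed
 qed auto
qed

section \<open>The equation of state\<close>

locale exponents =
 fixes gp gm :: real
 assumes gp: "1 < gp" and gm: "1 < gm"
begin

definition gr :: real where "gr = gp / gm"

lemma gr_pos: "0 < gr" using gp gm by (simp add: gr_def)

text \<open>In terms of the mass fraction \<open>\<theta> = R\<tau>\<close>, which does not depend on time, the implicit relation
 for \<open>Z\<close> is solved explicitly by the specific volume: \<open>\<tau> = \<theta> / Z + (1 - \<theta>) / Z\<^sup>\<gamma>\<close>.\<close>

definition vol :: "real => real => real" where
 "vol \<theta> z = \<theta> / z + (1 - \<theta>) * z powr (- gr)"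

text \<open>The value 0 outside the physical range makes \<open>Zst\<close> total; genuine values
  are positive, so the sublevel sets still separate the two cases.\<close>

definition Zst :: "real => real => real" where
 "Zst \<theta> \<tau> = (if 0 < \<theta> \<and> \<theta> < 1 \<and> 0 < \<tau> then Zfun gr (\<theta> / \<tau>) ((1 - \<theta>) / \<tau>) else 0)"

definition P :: "real => real => real" where
 "P \<theta> \<tau> = Zst \<theta> \<tau> powr gp"

text \<open>The potential energy per unit mass: the antiderivative of \<open>- P \<theta>\<close> in
  the volume that vanishes at infinite volume. It arises by integrating \<open>z powr gp\<close>
  against the derivative of \<open>vol \<theta>\<close>; the denominator \<open>gm - 1\<close> comes
  from \<open>gp - gr = gr * (gm - 1)\<close>.\<close>

definition W :: "real => real => real" where
 "W \<theta> \<tau> = \<theta> * Zst \<theta> \<tau> powr (gp - 1) / (gp - 1) + (1 - \<theta>) * Zst \<theta> \<tau> powr (gp - gr) / (gm - 1)"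

lemma Zfun_vol_iff:
 assumes "0 < \<theta>" "\<theta> < 1" "0 < \<tau>"
 shows "((1 - \<theta>) / \<tau> = (1 - \<theta> / \<tau> / z) * z powr gr \<and> \<theta> / \<tau> \<le> z) \<longleftrightarrow> 0 < z \<and> vol \<theta> z = \<tau>"
proof (cases "0 < z")
 case True
 define x where "x = z powr gr"
 have x: "0 < x" "z powr (- gr) = 1 / x" using True by (auto simp: x_def powr_minus_divide)
 define w where "w = \<theta> / z"
 have w: "1 - \<theta> / \<tau> / z = (\<tau> - w) / \<tau>" "vol \<theta> z = w + (1 - \<theta>) / x"
  using assms x by (simp_all add: w_def vol_def diff_divide_distrib)
 have "(1 - \<theta>) / \<tau> = (1 - \<theta> / \<tau> / z) * x \<longleftrightarrow> 1 - \<theta> = (\<tau> - w) * x"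
  unfolding w using assms by simp
 also have "\<dots> \<longleftrightarrow> vol \<theta> z = \<tau>" unfolding w using x by (auto simp: field_simps)
 finally have "(1 - \<theta>) / \<tau> = (1 - \<theta> / \<tau> / z) * x \<longleftrightarrow> vol \<theta> z = \<tau>" .
 moreover have "\<theta> / \<tau> \<le> z" if "vol \<theta> z = \<tau>"
 proof -
  have "\<theta> / z \<le> \<tau>" using that assms mult_nonneg_nonneg[of "1 - \<theta>" "z powr (- gr)"]
   by (simp add: vol_def del: mult_nonneg_nonneg zero_le_mult_iff)
  then show ?thesis using True assms by (simp add: field_simps)
 qed
 ultimately show ?thesis using True by (auto simp: x_def)
next
 case False
 moreover have "0 < \<theta> / \<tau>" using assms by simp
 ultimately show ?thesis by auto
qed

lemma Zst_props:
 assumes "0 < \<theta>" "\<theta> < 1" "0 < \<tau>"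
 shows "0 < Zst \<theta> \<tau>" "vol \<theta> (Zst \<theta> \<tau>) = \<tau>"
proof -
 have "\<exists>!Z. (1 - \<theta>) / \<tau> = (1 - \<theta> / \<tau> / Z) * Z powr gr \<and> \<theta> / \<tau> \<le> Z"
  using assms gr_pos by (intro Zfun_unique) auto
 from theI'[OF this] show "0 < Zst \<theta> \<tau>" "vol \<theta> (Zst \<theta> \<tau>) = \<tau>"
  using assms unfolding Zst_def Zfun_def Zfun_vol_iff[OF assms] by auto
qed

lemma vol_pos: "0 < \<theta> ==> \<theta> < 1 ==> 0 < z ==> 0 < vol \<theta> z"
 unfolding vol_def by (intro add_pos_pos mult_pos_pos) auto

lemma vol_strict_antimono:
 assumes "0 < \<theta>" "\<theta> < 1" "0 < a" "a < b"
 shows "vol \<theta> b < vol \<theta> a"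
proof -
 have "\<theta> / b < \<theta> / a" using assms by (simp add: divide_strict_left_mono)
 moreover have "b powr (- gr) < a powr (- gr)" using assms gr_pos by (intro powr_less_mono2_neg) auto
 ultimately show ?thesis using assms by (auto simp: vol_def intro!: add_strict_mono)
qed

lemma Zst_vol:
 assumes "0 < \<theta>" "\<theta> < 1" "0 < z"
 shows "Zst \<theta> (vol \<theta> z) = z"
proof -
 note p = Zst_props[OF assms(1,2) vol_pos[OF assms]]
 define w where "w = Zst \<theta> (vol \<theta> z)"
 have w: "0 < w" "vol \<theta> w = vol \<theta> z" using p by (auto simp: w_def)
 have "w = z"
  using vol_strict_antimono[OF assms(1,2), of z w] vol_strict_antimono[OF assms(1,2), of w z] w assms(3)
  by (cases w z rule: linorder_cases) auto
 then show ?thesis by (simp add: w_def)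
qed

lemma Zst_le_iff:
 assumes "0 < \<theta>" "\<theta> < 1" "0 < \<tau>" "0 < a"
 shows "Zst \<theta> \<tau> \<le> a \<longleftrightarrow> vol \<theta> a \<le> \<tau>"
proof -
 define w where "w = Zst \<theta> \<tau>"
 have w: "0 < w" "vol \<theta> w = \<tau>" using Zst_props[OF assms(1-3)] by (auto simp: w_def)
 have "w \<le> a \<longleftrightarrow> vol \<theta> a \<le> \<tau>"
  using vol_strict_antimono[OF assms(1,2), of a w] vol_strict_antimono[OF assms(1,2), of w a] w assms(4)
  by (cases w a rule: linorder_cases) auto
 then show ?thesis by (simp add: w_def)
qed

lemma Zst_nonneg: "0 \<le> Zst \<theta> \<tau>"
 using Zst_props[of \<theta> \<tau>] by (cases "0 < \<theta> \<and> \<theta> < 1 \<and> 0 < \<tau>") (auto simp: Zst_def)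

text \<open>By monotonicity \<open>Zst \<theta> \<tau> \<le> a\<close> is the explicit inequality
  \<open>vol \<theta> a \<le> \<tau>\<close>, so the sublevel sets of the implicitly given function
  are described by Borel expressions.\<close>

lemma Zst_measurable [measurable]: "case_prod Zst \<in> borel2"
proof (rule borel_measurableI_le)
 fix a :: real
 have "{w \<in> space (borel \<Otimes>\<^sub>M borel). case_prod Zst w \<le> a} =
  (if 0 < a then {w. 0 < fst w \<and> fst w < 1 \<and> 0 < snd w --> vol (fst w) a \<le> snd w}
  else if a = 0 then {w. \<not> (0 < fst w \<and> fst w < 1 \<and> 0 < snd w)} else {})" (is "?L = ?R")
 proof -
  have "w \<in> ?L \<longleftrightarrow> w \<in> ?R" for w
  proof (cases w)
   case (Pair \<theta> \<tau>)
   show ?thesis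
   proof (cases "0 < \<theta> \<and> \<theta> < 1 \<and> 0 < \<tau>")
    case True
    then have "Zst \<theta> \<tau> \<le> a \<longleftrightarrow> 0 < a \<and> vol \<theta> a \<le> \<tau>"
     using Zst_le_iff[of \<theta> \<tau> a] Zst_props(1)[of \<theta> \<tau>] by (cases "0 < a") auto
    then show ?thesis using True by (simp add: Pair space_pair_measure)
   next
    case False
    then have "Zst \<theta> \<tau> = 0" by (auto simp: Zst_def)
    then show ?thesis using False by (auto simp: Pair space_pair_measure)
   qed
  qed
  then show ?thesis by blast
 qed
 also have "\<dots> \<in> sets (borel \<Otimes>\<^sub>M borel)"
 proof -
  define k where "k = a powr (- gr)"
  have m: "{w \<in> space (borel \<Otimes>\<^sub>M borel). fst w / a + (1 - fst w) * k \<le> snd w} \<in> sets (borel \<Otimes>\<^sub>M (borel :: real measure))"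
   by measurable
  have m2: "{w \<in> space (borel \<Otimes>\<^sub>M borel). \<not> (0 < fst w \<and> fst w < (1::real) \<and> 0 < snd w)} \<in> sets (borel \<Otimes>\<^sub>M (borel :: real measure))"
   by measurable
  have eq: "{w. 0 < fst w \<and> fst w < 1 \<and> 0 < snd w --> vol (fst w) a \<le> snd w} =
   {w \<in> space (borel \<Otimes>\<^sub>M borel). fst w / a + (1 - fst w) * k \<le> snd w} \<union>
   {w \<in> space (borel \<Otimes>\<^sub>M borel). \<not> (0 < fst w \<and> fst w < (1::real) \<and> 0 < snd w)}"
   by (auto simp: vol_def k_def space_pair_measure)
  show ?thesis using sets.Un[OF m m2] m2 unfolding eq[symmetric] by (auto simp: space_pair_measure)
 qed
 finally show "{w \<in> space (borel \<Otimes>\<^sub>M borel). case_prod Zst w \<le> a} \<in> sets (borel \<Otimes>\<^sub>M borel)" .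
qed

lemma P_measurable [measurable]: "case_prod P \<in> borel2"
proof -
 have "case_prod P = (%w. case_prod Zst w powr gp)" by (auto simp: P_def fun_eq_iff)
 then show ?thesis using Zst_measurable by simp
qed

lemma W_measurable [measurable]: "case_prod W \<in> borel2"
proof -
 have "case_prod W = (%w. fst w * case_prod Zst w powr (gp - 1) / (gp - 1)
   + (1 - fst w) * case_prod Zst w powr (gp - gr) / (gm - 1))" by (auto simp: W_def fun_eq_iff)
 then show ?thesis using Zst_measurable by simp
qed

lemma DERIV_Zst:
 assumes \<theta>: "0 < \<theta>" "\<theta> < 1" and \<tau>: "0 < \<tau>"
 defines "z \<equiv> Zst \<theta> \<tau>"
 shows "(Zst \<theta> has_real_derivative - 1 / (\<theta> / z\<^sup>2 + gr * (1 - \<theta>) * z powr (- gr - 1))) (at \<tau>)"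
proof -
 have z: "0 < z" "vol \<theta> z = \<tau>" using Zst_props[OF \<theta> \<tau>] by (auto simp: z_def)
 define D where "D = - (\<theta> / z\<^sup>2 + gr * (1 - \<theta>) * z powr (- gr - 1))"
 have Dpos: "0 < \<theta> / z\<^sup>2 + gr * (1 - \<theta>) * z powr (- gr - 1)"
  using z \<theta> gr_pos by (intro add_pos_pos mult_pos_pos divide_pos_pos) auto
 have dv: "(vol \<theta> has_real_derivative D) (at z)"
  unfolding vol_def[abs_def] D_def
  by (rule derivative_eq_intros refl | use z in \<open>simp add: power2_eq_square algebra_simps\<close>)+
 have cont: "isCont (vol \<theta>) x" if "0 < x" for x
  unfolding vol_def[abs_def] using that by (intro continuous_intros) auto
 have "isCont (Zst \<theta>) (vol \<theta> z)"
  by (rule isCont_inverse_function2[of "z / 2" z "2 * z"]) (use z cont Zst_vol[OF \<theta>] in auto)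
 then have "isCont (Zst \<theta>) \<tau>" using z by simp
 then have "(Zst \<theta> has_real_derivative inverse D) (at \<tau>)"
  using dv Dpos Zst_props[OF \<theta>] \<tau>
  by (intro DERIV_inverse_function[where f="vol \<theta>" and a=0 and b="\<tau> + 1"]) (auto simp: z_def D_def)
 moreover have "inverse (- S) = - 1 / S" for S :: real by (simp add: inverse_eq_divide)
 ultimately show ?thesis by (simp only: D_def)
qed


lemma P_nonneg [simp]: "0 \<le> P \<theta> \<tau>" by (simp add: P_def)

text \<open>With \<open>a\<close> and \<open>b\<close> the partial volumes of the two fluids one has
  \<open>a + b = \<tau>\<close> and \<open>- D = gp * P \<theta> \<tau> / (a + gr * b)\<close>. The
  bounds follow from \<open>gr \<le> gp\<close> and \<open>gp = gm * gr\<close>. They make the slope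
  comparable to \<open>P \<theta> \<tau> / \<tau>\<close>, uniformly in the mass fraction.\<close>

lemma DERIV_P:
 assumes \<theta>: "0 < \<theta>" "\<theta> < 1" and \<tau>: "0 < \<tau>"
 obtains D where "(P \<theta> has_real_derivative D) (at \<tau>)" "P \<theta> \<tau> / \<tau> \<le> - D" "- D \<le> max gp gm * P \<theta> \<tau> / \<tau>"
proof -
 define z where "z = Zst \<theta> \<tau>"
 have z: "0 < z" "vol \<theta> z = \<tau>" using Zst_props[OF \<theta> \<tau>] by (auto simp: z_def)
 define a b where "a = \<theta> / z" and "b = (1 - \<theta>) * z powr (- gr)"
 have ab: "0 < a" "0 < b" "a + b = \<tau>" using z \<theta> by (auto simp: a_def b_def vol_def)
 define S where "S = \<theta> / z\<^sup>2 + gr * (1 - \<theta>) * z powr (- gr - 1)"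
 have S: "z * S = a + gr * b"
 proof -
  have "z powr (- gr) = z powr 1 * z powr (- gr - 1)" unfolding powr_add[symmetric] by simp
  then have "z powr (- gr) = z * z powr (- gr - 1)" using z by simp
  then show ?thesis using z by (simp add: S_def a_def b_def power2_eq_square algebra_simps)
 qed
 have ap: "0 < a + gr * b" using ab gr_pos by (simp add: add_pos_pos)
 then have Sp: "0 < S" using S z by (metis mult_pos_pos zero_less_mult_pos)
 define D where "D = gp * z powr (gp - 1) * (- 1 / S)"
 have "(P \<theta> has_real_derivative D) (at \<tau>)"
  unfolding P_def[abs_def] D_def
  by (rule derivative_eq_intros DERIV_Zst[OF \<theta> \<tau>] refl | use z in \<open>simp add: z_def S_def\<close>)+
 moreover have D: "- D = gp * P \<theta> \<tau> / (a + gr * b)"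
 proof -
  have "z powr gp = z powr (gp - 1) * z powr 1" unfolding powr_add[symmetric] by simp
  then show ?thesis using z Sp unfolding S[symmetric] by (simp add: D_def P_def z_def[symmetric])
 qed
 moreover have "P \<theta> \<tau> / \<tau> \<le> - D"
 proof -
  have "gr * b \<le> gp * b" using ab gp gm by (intro mult_right_mono) (auto simp: gr_def field_simps)
  moreover have "a \<le> gp * a" using ab gp by simp
  ultimately have "a + gr * b \<le> gp * \<tau>" unfolding ab(3)[symmetric] by (simp add: distrib_left)
  then have "P \<theta> \<tau> * (a + gr * b) \<le> P \<theta> \<tau> * (gp * \<tau>)" by (intro mult_left_mono) auto
  then show ?thesis unfolding D using ap \<tau> by (simp add: field_simps)
 qed
 moreover have "- D \<le> max gp gm * P \<theta> \<tau> / \<tau>"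
 proof -
  have "gp * a \<le> max gp gm * a" using ab by (intro mult_right_mono) auto
  moreover have "gp * b \<le> max gp gm * (gr * b)"
  proof -
   have "gp = gm * gr" using gm by (simp add: gr_def)
   also have "\<dots> \<le> max gp gm * gr" using gr_pos by (intro mult_right_mono) auto
   finally show ?thesis using ab by (simp add: mult.assoc[symmetric] mult_right_mono)
  qed
  ultimately have "gp * \<tau> \<le> max gp gm * (a + gr * b)" unfolding ab(3)[symmetric] by (simp add: distrib_left)
  then have "P \<theta> \<tau> * (gp * \<tau>) \<le> P \<theta> \<tau> * (max gp gm * (a + gr * b))" by (intro mult_left_mono) auto
  then show ?thesis unfolding D using ap \<tau> by (simp add: field_simps)
 qed
 ultimately show ?thesis using that by blast
qed

lemma DERIV_W:
 assumes \<theta>: "0 < \<theta>" "\<theta> < 1" and \<tau>: "0 < \<tau>"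
 shows "(W \<theta> has_real_derivative - P \<theta> \<tau>) (at \<tau>)"
proof -
 define z where "z = Zst \<theta> \<tau>"
 have z: "0 < z" "vol \<theta> z = \<tau>" using Zst_props[OF \<theta> \<tau>] by (auto simp: z_def)
 define S where "S = \<theta> / z\<^sup>2 + gr * (1 - \<theta>) * z powr (- gr - 1)"
 have Sp: "0 < S" unfolding S_def
  using z \<theta> gr_pos by (intro add_pos_pos mult_pos_pos divide_pos_pos) auto
 have d: "(Zst \<theta> has_real_derivative - 1 / S) (at \<tau>)" using DERIV_Zst[OF \<theta> \<tau>] by (simp add: S_def z_def)
 have dz: "((%x. Zst \<theta> x powr r) has_real_derivative r * z powr (r - 1) * (- 1 / S)) (at \<tau>)" for r
  using DERIV_fun_powr[OF d, of r] z by (simp add: z_def)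
 have "(W \<theta> has_real_derivative (\<theta> * ((gp - 1) * z powr (gp - 1 - 1) * (- 1 / S)) / (gp - 1)
  + (1 - \<theta>) * ((gp - gr) * z powr (gp - gr - 1) * (- 1 / S)) / (gm - 1))) (at \<tau>)"
  unfolding W_def[abs_def] by (intro DERIV_add DERIV_cdivide DERIV_cmult dz)
 moreover have "\<theta> * ((gp - 1) * z powr (gp - 1 - 1) * (- 1 / S)) / (gp - 1)
  + (1 - \<theta>) * ((gp - gr) * z powr (gp - gr - 1) * (- 1 / S)) / (gm - 1) = - P \<theta> \<tau>"
 proof -
  have 1: "gp - gr = gr * (gm - 1)" using gm by (simp add: gr_def field_simps)
  have p1: "z powr (gp - 1 - 1) = z powr gp / z\<^sup>2" using z(1) by (simp add: powr_diff power2_eq_square)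
  have "gp - gr - 1 = gp + (- gr - 1)" by simp
  then have p2: "z powr (gp - gr - 1) = z powr gp * z powr (- gr - 1)" by (simp only: powr_add)
  have "\<theta> * ((gp - 1) * x * (- 1 / S)) / (gp - 1) = - (\<theta> * x) / S" for x
   using gp by simp
  moreover have "(1 - \<theta>) * ((gp - gr) * x * (- 1 / S)) / (gm - 1) = - ((1 - \<theta>) * gr * x) / S" for x
   unfolding 1 using gm by simp
  ultimately have "\<theta> * ((gp - 1) * z powr (gp - 1 - 1) * (- 1 / S)) / (gp - 1)
  + (1 - \<theta>) * ((gp - gr) * z powr (gp - gr - 1) * (- 1 / S)) / (gm - 1)
   = - (\<theta> * z powr (gp - 1 - 1)) / S + - ((1 - \<theta>) * gr * z powr (gp - gr - 1)) / S" by simp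
  also have "\<dots> = - (z powr gp * S) / S" unfolding p1 p2 S_def add_divide_distrib[symmetric]
   by (simp add: algebra_simps)
  finally show ?thesis using Sp by (simp add: P_def z_def)
 qed
 ultimately show ?thesis by simp
qed

lemma W_nonneg: "0 \<le> \<theta> ==> \<theta> \<le> 1 ==> 0 \<le> W \<theta> \<tau>"
 using gp gm by (simp add: W_def)

text \<open>Both sides are combinations of the same two nonnegative terms, with coefficients 1 on
  the left and \<open>1 / (gp - 1)\<close>, \<open>1 / (gm - 1)\<close> inside \<open>W\<close>.
  Through this bound the energy controls the rate at which \<open>c\<close> falls.\<close>

lemma P_tau_le_W:
 assumes \<theta>: "0 < \<theta>" "\<theta> < 1" and \<tau>: "0 < \<tau>"
 shows "P \<theta> \<tau> * \<tau> \<le> max gp gm * W \<theta> \<tau>"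
proof -
 define z where "z = Zst \<theta> \<tau>"
 have z: "0 < z" "vol \<theta> z = \<tau>" using Zst_props[OF \<theta> \<tau>] by (auto simp: z_def)
 define A B where "A = \<theta> * z powr (gp - 1)" and "B = (1 - \<theta>) * z powr (gp - gr)"
 have AB: "0 \<le> A" "0 \<le> B" using \<theta> by (auto simp: A_def B_def)
 have "P \<theta> \<tau> * \<tau> = z powr gp * vol \<theta> z" using z by (simp add: P_def z_def)
 also have "\<dots> = A + B"
  using z(1) by (simp add: vol_def A_def B_def powr_diff powr_minus_divide field_simps)
 also have "\<dots> \<le> max gp gm * (A / (gp - 1) + B / (gm - 1))"
 proof -
  have "A * (gp - 1) \<le> A * max gp gm" using AB by (intro mult_left_mono) auto
  then have "A \<le> max gp gm * (A / (gp - 1))" using gp by (simp add: field_simps)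
  moreover have "B * (gm - 1) \<le> B * max gp gm" using AB by (intro mult_left_mono) auto
  then have "B \<le> max gp gm * (B / (gm - 1))" using gm by (simp add: field_simps)
  ultimately show ?thesis by (simp add: distrib_left)
 qed
 finally show ?thesis by (simp add: W_def A_def B_def z_def)
qed

lemma continuous_on_P: "0 < \<theta> ==> \<theta> < 1 ==> continuous_on {0<..} (P \<theta>)"
 by (rule continuous_at_imp_continuous_on) (metis DERIV_P DERIV_isCont greaterThan_iff)


text \<open>At \<open>Z = k\<close> the first fluid alone occupies at least \<open>lo / k\<close>,
  so a smaller volume forces a larger \<open>Z\<close>; this is what makes the threshold uniform in
  \<open>\<theta>\<close>.\<close>

lemma P_large:
 assumes "0 < lo"
 obtains d where "0 < d" "\<And>\<theta> \<tau>. lo \<le> \<theta> ==> \<theta> < 1 ==> 0 < \<tau> ==> \<tau> \<le> d ==> K \<le> P \<theta> \<tau>"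
proof -
 define k where "k = max 1 K powr (1 / gp)"
 have k: "0 < k" "k powr gp = max 1 K" using gp by (auto simp: k_def powr_powr)
 show ?thesis
 proof (rule that[of "lo / k"])
  show "0 < lo / k" using assms k by simp
  fix \<theta> \<tau> :: real assume a: "lo \<le> \<theta>" "\<theta> < 1" "0 < \<tau>" "\<tau> \<le> lo / k"
  have "\<tau> < vol \<theta> k"
  proof -
   have "lo / k \<le> \<theta> / k" using a k by (simp add: divide_right_mono)
   moreover have "0 < (1 - \<theta>) * k powr (- gr)" using a k by simp
   ultimately show ?thesis using a by (simp add: vol_def)
  qed
  then have "k \<le> Zst \<theta> \<tau>" using Zst_le_iff[of \<theta> \<tau> k] a assms k by auto
  then have "k powr gp \<le> P \<theta> \<tau>" unfolding P_def using k gp by (intro powr_mono2) auto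
  then show "K \<le> P \<theta> \<tau>" using k by simp
 qed
qed

text \<open>Whatever the mass fraction, the mixture at \<open>Z = k\<close> occupies at most
  \<open>1 / k + k powr (- gr)\<close>; a larger volume therefore has a smaller pressure.\<close>

lemma P_small:
 assumes "0 < e"
 obtains M where "0 < M" "\<And>\<theta> \<tau>. 0 < \<theta> ==> \<theta> < 1 ==> M \<le> \<tau> ==> P \<theta> \<tau> \<le> e"
proof -
 define k where "k = e powr (1 / gp)"
 have k: "0 < k" "k powr gp = e" using gp assms by (auto simp: k_def powr_powr)
 show ?thesis
 proof (rule that[of "1 / k + k powr (- gr)"])
  show "0 < 1 / k + k powr (- gr)" using k by (simp add: add_pos_pos)
  fix \<theta> \<tau> :: real assume a: "0 < \<theta>" "\<theta> < 1" "1 / k + k powr (- gr) \<le> \<tau>"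
  have "vol \<theta> k \<le> 1 / k + 1 * k powr (- gr)"
   unfolding vol_def using a k by (intro add_mono mult_right_mono divide_right_mono) auto
  moreover have "0 < 1 / k + k powr (- gr)" using k by (simp add: add_pos_pos)
  ultimately have "Zst \<theta> \<tau> \<le> k" using Zst_le_iff[of \<theta> \<tau> k] a k by auto
  then have "P \<theta> \<tau> \<le> k powr gp" unfolding P_def using Zst_nonneg gp by (intro powr_mono2) auto
  then show "P \<theta> \<tau> \<le> e" using k by simp
 qed
qed

lemma P_upper:
 assumes "0 < d"
 obtains K where "0 < K" "\<And>\<theta> \<tau>. 0 < \<theta> ==> \<theta> < 1 ==> d \<le> \<tau> ==> P \<theta> \<tau> \<le> K"
proof -
 \<comment> \<open>Chosen so that \<open>1 / k\<close> and \<open>k powr (- gr)\<close>, which bound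
   the two partial volumes, are each at most \<open>d / 2\<close>.\<close>
 define k where "k = max (2 / d) ((2 / d) powr (1 / gr))"
 have k: "0 < k" using assms by (simp add: k_def less_max_iff_disj)
 have "1 / k \<le> d / 2"
 proof -
  have "2 / d \<le> k" by (simp add: k_def)
  then show ?thesis using k assms by (simp add: field_simps)
 qed
 moreover have "k powr (- gr) \<le> d / 2"
 proof -
  have "((2 / d) powr (1 / gr)) powr gr \<le> k powr gr" using gr_pos by (intro powr_mono2) (auto simp: k_def)
  then have "2 / d \<le> k powr gr" using gr_pos assms by (simp add: powr_powr)
  then show ?thesis using assms k by (simp add: powr_minus_divide field_simps)
 qed
 ultimately have *: "1 / k + k powr (- gr) \<le> d" by simp
 show ?thesis
 proof (rule that[of "k powr gp"])
  show "0 < k powr gp" using k by simp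
  fix \<theta> \<tau> :: real assume a: "0 < \<theta>" "\<theta> < 1" "d \<le> \<tau>"
  have "vol \<theta> k \<le> 1 / k + 1 * k powr (- gr)"
   unfolding vol_def using a k by (intro add_mono mult_right_mono divide_right_mono) auto
  then have "Zst \<theta> \<tau> \<le> k" using Zst_le_iff[of \<theta> \<tau> k] a k * assms by auto
  then show "P \<theta> \<tau> \<le> k powr gp" unfolding P_def using Zst_nonneg gp by (intro powr_mono2) auto
 qed
qed

text \<open>At \<open>Z = lo / M\<close> the first fluid by itself already fills the volume
  \<open>M\<close>, so volumes up to \<open>M\<close> require at least this
  \<open>Z\<close>.\<close>

lemma P_lower:
 assumes "0 < lo" "0 < M"
 obtains k where "0 < k" "\<And>\<theta> \<tau>. lo \<le> \<theta> ==> \<theta> < 1 ==> 0 < \<tau> ==> \<tau> \<le> M ==> k \<le> P \<theta> \<tau>"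
proof -
 show ?thesis
 proof (rule that[of "(lo / M) powr gp"])
  show "0 < (lo / M) powr gp" using assms by simp
  fix \<theta> \<tau> :: real assume a: "lo \<le> \<theta>" "\<theta> < 1" "0 < \<tau>" "\<tau> \<le> M"
  have "\<tau> < vol \<theta> (lo / M)"
  proof -
   have "M \<le> \<theta> / (lo / M)" using a assms by (simp add: field_simps)
   moreover have "0 < (1 - \<theta>) * (lo / M) powr (- gr)" using a assms by simp
   ultimately show ?thesis using a by (simp add: vol_def)
  qed
  then have "lo / M \<le> Zst \<theta> \<tau>" using Zst_le_iff[of \<theta> \<tau> "lo / M"] a assms by auto
  then show "(lo / M) powr gp \<le> P \<theta> \<tau>" unfolding P_def using assms gp by (intro powr_mono2) auto
 qed
qed

text \<open>The Bregman distance of \<open>W \<theta>\<close>, whose derivative is \<open>- P \<theta>\<close>.\<close>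

definition H :: "real => real => real => real" where
 "H \<theta> s \<tau> = W \<theta> \<tau> - W \<theta> s + P \<theta> s * (\<tau> - s)"

text \<open>On a compact range of volumes the slope of \<open>- P \<theta>\<close> lies between
  \<open>c = k / M\<close> and \<open>C = max gp gm * K / d\<close> by \<open>DERIV_P\<close>. These
  two constants govern both the monotonicity and the quadratic bounds on \<open>H\<close>.\<close>

lemma P_strong_mono:
 assumes "0 < lo" "0 < d" "d \<le> M"
 obtains c C where "0 < c" "0 < C"
  "\<And>\<theta> s \<tau>. lo \<le> \<theta> ==> \<theta> < 1 ==> d \<le> s ==> s \<le> M ==> d \<le> \<tau> ==> \<tau> \<le> M ==>
   c * (\<tau> - s)\<^sup>2 \<le> (P \<theta> s - P \<theta> \<tau>) * (\<tau> - s) \<and> c / 2 * (\<tau> - s)\<^sup>2 \<le> H \<theta> s \<tau> \<and> H \<theta> s \<tau> \<le> C / 2 * (\<tau> - s)\<^sup>2"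
proof -
 obtain k where k: "0 < k" "\<And>\<theta> \<tau>. lo \<le> \<theta> ==> \<theta> < 1 ==> 0 < \<tau> ==> \<tau> \<le> M ==> k \<le> P \<theta> \<tau>"
  using P_lower[of lo M] assms by (auto)
 obtain K where K: "0 < K" "\<And>\<theta> \<tau>. 0 < \<theta> ==> \<theta> < 1 ==> d \<le> \<tau> ==> P \<theta> \<tau> \<le> K"
  using P_upper[OF assms(2)] by auto
 define c C where "c = k / M" and "C = max gp gm * K / d"
 show ?thesis
 proof (rule that[of c C])
  show "0 < c" "0 < C" using k K assms gp by (auto simp: c_def C_def less_max_iff_disj)
  fix \<theta> s \<tau> :: real assume a: "lo \<le> \<theta>" "\<theta> < 1" "d \<le> s" "s \<le> M" "d \<le> \<tau>" "\<tau> \<le> M"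
  have \<theta>: "0 < \<theta>" "\<theta> < 1" using a assms by auto
  have D: "\<exists>D. (P \<theta> has_real_derivative D) (at x) \<and> c \<le> - D \<and> - D \<le> C" if "d \<le> x" "x \<le> M" for x
  proof -
   have x: "0 < x" using that assms by simp
   obtain D where D: "(P \<theta> has_real_derivative D) (at x)" "P \<theta> x / x \<le> - D" "- D \<le> max gp gm * P \<theta> x / x"
    using DERIV_P[OF \<theta> x] .
   have "k / M \<le> P \<theta> x / x" using k(1) k(2)[OF a(1,2) x that(2)] x that by (intro frac_le) auto
   moreover have "max gp gm * P \<theta> x / x \<le> max gp gm * K / d"
    using K(1) K(2)[OF \<theta> that(1)] that assms gp by (intro frac_le mult_left_mono mult_nonneg_nonneg) auto
   ultimately show ?thesis using D by (auto simp: c_def C_def)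
  qed
  have diff: "\<exists>e. P \<theta> s - P \<theta> x = e * (x - s) \<and> c \<le> e \<and> e \<le> C" if x: "d \<le> x" "x \<le> M" for x
  proof -
   obtain P' where P': "\<And>x. d \<le> x ==> x \<le> M ==> (P \<theta> has_real_derivative P' x) (at x) \<and> c \<le> - P' x \<and> - P' x \<le> C"
    using D by metis
   consider "x = s" | "x < s" | "s < x" by linarith
   then show ?thesis
   proof cases
    case 1
    then show ?thesis using P'[of s] a by (intro exI[of _ "- P' s"]) auto
   next
    case 2
    then obtain y where y: "x < y" "y < s" "P \<theta> s - P \<theta> x = (s - x) * P' y"
     using MVT2[of x s "P \<theta>" P'] P' a x by auto
    then show ?thesis using P'[of y] a x by (intro exI[of _ "- P' y"]) (auto simp: algebra_simps)
   next
    case 3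
    then obtain y where y: "s < y" "y < x" "P \<theta> x - P \<theta> s = (x - s) * P' y"
     using MVT2[of s x "P \<theta>" P'] P' a x by auto
    then show ?thesis using P'[of y] a x by (intro exI[of _ "- P' y"]) (auto simp: algebra_simps)
   qed
  qed
  have 1: "c * (\<tau> - s)\<^sup>2 \<le> (P \<theta> s - P \<theta> \<tau>) * (\<tau> - s)"
  proof -
   obtain e where "P \<theta> s - P \<theta> \<tau> = e * (\<tau> - s)" "c \<le> e" using diff[OF a(5,6)] by auto
   then show ?thesis by (simp add: power2_eq_square mult_right_mono mult.assoc)
  qed
  have dH: "(H \<theta> s has_real_derivative (P \<theta> s - P \<theta> x)) (at x)" if "0 < x" for x
   unfolding H_def[abs_def] by (rule derivative_eq_intros DERIV_W[OF \<theta> that] refl | simp)+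
  have H0: "H \<theta> s s = 0" by (simp add: H_def)
  have dH2: "((%x. H \<theta> s x - e / 2 * (x - s)\<^sup>2) has_real_derivative (P \<theta> s - P \<theta> x - e * (x - s))) (at x)" if "0 < x" for x e
   by (rule derivative_eq_intros dH[OF that] refl | simp)+
  have 2: "c / 2 * (\<tau> - s)\<^sup>2 \<le> H \<theta> s \<tau> \<and> H \<theta> s \<tau> \<le> C / 2 * (\<tau> - s)\<^sup>2"
  proof -
   \<comment> \<open>Subtracting a parabola replaces a second-order Taylor expansion: the derivative
     of the difference has the form \<open>(e' - e) * (y - s)\<close> with
     \<open>c \<le> e' \<le> C\<close>, and the choices \<open>e = c\<close> and
     \<open>e = C\<close> give it a definite sign.\<close>
   have mv: "\<exists>y. d \<le> y \<and> y \<le> M \<and> 0 \<le> (y - s) * (\<tau> - s) \<and> H \<theta> s \<tau> - e / 2 * (\<tau> - s)\<^sup>2 = (\<tau> - s) * (P \<theta> s - P \<theta> y - e * (y - s))" for e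
   proof -
    consider "\<tau> = s" | "\<tau> < s" | "s < \<tau>" by linarith
    then show ?thesis
    proof cases
     case 1 then show ?thesis using H0 a by auto
    next
     case 2
     then obtain y where y: "\<tau> < y" "y < s" "(H \<theta> s s - e / 2 * (s - s)\<^sup>2) - (H \<theta> s \<tau> - e / 2 * (\<tau> - s)\<^sup>2) = (s - \<tau>) * (P \<theta> s - P \<theta> y - e * (y - s))"
      using MVT2[of \<tau> s "%x. H \<theta> s x - e / 2 * (x - s)\<^sup>2" "%x. P \<theta> s - P \<theta> x - e * (x - s)"] dH2 a assms by force
     have "0 \<le> (y - s) * (\<tau> - s)" using y by (simp add: mult_nonpos_nonpos)
     then show ?thesis using y a H0 by (intro exI[of _ y]) (auto simp: algebra_simps)
    next
     case 3
     then obtain y where y: "s < y" "y < \<tau>" "(H \<theta> s \<tau> - e / 2 * (\<tau> - s)\<^sup>2) - (H \<theta> s s - e / 2 * (s - s)\<^sup>2) = (\<tau> - s) * (P \<theta> s - P \<theta> y - e * (y - s))"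
      using MVT2[of s \<tau> "%x. H \<theta> s x - e / 2 * (x - s)\<^sup>2" "%x. P \<theta> s - P \<theta> x - e * (x - s)"] dH2 a assms by force
     then show ?thesis using a H0 by (intro exI[of _ y]) auto
    qed
   qed
   have sgn: "(\<tau> - s) * (P \<theta> s - P \<theta> y - e * (y - s)) = (e' - e) * ((y - s) * (\<tau> - s))" if "P \<theta> s - P \<theta> y = e' * (y - s)" for y e e'
    unfolding that by (simp add: algebra_simps)
   have "0 \<le> H \<theta> s \<tau> - c / 2 * (\<tau> - s)\<^sup>2"
   proof -
    obtain y where y: "d \<le> y" "y \<le> M" "0 \<le> (y - s) * (\<tau> - s)" "H \<theta> s \<tau> - c / 2 * (\<tau> - s)\<^sup>2 = (\<tau> - s) * (P \<theta> s - P \<theta> y - c * (y - s))"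
     using mv[of c] by auto
    obtain e where e: "P \<theta> s - P \<theta> y = e * (y - s)" "c \<le> e" "e \<le> C" using diff[OF y(1,2)] by auto
    show ?thesis unfolding y(4) sgn[OF e(1)] by (rule mult_nonneg_nonneg) (use e y(3) in auto)
   qed
   moreover have "H \<theta> s \<tau> - C / 2 * (\<tau> - s)\<^sup>2 \<le> 0"
   proof -
    obtain y where y: "d \<le> y" "y \<le> M" "0 \<le> (y - s) * (\<tau> - s)" "H \<theta> s \<tau> - C / 2 * (\<tau> - s)\<^sup>2 = (\<tau> - s) * (P \<theta> s - P \<theta> y - C * (y - s))"
     using mv[of C] by auto
    obtain e where e: "P \<theta> s - P \<theta> y = e * (y - s)" "c \<le> e" "e \<le> C" using diff[OF y(1,2)] by auto
    show ?thesis unfolding y(4) sgn[OF e(1)] by (rule mult_nonpos_nonneg) (use e y(3) in auto)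
   qed
   ultimately show ?thesis by simp
  qed
  show "c * (\<tau> - s)\<^sup>2 \<le> (P \<theta> s - P \<theta> \<tau>) * (\<tau> - s) \<and> c / 2 * (\<tau> - s)\<^sup>2 \<le> H \<theta> s \<tau> \<and> H \<theta> s \<tau> \<le> C / 2 * (\<tau> - s)\<^sup>2"
   using 1 2 by simp
 qed
qed

end

section \<open>Null sets in products and integrals depending on a parameter\<close>

lemma AE_pair_fst:
 assumes "AE y in ivl a b. Q y"
 shows "AE w in ivl a b \<Otimes>\<^sub>M ivl c d. Q (fst w)"
proof -
 obtain N where N: "N \<in> null_sets (ivl a b)" "{y. \<not> Q y} \<subseteq> N" by (rule AE_E3[OF assms]) auto
 have "emeasure (ivl a b \<Otimes>\<^sub>M ivl c d) (N \<times> UNIV) = 0"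
  using N(1) by (subst ivl.emeasure_pair_measure_Times) auto
 then have "N \<times> UNIV \<in> null_sets (ivl a b \<Otimes>\<^sub>M ivl c d)"
  using N(1) by (auto intro!: null_setsI)
 then show ?thesis by (rule AE_I') (use N(2) in auto)
qed

lemma AE_pair_snd:
 assumes "AE t in ivl c d. Q t"
 shows "AE w in ivl a b \<Otimes>\<^sub>M ivl c d. Q (snd w)"
proof -
 obtain N where N: "N \<in> null_sets (ivl c d)" "{y. \<not> Q y} \<subseteq> N" by (rule AE_E3[OF assms]) auto
 have "emeasure (ivl a b \<Otimes>\<^sub>M ivl c d) (UNIV \<times> N) = 0"
  using N(1) by (subst ivl.emeasure_pair_measure_Times) auto
 then have "UNIV \<times> N \<in> null_sets (ivl a b \<Otimes>\<^sub>M ivl c d)"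
  using N(1) by (auto intro!: null_setsI)
 then show ?thesis by (rule AE_I') (use N(2) in auto)
qed

lemma AE_ivl_exists:
 assumes "AE y in ivl a b. Q y" "a < b"
 shows "\<exists>y. a < y \<and> y < b \<and> Q y"
proof (rule ccontr)
 assume "\<not> ?thesis"
 then have "AE y in ivl a b. False" 
  by (intro eventually_mono[OF eventually_conj[OF assms(1) AE_ivl_mem]]) auto
 then have "emeasure (ivl a b) (space (ivl a b)) = 0" by (simp add: AE_iff_measurable[of UNIV])
 then show False using assms(2) by (simp add: emeasure_ivl)
qed

lemma AE_all_times:
 assumes "\<And>T. AE y in M. Q y T" "\<And>y S T. Q y T ==> S \<le> T ==> Q y (S::real)"
 shows "AE y in M. \<forall>T. Q y T"
proof -
 have "AE y in M. \<forall>n::nat. Q y (real n)" using assms(1) by (simp add: AE_all_countable)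
 then show ?thesis
 proof eventually_elim
  case (elim y)
  show ?case
  proof
   fix T :: real
   obtain n :: nat where "T \<le> n" using real_arch_simple by blast
   then show "Q y T" using elim assms(2) by blast
  qed
 qed
qed

text \<open>The variable limits are moved into an indicator, so that the integral is taken against
  one fixed measure and the measurability theorem for parameter integrals applies.\<close>

lemma measurable_indefinite [measurable (raw)]:
 fixes f :: "'a => real => real"
 assumes [measurable]: "case_prod f \<in> borel_measurable (M \<Otimes>\<^sub>M borel)" "a \<in> borel_measurable M" "b \<in> borel_measurable M"
 shows "(%x. \<integral>r. f x r \<partial>ivl (a x) (b x)) \<in> borel_measurable M"
proof -
 have m: "(%(x, r). indicator {a x<..<b x} r * f x r) \<in> borel_measurable (M \<Otimes>\<^sub>M lborel)"
 proof -
  have "(%(x, r). indicator {a x<..<b x} r * f x r) = (%(x, r). (if a x < r \<and> r < b x then 1 else 0) * f x r)"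
   by (auto simp: indicator_def fun_eq_iff)
  also have "\<dots> \<in> borel_measurable (M \<Otimes>\<^sub>M lborel)" by measurable
  finally show ?thesis .
 qed
 have "(%x. \<integral>r. indicator {a x<..<b x} r * f x r \<partial>lborel) \<in> borel_measurable M"
  by (rule lborel.borel_measurable_lebesgue_integral) (use m in simp)
 moreover have "(\<integral>r. f x r \<partial>ivl (a x) (b x)) = (\<integral>r. indicator {a x<..<b x} r * f x r \<partial>lborel)" if "x \<in> space M" for x
  using that by (intro integral_ivl) measurable
 ultimately show ?thesis by (simp cong: measurable_cong)
qed

section \<open>A priori estimates and decay\<close>

text \<open>All that the estimates use of a weak solution. Here \<open>g\<close> is at once the
  space derivative of \<open>u\<close> and the time derivative of \<open>\<tau>\<close>, and
  momentum is balanced only after integration in both variables; this leaves an unspecified function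
  \<open>c\<close> of time, formally the time integral of the stress at \<open>y = 0\<close>. No
  positive lower bound of \<open>\<tau>\<close> is part of the assumptions.\<close>

locale flow = exponents +
 fixes \<mu> \<theta>lo \<theta>hi \<tau>lo \<tau>hi :: real and \<theta> \<tau>0 :: "real => real"
  and g u \<tau> :: "real => real => real" and c :: "real => real"
 assumes mu: "0 < \<mu>"
  and \<theta>_meas [measurable]: "\<theta> \<in> borel1"
  and \<tau>0_meas [measurable]: "\<tau>0 \<in> borel1"
  and \<theta>_const: "0 < \<theta>lo" "\<theta>hi < 1" and \<tau>0_const: "0 < \<tau>lo"
  and \<theta>_bounds: "AE y in ivl 0 1. \<theta>lo \<le> \<theta> y \<and> \<theta> y \<le> \<theta>hi"
  and \<tau>0_bounds: "AE y in ivl 0 1. \<tau>lo \<le> \<tau>0 y \<and> \<tau>0 y \<le> \<tau>hi"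
  and g_meas [measurable]: "case_prod g \<in> borel2"
  and g_L2: "\<And>T. in_L2 (cyl T) (case_prod g)"
  and \<tau>_eq: "\<And>y t. \<tau> y t = \<tau>0 y + (\<integral>r. g y r \<partial>ivl 0 t)"
  and \<tau>_pos: "AE y in ivl 0 1. \<forall>t\<ge>0. 0 < \<tau> y t"
  and u_L2: "\<And>t. 0 \<le> t ==> in_L2 (ivl 0 1) (%y. u y t)"
  and u_cont: "\<And>t. 0 \<le> t ==> ((%s. L2_norm (ivl 0 1) (%y. u y s - u y t)) \<longlongrightarrow> 0) (at t within {0..})"
  and u_g: "\<And>T. AE t in ivl 0 T. (\<integral>x. g x t \<partial>ivl 0 1) = 0 \<and> (AE y in ivl 0 1. u y t = (\<integral>x. g x t \<partial>ivl 0 y))"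
  and mom: "\<And>t. 0 \<le> t ==> AE y in ivl 0 1.
   \<mu> * ln (\<tau> y t / \<tau>0 y) - (\<integral>r. P (\<theta> y) (\<tau> y r) \<partial>ivl 0 t)
    = c t + (\<integral>x. u x t \<partial>ivl 0 y) - (\<integral>x. u x 0 \<partial>ivl 0 y)"
begin

lemma \<tau>_meas [measurable]: "case_prod \<tau> \<in> borel2"
proof -
 have "case_prod \<tau> = (%w. \<tau>0 (fst w) + (\<integral>r. g (fst w) r \<partial>ivl 0 (snd w)))" by (auto simp: \<tau>_eq)
 also have "\<dots> \<in> borel2" by measurable
 finally show ?thesis .
qed

lemma u_meas [measurable]: "0 \<le> t ==> (%y. u y t) \<in> borel1"
 using in_L2_measurable[OF u_L2[of t]] by simp

text \<open>Its formal time derivative is the stress at \<open>y\<close> minus \<open>c' t\<close>,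
  so working with \<open>I\<close> avoids space derivatives of the stress.\<close>

definition I :: "real => real => real" where "I y t = (\<integral>x. u x t \<partial>ivl 0 y)"

lemma u_integrable: "0 \<le> t ==> integrable (ivl 0 1) (%y. u y t)"
 using u_L2 ivl.in_L2_integrable by blast

lemma I_meas: "0 \<le> t ==> (%y. I y t) \<in> borel1"
 unfolding I_def by measurable

definition nu :: "real => real" where "nu t = L2_norm (ivl 0 1) (%y. u y t)"
definition du :: "real => real => real" where "du s t = L2_norm (ivl 0 1) (%y. u y s - u y t)"

lemma integral_le_L2_norm01:
 assumes f: "in_L2 (ivl 0 1) f" and y: "0 \<le> y" "y \<le> 1"
 shows "\<bar>\<integral>x. f x \<partial>ivl 0 y\<bar> \<le> L2_norm (ivl 0 1) f"
proof -
 have "integrable (ivl 0 1) f" using f ivl.in_L2_integrable by blast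
 then have "\<bar>\<integral>x. f x \<partial>ivl 0 y\<bar> \<le> (\<integral>x. \<bar>f x\<bar> \<partial>ivl 0 y)" by (simp add: integral_abs_bound)
 also have "\<dots> \<le> (\<integral>x. \<bar>f x\<bar> \<partial>ivl 0 1)"
  using \<open>integrable (ivl 0 1) f\<close> y by (intro integral_ivl_nonneg_mono) auto
 also have "\<dots> \<le> L2_norm (ivl 0 1) f"
  using f by (intro ivl.integral_le_L2_norm) (auto simp: measure_ivl)
 finally show ?thesis .
qed

lemma I_bound: "0 \<le> t ==> 0 \<le> y ==> y \<le> 1 ==> \<bar>I y t\<bar> \<le> nu t"
 unfolding I_def nu_def by (intro integral_le_L2_norm01 u_L2)

lemma I_diff:
 assumes "0 \<le> t" "0 \<le> s" "0 \<le> y" "y \<le> 1"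
 shows "\<bar>I y s - I y t\<bar> \<le> du s t"
proof -
 have "I y s - I y t = (\<integral>x. u x s - u x t \<partial>ivl 0 y)"
  unfolding I_def using integrable_ivl_subset[OF u_integrable[of s], of 0 y] integrable_ivl_subset[OF u_integrable[of t], of 0 y] assms by simp
 then show ?thesis unfolding du_def
  using integral_le_L2_norm01[OF in_L2_diff[OF u_L2[of s] u_L2[of t]], of y] assms by simp
qed

lemma du_tendsto: "0 \<le> t ==> ((%s. du s t) \<longlongrightarrow> 0) (at t within {0..})"
 unfolding du_def by (rule u_cont)

lemma du_nonneg [simp]: "0 \<le> du s t" by (simp add: du_def)
lemma nu_nonneg [simp]: "0 \<le> nu t" by (simp add: nu_def)

lemma du_commute: "du s t = du t s"
 unfolding du_def by (rule L2_norm_diff_commute)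

lemma nu_diff: "0 \<le> s ==> 0 \<le> t ==> \<bar>nu s - nu t\<bar> \<le> du s t"
 unfolding nu_def du_def by (intro L2_norm_triangle_diff u_L2)

lemma du_triangle: "0 \<le> r ==> 0 \<le> s ==> 0 \<le> t ==> du r t \<le> du r s + du s t"
 unfolding du_def
 using L2_norm_triangle[OF in_L2_diff[OF u_L2[of r] u_L2[of s]] in_L2_diff[OF u_L2[of s] u_L2[of t]]] by simp

lemma continuous_on_of_du:
 assumes "\<And>s t. 0 \<le> s ==> 0 \<le> t ==> \<bar>f s - f t\<bar> \<le> du s t"
 shows "continuous_on {0..} f"
 unfolding continuous_on_def
proof
 fix t :: real assume t: "t \<in> {0..}"
 have "((%s. f s - f t) \<longlongrightarrow> 0) (at t within {0..})"
 proof (rule Lim_null_comparison[OF _ du_tendsto[of t]])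
  show "\<forall>\<^sub>F s in at t within {0..}. norm (f s - f t) \<le> du s t"
   using assms t by (auto simp: eventually_at_filter)
 qed (use t in auto)
 then show "(f \<longlongrightarrow> f t) (at t within {0..})" by (rule LIM_zero_cancel)
qed

lemma nu_continuous: "continuous_on {0..} nu"
 by (rule continuous_on_of_du[OF nu_diff])

lemma I_continuous: "0 \<le> y ==> y \<le> 1 ==> continuous_on {0..} (I y)"
 by (rule continuous_on_of_du) (rule I_diff)

text \<open>The Heine-Cantor theorem for the continuous curve of velocities in the space of
  square-integrable functions, proved by extracting a convergent subsequence of times.\<close>

lemma du_uniform:
 assumes "0 < e"
 obtains d where "0 < d" "\<And>s t. 0 \<le> s ==> s \<le> T ==> 0 \<le> t ==> t \<le> T ==> \<bar>t - s\<bar> < d ==> du s t < e"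
proof -
 have "\<exists>d>0. \<forall>s t. 0 \<le> s \<and> s \<le> T \<and> 0 \<le> t \<and> t \<le> T \<and> \<bar>t - s\<bar> < d --> du s t < e"
 proof (rule ccontr)
  assume "\<not> ?thesis"
  then have "\<exists>s t. 0 \<le> s \<and> s \<le> T \<and> 0 \<le> t \<and> t \<le> T \<and> \<bar>t - s\<bar> < inverse (Suc n) \<and> e \<le> du s t" for n
   by (metis inverse_positive_iff_positive not_le of_nat_0_less_iff zero_less_Suc)
  then obtain s t where st: "\<And>n. 0 \<le> s n" "\<And>n. s n \<le> T" "\<And>n. 0 \<le> t n" "\<And>n. t n \<le> T"
   "\<And>n. \<bar>t n - s n\<bar> < inverse (Suc n)" "\<And>n. e \<le> du (s n) (t n)" by metis
  have "\<forall>n. s n \<in> {0..T}" using st by auto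
  then obtain l r where l: "l \<in> {0..T}" "strict_mono r" "(s \<circ> r) \<longlonglongrightarrow> l"
   using compact_Icc[of 0 T] unfolding compact_eq_seq_compact_metric seq_compact_def by blast
  have dts: "(%n. t (r n) - s (r n)) \<longlonglongrightarrow> 0"
  proof (rule Lim_null_comparison[OF _ LIMSEQ_subseq_LIMSEQ[OF LIMSEQ_inverse_real_of_nat l(2)]])
   show "\<forall>\<^sub>F n in sequentially. norm (t (r n) - s (r n)) \<le> ((%n. inverse (real (Suc n))) \<circ> r) n"
    using st(5) by (auto intro!: always_eventually less_imp_le)
  qed
  have tl: "(%n. t (r n)) \<longlonglongrightarrow> l"
   using tendsto_add[OF dts l(3)[unfolded o_def]] by simp
  have lim: "(%n. du (X n) l) \<longlonglongrightarrow> 0" if "X \<longlonglongrightarrow> l" "\<And>n. 0 \<le> X n" for X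
  proof -
   have d0: "du l l = 0" by (simp add: du_def L2_norm_def)
   have "continuous (at l within {0..}) (%s. du s l)"
    using du_tendsto[of l] l(1) d0 by (simp add: continuous_within)
   then have "(%n. du (X n) l) \<longlonglongrightarrow> du l l"
    using that by (auto simp: continuous_within_sequentially o_def)
   then show ?thesis using d0 by simp
  qed
  have "(%n. du (s (r n)) l + du (t (r n)) l) \<longlonglongrightarrow> 0"
   using tendsto_add[OF lim[OF l(3)[unfolded o_def]] lim[OF tl]] st by simp
  then have "\<forall>\<^sub>F n in sequentially. du (s (r n)) l + du (t (r n)) l < e"
   using assms order_tendstoD(2) by blast
  then obtain n where "du (s (r n)) l + du (t (r n)) l < e" unfolding eventually_sequentially by blast
  moreover have "e \<le> du (s (r n)) l + du (t (r n)) l"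
   using st(6)[of "r n"] du_triangle[of "s (r n)" l "t (r n)"] st(1,3) l(1) du_commute[of "t (r n)" l] by force
  ultimately show False by simp
 qed
 then show ?thesis using that by blast
qed

text \<open>The properties at a fixed \<open>y\<close> that do not involve the momentum balance.
  They give continuity in time of every term of the balance except \<open>c\<close>, which must be
  available before the balance can be asserted at all times simultaneously.\<close>

definition pre_good :: "real => bool" where
 "pre_good y \<longleftrightarrow> 0 < y \<and> y < 1 \<and> \<theta>lo \<le> \<theta> y \<and> \<theta> y \<le> \<theta>hi \<and> \<tau>lo \<le> \<tau>0 y \<and> \<tau>0 y \<le> \<tau>hi \<and>
  (\<forall>T. integrable (ivl 0 T) (%r. (g y r)\<^sup>2)) \<and> (\<forall>t\<ge>0. 0 < \<tau> y t)"

lemma AE_pre_good: "AE y in ivl 0 1. pre_good y"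
proof -
 have "AE y in ivl 0 1. integrable (ivl 0 T) (%r. (g y r)\<^sup>2)" for T
  using ivl2.AE_integrable_fst'[OF in_L2_integrable_sq[OF g_L2[of T]]] by simp
 then have "AE y in ivl 0 1. \<forall>T. integrable (ivl 0 T) (%r. (g y r)\<^sup>2)"
  by (rule AE_all_times) (rule integrable_ivl_subset, auto)
 then show ?thesis
  using AE_ivl_mem[of 0 1] \<theta>_bounds \<tau>0_bounds \<tau>_pos by eventually_elim (auto simp: pre_good_def)
qed

lemma pre_goodD:
 assumes "pre_good y"
 shows "0 < y" "y < 1" "0 < \<theta> y" "\<theta> y < 1" "\<theta>lo \<le> \<theta> y" "0 < \<tau>0 y" "\<tau>lo \<le> \<tau>0 y" "\<tau>0 y \<le> \<tau>hi"
  "\<And>t. 0 \<le> t ==> 0 < \<tau> y t"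
  "\<And>s T. 0 \<le> s ==> integrable (ivl s T) (g y)"
  "\<And>s T. 0 \<le> s ==> integrable (ivl s T) (%r. (g y r)\<^sup>2)"
proof -
 have "in_L2 (ivl 0 T) (g y)" for T
  using assms by (auto simp: in_L2_def pre_good_def)
 then have "integrable (ivl 0 T) (g y)" for T using ivl.in_L2_integrable by blast
 then show "\<And>s T. 0 \<le> s ==> integrable (ivl s T) (g y)" by (rule integrable_ivl_subset) auto
 have "integrable (ivl 0 T) (%r. (g y r)\<^sup>2)" for T using assms by (auto simp: pre_good_def)
 then show "\<And>s T. 0 \<le> s ==> integrable (ivl s T) (%r. (g y r)\<^sup>2)" by (rule integrable_ivl_subset) auto
qed (use assms \<theta>_const \<tau>0_const in \<open>auto simp: pre_good_def\<close>)

lemma \<tau>_diff: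
 assumes "pre_good y" "0 \<le> s" "s \<le> t"
 shows "\<tau> y t = \<tau> y s + (\<integral>r. g y r \<partial>ivl s t)"
 unfolding \<tau>_eq using integral_ivl_split[OF pre_goodD(10)[OF assms(1), of 0 t], of s] assms by simp

lemma \<tau>_continuous: "pre_good y ==> continuous_on {0..} (\<tau> y)"
 by (rule continuous_on_eq[where f="%t. \<tau>0 y + (\<integral>r. g y r \<partial>ivl 0 t)"],
   intro continuous_intros continuous_on_indefinite_Ici pre_goodD) (auto intro: \<tau>_eq[symmetric])

lemma P\<tau>_continuous:
 assumes "pre_good y"
 shows "continuous_on {0..} (%t. P (\<theta> y) (\<tau> y t))"
 by (rule continuous_on_compose2[OF continuous_on_P \<tau>_continuous])
  (use assms pre_goodD in auto)

lemma P\<tau>_meas [measurable]: "(%w. P (\<theta> (fst w)) (\<tau> (fst w) (snd w))) \<in> borel2"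
 by measurable

lemma P\<tau>_meas1 [measurable]: "(%r. P (\<theta> y) (\<tau> y r)) \<in> borel1"
 by measurable

lemma P\<tau>_integrable:
 assumes "pre_good y" "0 \<le> s"
 shows "integrable (ivl s t) (%r. P (\<theta> y) (\<tau> y r))"
 by (rule integrable_ivl_continuous)
  (use assms in \<open>auto intro: continuous_on_subset[OF P\<tau>_continuous]\<close>)

definition SG :: "real => real => real" where
 "SG y t = \<mu> * ln (\<tau> y t / \<tau>0 y) - (\<integral>r. P (\<theta> y) (\<tau> y r) \<partial>ivl 0 t)"

lemma SG_continuous:
 assumes "pre_good y"
 shows "continuous_on {0..} (SG y)"
 unfolding SG_def
proof (intro continuous_intros continuous_on_indefinite_Ici P\<tau>_integrable assms \<tau>_continuous ballI)
 fix t :: real assume "t \<in> {0..}"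
 show "\<tau>0 y \<noteq> 0" "\<tau> y t / \<tau>0 y \<noteq> 0" using pre_goodD[OF assms] \<open>t \<in> {0..}\<close> by force+
qed (use pre_goodD[OF assms] in auto)

lemma mom': "0 \<le> t ==> AE y in ivl 0 1. SG y t = c t + I y t - I y 0"
 unfolding SG_def I_def by (rule mom)

text \<open>Given a sequence of times, some single \<open>y\<close> satisfies the balance at all of
  them and at the limit; at this \<open>y\<close> every other term is continuous in time.\<close>

lemma c_continuous: "continuous_on {0..} c"
 unfolding continuous_on_def
proof
 fix t :: real assume t: "t \<in> {0..}"
 show "(c \<longlongrightarrow> c t) (at t within {0..})"
 proof (subst tendsto_at_iff_sequentially, safe)
  fix X :: "nat => real" assume X: "\<forall>i. X i \<in> {0..} - {t}" "X \<longlonglongrightarrow> t"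
  have "AE y in ivl 0 1. \<forall>n. SG y (X n) = c (X n) + I y (X n) - I y 0"
   unfolding AE_all_countable using mom' X by auto
  moreover have "AE y in ivl 0 1. SG y t = c t + I y t - I y 0" using mom' t by auto
  ultimately have "AE y in ivl 0 1. pre_good y \<and> (\<forall>n. SG y (X n) = c (X n) + I y (X n) - I y 0) \<and> SG y t = c t + I y t - I y 0"
   using AE_pre_good by eventually_elim auto
  from AE_ivl_exists[OF this] obtain y where y: "pre_good y" "\<And>n. SG y (X n) = c (X n) + I y (X n) - I y 0"
   "SG y t = c t + I y t - I y 0" by auto
  have lim: "(%n. f (X n)) \<longlonglongrightarrow> f t" if "continuous_on {0..} f" for f :: "real => real"
   using continuous_on_tendsto_compose[OF that X(2)] X(1) t by auto
  have "(%n. SG y (X n) - I y (X n) + I y 0) \<longlonglongrightarrow> SG y t - I y t + I y 0"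
   using y(1) pre_goodD(1,2)[OF y(1)] by (intro tendsto_intros lim SG_continuous I_continuous) auto
  then show "(c \<circ> X) \<longlonglongrightarrow> c t" using y(2,3) by (simp add: o_def)
 qed
qed

text \<open>In \<open>mom\<close> the exceptional null set depends on the time; here the balance is
  required at all times for the same \<open>y\<close>.\<close>

definition good :: "real => bool" where
 "good y \<longleftrightarrow> pre_good y \<and> (\<forall>t\<ge>0. SG y t = c t + I y t - I y 0)"

lemma AE_good: "AE y in ivl 0 1. good y"
proof -
 have "AE y in ivl 0 1. \<forall>t. 0 \<le> t \<and> t < T --> SG y t - (c t + I y t - I y 0) \<in> {0}" for T
 proof (rule AE_all_continuous)
  show "AE y in ivl 0 1. continuous_on {0..} (%t. SG y t - (c t + I y t - I y 0))"
   using AE_pre_good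
  proof eventually_elim
   case (elim y)
   then show ?case using pre_goodD(1,2)[OF elim]
    by (intro continuous_intros SG_continuous c_continuous I_continuous) auto
  qed
  show "AE y in ivl 0 1. SG y t - (c t + I y t - I y 0) \<in> {0}" if "0 \<le> t" for t
   using mom'[OF that] by eventually_elim simp
 qed simp
 then have "AE y in ivl 0 1. \<forall>T t. 0 \<le> t \<and> t < T --> SG y t - (c t + I y t - I y 0) \<in> {0}"
  by (rule AE_all_times) auto
 then show ?thesis using AE_pre_good
 proof eventually_elim
  case (elim y)
  have "SG y t = c t + I y t - I y 0" if "0 \<le> t" for t
   using elim(1)[rule_format, of t "t + 1"] that by simp
  then show ?case using elim(2) by (simp add: good_def)
 qed
qed

lemma goodD: "good y ==> pre_good y" "good y ==> 0 \<le> t ==> SG y t = c t + I y t - I y 0"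
 by (auto simp: good_def)

lemma compact_bound:
 fixes f :: "real => real"
 assumes "continuous_on {0..} f"
 obtains B where "0 < B" "\<And>t. 0 \<le> t ==> t \<le> T ==> \<bar>f t\<bar> \<le> B"
proof -
 have "bounded (f ` {0..T})"
  using assms continuous_on_subset by (intro compact_imp_bounded compact_continuous_image) fastforce+
 then show ?thesis using that unfolding bounded_pos by auto
qed

lemma nu_bound:
 obtains B where "0 < B" "\<And>t. 0 \<le> t ==> t \<le> T ==> nu t \<le> B"
 using compact_bound[OF nu_continuous, of T] by (metis abs_le_D1)

text \<open>Dropping the nonnegative pressure integral bounds the volume from below, this bounds the
  pressure, and the bounded pressure gives the upper bound. The constants depend on
  \<open>T\<close>; these bounds only serve integrability.\<close>

lemma local_bounds:
 obtains d M where "0 < d" "d \<le> M" "\<And>y t. good y ==> 0 \<le> t ==> t \<le> T ==> d \<le> \<tau> y t \<and> \<tau> y t \<le> M"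
proof -
 obtain B where B: "0 < B" "\<And>t. 0 \<le> t ==> t \<le> T ==> \<bar>c t\<bar> \<le> B" using compact_bound[OF c_continuous] by metis
 obtain U where U: "0 < U" "\<And>t. 0 \<le> t ==> t \<le> T ==> nu t \<le> U" using nu_bound by metis
 define d where "d = \<tau>lo * exp (- (B + 2 * U) / \<mu>)"
 have d: "0 < d" using \<tau>0_const by (simp add: d_def)
 obtain K where K: "0 < K" "\<And>\<theta> \<tau>. 0 < \<theta> ==> \<theta> < 1 ==> d \<le> \<tau> ==> P \<theta> \<tau> \<le> K"
  using P_upper[OF d] by auto
 define M where "M = max d (\<tau>hi * exp ((B + 2 * U + K * max 0 T) / \<mu>))"
 show ?thesis
 proof (rule that[of d M])
  fix y t assume y: "good y" and t: "0 \<le> t" "t \<le> T"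
  note pg = pre_goodD[OF goodD(1)[OF y]]
  have base: "\<tau> y s = \<tau>0 y * exp ((c s + I y s - I y 0 + (\<integral>r. P (\<theta> y) (\<tau> y r) \<partial>ivl 0 s)) / \<mu>)" if "0 \<le> s" for s
  proof -
   have "\<mu> * ln (\<tau> y s / \<tau>0 y) = c s + I y s - I y 0 + (\<integral>r. P (\<theta> y) (\<tau> y r) \<partial>ivl 0 s)"
    using goodD(2)[OF y that] by (simp add: SG_def)
   then have "ln (\<tau> y s / \<tau>0 y) = (c s + I y s - I y 0 + (\<integral>r. P (\<theta> y) (\<tau> y r) \<partial>ivl 0 s)) / \<mu>"
    using mu by (simp add: field_simps)
   then have "\<tau> y s / \<tau>0 y = exp ((c s + I y s - I y 0 + (\<integral>r. P (\<theta> y) (\<tau> y r) \<partial>ivl 0 s)) / \<mu>)"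
    using pg that by (metis divide_pos_pos exp_ln)
   then show ?thesis using pg by (simp add: field_simps)
  qed
  have ci: "\<bar>c s + I y s - I y 0\<bar> \<le> B + 2 * U" if "0 \<le> s" "s \<le> T" for s
   using B(2)[OF that] U(2)[OF that] U(2)[of 0] I_bound[of s y] I_bound[of 0 y] pg that by auto
  have lower: "d \<le> \<tau> y s" if s: "0 \<le> s" "s \<le> T" for s
  proof -
   have "0 \<le> (\<integral>r. P (\<theta> y) (\<tau> y r) \<partial>ivl 0 s)" by simp
   then have "- (B + 2 * U) / \<mu> \<le> (c s + I y s - I y 0 + (\<integral>r. P (\<theta> y) (\<tau> y r) \<partial>ivl 0 s)) / \<mu>"
    using ci[OF s, unfolded abs_le_iff] mu by (intro divide_right_mono) linarith+
   then show ?thesis unfolding base[OF s(1)] d_def using pg \<tau>0_const by (intro mult_mono) auto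
  qed
  have "(\<integral>r. P (\<theta> y) (\<tau> y r) \<partial>ivl 0 t) \<le> (\<integral>r. K \<partial>ivl 0 t)"
   using P\<tau>_integrable[OF goodD(1)[OF y]] K(2)[OF pg(3,4)] lower t
   by (intro integral_mono_AE) (auto intro!: AE_ivl_I)
  also have "\<dots> \<le> K * max 0 T" using t K by (simp add: measure_ivl mult_left_mono mult.commute)
  finally have "(c t + I y t - I y 0 + (\<integral>r. P (\<theta> y) (\<tau> y r) \<partial>ivl 0 t)) / \<mu> \<le> (B + 2 * U + K * max 0 T) / \<mu>"
   using ci[OF t] mu by (intro divide_right_mono) auto
  then have "\<tau> y t \<le> \<tau>hi * exp ((B + 2 * U + K * max 0 T) / \<mu>)"
   unfolding base[OF t(1)] using pg by (intro mult_mono) auto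
  then show "d \<le> \<tau> y t \<and> \<tau> y t \<le> M" using lower[OF t] by (auto simp: M_def)
 qed (use d in \<open>auto simp: M_def\<close>)
qed

text \<open>The total stress, viscous part minus pressure. Its primitive in time is
  \<open>SG y\<close>.\<close>

definition \<sigma> :: "real => real => real" where
 "\<sigma> y r = \<mu> * g y r / \<tau> y r - P (\<theta> y) (\<tau> y r)"

lemma \<sigma>_meas [measurable]: "case_prod \<sigma> \<in> borel2"
 unfolding \<sigma>_def by measurable

lemma SG_diff:
 assumes y: "good y" and st: "0 \<le> s" "s \<le> t"
 shows "integrable (ivl s t) (\<sigma> y)" "SG y t - SG y s = (\<integral>r. \<sigma> y r \<partial>ivl s t)"
proof -
 note pg = pre_goodD[OF goodD(1)[OF y]]
 have pos: "0 < x" if "x \<in> \<tau> y ` {s..t}" for x using that pg st by auto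
 have ch: "integrable (ivl s t) (%r. \<mu> / \<tau> y r * g y r)"
  "\<mu> * ln (\<tau> y t) - \<mu> * ln (\<tau> y s) = (\<integral>r. \<mu> / \<tau> y r * g y r \<partial>ivl s t)"
 proof -
  have *: "((%x. \<mu> * ln x) has_real_derivative \<mu> / x) (at x)" if "x \<in> \<tau> y ` {s..t}" for x
   by (rule derivative_eq_intros refl pos[OF that] | simp)+
  have **: "continuous_on (\<tau> y ` {s..t}) (%x. \<mu> / x)" by (intro continuous_intros ballI) (metis pos less_irrefl)
  have td: "\<tau> y r = \<tau> y s + (\<integral>r. g y r \<partial>ivl s r)" if "r \<in> {s..t}" for r
   using \<tau>_diff[OF goodD(1)[OF y] st(1), of r] that by simp
  have m: "(%r. \<mu> / \<tau> y r * g y r) \<in> borel1" by measurable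
  show "integrable (ivl s t) (%r. \<mu> / \<tau> y r * g y r)"
   by (rule indefinite_chain_rule(1)[OF pg(10)[OF st(1)] st(2) td * ** m])
  show "\<mu> * ln (\<tau> y t) - \<mu> * ln (\<tau> y s) = (\<integral>r. \<mu> / \<tau> y r * g y r \<partial>ivl s t)"
   by (rule indefinite_chain_rule(2)[OF pg(10)[OF st(1)] st(2) td * ** m])
 qed
 have \<sigma>: "\<sigma> y = (%r. \<mu> / \<tau> y r * g y r - P (\<theta> y) (\<tau> y r))" by (simp add: \<sigma>_def fun_eq_iff)
 show "integrable (ivl s t) (\<sigma> y)" unfolding \<sigma>
  using ch(1) P\<tau>_integrable[OF goodD(1)[OF y] st(1), of t] by auto
 have "SG y t - SG y s = (\<mu> * ln (\<tau> y t) - \<mu> * ln (\<tau> y s)) - (\<integral>r. P (\<theta> y) (\<tau> y r) \<partial>ivl s t)"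
  unfolding SG_def using integral_ivl_split[OF P\<tau>_integrable[OF goodD(1)[OF y], of 0 t], of s] st pg(6) pg(9)[of s] pg(9)[of t]
  by (simp add: ln_div algebra_simps)
 then show "SG y t - SG y s = (\<integral>r. \<sigma> y r \<partial>ivl s t)" unfolding \<sigma> ch(2)
  using ch(1) P\<tau>_integrable[OF goodD(1)[OF y] st(1), of t] by simp
qed

lemma \<sigma>_I:
 assumes y: "good y" and st: "0 \<le> s" "s \<le> t"
 shows "(\<integral>r. \<sigma> y r \<partial>ivl s t) = (c t - c s) + (I y t - I y s)"
 using SG_diff(2)[OF y st] goodD(2)[OF y, of t] goodD(2)[OF y, of s] st by simp

lemma AE_cyl:
 assumes "\<And>y t. good y ==> s < t ==> t < T ==> Q y t"
 shows "AE w in slab s T. Q (fst w) (snd w)"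
 using AE_pair_fst[OF AE_good, of s T] AE_pair_snd[OF AE_ivl_mem[of s T], of 0 1]
 by eventually_elim (use assms in auto)

lemma \<sigma>_L2: "in_L2 (cyl T) (case_prod \<sigma>)"
proof -
 obtain d M where dM: "0 < d" "d \<le> M" "\<And>y t. good y ==> 0 \<le> t ==> t \<le> T ==> d \<le> \<tau> y t \<and> \<tau> y t \<le> M"
  using local_bounds by metis
 obtain K where K: "0 < K" "\<And>\<theta> \<tau>. 0 < \<theta> ==> \<theta> < 1 ==> d \<le> \<tau> ==> P \<theta> \<tau> \<le> K"
  using P_upper[OF dM(1)] by auto
 have "in_L2 (cyl T) (%w. \<mu> / \<tau> (fst w) (snd w) * case_prod g w)"
 proof (rule in_L2_mult_bounded[OF g_L2, where C="\<mu> / d"])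
  show "AE w in cyl T. \<bar>\<mu> / \<tau> (fst w) (snd w)\<bar> \<le> \<mu> / d"
  proof (rule AE_cyl)
   fix y t assume "good y" "0 < t" "t < T"
   then show "\<bar>\<mu> / \<tau> y t\<bar> \<le> \<mu> / d" using dM(3)[of y t] dM(1) mu by (auto simp: abs_divide intro!: divide_left_mono)
  qed
 qed simp
 moreover have "in_L2 (cyl T) (%w. P (\<theta> (fst w)) (\<tau> (fst w) (snd w)))"
 proof (rule ivl2.in_L2_bounded[where C=K])
  show "AE w in cyl T. \<bar>P (\<theta> (fst w)) (\<tau> (fst w) (snd w))\<bar> \<le> K"
  proof (rule AE_cyl)
   fix y t assume "good y" "0 < t" "t < T"
   then show "\<bar>P (\<theta> y) (\<tau> y t)\<bar> \<le> K" using dM(3)[of y t] K(2)[of "\<theta> y" "\<tau> y t"] pre_goodD[OF goodD(1)] by auto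
  qed
 qed simp
 ultimately have "in_L2 (cyl T) (%w. \<mu> / \<tau> (fst w) (snd w) * case_prod g w - P (\<theta> (fst w)) (\<tau> (fst w) (snd w)))"
  by (rule in_L2_diff)
 then show ?thesis by (simp add: \<sigma>_def case_prod_beta')
qed

end

section \<open>Boxes in the plane, integration by parts and averages in time\<close>

lemma ivl2_density: "ivl a b \<Otimes>\<^sub>M ivl c d = density lborel (indicator ({a<..<b} \<times> {c<..<d}))"
proof -
 have "ivl a b \<Otimes>\<^sub>M ivl c d = density (lborel \<Otimes>\<^sub>M lborel) (%(x, y). indicator {a<..<b} x * indicator {c<..<d} y)"
  unfolding ivl_def
  by (intro pair_measure_density)
   (auto simp: ivl.sigma_finite_measure_axioms[unfolded ivl_def] intro: lborel.sigma_finite_measure_axioms)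
 also have "\<dots> = density lborel (indicator ({a<..<b} \<times> {c<..<d}))"
  unfolding lborel_prod by (intro arg_cong2[where f=density] refl) (auto simp: fun_eq_iff indicator_def)
 finally show ?thesis .
qed

lemma borel_prod_real: "borel2 = (borel1 :: (real \<times> real => real) set)"
 by (simp add: borel_prod)

lemma integral_ivl2:
 fixes f :: "real \<times> real => real"
 assumes "f \<in> borel1"
 shows "integral\<^sup>L (ivl a b \<Otimes>\<^sub>M ivl c d) f = (\<integral>w. indicator ({a<..<b} \<times> {c<..<d}) w * f w \<partial>lborel)"
proof -
 have "ivl a b \<Otimes>\<^sub>M ivl c d = density lborel (%w. ennreal (indicator ({a<..<b} \<times> {c<..<d}) w))"
  by (simp add: ivl2_density ennreal_indicator)
 moreover have "{a<..<b} \<times> {c<..<d} \<in> sets borel" by (intro borel_open open_Times) auto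
 ultimately show ?thesis using assms by (simp add: integral_density)
qed

lemma integrable_ivl2:
 fixes f :: "real \<times> real => real"
 assumes "f \<in> borel1"
 shows "integrable (ivl a b \<Otimes>\<^sub>M ivl c d) f \<longleftrightarrow> integrable lborel (%w. indicator ({a<..<b} \<times> {c<..<d}) w * f w)"
proof -
 have "ivl a b \<Otimes>\<^sub>M ivl c d = density lborel (%w. ennreal (indicator ({a<..<b} \<times> {c<..<d}) w))"
  by (simp add: ivl2_density ennreal_indicator)
 moreover have "{a<..<b} \<times> {c<..<d} \<in> sets borel" by (intro borel_open open_Times) auto
 ultimately show ?thesis using assms by (simp add: integrable_density)
qed

lemma AE_ivl2: "(AE w in ivl a b \<Otimes>\<^sub>M ivl c d. P w) \<longleftrightarrow> (AE w in lborel. w \<in> {a<..<b} \<times> {c<..<d} --> P w)"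
proof -
 have "{a<..<b} \<times> {c<..<d} \<in> sets borel" by (intro borel_open open_Times) auto
 moreover have "0 < (indicator ({a<..<b} \<times> {c<..<d}) w :: ennreal) \<longleftrightarrow> w \<in> {a<..<b} \<times> {c<..<d}" for w
  by (simp add: indicator_def)
 ultimately show ?thesis unfolding ivl2_density by (subst AE_density) auto
qed

lemma in_L2_ivl2_iff:
 fixes f :: "real \<times> real => real"
 assumes "f \<in> borel1"
 shows "in_L2 (ivl a b \<Otimes>\<^sub>M ivl c d) f \<longleftrightarrow> in_L2 lborel (%w. indicator ({a<..<b} \<times> {c<..<d}) w * f w)"
proof -
 have [measurable]: "{a<..<b} \<times> {c<..<d} \<in> sets borel" by (intro borel_open open_Times) auto
 have "(%w. (f w)\<^sup>2) \<in> borel1" using assms by simp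
 moreover have "(%w. (indicator ({a<..<b} \<times> {c<..<d}) w * f w)\<^sup>2) = (%w. indicator ({a<..<b} \<times> {c<..<d}) w * (f w)\<^sup>2)"
  by (auto simp: fun_eq_iff indicator_def)
 ultimately show ?thesis
  using assms integrable_ivl2[of "%w. (f w)\<^sup>2" a b c d] by (simp add: in_L2_def borel_prod)
qed

lemma integrable_ivl2_subset:
 fixes f :: "real \<times> real => real"
 assumes "integrable (ivl a b \<Otimes>\<^sub>M ivl c d) f" "a \<le> a'" "b' \<le> b" "c \<le> c'" "d' \<le> d"
 shows "integrable (ivl a' b' \<Otimes>\<^sub>M ivl c' d') f"
proof -
 have f: "f \<in> borel1" using borel_measurable_integrable[OF assms(1)] by (simp add: borel_prod)
 have [measurable]: "{a'<..<b'} \<times> {c'<..<d'} \<in> sets borel" by (intro borel_open open_Times) auto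
 from assms show ?thesis unfolding integrable_ivl2[OF f]
  by (elim Bochner_Integration.integrable_bound) (use f in \<open>auto simp: indicator_def\<close>)
qed

lemma in_L2_ivl2_subset:
 fixes f :: "real \<times> real => real"
 assumes "in_L2 (ivl a b \<Otimes>\<^sub>M ivl c d) f" "a \<le> a'" "b' \<le> b" "c \<le> c'" "d' \<le> d"
 shows "in_L2 (ivl a' b' \<Otimes>\<^sub>M ivl c' d') f"
 using assms integrable_ivl2_subset[of a b c d "%x. (f x)\<^sup>2" a' b' c' d'] by (auto simp: in_L2_def)

lemma integral_ivl2_split:
 fixes f :: "real \<times> real => real"
 assumes f: "integrable (ivl a b \<Otimes>\<^sub>M ivl s t) f" and r: "s \<le> r" "r \<le> t"
 shows "integral\<^sup>L (ivl a b \<Otimes>\<^sub>M ivl s t) f = integral\<^sup>L (ivl a b \<Otimes>\<^sub>M ivl s r) f + integral\<^sup>L (ivl a b \<Otimes>\<^sub>M ivl r t) f"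
proof -
 have f': "integrable (ivl a b \<Otimes>\<^sub>M ivl s r) f" "integrable (ivl a b \<Otimes>\<^sub>M ivl r t) f"
  using integrable_ivl2_subset[OF f] r by auto
 have i: "integrable (ivl s t) (%y. \<integral>x. f (x, y) \<partial>ivl a b)"
  using ivl2.integrable_snd[of a b s t "curry f"] f by simp
 show ?thesis
  using ivl2.integral_snd[of a b s t "curry f"] ivl2.integral_snd[of a b s r "curry f"] ivl2.integral_snd[of a b r t "curry f"]
   f f' integral_ivl_split[OF i r] by simp
qed

text \<open>By Fubini's theorem on the triangle \<open>x < y\<close>.\<close>

lemma integral_by_parts_indefinite:
 fixes f h :: "real => real"
 assumes f: "integrable (ivl a b) f" and h: "integrable (ivl a b) h" and h0: "integral\<^sup>L (ivl a b) h = 0"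
 shows "integrable (ivl a b) (%y. (\<integral>x. f x \<partial>ivl a y) * h y)"
  and "integrable (ivl a b) (%x. f x * (\<integral>y. h y \<partial>ivl a x))"
  and "(\<integral>y. (\<integral>x. f x \<partial>ivl a y) * h y \<partial>ivl a b) = - (\<integral>x. f x * (\<integral>y. h y \<partial>ivl a x) \<partial>ivl a b)"
proof -
 have [measurable]: "f \<in> borel1" "h \<in> borel1"
  using borel_measurable_integrable[OF f] borel_measurable_integrable[OF h] by auto
 have fh: "integrable (ivl a b \<Otimes>\<^sub>M ivl a b) (%w. f (fst w) * h (snd w))"
 proof (rule ivl2.Fubini_integrable)
  show "integrable (ivl a b) (%x. \<integral>y. norm (f (fst (x, y)) * h (snd (x, y))) \<partial>ivl a b)"
   using f by (simp add: abs_mult)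
  show "AE x in ivl a b. integrable (ivl a b) (%y. f (fst (x, y)) * h (snd (x, y)))"
   using h by simp
 qed simp
 define k where "k = (%x y. if x < y then f x * h y else 0)"
 have [measurable]: "(%(x, y). k x y) \<in> borel2" unfolding k_def by measurable
 have k: "integrable (ivl a b \<Otimes>\<^sub>M ivl a b) (%(x, y). k x y)"
  by (rule Bochner_Integration.integrable_bound[OF fh]) (auto simp: k_def)
 have inner1: "(\<integral>x. k x y \<partial>ivl a b) = (\<integral>x. f x \<partial>ivl a y) * h y" if "a < y" "y < b" for y
 proof -
  have "(\<integral>x. k x y \<partial>ivl a b) = (\<integral>x. indicator {a<..<b} x * k x y \<partial>lborel)"
   unfolding k_def by (intro integral_ivl) measurable
  also have "\<dots> = (\<integral>x. (indicator {a<..<y} x * f x) * h y \<partial>lborel)"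
   by (rule Bochner_Integration.integral_cong) (use that in \<open>auto simp: k_def indicator_def\<close>)
  also have "\<dots> = (\<integral>x. f x \<partial>ivl a y) * h y" by (simp add: integral_ivl)
  finally show ?thesis .
 qed
 \<comment> \<open>Here the zero mean enters: the integral of \<open>h\<close> over
   \<open>(x, b)\<close> is minus that over \<open>(a, x)\<close>, and no boundary term
   remains.\<close>
 have inner2: "(\<integral>y. k x y \<partial>ivl a b) = - (f x * (\<integral>y. h y \<partial>ivl a x))" if "a < x" "x < b" for x
 proof -
  have "(\<integral>y. k x y \<partial>ivl a b) = (\<integral>y. indicator {a<..<b} y * k x y \<partial>lborel)"
   unfolding k_def by (intro integral_ivl) measurable
  also have "\<dots> = (\<integral>y. f x * (indicator {x<..<b} y * h y) \<partial>lborel)"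
   by (rule Bochner_Integration.integral_cong) (use that in \<open>auto simp: k_def indicator_def\<close>)
  also have "\<dots> = f x * (\<integral>y. h y \<partial>ivl x b)" by (simp add: integral_ivl)
  finally show ?thesis using integral_ivl_split[OF h, of x] h0 that by (simp add: eq_neg_iff_add_eq_0 flip: distrib_left)
 qed
 have m1: "(%y. (\<integral>x. f x \<partial>ivl a y) * h y) \<in> borel1" by measurable
 have m2: "(%x. f x * (\<integral>y. h y \<partial>ivl a x)) \<in> borel1" by measurable
 have mk1: "(%y. \<integral>x. k x y \<partial>ivl a b) \<in> borel1" by measurable
 have mk2: "(%x. \<integral>y. k x y \<partial>ivl a b) \<in> borel1" by measurable
 have ae1: "AE y in ivl a b. (\<integral>x. k x y \<partial>ivl a b) = (\<integral>x. f x \<partial>ivl a y) * h y" using inner1 by (intro AE_ivl_I) auto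
 have ae2: "AE x in ivl a b. (\<integral>y. k x y \<partial>ivl a b) = - (f x * (\<integral>y. h y \<partial>ivl a x))" using inner2 by (intro AE_ivl_I) auto
 show i1: "integrable (ivl a b) (%y. (\<integral>x. f x \<partial>ivl a y) * h y)"
  using ivl2.integrable_snd[OF k] ae1 m1 mk1 by (subst integrable_cong_AE[symmetric, OF _ _ ae1]) auto
 have i2: "integrable (ivl a b) (%x. - (f x * (\<integral>y. h y \<partial>ivl a x)))"
  using ivl2.integrable_fst[OF k] ae2 m2 mk2 by (subst integrable_cong_AE[symmetric, OF _ _ ae2]) auto
 then show "integrable (ivl a b) (%x. f x * (\<integral>y. h y \<partial>ivl a x))" by simp
 have "(\<integral>y. (\<integral>x. f x \<partial>ivl a y) * h y \<partial>ivl a b) = (\<integral>y. \<integral>x. k x y \<partial>ivl a b \<partial>ivl a b)"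
  using ae1 m1 mk1 by (intro integral_cong_AE) (auto elim: eventually_mono)
 also have "\<dots> = (\<integral>x. \<integral>y. k x y \<partial>ivl a b \<partial>ivl a b)" by (rule ivl2.Fubini_integral[OF k])
 also have "\<dots> = (\<integral>x. - (f x * (\<integral>y. h y \<partial>ivl a x)) \<partial>ivl a b)"
  using ae2 m2 mk2 by (intro integral_cong_AE) auto
 finally show "(\<integral>y. (\<integral>x. f x \<partial>ivl a y) * h y \<partial>ivl a b) = - (\<integral>x. f x * (\<integral>y. h y \<partial>ivl a x) \<partial>ivl a b)"
  by simp
qed

text \<open>Averages over a short forward time interval converge in the mean square. By
  Cauchy-Schwarz in \<open>z\<close> the squared error of the average is at most the average of the
  squared errors of the translates, which are small by \<open>translation_L2\<close>.\<close>

lemma steklov_L2: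
 fixes f :: "real \<times> real => real"
 assumes f: "in_L2 lborel f"
 defines "F \<equiv> %h w. (\<integral>z. f (w + (0, z)) \<partial>ivl 0 h) / h"
 shows "\<And>h. F h \<in> borel1"
  and "\<And>e. 0 < e ==> \<exists>d>0. \<forall>h. 0 < h \<and> h < d --> in_L2 lborel (%w. F h w - f w) \<and> (\<integral>w. (F h w - f w)\<^sup>2 \<partial>lborel) \<le> e"
proof -
 have fm[measurable]: "f \<in> borel1" using in_L2_measurable[OF f] by simp
 have "(%p::(real \<times> real) \<times> real. fst p + (0, snd p)) \<in> borel1"
  by (intro borel_measurable_continuous_onI continuous_intros)
 then have sh[measurable]: "(%p::(real \<times> real) \<times> real. fst p + (0, snd p)) \<in> borel \<Otimes>\<^sub>M borel \<rightarrow>\<^sub>M borel"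
  by (simp add: borel_prod)
 have fs[measurable]: "(%(w, z). f (w + (0, z))) \<in> borel2"
  using measurable_compose[OF sh fm] by (simp add: case_prod_beta')
 show Fm: "F h \<in> borel1" for h
 proof -
  have "(%w. \<integral>z. f (w + (0, z)) \<partial>ivl 0 h) \<in> borel1"
   by (rule measurable_indefinite[OF fs]) auto
  then show ?thesis unfolding F_def by simp
 qed
 fix e :: real assume e: "0 < e"
 define D where "D = (%z::real. \<integral>w. (f (w + (0, z)) - f w)\<^sup>2 \<partial>lborel)"
 have "\<forall>\<^sub>F k in at 0. dist (\<integral>w. (f (w + k) - f w)\<^sup>2 \<partial>lborel) 0 < e"
  using translation_L2[OF f] e by (rule tendstoD)
 then obtain d where d: "0 < d" "\<And>k. k \<noteq> 0 ==> dist k 0 < d ==> dist (\<integral>w. (f (w + k) - f w)\<^sup>2 \<partial>lborel) 0 < e"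
  unfolding eventually_at by auto
 have Dle: "D z \<le> e" if "0 < z" "z < d" for z
  using d(2)[of "(0, z)"] that by (simp add: D_def dist_norm norm_Pair zero_prod_def abs_if split: if_splits)
 have fL: "in_L2 lborel (%w. f (w + k) - f w)" for k
  using integrable_lborel_shift[OF in_L2_integrable_sq[OF f], of k] f
  by (intro in_L2_diff) (auto simp: in_L2_def)
 have main: "(\<integral>\<^sup>+w. ennreal ((F h w - f w)\<^sup>2) \<partial>lborel) \<le> ennreal e" if h: "0 < h" "h < d" for h
 proof -
  \<comment> \<open>Stated for extended nonnegative integrals, since integrability along the short
    interval is not known beforehand. If the right-hand side is infinite there is nothing to prove;
    otherwise it yields the integrability needed to subtract \<open>f w\<close> under the
    integral.\<close>
  have pw: "ennreal ((F h w - f w)\<^sup>2) \<le> ennreal (1 / h) * (\<integral>\<^sup>+z. ennreal ((f (w + (0, z)) - f w)\<^sup>2) \<partial>ivl 0 h)" for w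
  proof (cases "(\<integral>\<^sup>+z. ennreal ((f (w + (0, z)) - f w)\<^sup>2) \<partial>ivl 0 h) < \<infinity>")
   case False
   then show ?thesis using h by (simp add: not_less top_unique ennreal_mult_top)
  next
   case True
   define k where "k = (%z. f (w + (0, z)) - f w)"
   have [measurable]: "k \<in> borel1" unfolding k_def
    using measurable_compose[OF _ fs, of "%z. (w, z)" borel] by simp
   have "(\<integral>\<^sup>+z. ennreal ((k z)\<^sup>2) \<partial>ivl 0 h) < \<infinity>" using True by (simp add: k_def)
   then have kL: "in_L2 (ivl 0 h) k" unfolding in_L2_def
    by (auto intro!: integrableI_bounded)
   then have ki: "integrable (ivl 0 h) k" using ivl.in_L2_integrable by blast
   have "(\<integral>z. f (w + (0, z)) \<partial>ivl 0 h) = (\<integral>z. k z + f w \<partial>ivl 0 h)" by (simp add: k_def)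
   also have "\<dots> = (\<integral>z. k z \<partial>ivl 0 h) + h * f w" using ki h by (simp add: measure_ivl)
   finally have Fk: "F h w - f w = (\<integral>z. k z \<partial>ivl 0 h) / h" using h by (simp add: F_def field_simps)
   have "(\<integral>z. k z * 1 \<partial>ivl 0 h)\<^sup>2 \<le> (\<integral>z. (k z)\<^sup>2 \<partial>ivl 0 h) * (\<integral>z. 1\<^sup>2 \<partial>ivl 0 h)"
    by (rule Cauchy_Schwarz_integral[OF kL ivl.in_L2_const])
   then have "(\<integral>z. k z \<partial>ivl 0 h)\<^sup>2 \<le> h * (\<integral>z. (k z)\<^sup>2 \<partial>ivl 0 h)" using h by (simp add: measure_ivl mult.commute)
   then have "(\<integral>z. k z \<partial>ivl 0 h)\<^sup>2 / h\<^sup>2 \<le> h * (\<integral>z. (k z)\<^sup>2 \<partial>ivl 0 h) / h\<^sup>2"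
    by (rule divide_right_mono) simp
   also have "\<dots> = 1 / h * (\<integral>z. (k z)\<^sup>2 \<partial>ivl 0 h)" using h by (simp add: power2_eq_square)
   finally have "(F h w - f w)\<^sup>2 \<le> 1 / h * (\<integral>z. (k z)\<^sup>2 \<partial>ivl 0 h)"
    unfolding Fk by (simp only: power_divide)
   then have "ennreal ((F h w - f w)\<^sup>2) \<le> ennreal (1 / h * (\<integral>z. (k z)\<^sup>2 \<partial>ivl 0 h))" by (rule ennreal_leI)
   also have "\<dots> = ennreal (1 / h) * (\<integral>\<^sup>+z. ennreal ((k z)\<^sup>2) \<partial>ivl 0 h)"
    using h in_L2_integrable_sq[OF kL] ennreal_mult[of "1 / h" "\<integral>z. (k z)\<^sup>2 \<partial>ivl 0 h"]
    by (subst nn_integral_eq_integral) auto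
   finally show ?thesis by (simp add: k_def)
  qed
  interpret Q: pair_sigma_finite "lborel :: (real \<times> real) measure" "ivl 0 h"
   by (simp add: pair_sigma_finite_def ivl.sigma_finite_measure_axioms lborel.sigma_finite_measure_axioms)
  have m: "(%(w, z). ennreal ((f (w + (0, z)) - f w)\<^sup>2)) \<in> borel_measurable (lborel \<Otimes>\<^sub>M ivl 0 h)"
  proof -
   have "(%(w, z). ennreal ((f (w + (0, z)) - f w)\<^sup>2)) \<in> borel2"
    unfolding case_prod_beta' using measurable_compose[OF sh fm] by measurable
   moreover have "sets (lborel \<Otimes>\<^sub>M ivl 0 h) = sets (borel \<Otimes>\<^sub>M borel)" by (intro sets_pair_measure_cong) auto
   ultimately show ?thesis by (simp cong: measurable_cong_sets)
  qed
  have "(\<integral>\<^sup>+w. ennreal ((F h w - f w)\<^sup>2) \<partial>lborel)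
   \<le> (\<integral>\<^sup>+w. ennreal (1 / h) * (\<integral>\<^sup>+z. ennreal ((f (w + (0, z)) - f w)\<^sup>2) \<partial>ivl 0 h) \<partial>lborel)"
   by (intro nn_integral_mono pw)
  also have "\<dots> = ennreal (1 / h) * (\<integral>\<^sup>+w. \<integral>\<^sup>+z. ennreal ((f (w + (0, z)) - f w)\<^sup>2) \<partial>ivl 0 h \<partial>lborel)"
   using ivl.borel_measurable_nn_integral[OF m] by (intro nn_integral_cmult) simp
  also have "\<dots> = ennreal (1 / h) * (\<integral>\<^sup>+z. \<integral>\<^sup>+w. ennreal ((f (w + (0, z)) - f w)\<^sup>2) \<partial>lborel \<partial>ivl 0 h)"
   using Q.Fubini'[OF m] by simp
  also have "\<dots> \<le> ennreal (1 / h) * (\<integral>\<^sup>+z. ennreal e \<partial>ivl 0 h)"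
  proof (intro mult_left_mono nn_integral_mono_AE AE_ivl_I)
   fix z assume z: "0 < z" "z < h"
   have "(\<integral>\<^sup>+w. ennreal ((f (w + (0, z)) - f w)\<^sup>2) \<partial>lborel) = ennreal (D z)"
    unfolding D_def using in_L2_integrable_sq[OF fL[of "(0, z)"]] by (intro nn_integral_eq_integral) auto
   then show "(\<integral>\<^sup>+w. ennreal ((f (w + (0, z)) - f w)\<^sup>2) \<partial>lborel) \<le> ennreal e"
    using Dle[of z] z h e by (simp add: ennreal_leI)
  qed simp
  also have "\<dots> = ennreal e"
   using h e by (simp add: emeasure_ivl ennreal_mult[symmetric])
  finally show ?thesis .
 qed
 show "\<exists>d>0. \<forall>h. 0 < h \<and> h < d --> in_L2 lborel (%w. F h w - f w) \<and> (\<integral>w. (F h w - f w)\<^sup>2 \<partial>lborel) \<le> e"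
 proof (intro exI[of _ d] conjI allI impI d(1))
  fix h assume h: "0 < h \<and> h < d"
  show L: "in_L2 lborel (%w. F h w - f w)"
   unfolding in_L2_def using Fm[of h] main[of h] h
   by (auto intro!: integrableI_bounded intro: le_less_trans)
  have "ennreal (\<integral>w. (F h w - f w)\<^sup>2 \<partial>lborel) \<le> ennreal e"
   using main[of h] h nn_integral_eq_integral[OF in_L2_integrable_sq[OF L]] by auto
  then show "(\<integral>w. (F h w - f w)\<^sup>2 \<partial>lborel) \<le> e" using e by (simp add: ennreal_le_iff)
 qed
qed

lemma integral_ivl_shift:
 fixes f :: "real => real"
 assumes "f \<in> borel1"
 shows "(\<integral>z. f (z + s) \<partial>ivl a b) = integral\<^sup>L (ivl (a + s) (b + s)) f"
proof -
 have m: "(%x. indicator {a + s<..<b + s} x * f x) \<in> borel1" using assms by simp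
 have "(\<integral>z. f (z + s) \<partial>ivl a b) = (\<integral>z. indicator {a<..<b} z * f (z + s) \<partial>lborel)"
  using assms by (intro integral_ivl) simp
 also have "\<dots> = (\<integral>z. indicator {a + s<..<b + s} (z + s) * f (z + s) \<partial>lborel)"
  by (rule Bochner_Integration.integral_cong) (auto simp: indicator_def)
 also have "\<dots> = integral\<^sup>L (ivl (a + s) (b + s)) f"
  using integral_lborel_shift[OF m, of s] assms by (simp add: integral_ivl)
 finally show ?thesis .
qed

lemma integrable_ivl_bounded:
 fixes f :: "real => real"
 assumes "f \<in> borel1" "AE x in ivl a b. \<bar>f x\<bar> \<le> B"
 shows "integrable (ivl a b) f"
 using assms by (intro ivl.integrable_const_bound[of _ B]) auto

lemma average_close:
 fixes f :: "real => real"
 assumes "integrable (ivl a b) f" "a < b" "AE x in ivl a b. \<bar>f x - l\<bar> \<le> e"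
 shows "\<bar>(\<integral>x. f x \<partial>ivl a b) - (b - a) * l\<bar> \<le> (b - a) * e"
proof -
 have "(\<integral>x. f x \<partial>ivl a b) - (b - a) * l = (\<integral>x. f x - l \<partial>ivl a b)"
  using assms(1,2) by (simp add: measure_ivl)
 also have "\<bar>\<dots>\<bar> \<le> (\<integral>x. \<bar>f x - l\<bar> \<partial>ivl a b)" by (rule integral_abs_bound)
 also have "\<dots> \<le> (\<integral>x. e \<partial>ivl a b)" using assms by (intro integral_mono_AE) auto
 finally show ?thesis using assms(2) by (simp add: measure_ivl)
qed

section \<open>Velocity at almost every time and the cross identity\<close>

context flow
begin

text \<open>A jointly measurable version of the velocity, vanishing at \<open>y = 0\<close>. It
  agrees with \<open>u\<close> only at almost every time, whereas \<open>u\<close> is meaningful at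
  each time but is not assumed jointly measurable.\<close>

definition ut :: "real => real => real" where "ut y t = (\<integral>x. g x t \<partial>ivl 0 y)"
definition n2 :: "real => real" where "n2 t = (\<integral>y. (ut y t)\<^sup>2 \<partial>ivl 0 1)"

lemma ut_meas [measurable]: "case_prod ut \<in> borel2"
proof -
 have "case_prod ut = (%w. \<integral>x. g x (snd w) \<partial>ivl 0 (fst w))" by (auto simp: ut_def)
 also have "\<dots> \<in> borel2" by measurable
 finally show ?thesis .
qed

lemma n2_meas [measurable]: "n2 \<in> borel1"
 unfolding n2_def by measurable

text \<open>The times at which the velocity has a square-integrable space derivative and vanishes at
  both walls, the latter expressed by the zero mean of \<open>g\<close>.\<close>

definition gtime :: "real => bool" where
 "gtime t \<longleftrightarrow> 0 < t \<and> in_L2 (ivl 0 1) (%y. g y t) \<and> (\<integral>x. g x t \<partial>ivl 0 1) = 0 \<and> (AE y in ivl 0 1. u y t = ut y t)"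

lemma AE_gtime: "AE t in ivl 0 T. gtime t"
proof -
 have "AE t in ivl 0 T. integrable (ivl 0 1) (%y. (g y t)\<^sup>2)"
  using ivl2.AE_integrable_snd[of 0 1 0 T "%y t. (g y t)\<^sup>2"] in_L2_integrable_sq[OF g_L2[of T]]
  by (simp add: case_prod_beta')
 then show ?thesis using u_g[of T] AE_ivl_mem[of 0 T]
  by eventually_elim (auto simp: gtime_def ut_def in_L2_def)
qed

lemma AE_gtime': "0 \<le> s ==> AE t in ivl s T. gtime t"
 using AE_ivl_subset[OF AE_gtime[of T], of s T] by simp

lemma gtime_L2:
 assumes "gtime t"
 shows "in_L2 (ivl 0 1) (%y. ut y t)" "n2 t = (nu t)\<^sup>2" "0 \<le> n2 t"
proof -
 have t: "0 \<le> t" and ae: "AE y in ivl 0 1. u y t = ut y t" using assms by (auto simp: gtime_def)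
 have [measurable]: "(%y. u y t) \<in> borel1" using t by simp
 show "in_L2 (ivl 0 1) (%y. ut y t)" by (rule in_L2_cong_AE[OF u_L2[OF t] _ ae]) simp
 show "n2 t = (nu t)\<^sup>2" unfolding n2_def nu_def L2_norm_sq
  by (rule integral_cong_AE) (use ae in \<open>auto elim: eventually_mono\<close>)
 then show "0 \<le> n2 t" by simp
qed

lemma gtime_g: "gtime t ==> integrable (ivl 0 1) (%y. g y t)"
 using ivl.in_L2_integrable by (auto simp: gtime_def)

text \<open>\<open>ut\<close> starts from 0 at the left wall and is thus bounded pointwise by the
  norm of its derivative; the interval has length 1, hence the constant 1.\<close>

lemma poincare:
 assumes "gtime t"
 shows "n2 t \<le> (\<integral>y. (g y t)\<^sup>2 \<partial>ivl 0 1)"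
proof -
 have gL: "in_L2 (ivl 0 1) (%y. g y t)" using assms by (simp add: gtime_def)
 have "n2 t \<le> (\<integral>y. (\<integral>y. (g y t)\<^sup>2 \<partial>ivl 0 1) \<partial>ivl 0 1)"
  unfolding n2_def
 proof (rule integral_mono_AE)
  show "AE y in ivl 0 1. (ut y t)\<^sup>2 \<le> (\<integral>y. (g y t)\<^sup>2 \<partial>ivl 0 1)"
  proof (rule AE_ivl_I)
   fix y :: real assume "0 < y" "y < 1"
   then have "\<bar>ut y t\<bar> \<le> \<bar>L2_norm (ivl 0 1) (%y. g y t)\<bar>"
    unfolding ut_def using integral_le_L2_norm01[OF gL, of y] by simp
   then have "(ut y t)\<^sup>2 \<le> (L2_norm (ivl 0 1) (%y. g y t))\<^sup>2" by (simp only: abs_le_square_iff)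
   then show "(ut y t)\<^sup>2 \<le> (\<integral>y. (g y t)\<^sup>2 \<partial>ivl 0 1)" by (simp only: L2_norm_sq)
  qed
 qed (use in_L2_integrable_sq[OF gtime_L2(1)[OF assms]] in auto)
 then show ?thesis by (simp add: measure_ivl)
qed

lemma n2_bound: "\<exists>B>0. AE t in ivl 0 T. \<bar>n2 t\<bar> \<le> B"
proof -
 obtain U where U: "0 < U" "\<And>t. 0 \<le> t ==> t \<le> T ==> nu t \<le> U" using nu_bound by metis
 have "AE t in ivl 0 T. \<bar>n2 t\<bar> \<le> U\<^sup>2"
  using AE_gtime[of T] AE_ivl_mem[of 0 T]
 proof eventually_elim
  case (elim t)
  then have "(nu t)\<^sup>2 \<le> U\<^sup>2" using U by (intro power_mono) auto
  then show ?case using gtime_L2[OF elim(1)] by simp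
 qed
 then show ?thesis using U(1) by (intro exI[of _ "U\<^sup>2"]) auto
qed

lemma n2_integrable: "0 \<le> s ==> integrable (ivl s t) n2"
proof -
 assume s: "0 \<le> s"
 obtain B where "AE r in ivl 0 t. \<bar>n2 r\<bar> \<le> B" using n2_bound[of t] by auto
 then have "integrable (ivl 0 t) n2" by (intro integrable_ivl_bounded[where B=B]) auto
 then show ?thesis by (rule integrable_ivl_subset) (use s in auto)
qed

lemma ibp_u:
 assumes r: "gtime r" and s: "0 \<le> s"
 shows "(\<integral>y. I y s * g y r \<partial>ivl 0 1) = - (\<integral>y. u y s * ut y r \<partial>ivl 0 1)"
 unfolding I_def ut_def
 by (rule integral_by_parts_indefinite(3)[OF u_integrable[OF s] gtime_g[OF r]]) (use r in \<open>simp add: gtime_def\<close>)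

lemma g_integrable: "0 \<le> s ==> integrable (slab s t) (%(y, r). g y r)"
 using ivl2.in_L2_integrable[OF in_L2_ivl2_subset[OF g_L2[of t], of 0 1 s t]] by simp

lemma g_L2': "0 \<le> s ==> in_L2 (slab s t) (%(y, r). g y r)"
 using in_L2_ivl2_subset[OF g_L2[of t], of 0 1 s t] by simp

lemma \<sigma>_L2': "0 \<le> s ==> in_L2 (slab s t) (%(y, r). \<sigma> y r)"
 using in_L2_ivl2_subset[OF \<sigma>_L2[of t], of 0 1 s t] by simp

lemma \<tau>_bounded_AE:
 assumes "0 \<le> t"
 obtains M where "AE y in ivl 0 1. \<bar>\<tau> y t\<bar> \<le> M"
proof -
 obtain d M where dM: "0 < d" "d \<le> M" "\<And>y r. good y ==> 0 \<le> r ==> r \<le> t ==> d \<le> \<tau> y r \<and> \<tau> y r \<le> M"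
  using local_bounds by metis
 have "AE y in ivl 0 1. \<bar>\<tau> y t\<bar> \<le> M" using AE_good
 proof eventually_elim
  case (elim y) then show ?case using dM(3)[of y t] dM(1) assms by auto
 qed
 then show ?thesis by (rule that)
qed

lemma \<tau>_slice [measurable]: "(%y. \<tau> y t) \<in> borel1"
 by measurable

lemma \<tau>_joint: "(%w. \<tau> (fst w) (snd w)) \<in> borel2"
 using \<tau>_meas by (simp add: case_prod_beta')

lemma \<sigma>_joint: "(%w. \<sigma> (fst w) (snd w)) \<in> borel2"
 using \<sigma>_meas by (simp add: case_prod_beta')

lemma \<tau>_integrable:
 assumes "0 \<le> t"
 shows "integrable (ivl 0 1) (%y. \<tau> y t)"
proof -
 obtain M where "AE y in ivl 0 1. \<bar>\<tau> y t\<bar> \<le> M" using \<tau>_bounded_AE[OF assms] .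
 then show ?thesis by (intro integrable_ivl_bounded[where B=M] \<tau>_slice)
qed

lemma volume_conserved:
 assumes t: "0 \<le> t"
 shows "(\<integral>y. \<tau> y t \<partial>ivl 0 1) = (\<integral>y. \<tau>0 y \<partial>ivl 0 1)"
proof -
 have i: "integrable (ivl 0 1) (%y. \<integral>r. g y r \<partial>ivl 0 t)"
  using ivl2.integrable_fst[OF g_integrable[of 0 t]] by simp
 have i0: "integrable (ivl 0 1) \<tau>0" using \<tau>_integrable[of 0] by (simp add: \<tau>_eq)
 have "(\<integral>y. \<integral>r. g y r \<partial>ivl 0 t \<partial>ivl 0 1) = (\<integral>r. \<integral>y. g y r \<partial>ivl 0 1 \<partial>ivl 0 t)"
  using ivl2.Fubini_integral[OF g_integrable[of 0 t]] by simp
 also have "\<dots> = (\<integral>r. 0 \<partial>ivl 0 t)"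
  by (rule integral_cong_AE) (use AE_gtime[of t] in \<open>auto simp: gtime_def elim: eventually_mono\<close>)
 finally show ?thesis unfolding \<tau>_eq using i i0 by simp
qed

text \<open>Formally the product rule: \<open>I\<close> changes at the rate
  \<open>\<sigma> - c'\<close>, \<open>\<tau>\<close> at the rate \<open>g\<close>, and integrating
  \<open>I * g\<close> by parts gives minus the squared norm of the velocity. Only the sum
  \<open>c t + I y t\<close> is an indefinite integral in time, not its summands, so the rule is
  verified on increments. The weight \<open>\<beta>\<close> will be 0 in the bounds for the volume
  and the steady volume in the decay estimate.\<close>

lemma cross_identity:
 fixes \<beta> :: "real => real"
 assumes [measurable]: "\<beta> \<in> borel1" and \<beta>: "AE y in ivl 0 1. \<bar>\<beta> y\<bar> \<le> b"
  and st0: "0 \<le> s" "s \<le> t"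
 defines "X \<equiv> %t. \<integral>y. I y t * (\<tau> y t - \<beta> y) \<partial>ivl 0 1"
 shows "X t - X s = (\<integral>w. (\<tau> (fst w) (snd w) - \<beta> (fst w)) * \<sigma> (fst w) (snd w) \<partial>slab s t)
  - (\<integral>r. n2 r \<partial>ivl s t) - (c t - c s) * (\<integral>y. \<tau>0 y - \<beta> y \<partial>ivl 0 1)"
proof -
 let ?S = "%s t. \<integral>w. (\<sigma> (fst w) (snd w))\<^sup>2 \<partial>slab s t"
 let ?A = "%p r. \<integral>y. (u y p - ut y r) * ut y r \<partial>ivl 0 1"
 let ?B = "%p r. \<integral>y. u y p * ut y r \<partial>ivl 0 1"
 define T where "T = t"
 define V where "V = (\<integral>y. \<tau>0 y - \<beta> y \<partial>ivl 0 1)"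
 define kf where "kf = (%w. (\<tau> (fst w) (snd w) - \<beta> (fst w)) * \<sigma> (fst w) (snd w))"
 have [measurable]: "kf \<in> borel2" unfolding kf_def
  by (intro borel_measurable_times borel_measurable_diff \<tau>_joint \<sigma>_joint measurable_compose[OF measurable_fst assms(1)])
 obtain d M where dM: "0 < d" "d \<le> M" "\<And>y r. good y ==> 0 \<le> r ==> r \<le> T ==> d \<le> \<tau> y r \<and> \<tau> y r \<le> M"
  using local_bounds by metis
 obtain U where U: "0 < U" "\<And>t. 0 \<le> t ==> t \<le> T ==> nu t \<le> U" using nu_bound by metis
 have Im[measurable]: "(%y. I y r) \<in> borel1" if "0 \<le> r" for r using that by (rule I_meas)
 have \<tau>M: "\<bar>\<tau> y r\<bar> \<le> M" if "good y" "0 \<le> r" "r \<le> T" for y r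
  using dM(1) dM(3)[OF that] by auto
 have \<tau>b: "AE y in ivl 0 1. \<bar>\<tau> y r - \<beta> y\<bar> \<le> M + b" if "0 \<le> r" "r \<le> T" for r
  using AE_good \<beta> by eventually_elim (use dM(1) dM(3) that in force)
 have Ib: "AE y in ivl 0 1. \<bar>I y r\<bar> \<le> U" if "0 \<le> r" "r \<le> T" for r
 proof (rule AE_ivl_I)
  fix y :: real assume "0 < y" "y < 1"
  then show "\<bar>I y r\<bar> \<le> U" using I_bound[of r y] U(2)[of r] that by auto
 qed
 have prodi: "integrable (ivl 0 1) (%y. f y * h y)"
  if "f \<in> borel1" "h \<in> borel1" "AE y in ivl 0 1. \<bar>f y\<bar> \<le> A" "AE y in ivl 0 1. \<bar>h y\<bar> \<le> B"
  for f h :: "real => real" and A B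
 proof (rule integrable_ivl_bounded[where B="A * B"])
  show "AE y in ivl 0 1. \<bar>f y * h y\<bar> \<le> A * B" using that(3,4)
   by eventually_elim (auto simp: abs_mult intro!: mult_mono)
 qed (use that in auto)
 have \<beta>L2: "in_L2 (slab p q) (%w. (h w - \<beta> (fst w)) * \<sigma> (fst w) (snd w))"
  if "0 \<le> p" "h \<in> borel2" "AE w in slab p q. \<bar>h w\<bar> \<le> M" for h p q
 proof (rule in_L2_mult_bounded[where C="M + b"])
  show "in_L2 (slab p q) (%w. \<sigma> (fst w) (snd w))"
   using \<sigma>_L2'[OF that(1), of q] by (simp add: case_prod_beta')
  show "AE w in slab p q. \<bar>h w - \<beta> (fst w)\<bar> \<le> M + b"
   using that(3) AE_pair_fst[OF \<beta>, of p q] by eventually_elim auto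
 qed (use that in measurable)
 have \<tau>cyl: "AE w in slab p q. \<bar>\<tau> (fst w) (snd w)\<bar> \<le> M" if "0 \<le> p" "q \<le> T" for p q
  by (rule AE_cyl, rule \<tau>M) (use that in auto)
 have kint: "integrable (slab p q) kf" if "0 \<le> p" "q \<le> T" for p q
  unfolding kf_def by (rule ivl2.in_L2_integrable[OF \<beta>L2]) (use \<tau>cyl that in auto)
 have \<tau>t: "AE w in slab p q. \<bar>\<tau> (fst w) r\<bar> \<le> M" if "0 \<le> r" "r \<le> T" for p q r
  using AE_pair_fst[OF AE_good, of p q] by eventually_elim (rule \<tau>M[OF _ that])
 define G where "G = (\<integral>w. (case_prod g w)\<^sup>2 \<partial>cyl T)"
 have G0: "0 \<le> G" by (simp add: G_def)
 define D where "D = (%t. X t + c t * V - integral\<^sup>L (cyl t) kf + (\<integral>r. n2 r \<partial>ivl 0 t))"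
 \<comment> \<open>A discrete product rule with \<open>\<tau>\<close> frozen at the right end
   \<open>q\<close> and \<open>I\<close> at the left end \<open>p\<close>. The defect then pairs
   \<open>\<tau> y q - \<tau> y r\<close> with the stress and \<open>u y p - ut y r\<close> with the
   velocity, and both differences are small.\<close>
 have incr: "\<bar>D q - D p\<bar> \<le> (\<integral>w. \<bar>\<tau> (fst w) q - \<tau> (fst w) (snd w)\<bar> * \<bar>\<sigma> (fst w) (snd w)\<bar> \<partial>slab p q)
   + (\<integral>r. \<bar>?A p r\<bar> \<partial>ivl p q)" (is ?incr1)
  and incr2: "integrable (ivl p q) (%r. \<bar>?A p r\<bar>)" (is ?incr2)
  if pq: "0 \<le> p" "p < q" "q \<le> T" for p q
 proof -
  have q0: "0 \<le> q" using pq by simp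
  define kq where "kq = (%w. (\<tau> (fst w) q - \<beta> (fst w)) * \<sigma> (fst w) (snd w))"
  have kqi: "integrable (slab p q) kq"
   unfolding kq_def by (rule ivl2.in_L2_integrable[OF \<beta>L2]) (use \<tau>t[of q p q] pq in auto)
  have 1: "integral\<^sup>L (slab p q) kq = (c q - c p) * V + (\<integral>y. (I y q - I y p) * (\<tau> y q - \<beta> y) \<partial>ivl 0 1)"
  proof -
   have "integral\<^sup>L (slab p q) kq = (\<integral>y. (\<tau> y q - \<beta> y) * (\<integral>r. \<sigma> y r \<partial>ivl p q) \<partial>ivl 0 1)"
    using ivl2.integral_fst'[OF kqi] by (simp add: kq_def)
   also have "\<dots> = (\<integral>y. (c q - c p) * (\<tau> y q - \<beta> y) + (I y q - I y p) * (\<tau> y q - \<beta> y) \<partial>ivl 0 1)"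
   proof (rule integral_cong_AE)
    show "AE y in ivl 0 1. (\<tau> y q - \<beta> y) * (\<integral>r. \<sigma> y r \<partial>ivl p q) = (c q - c p) * (\<tau> y q - \<beta> y) + (I y q - I y p) * (\<tau> y q - \<beta> y)"
     using AE_good
    proof eventually_elim
     case (elim y)
     show ?case unfolding \<sigma>_I[OF elim pq(1) less_imp_le[OF pq(2)]] by (simp add: algebra_simps)
    qed
   qed (use q0 pq in measurable)
   also have "\<dots> = (c q - c p) * (\<integral>y. \<tau> y q - \<beta> y \<partial>ivl 0 1) + (\<integral>y. (I y q - I y p) * (\<tau> y q - \<beta> y) \<partial>ivl 0 1)"
   proof (subst Bochner_Integration.integral_add)
    show "integrable (ivl 0 1) (%y. (c q - c p) * (\<tau> y q - \<beta> y))"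
     by (rule prodi[where A="\<bar>c q - c p\<bar>"]) (use \<tau>b[of q] pq in auto)
    show "integrable (ivl 0 1) (%y. (I y q - I y p) * (\<tau> y q - \<beta> y))"
    proof (rule prodi)
     show "AE y in ivl 0 1. \<bar>I y q - I y p\<bar> \<le> 2 * U" using Ib[of q] Ib[of p] pq by (auto elim!: eventually_elim2)
    qed (use \<tau>b[of q] q0 pq in auto)
   qed simp
   also have "(\<integral>y. \<tau> y q - \<beta> y \<partial>ivl 0 1) = V"
    unfolding V_def using volume_conserved[OF q0] \<tau>_integrable[OF q0] \<tau>_integrable[of 0] integrable_ivl_bounded[OF assms(1) \<beta>]
    by (simp add: \<tau>_eq)
   finally show ?thesis .
  qed
  have i2: "integrable (slab p q) (%(y, r). I y p * g y r)"
  proof -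
   have "in_L2 (slab p q) (%w. I (fst w) p * (%(y, r). g y r) w)"
    by (rule in_L2_mult_bounded[OF g_L2'[OF pq(1)] _ AE_pair_fst[OF Ib[of p]]]) (use pq in auto)
   then show ?thesis using ivl2.in_L2_integrable by (simp add: case_prod_beta')
  qed
  have aeu: "AE r in ivl p q. (\<integral>y. I y p * g y r \<partial>ivl 0 1) = - ?B p r"
   using AE_gtime'[OF pq(1), of q] by eventually_elim (rule ibp_u[OF _ pq(1)])
  have um[measurable]: "(%y. u y p) \<in> borel1" using pq by simp
  have usm: "(%r. ?B p r) \<in> borel1" by measurable
  have Igm: "(%r. \<integral>y. I y p * g y r \<partial>ivl 0 1) \<in> borel1" using pq by measurable
  have usi: "integrable (ivl p q) (%r. - ?B p r)"
   using ivl2.integrable_snd[OF i2] usm Igm by (subst integrable_cong_AE[symmetric, OF _ _ aeu]) auto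
  have 2: "(\<integral>y. I y p * (\<tau> y q - \<tau> y p) \<partial>ivl 0 1) = - (\<integral>r. ?B p r \<partial>ivl p q)"
  proof -
   have "(\<integral>y. I y p * (\<tau> y q - \<tau> y p) \<partial>ivl 0 1) = (\<integral>y. \<integral>r. I y p * g y r \<partial>ivl p q \<partial>ivl 0 1)"
   proof (rule integral_cong_AE)
    show "AE y in ivl 0 1. I y p * (\<tau> y q - \<tau> y p) = (\<integral>r. I y p * g y r \<partial>ivl p q)"
     using AE_pre_good by eventually_elim (use \<tau>_diff[of _ p q] pq in simp)
   qed (use q0 pq in measurable)
   also have "\<dots> = (\<integral>r. \<integral>y. I y p * g y r \<partial>ivl 0 1 \<partial>ivl p q)"
    using ivl2.Fubini_integral[OF i2] by simp
   also have "\<dots> = (\<integral>r. - ?B p r \<partial>ivl p q)"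
    by (rule integral_cong_AE) (use aeu usm Igm in auto)
   finally show ?thesis by simp
  qed
  have 3: "X q - X p = (\<integral>y. (I y q - I y p) * (\<tau> y q - \<beta> y) \<partial>ivl 0 1) + (\<integral>y. I y p * (\<tau> y q - \<tau> y p) \<partial>ivl 0 1)"
  proof -
   have i: "integrable (ivl 0 1) (%y. I y r * (\<tau> y r' - \<beta> y))" if "r \<in> {p, q}" "r' \<in> {p, q}" for r r'
    by (rule prodi) (use Ib[of r] \<tau>b[of r'] that q0 pq in auto)
   have "X q - X p = (\<integral>y. I y q * (\<tau> y q - \<beta> y) - I y p * (\<tau> y p - \<beta> y) \<partial>ivl 0 1)"
    unfolding X_def using i[of q q] i[of p p] by simp
   also have "\<dots> = (\<integral>y. (I y q * (\<tau> y q - \<beta> y) - I y p * (\<tau> y q - \<beta> y)) + (I y p * (\<tau> y q - \<beta> y) - I y p * (\<tau> y p - \<beta> y)) \<partial>ivl 0 1)"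
    by simp
   also have "\<dots> = (\<integral>y. I y q * (\<tau> y q - \<beta> y) - I y p * (\<tau> y q - \<beta> y) \<partial>ivl 0 1) + (\<integral>y. I y p * (\<tau> y q - \<beta> y) - I y p * (\<tau> y p - \<beta> y) \<partial>ivl 0 1)"
    by (rule Bochner_Integration.integral_add) (use i in auto)
   finally show ?thesis by (simp add: algebra_simps)
  qed
  have n2e: "AE r in ivl p q. n2 r - ?B p r = - ?A p r"
   using AE_gtime'[OF pq(1), of q]
  proof eventually_elim
   case (elim r)
   have "integrable (ivl 0 1) (%y. u y p * ut y r)" "integrable (ivl 0 1) (%y. ut y r * ut y r)"
    by (rule in_L2_mult_integrable u_L2 gtime_L2(1)[OF elim] pq(1))+
   then show ?case by (simp add: n2_def left_diff_distrib power2_eq_square)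
  qed
  have n2m: "(%r. ?A p r) \<in> borel1" by measurable
  have n2i: "integrable (ivl p q) (%r. n2 r - ?B p r)"
   using n2_integrable[OF pq(1), of q] usi by auto
  have n2i': "integrable (ivl p q) (%r. - ?A p r)"
   using n2i n2m usm by (subst integrable_cong_AE[symmetric, OF _ _ n2e]) auto
  then show ?incr2 by auto
  have "D q - D p = integral\<^sup>L (slab p q) kq - integral\<^sup>L (slab p q) kf
    + (\<integral>r. n2 r \<partial>ivl p q) - (\<integral>r. ?B p r \<partial>ivl p q)"
   using 1 2 3 integral_ivl2_split[OF kint[of 0 q], of p] integral_ivl_split[OF n2_integrable[of 0 q], of p] pq
   by (simp add: D_def algebra_simps)
  also have "integral\<^sup>L (slab p q) kq - integral\<^sup>L (slab p q) kf
   = (\<integral>w. (\<tau> (fst w) q - \<tau> (fst w) (snd w)) * \<sigma> (fst w) (snd w) \<partial>slab p q)"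
   using kqi kint[of p q] pq by (subst Bochner_Integration.integral_diff[symmetric]) (auto simp: kq_def kf_def algebra_simps)
  finally have Deq: "D q - D p = (\<integral>w. (\<tau> (fst w) q - \<tau> (fst w) (snd w)) * \<sigma> (fst w) (snd w) \<partial>slab p q)
   + (\<integral>r. n2 r - ?B p r \<partial>ivl p q)"
   using n2_integrable[OF pq(1), of q] usi by simp
  have "(\<integral>r. n2 r - ?B p r \<partial>ivl p q) = (\<integral>r. - ?A p r \<partial>ivl p q)"
   by (rule integral_cong_AE) (use n2e n2m usm in auto)
  then have "(\<integral>r. n2 r - ?B p r \<partial>ivl p q) = - (\<integral>r. ?A p r \<partial>ivl p q)"
   by simp
  with Deq show ?incr1
   using integral_abs_bound[of "slab p q" "%w. (\<tau> (fst w) q - \<tau> (fst w) (snd w)) * \<sigma> (fst w) (snd w)"]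
    integral_abs_bound[of "ivl p q" "%r. ?A p r"]
   unfolding abs_mult abs_minus_cancel by linarith
 qed
 have "D t = D s"
 proof (rule constant_if_small_increments[OF st0(2), where M="%t. ?S 0 t / 2 + (G / 2 + U) * t"])
  fix e :: real assume e: "0 < e"
  obtain d0 where d0: "0 < d0" "\<And>s t. 0 \<le> s ==> s \<le> T ==> 0 \<le> t ==> t \<le> T ==> \<bar>t - s\<bar> < d0 ==> du s t < e"
   using du_uniform[OF e] by metis
  show "\<exists>d>0. \<forall>p q. s \<le> p \<and> p < q \<and> q \<le> t \<and> q - p < d --> \<bar>D q - D p\<bar> \<le> e *
   (?S 0 q / 2 + (G / 2 + U) * q
   - (?S 0 p / 2 + (G / 2 + U) * p))"
  \<comment> \<open>The bound \<open>d0\<close> makes the velocity difference small. The bound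
    \<open>e\<^sup>2\<close> turns the error \<open>(q - p)\<^sup>2 * G / (2 * e)\<close> left by
    Young's inequality into \<open>e * (G / 2 * (q - p))\<close>.\<close>
  proof (intro exI[of _ "min d0 (e\<^sup>2)"] conjI allI impI)
   show "0 < min d0 (e\<^sup>2)" using d0 e by simp
   fix p q assume a: "s \<le> p \<and> p < q \<and> q \<le> t \<and> q - p < min d0 (e\<^sup>2)"
   have pq: "0 \<le> p" "p < q" "q \<le> T" "q - p < d0" "q - p < e\<^sup>2" using a st0 by (auto simp: T_def)
   have s2: "integrable (slab r q) (%w. (\<sigma> (fst w) (snd w))\<^sup>2)" if "0 \<le> r" for r
    using in_L2_integrable_sq[OF \<sigma>_L2'[OF that, of q]] by (simp add: case_prod_beta')
   have g2: "integrable (cyl T) (%(y, r). (g y r)\<^sup>2)"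
    using in_L2_integrable_sq[OF g_L2[of T]] by (simp add: case_prod_beta')
   have Gy: "integrable (ivl 0 1) (%y. \<integral>r. (g y r)\<^sup>2 \<partial>ivl 0 T)" "G = (\<integral>y. \<integral>r. (g y r)\<^sup>2 \<partial>ivl 0 T \<partial>ivl 0 1)"
    using ivl2.integrable_fst[OF g2] ivl2.integral_fst[OF g2] by (simp_all add: G_def case_prod_beta')
   define Gf where "Gf = (%w::real \<times> real. (q - p) * (\<integral>r. (g (fst w) r)\<^sup>2 \<partial>ivl 0 T))"
   have Gf: "integrable (slab p q) Gf" "integral\<^sup>L (slab p q) Gf = (q - p) * ((q - p) * G)"
   proof -
    show gi: "integrable (slab p q) Gf"
     unfolding Gf_def
    proof (rule ivl2.Fubini_integrable)
     show "integrable (ivl 0 1) (%y. \<integral>z. norm ((q - p) * (\<integral>r. (g (fst (y, z)) r)\<^sup>2 \<partial>ivl 0 T)) \<partial>ivl p q)"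
      using Gy(1) by (simp add: abs_mult)
    qed (simp, simp)
    show "integral\<^sup>L (slab p q) Gf = (q - p) * ((q - p) * G)"
     using ivl2.integral_fst'[OF gi] Gy pq by (simp add: Gf_def measure_ivl)
   qed
   have \<tau>2: "AE w in slab p q. (\<tau> (fst w) q - \<tau> (fst w) (snd w))\<^sup>2 \<le> Gf w"
    unfolding Gf_def
   proof (rule AE_cyl[of p q "%y r. (\<tau> y q - \<tau> y r)\<^sup>2 \<le> (q - p) * (\<integral>r. (g y r)\<^sup>2 \<partial>ivl 0 T)"])
    fix y r assume y: "good y" and r: "p < r" "r < q"
    note pg = pre_goodD[OF goodD(1)[OF y]]
    have gL: "in_L2 (ivl r q) (g y)" using pg(11)[of r q] r pq by (simp add: in_L2_def)
    have "(\<tau> y q - \<tau> y r)\<^sup>2 = (\<integral>r. g y r * 1 \<partial>ivl r q)\<^sup>2" using \<tau>_diff[OF goodD(1)[OF y], of r q] r pq by simp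
    also have "\<dots> \<le> (\<integral>r. (g y r)\<^sup>2 \<partial>ivl r q) * (\<integral>r. 1\<^sup>2 \<partial>ivl r q)"
     by (rule Cauchy_Schwarz_integral[OF gL ivl.in_L2_const])
    also have "\<dots> = (q - r) * (\<integral>r. (g y r)\<^sup>2 \<partial>ivl r q)" using r by (simp add: measure_ivl)
    also have "\<dots> \<le> (q - p) * (\<integral>r. (g y r)\<^sup>2 \<partial>ivl 0 T)"
     using r pq pg(11)[of 0 T] by (intro mult_mono integral_ivl_nonneg_mono) auto
    finally show "(\<tau> y q - \<tau> y r)\<^sup>2 \<le> (q - p) * (\<integral>r. (g y r)\<^sup>2 \<partial>ivl 0 T)" .
   qed
   have A1: "(\<integral>w. \<bar>\<tau> (fst w) q - \<tau> (fst w) (snd w)\<bar> * \<bar>\<sigma> (fst w) (snd w)\<bar> \<partial>slab p q)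
    \<le> (\<integral>w. e / 2 * (\<sigma> (fst w) (snd w))\<^sup>2 + 1 / (2 * e) * Gf w \<partial>slab p q)"
   proof (rule integral_mono_AE')
    show "integrable (slab p q) (%w. e / 2 * (\<sigma> (fst w) (snd w))\<^sup>2 + 1 / (2 * e) * Gf w)"
     using s2[OF pq(1)] Gf(1) by auto
    show "AE w in slab p q. \<bar>\<tau> (fst w) q - \<tau> (fst w) (snd w)\<bar> * \<bar>\<sigma> (fst w) (snd w)\<bar>
     \<le> e / 2 * (\<sigma> (fst w) (snd w))\<^sup>2 + 1 / (2 * e) * Gf w"
     using \<tau>2
    proof eventually_elim
     case (elim w)
     have am: "x * z \<le> e / 2 * z\<^sup>2 + 1 / (2 * e) * x\<^sup>2" for x z :: real
     proof -
      have "0 \<le> (e * z - x)\<^sup>2 / (2 * e)" using e by simp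
      also have "\<dots> = e / 2 * z\<^sup>2 + 1 / (2 * e) * x\<^sup>2 - x * z"
       using e by (simp add: power2_diff field_simps power2_eq_square)
      finally show ?thesis by simp
     qed
     have "\<bar>\<tau> (fst w) q - \<tau> (fst w) (snd w)\<bar> * \<bar>\<sigma> (fst w) (snd w)\<bar>
      \<le> e / 2 * \<bar>\<sigma> (fst w) (snd w)\<bar>\<^sup>2 + 1 / (2 * e) * \<bar>\<tau> (fst w) q - \<tau> (fst w) (snd w)\<bar>\<^sup>2" by (rule am)
     also have "\<dots> \<le> e / 2 * (\<sigma> (fst w) (snd w))\<^sup>2 + 1 / (2 * e) * Gf w"
      using elim e by (simp add: divide_right_mono)
     finally show ?case .
    qed
    show "AE w in slab p q. 0 \<le> e / 2 * (\<sigma> (fst w) (snd w))\<^sup>2 + 1 / (2 * e) * Gf w"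
     using \<tau>2
    proof eventually_elim
     case (elim w)
     have "0 \<le> Gf w" using elim zero_le_power2 order_trans by blast
     then show ?case using e by simp
    qed
   qed
   also have "\<dots> = e / 2 * ?S p q + 1 / (2 * e) * ((q - p) * ((q - p) * G))"
    using s2[OF pq(1)] Gf by simp
   also have "1 / (2 * e) * ((q - p) * ((q - p) * G)) \<le> 1 / (2 * e) * (e\<^sup>2 * ((q - p) * G))"
    using pq e G0 by (intro mult_left_mono mult_right_mono) auto
   also have "1 / (2 * e) * (e\<^sup>2 * ((q - p) * G)) = e * (G / 2 * (q - p))"
    using e by (simp add: power2_eq_square)
   finally have A1: "(\<integral>w. \<bar>\<tau> (fst w) q - \<tau> (fst w) (snd w)\<bar> * \<bar>\<sigma> (fst w) (snd w)\<bar> \<partial>slab p q)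
    \<le> e / 2 * ?S p q + e * (G / 2 * (q - p))" by simp
   have "(\<integral>r. \<bar>?A p r\<bar> \<partial>ivl p q) \<le> (\<integral>r. e * U \<partial>ivl p q)"
   proof (rule integral_mono_AE[OF incr2[OF pq(1-3)]])
    show "AE r in ivl p q. \<bar>?A p r\<bar> \<le> e * U"
     using AE_gtime'[OF pq(1), of q] AE_ivl_mem[of p q]
    proof eventually_elim
     case (elim r)
     have r0: "0 \<le> r" using elim pq by simp
     have ae: "AE y in ivl 0 1. u y r = ut y r" using elim(1) by (simp add: gtime_def)
     have um: "(%y. u y p) \<in> borel1" "(%y. u y r) \<in> borel1" using pq r0 by auto
     have "?A p r = (\<integral>y. (u y p - u y r) * u y r \<partial>ivl 0 1)"
      by (rule integral_cong_AE) (use ae um in \<open>auto elim: eventually_mono\<close>)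
     also have "\<bar>\<dots>\<bar> \<le> du p r * nu r" unfolding du_def nu_def
      by (intro Cauchy_Schwarz_L2 in_L2_diff u_L2 pq r0)
     also have "\<dots> \<le> e * U"
      using d0(2)[of p r] U(2)[of r] elim pq r0 e by (intro mult_mono) auto
     finally show ?case .
    qed
   qed simp
   also have "\<dots> = e * (U * (q - p))" using pq by (simp add: measure_ivl)
   finally have A2: "(\<integral>r. \<bar>?A p r\<bar> \<partial>ivl p q) \<le> e * (U * (q - p))" .
   have sp: "?S 0 q =
    ?S 0 p + ?S p q"
    by (rule integral_ivl2_split[OF s2[of 0]]) (use pq in auto)
   have "\<bar>D q - D p\<bar> \<le> e / 2 * ?S p q + e * (G / 2 * (q - p)) + e * (U * (q - p))"
    using incr[OF pq(1-3)] A1 A2 by linarith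
   also have "\<dots> = e * (?S 0 q / 2 + (G / 2 + U) * q
   - (?S 0 p / 2 + (G / 2 + U) * p))"
    unfolding sp by (simp add: field_simps)
   finally show "\<bar>D q - D p\<bar> \<le> e * (?S 0 q / 2 + (G / 2 + U) * q
   - (?S 0 p / 2 + (G / 2 + U) * p))" .
  qed
 qed
 then show ?thesis
  using integral_ivl2_split[OF kint[of 0 t], of s] integral_ivl_split[OF n2_integrable[of 0 t], of s] st0
  by (simp add: D_def V_def T_def kf_def algebra_simps)
qed

end

section \<open>Kinetic energy identity by averaging in time\<close>

text \<open>Compares integrals over a box with norms on the whole plane, where translations in time
  can be applied without leaving the domain.\<close>

lemma L2_integral_mult_bound:
 fixes f h :: "real \<times> real => real"
 assumes f: "in_L2 lborel f" and h: "in_L2 lborel h" and f': "f' \<in> borel1" and h': "h' \<in> borel1"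
  and ff: "\<And>w. w \<in> {a<..<b} \<times> {c<..<d} ==> f' w = f w" and hh: "\<And>w. w \<in> {a<..<b} \<times> {c<..<d} ==> h' w = h w"
 shows "integrable (ivl a b \<Otimes>\<^sub>M ivl c d) (%w. f' w * h' w)"
  and "\<bar>\<integral>w. f' w * h' w \<partial>(ivl a b \<Otimes>\<^sub>M ivl c d)\<bar> \<le> L2_norm lborel f * L2_norm lborel h"
proof -
 define A where "A = {a<..<b} \<times> {c<..<d}"
 have [measurable]: "A \<in> sets borel" unfolding A_def by (intro borel_open open_Times) auto
 have fm: "f \<in> borel1" "h \<in> borel1" using in_L2_measurable[OF f] in_L2_measurable[OF h] by auto
 have fA: "in_L2 lborel (%w. indicator A w * f w)"
  by (rule in_L2_mult_bounded[OF f, where C=1]) (auto simp: indicator_def)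
 have eq: "indicator A w * (f' w * h' w) = (indicator A w * f w) * h w" for w
  using ff[of w] hh[of w] by (auto simp: A_def indicator_def)
 have m: "(%w. f' w * h' w) \<in> borel1" using f' h' by simp
 show "integrable (ivl a b \<Otimes>\<^sub>M ivl c d) (%w. f' w * h' w)"
  unfolding integrable_ivl2[OF m] A_def[symmetric] eq by (rule in_L2_mult_integrable[OF fA h])
 have "\<bar>\<integral>w. f' w * h' w \<partial>(ivl a b \<Otimes>\<^sub>M ivl c d)\<bar> = \<bar>\<integral>w. (indicator A w * f w) * h w \<partial>lborel\<bar>"
  unfolding integral_ivl2[OF m] A_def[symmetric] eq by simp
 also have "\<dots> \<le> L2_norm lborel (%w. indicator A w * f w) * L2_norm lborel h" by (rule Cauchy_Schwarz_L2[OF fA h])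
 also have "\<dots> \<le> L2_norm lborel f * L2_norm lborel h"
  using f fm by (intro mult_right_mono L2_norm_mono) (auto simp: indicator_def)
 finally show "\<bar>\<integral>w. f' w * h' w \<partial>(ivl a b \<Otimes>\<^sub>M ivl c d)\<bar> \<le> L2_norm lborel f * L2_norm lborel h" .
qed

context flow
begin

text \<open>The difference of squares is factored into difference times sum. Integration by parts
  moves a primitive onto the difference and a derivative onto the sum; the term
  \<open>c t - c s\<close> disappears because the summed gradient has zero mean. No time derivative
  of the velocity occurs.\<close>

lemma energy_increment:
 assumes s: "gtime s" and t: "gtime t" and st: "s \<le> t"
 shows "n2 t - n2 s = - (\<integral>y. (\<integral>r. \<sigma> y r \<partial>ivl s t) * (g y t + g y s) \<partial>ivl 0 1)"
proof -
 have s0: "0 \<le> s" "0 \<le> t" using s t by (auto simp: gtime_def)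
 define h where "h = (%y. g y t + g y s)"
 have hi: "integrable (ivl 0 1) h" unfolding h_def using gtime_g[OF s] gtime_g[OF t] by simp
 have hm: "h \<in> borel1" using borel_measurable_integrable[OF hi] by simp
 have h0: "integral\<^sup>L (ivl 0 1) h = 0" unfolding h_def using gtime_g[OF s] gtime_g[OF t] s t by (simp add: gtime_def)
 define w where "w = (%y. u y t - u y s)"
 have wi: "integrable (ivl 0 1) w" unfolding w_def using u_integrable s0 by simp
 have wm: "w \<in> borel1" using borel_measurable_integrable[OF wi] by simp
 have wI: "(\<integral>x. w x \<partial>ivl 0 y) = I y t - I y s" if "0 < y" "y < 1" for y
  unfolding w_def I_def using integrable_ivl_subset[OF u_integrable[OF s0(1)], of 0 y] integrable_ivl_subset[OF u_integrable[OF s0(2)], of 0 y] that by simp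
 have hI: "(\<integral>x. h x \<partial>ivl 0 y) = ut y t + ut y s" if "0 < y" "y < 1" for y
  unfolding h_def ut_def using integrable_ivl_subset[OF gtime_g[OF s], of 0 y] integrable_ivl_subset[OF gtime_g[OF t], of 0 y] that by simp
 have utm: "(%y. ut y r) \<in> borel1" for r by measurable
 have ae: "AE y in ivl 0 1. u y t = ut y t" "AE y in ivl 0 1. u y s = ut y s" using s t by (auto simp: gtime_def)
 have "n2 t - n2 s = (\<integral>y. (ut y t)\<^sup>2 - (ut y s)\<^sup>2 \<partial>ivl 0 1)"
  unfolding n2_def using in_L2_integrable_sq[OF gtime_L2(1)[OF s]] in_L2_integrable_sq[OF gtime_L2(1)[OF t]] by simp
 also have "\<dots> = (\<integral>y. w y * (\<integral>x. h x \<partial>ivl 0 y) \<partial>ivl 0 1)"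
 proof (rule integral_cong_AE)
  show "AE y in ivl 0 1. (ut y t)\<^sup>2 - (ut y s)\<^sup>2 = w y * (\<integral>x. h x \<partial>ivl 0 y)"
   using ae AE_ivl_mem[of 0 1]
  proof eventually_elim
   case (elim y)
   then show ?case using hI[of y] by (simp add: w_def power2_eq_square algebra_simps)
  qed
  show "(%y. w y * (\<integral>x. h x \<partial>ivl 0 y)) \<in> borel_measurable (ivl 0 1)" using wm hm by measurable
 qed (use utm in simp)
 also have "\<dots> = - (\<integral>y. (\<integral>x. w x \<partial>ivl 0 y) * h y \<partial>ivl 0 1)"
  using integral_by_parts_indefinite(3)[OF wi hi h0] by simp
 also have "(\<integral>y. (\<integral>x. w x \<partial>ivl 0 y) * h y \<partial>ivl 0 1) = (\<integral>y. (\<integral>r. \<sigma> y r \<partial>ivl s t) * h y - (c t - c s) * h y \<partial>ivl 0 1)"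
 proof (rule integral_cong_AE)
  show "AE y in ivl 0 1. (\<integral>x. w x \<partial>ivl 0 y) * h y = (\<integral>r. \<sigma> y r \<partial>ivl s t) * h y - (c t - c s) * h y"
   using AE_good AE_ivl_mem[of 0 1]
  proof eventually_elim
   case (elim y)
   have "(\<integral>x. w x \<partial>ivl 0 y) = (\<integral>r. \<sigma> y r \<partial>ivl s t) - (c t - c s)"
    using \<sigma>_I[OF elim(1) s0(1) st] wI[of y] elim(2) by simp
   then show ?case by (simp add: left_diff_distrib)
  qed
  show "(%y. (\<integral>x. w x \<partial>ivl 0 y) * h y) \<in> borel_measurable (ivl 0 1)" using wm hm by measurable
  show "(%y. (\<integral>r. \<sigma> y r \<partial>ivl s t) * h y - (c t - c s) * h y) \<in> borel_measurable (ivl 0 1)" using hm by measurable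
 qed
 also have "\<dots> = (\<integral>y. (\<integral>r. \<sigma> y r \<partial>ivl s t) * h y \<partial>ivl 0 1)"
 proof -
  have i1: "integrable (ivl 0 1) (%y. (\<integral>x. w x \<partial>ivl 0 y) * h y)" by (rule integral_by_parts_indefinite(1)[OF wi hi h0])
  have i: "integrable (ivl 0 1) (%y. (\<integral>r. \<sigma> y r \<partial>ivl s t) * h y)"
  proof (subst integrable_cong_AE[where g="%y. (\<integral>x. w x \<partial>ivl 0 y) * h y + (c t - c s) * h y"])
   show "AE y in ivl 0 1. (\<integral>r. \<sigma> y r \<partial>ivl s t) * h y = (\<integral>x. w x \<partial>ivl 0 y) * h y + (c t - c s) * h y"
    using AE_good AE_ivl_mem[of 0 1]
   proof eventually_elim
    case (elim y)
    have "(\<integral>r. \<sigma> y r \<partial>ivl s t) = (\<integral>x. w x \<partial>ivl 0 y) + (c t - c s)"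
     using \<sigma>_I[OF elim(1) s0(1) st] wI[of y] elim(2) by simp
    then show ?case by (simp add: distrib_right)
   qed
   show "integrable (ivl 0 1) (%y. (\<integral>x. w x \<partial>ivl 0 y) * h y + (c t - c s) * h y)" using i1 hi by simp
   show "(%y. (\<integral>x. w x \<partial>ivl 0 y) * h y + (c t - c s) * h y) \<in> borel_measurable (ivl 0 1)" using wm hm by measurable
   show "(%y. (\<integral>r. \<sigma> y r \<partial>ivl s t) * h y) \<in> borel_measurable (ivl 0 1)" using hm by measurable
  qed
  show ?thesis using i hi h0 by simp
 qed
 finally show ?thesis by (simp add: h_def)
qed

text \<open>\<open>energy_increment\<close> is available only at almost every pair of times and
  contains gradients at single times. It is averaged over \<open>s\<close> in \<open>(a, b)\<close>
  with \<open>t = s + h\<close> and divided by \<open>h\<close>: on the left only averages near the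
  two ends survive, where \<open>nu\<close> is continuous, and on the right the averaged stress and
  the shifted gradient converge in the mean square.\<close>

lemma energy_identity:
 assumes ab: "0 \<le> a" "a < b"
 shows "(nu b)\<^sup>2 - (nu a)\<^sup>2 = - 2 * (\<integral>w. \<sigma> (fst w) (snd w) * g (fst w) (snd w) \<partial>slab a b)"
proof -
 \<comment> \<open>Truncating one unit beyond \<open>b\<close> leaves room for forward shifts by
   \<open>h < 1\<close>.\<close>
 define T where "T = b + 1"
 define A where "A = {0<..<1::real} \<times> {0<..<T}"
 have [measurable]: "A \<in> sets borel" unfolding A_def by (intro borel_open open_Times) auto
 define G where "G = (%w. indicator A w * case_prod g w)"
 define S where "S = (%w. indicator A w * case_prod \<sigma> w)"
 have gm: "case_prod g \<in> borel1" "case_prod \<sigma> \<in> borel1"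
  using g_meas \<sigma>_meas by (simp_all add: borel_prod)
 have GL: "in_L2 lborel G" and SL: "in_L2 lborel S"
  using g_L2[of T] \<sigma>_L2[of T] in_L2_ivl2_iff[OF gm(1), of 0 1 0 T] in_L2_ivl2_iff[OF gm(2), of 0 1 0 T]
  by (simp_all add: G_def S_def A_def)
 have GSm[measurable]: "G \<in> borel1" "S \<in> borel1"
  using in_L2_measurable[OF GL] in_L2_measurable[OF SL] by auto
 define F where "F = (%h w. (\<integral>z. S (w + (0, z)) \<partial>ivl 0 h) / h)"
 have Fm[measurable]: "F h \<in> borel1" for h
  unfolding F_def by (rule steklov_L2(1)[OF SL])
 define Gh where "Gh = (%h w. G (w + (0, h)))"
 have Ghm[measurable]: "Gh h \<in> borel1" for h unfolding Gh_def by simp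
 have GhL: "in_L2 lborel (Gh h)" for h
  using integrable_lborel_shift[OF in_L2_integrable_sq[OF GL], of "(0, h)"] Ghm[of h] by (simp add: in_L2_def Gh_def)
 define p q where "p = L2_norm lborel S" and "q = L2_norm lborel G"
 have pq0: "0 \<le> p" "0 \<le> q" by (auto simp: p_def q_def)
 define J where "J = (\<integral>w. \<sigma> (fst w) (snd w) * g (fst w) (snd w) \<partial>slab a b)"
 have JS: "J = (\<integral>w. S w * G w \<partial>slab a b)"
 proof -
  have "AE w in slab a b. \<sigma> (fst w) (snd w) * g (fst w) (snd w) = S w * G w"
   unfolding AE_ivl2 using ab by (intro AE_I2) (auto simp: S_def G_def A_def T_def indicator_def)
  moreover have "(%w. \<sigma> (fst w) (snd w) * g (fst w) (snd w)) \<in> borel1"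
   using gm by (simp add: case_prod_beta')
  ultimately show ?thesis unfolding J_def by (intro integral_cong_AE) (auto simp: borel_prod)
 qed
 have step: "(\<integral>s. n2 (s + h) - n2 s \<partial>ivl a b) = - h * (\<integral>w. F h w * (Gh h w + G w) \<partial>slab a b)"
  and FGi: "integrable (slab a b) (%w. F h w * (Gh h w + G w))"
  if h: "0 < h" "h < 1" and FL: "in_L2 lborel (%w. F h w - S w)" for h
 proof -
  have "in_L2 lborel (%w. (F h w - S w) + S w)" by (rule in_L2_add[OF FL SL])
  then have FhL: "in_L2 lborel (F h)" by simp
  show FGi: "integrable (slab a b) (%w. F h w * (Gh h w + G w))"
   by (rule L2_integral_mult_bound(1)[OF FhL in_L2_add[OF GhL GL]]) auto
  have ae: "AE s in ivl a b. n2 (s + h) - n2 s = - h * (\<integral>y. F h (y, s) * (Gh h (y, s) + G (y, s)) \<partial>ivl 0 1)"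
  proof -
   have 1: "AE s in ivl a b. gtime s" by (rule AE_gtime'[OF ab(1)])
   have "AE s in lborel. 0 < s + h \<and> s + h < T --> gtime (s + h)"
    using AE_lborel_shift[OF AE_gtime[of T, unfolded AE_ivl], of h] by simp
   then have 2: "AE s in ivl a b. gtime (s + h)"
    unfolding AE_ivl by eventually_elim (use ab h in \<open>auto simp: T_def\<close>)
   show ?thesis using 1 2 AE_ivl_mem[of a b]
   proof eventually_elim
    case (elim s)
    have "n2 (s + h) - n2 s = - (\<integral>y. (\<integral>r. \<sigma> y r \<partial>ivl s (s + h)) * (g y (s + h) + g y s) \<partial>ivl 0 1)"
     by (rule energy_increment) (use elim h in auto)
    also have "(\<integral>y. (\<integral>r. \<sigma> y r \<partial>ivl s (s + h)) * (g y (s + h) + g y s) \<partial>ivl 0 1)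
     = (\<integral>y. h * (F h (y, s) * (Gh h (y, s) + G (y, s))) \<partial>ivl 0 1)"
    proof (rule integral_cong_AE)
     show "AE y in ivl 0 1. (\<integral>r. \<sigma> y r \<partial>ivl s (s + h)) * (g y (s + h) + g y s) = h * (F h (y, s) * (Gh h (y, s) + G (y, s)))"
     proof (rule AE_ivl_I)
      fix y :: real assume y: "0 < y" "y < 1"
      have \<sigma>m: "(%r. \<sigma> y r) \<in> borel1" by measurable
      have "(\<integral>z. S ((y, s) + (0, z)) \<partial>ivl 0 h) = (\<integral>z. \<sigma> y (z + s) \<partial>ivl 0 h)"
      proof (rule integral_cong_AE)
       show "AE z in ivl 0 h. S ((y, s) + (0, z)) = \<sigma> y (z + s)"
        using y elim h ab by (intro AE_ivl_I) (auto simp: S_def A_def T_def add.commute)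
       have "(%z. (y, s) + (0, z)) \<in> borel1"
        by (intro borel_measurable_continuous_onI continuous_intros)
       then show "(%z. S ((y, s) + (0, z))) \<in> borel_measurable (ivl 0 h)"
        using measurable_compose GSm(2) by (simp cong: measurable_cong_sets)
       show "(%z. \<sigma> y (z + s)) \<in> borel_measurable (ivl 0 h)" by measurable
      qed
      also have "\<dots> = (\<integral>r. \<sigma> y r \<partial>ivl s (s + h))" using integral_ivl_shift[OF \<sigma>m, of 0 h s] by (simp add: add.commute)
      finally have F: "(\<integral>r. \<sigma> y r \<partial>ivl s (s + h)) = h * F h (y, s)" using h by (simp add: F_def)
      have "Gh h (y, s) = g y (s + h)" "G (y, s) = g y s"
       using y elim h ab by (auto simp: Gh_def G_def A_def T_def)
      then show "(\<integral>r. \<sigma> y r \<partial>ivl s (s + h)) * (g y (s + h) + g y s) = h * (F h (y, s) * (Gh h (y, s) + G (y, s)))"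
       by (simp add: F)
     qed
     show "(%y. (\<integral>r. \<sigma> y r \<partial>ivl s (s + h)) * (g y (s + h) + g y s)) \<in> borel_measurable (ivl 0 1)" by measurable
     have pm: "(%y. (y, s)) \<in> borel1" by (intro borel_measurable_continuous_onI continuous_intros)
     show "(%y. h * (F h (y, s) * (Gh h (y, s) + G (y, s)))) \<in> borel_measurable (ivl 0 1)"
      using measurable_compose[OF pm Fm[of h]] measurable_compose[OF pm Ghm[of h]] measurable_compose[OF pm GSm(1)] by simp
    qed
    finally show ?case by simp
   qed
  qed
  have FGi': "integrable (slab a b) (%(y, s). F h (y, s) * (Gh h (y, s) + G (y, s)))"
   using FGi by (simp add: case_prod_beta')
  have "(\<integral>s. n2 (s + h) - n2 s \<partial>ivl a b) = (\<integral>s. - h * (\<integral>y. F h (y, s) * (Gh h (y, s) + G (y, s)) \<partial>ivl 0 1) \<partial>ivl a b)"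
  proof (rule integral_cong_AE[OF _ _ ae])
   show "(%s. n2 (s + h) - n2 s) \<in> borel_measurable (ivl a b)" by measurable
   show "(%s. - h * (\<integral>y. F h (y, s) * (Gh h (y, s) + G (y, s)) \<partial>ivl 0 1)) \<in> borel_measurable (ivl a b)"
    using borel_measurable_integrable[OF ivl2.integrable_snd[OF FGi']] by simp
  qed
  also have "\<dots> = - h * (\<integral>w. F h w * (Gh h w + G w) \<partial>slab a b)"
   using ivl2.integral_snd[OF FGi'] by (simp add: case_prod_beta')
  finally show "(\<integral>s. n2 (s + h) - n2 s \<partial>ivl a b) = - h * (\<integral>w. F h w * (Gh h w + G w) \<partial>slab a b)" .
 qed
 have split: "(\<integral>s. n2 (s + h) - n2 s \<partial>ivl a b) = (\<integral>s. n2 s \<partial>ivl b (b + h)) - (\<integral>s. n2 s \<partial>ivl a (a + h))" if h: "0 < h" "h < b - a" for h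
 proof -
  have i: "integrable (ivl a b) (%s. n2 (s + h))"
  proof -
   have "integrable lborel (%x. indicator {a + h<..<b + h} (x + h) * n2 (x + h))"
    using integrable_lborel_shift[OF n2_integrable[of "a + h" "b + h", unfolded integrable_ivl[OF n2_meas]], of h] ab h by simp
   moreover have "(%x. indicator {a + h<..<b + h} (x + h) * n2 (x + h)) = (%x. indicator {a<..<b} x * n2 (x + h))"
    by (auto simp: fun_eq_iff indicator_def)
   ultimately show ?thesis by (subst integrable_ivl) auto
  qed
  have "(\<integral>s. n2 (s + h) - n2 s \<partial>ivl a b) = (\<integral>s. n2 s \<partial>ivl (a + h) (b + h)) - (\<integral>s. n2 s \<partial>ivl a b)"
   using i n2_integrable[OF ab(1), of b] integral_ivl_shift[OF n2_meas, of a b h] by simp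
  then show ?thesis
   using integral_ivl_split[OF n2_integrable[of a b], of "a + h"] integral_ivl_split[OF n2_integrable[of "a + h" "b + h"], of b] ab h by simp
 qed
 have avg: "\<exists>d>0. \<forall>h. 0 < h \<and> h < d --> \<bar>(\<integral>s. n2 s \<partial>ivl t (t + h)) - h * (nu t)\<^sup>2\<bar> \<le> h * e" if "0 \<le> t" "0 < e" for t e
 proof -
  have "continuous_on {0..} (%s. (nu s)\<^sup>2)" by (intro continuous_intros nu_continuous)
  then have "((%s. (nu s)\<^sup>2) \<longlongrightarrow> (nu t)\<^sup>2) (at t within {0..})" using that by (simp add: continuous_on)
  from tendstoD[OF this that(2)] obtain d where d: "0 < d" "\<And>s. 0 \<le> s ==> s \<noteq> t ==> \<bar>s - t\<bar> < d ==> \<bar>(nu s)\<^sup>2 - (nu t)\<^sup>2\<bar> < e"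
   unfolding eventually_at dist_real_def by auto
  show ?thesis
  proof (intro exI[of _ d] conjI allI impI d(1))
   fix h assume h: "0 < h \<and> h < d"
   have "AE s in ivl t (t + h). \<bar>n2 s - (nu t)\<^sup>2\<bar> \<le> e"
    using AE_gtime'[OF that(1), of "t + h"] AE_ivl_mem[of t "t + h"]
   proof eventually_elim
    case (elim s)
    have "\<bar>s - t\<bar> < d" using elim h by (simp add: abs_if)
    then show ?case using d(2)[of s] elim that gtime_L2(2)[OF elim(1)] by auto
   qed
   from average_close[OF n2_integrable[OF that(1)] _ this] show "\<bar>(\<integral>s. n2 s \<partial>ivl t (t + h)) - h * (nu t)\<^sup>2\<bar> \<le> h * e" using h by simp
  qed
 qed
 \<comment> \<open>The factor collects 2 from the two ends, \<open>1 + 2 * q\<close> bounding the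
   norm of \<open>Gh h w + G w\<close>, and the norm \<open>p\<close> of the stress.\<close>
 have key: "\<bar>(nu b)\<^sup>2 - (nu a)\<^sup>2 + 2 * J\<bar> \<le> e * (3 + 2 * q + p)" if e: "0 < e" "e \<le> 1" for e
 proof -
  obtain d1 where d1: "0 < d1" "\<And>h. 0 < h ==> h < d1 ==> \<bar>(\<integral>s. n2 s \<partial>ivl b (b + h)) - h * (nu b)\<^sup>2\<bar> \<le> h * e"
   using avg[of b e] ab e by auto
  obtain d2 where d2: "0 < d2" "\<And>h. 0 < h ==> h < d2 ==> \<bar>(\<integral>s. n2 s \<partial>ivl a (a + h)) - h * (nu a)\<^sup>2\<bar> \<le> h * e"
   using avg[of a e] ab e by auto
  obtain d3 where d3: "0 < d3" "\<And>h. 0 < h ==> h < d3 ==> in_L2 lborel (%w. F h w - S w)"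
   "\<And>h. 0 < h ==> h < d3 ==> (\<integral>w. (F h w - S w)\<^sup>2 \<partial>lborel) \<le> e\<^sup>2"
   using steklov_L2(2)[OF SL, of "e\<^sup>2"] e unfolding F_def by fastforce
  have "\<forall>\<^sub>F k in at 0. dist (\<integral>w. (G (w + k) - G w)\<^sup>2 \<partial>lborel) 0 < e\<^sup>2"
   using translation_L2[OF GL] e by (intro tendstoD) auto
  then obtain d4 where d4: "0 < d4" "\<And>k. k \<noteq> 0 ==> dist k 0 < d4 ==> dist (\<integral>w. (G (w + k) - G w)\<^sup>2 \<partial>lborel) 0 < e\<^sup>2"
   unfolding eventually_at by auto
  define h where "h = min (min d1 d2) (min (min d3 d4) (min 1 (b - a))) / 2"
  have h: "0 < h" "h < d1" "h < d2" "h < d3" "h < d4" "h < 1" "h < b - a"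
   using d1(1) d2(1) d3(1) d4(1) ab by (auto simp: h_def)
  have FL: "in_L2 lborel (%w. F h w - S w)" using d3(2) h by simp
  have nF: "L2_norm lborel (%w. F h w - S w) \<le> e"
   unfolding L2_norm_def using d3(3)[of h] h e by (intro real_le_lsqrt) auto
  have DL: "in_L2 lborel (%w. Gh h w - G w)" by (rule in_L2_diff[OF GhL GL])
  have nG: "L2_norm lborel (%w. Gh h w - G w) \<le> e"
   unfolding L2_norm_def Gh_def using d4(2)[of "(0, h)"] h e
   by (intro real_le_lsqrt) (auto simp: zero_prod_def dist_norm norm_Pair)
  have GGL: "in_L2 lborel (%w. Gh h w + G w)" by (rule in_L2_add[OF GhL GL])
  have nGG: "L2_norm lborel (%w. Gh h w + G w) \<le> 1 + 2 * q"
  proof -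
   have "L2_norm lborel (%w. (Gh h w - G w) + 2 * G w) \<le> L2_norm lborel (%w. Gh h w - G w) + L2_norm lborel (%w. 2 * G w)"
    by (rule L2_norm_triangle[OF DL in_L2_cmult[OF GL]])
   moreover have "L2_norm lborel (%w. 2 * G w) = 2 * q"
    by (simp add: L2_norm_def q_def power_mult_distrib real_sqrt_mult)
   moreover have "(%w. (Gh h w - G w) + 2 * G w) = (%w. Gh h w + G w)" by auto
   ultimately show ?thesis using nG e by simp
  qed
  define B where "B = (\<integral>w. F h w * (Gh h w + G w) \<partial>slab a b)"
  have e1: "integrable (slab a b) (%w. (F h w - S w) * (Gh h w + G w))"
   "\<bar>\<integral>w. (F h w - S w) * (Gh h w + G w) \<partial>slab a b\<bar> \<le> L2_norm lborel (%w. F h w - S w) * L2_norm lborel (%w. Gh h w + G w)"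
   by (rule L2_integral_mult_bound[OF FL GGL]; simp)+
  have e2: "integrable (slab a b) (%w. S w * (Gh h w - G w))"
   "\<bar>\<integral>w. S w * (Gh h w - G w) \<partial>slab a b\<bar> \<le> L2_norm lborel S * L2_norm lborel (%w. Gh h w - G w)"
   by (rule L2_integral_mult_bound[OF SL DL]; simp)+
  have e3: "integrable (slab a b) (%w. S w * G w)"
   by (rule L2_integral_mult_bound(1)[OF SL GL]) auto
  have "B = (\<integral>w. (F h w - S w) * (Gh h w + G w) + S w * (Gh h w - G w) + 2 * (S w * G w) \<partial>slab a b)"
   unfolding B_def by (rule Bochner_Integration.integral_cong) (auto simp: algebra_simps)
  also have "\<dots> = (\<integral>w. (F h w - S w) * (Gh h w + G w) \<partial>slab a b) + (\<integral>w. S w * (Gh h w - G w) \<partial>slab a b) + 2 * J"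
   using e1(1) e2(1) e3 by (simp add: JS)
  finally have "\<bar>B - 2 * J\<bar> \<le> L2_norm lborel (%w. F h w - S w) * L2_norm lborel (%w. Gh h w + G w) + L2_norm lborel S * L2_norm lborel (%w. Gh h w - G w)"
   using e1(2) e2(2) by linarith
  also have "\<dots> \<le> e * (1 + 2 * q) + p * e"
   using nF nG nGG e pq0 unfolding p_def[symmetric] by (intro add_mono mult_mono) auto
  finally have B: "\<bar>B - 2 * J\<bar> \<le> e * (1 + 2 * q) + p * e" .
  have "(\<integral>s. n2 s \<partial>ivl b (b + h)) - (\<integral>s. n2 s \<partial>ivl a (a + h)) = - h * B"
   using step[OF h(1) h(6) FL] split[OF h(1) h(7)] by (simp add: B_def)
  then have "\<bar>- h * B - h * ((nu b)\<^sup>2 - (nu a)\<^sup>2)\<bar> \<le> 2 * (h * e)"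
   using d1(2)[of h] d2(2)[of h] h by (simp add: algebra_simps)
  also have "- h * B - h * ((nu b)\<^sup>2 - (nu a)\<^sup>2) = - h * (B + ((nu b)\<^sup>2 - (nu a)\<^sup>2))" by (simp add: algebra_simps)
  finally have "h * \<bar>B + ((nu b)\<^sup>2 - (nu a)\<^sup>2)\<bar> \<le> h * (2 * e)" using h by (simp add: abs_mult)
  then have "\<bar>B + ((nu b)\<^sup>2 - (nu a)\<^sup>2)\<bar> \<le> 2 * e" using h by simp
  with B show ?thesis by (simp add: algebra_simps)
 qed
 have "(nu b)\<^sup>2 - (nu a)\<^sup>2 + 2 * J = 0"
 proof (rule ccontr)
  define x where "x = \<bar>(nu b)\<^sup>2 - (nu a)\<^sup>2 + 2 * J\<bar>"
  define k where "k = 3 + 2 * q + p"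
  assume "(nu b)\<^sup>2 - (nu a)\<^sup>2 + 2 * J \<noteq> 0"
  then have x: "0 < x" by (simp add: x_def)
  have k: "0 < k" using pq0 by (simp add: k_def)
  have "x \<le> min 1 (x / (2 * k)) * k" unfolding x_def[symmetric] using key[of "min 1 (x / (2 * k))"] x k by (simp add: x_def k_def)
  also have "\<dots> \<le> x / (2 * k) * k" using k by (intro mult_right_mono) auto
  also have "\<dots> = x / 2" using k by simp
  finally show False using x by simp
 qed
 then show ?thesis by (simp add: J_def)
qed

end

section \<open>Energy balance and bounds on the volume uniform in time\<close>

text \<open>Singles out a time interval ending at \<open>t\<close> throughout which the volume stays
  beyond the threshold, so that the pressure can be estimated on all of it. Applied to
  \<open>\<tau> y\<close> for the lower and to its negative for the upper bound.\<close>

lemma last_exit: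
 fixes f :: "real => real"
 assumes f: "continuous_on {0..} f" and t: "0 \<le> t" and d: "d \<le> f 0"
 obtains s where "0 \<le> s" "s \<le> t" "d \<le> f s" "\<And>r. s < r ==> r \<le> t ==> f r < d"
proof -
 define S where "S = {r \<in> {0..t}. d \<le> f r}"
 have S: "S = {0..t} \<inter> f -` {d..}" by (auto simp: S_def)
 have "closed S" unfolding S
  by (rule continuous_closed_preimage) (use continuous_on_subset[OF f, of "{0..t}"] in auto)
 moreover have "{0..t} \<inter> S = S" by (auto simp: S_def)
 ultimately have "compact S" using compact_Int_closed[OF compact_Icc[of 0 t], of S] by simp
 moreover have "S \<noteq> {}" using t d by (auto simp: S_def)
 ultimately have "\<exists>s\<in>S. \<forall>r\<in>S. r \<le> s" by (rule compact_attains_sup)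
 then obtain s where s: "s \<in> S" "\<And>r. r \<in> S ==> r \<le> s" by auto
 show ?thesis
 proof (rule that[of s])
  fix r assume "s < r" "r \<le> t"
  then show "f r < d" using s(2)[of r] s(1) by (force simp: S_def)
 qed (use s in \<open>auto simp: S_def\<close>)
qed

text \<open>The converse of \<open>P_tau_le_W\<close>; it transfers boundedness from the pressure to
  the potential energy.\<close>

lemma (in exponents) W_le_P_tau:
 assumes \<theta>: "0 < \<theta>" "\<theta> < 1" and \<tau>: "0 < \<tau>"
 shows "W \<theta> \<tau> \<le> (1 / (gp - 1) + 1 / (gm - 1)) * (P \<theta> \<tau> * \<tau>)"
proof -
 define z where "z = Zst \<theta> \<tau>"
 have z: "0 < z" "vol \<theta> z = \<tau>" using Zst_props[OF \<theta> \<tau>] by (auto simp: z_def)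
 define A B where "A = \<theta> * z powr (gp - 1)" and "B = (1 - \<theta>) * z powr (gp - gr)"
 have AB: "0 \<le> A" "0 \<le> B" using \<theta> by (auto simp: A_def B_def)
 have "P \<theta> \<tau> * \<tau> = z powr gp * vol \<theta> z" using z by (simp add: P_def z_def)
 also have "\<dots> = A + B"
  using z(1) by (simp add: vol_def A_def B_def powr_diff powr_minus_divide field_simps)
 finally have AB': "P \<theta> \<tau> * \<tau> = A + B" .
 have "W \<theta> \<tau> = 1 / (gp - 1) * A + 1 / (gm - 1) * B" by (simp add: W_def A_def B_def z_def)
 also have "\<dots> \<le> 1 / (gp - 1) * (A + B) + 1 / (gm - 1) * (A + B)"
  using AB gp gm by (intro add_mono mult_left_mono) auto
 finally show ?thesis unfolding AB' by (simp add: distrib_right)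
qed

lemma (in exponents) P_tau_bound:
 assumes "0 < d" "d \<le> M"
 obtains K where "0 < K" "\<And>\<theta> \<tau>. 0 < \<theta> ==> \<theta> < 1 ==> d \<le> \<tau> ==> \<tau> \<le> M ==> P \<theta> \<tau> \<le> K \<and> P \<theta> \<tau> * \<tau> \<le> K \<and> W \<theta> \<tau> \<le> K"
proof -
 obtain K where K: "0 < K" "\<And>\<theta> \<tau>. 0 < \<theta> ==> \<theta> < 1 ==> d \<le> \<tau> ==> P \<theta> \<tau> \<le> K" using P_upper[OF assms(1)] by metis
 define C where "C = 1 / (gp - 1) + 1 / (gm - 1)"
 have C: "0 \<le> C" using gp gm by (simp add: C_def)
 have KM: "0 \<le> K * M" using K(1) assms by simp
 show ?thesis
 proof (rule that[of "K + K * M + C * (K * M)"])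
  show "0 < K + K * M + C * (K * M)" using K(1) KM C by (simp add: add_pos_nonneg)
  fix \<theta> \<tau> :: real assume a: "0 < \<theta>" "\<theta> < 1" "d \<le> \<tau>" "\<tau> \<le> M"
  have 1: "P \<theta> \<tau> \<le> K" using K a by simp
  have 2: "P \<theta> \<tau> * \<tau> \<le> K * M" using 1 a assms K(1) by (intro mult_mono) auto
  have "W \<theta> \<tau> \<le> C * (P \<theta> \<tau> * \<tau>)" using W_le_P_tau[of \<theta> \<tau>] a assms by (simp add: C_def)
  also have "\<dots> \<le> C * (K * M)" using 2 C by (rule mult_left_mono)
  finally have 3: "W \<theta> \<tau> \<le> C * (K * M)" .
  have "0 \<le> C * (K * M)" using C KM by simp
  then show "P \<theta> \<tau> \<le> K + K * M + C * (K * M) \<and> P \<theta> \<tau> * \<tau> \<le> K + K * M + C * (K * M) \<and> W \<theta> \<tau> \<le> K + K * M + C * (K * M)"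
   using 1 2 3 K(1) KM by linarith
 qed
qed

context flow
begin

lemma W\<tau>_meas [measurable]: "(%w. W (\<theta> (fst w)) (\<tau> (fst w) (snd w))) \<in> borel2"
 by measurable

lemma W\<tau>_slice [measurable]: "(%y. W (\<theta> y) (\<tau> y t)) \<in> borel1"
 by measurable

lemma P\<tau>_slice [measurable]: "(%y. P (\<theta> y) (\<tau> y t)) \<in> borel1"
 by measurable

lemma local_P_bounds:
 obtains K where "0 < K" "\<And>y r. good y ==> 0 \<le> r ==> r \<le> T ==>
  P (\<theta> y) (\<tau> y r) \<le> K \<and> P (\<theta> y) (\<tau> y r) * \<tau> y r \<le> K \<and> W (\<theta> y) (\<tau> y r) \<le> K"
proof -
 obtain d M where dM: "0 < d" "d \<le> M" "\<And>y t. good y ==> 0 \<le> t ==> t \<le> T ==> d \<le> \<tau> y t \<and> \<tau> y t \<le> M"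
  using local_bounds by metis
 obtain K where K: "0 < K" "\<And>\<theta> \<tau>. 0 < \<theta> ==> \<theta> < 1 ==> d \<le> \<tau> ==> \<tau> \<le> M ==> P \<theta> \<tau> \<le> K \<and> P \<theta> \<tau> * \<tau> \<le> K \<and> W \<theta> \<tau> \<le> K"
  using P_tau_bound[OF dM(1,2)] by metis
 show ?thesis
  by (rule that[OF K(1)], rule K(2)) (use dM(3) pre_goodD goodD(1) in blast)+
qed

lemma W\<tau>_integrable: "0 \<le> t ==> integrable (ivl 0 1) (%y. W (\<theta> y) (\<tau> y t))"
proof -
 assume t: "0 \<le> t"
 obtain K where K: "0 < K" "\<And>y r. good y ==> 0 \<le> r ==> r \<le> t ==>
  P (\<theta> y) (\<tau> y r) \<le> K \<and> P (\<theta> y) (\<tau> y r) * \<tau> y r \<le> K \<and> W (\<theta> y) (\<tau> y r) \<le> K" using local_P_bounds by metis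
 have "AE y in ivl 0 1. \<bar>W (\<theta> y) (\<tau> y t)\<bar> \<le> K" using AE_good
 proof eventually_elim
  case (elim y)
  then show ?case using K(2)[of y t] t W_nonneg[of "\<theta> y" "\<tau> y t"] pre_goodD(3,4)[OF goodD(1)[OF elim]] by auto
 qed
 then show ?thesis by (intro integrable_ivl_bounded[where B=K]) auto
qed

definition pot :: "real => real" where "pot t = (\<integral>y. W (\<theta> y) (\<tau> y t) \<partial>ivl 0 1)"

lemma pot_nonneg: "0 \<le> pot t"
 unfolding pot_def
proof (rule integral_nonneg_AE)
 show "AE y in ivl 0 1. 0 \<le> W (\<theta> y) (\<tau> y t)" using AE_good
 proof eventually_elim
  case (elim y)
  then show ?case using W_nonneg[of "\<theta> y" "\<tau> y t"] pre_goodD(3,4)[OF goodD(1)[OF elim]] by auto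
 qed
qed

lemma W_diff:
 assumes y: "good y" and st: "0 \<le> s" "s \<le> t"
 shows "W (\<theta> y) (\<tau> y t) - W (\<theta> y) (\<tau> y s) = - (\<integral>r. P (\<theta> y) (\<tau> y r) * g y r \<partial>ivl s t)"
proof -
 note pg = pre_goodD[OF goodD(1)[OF y]]
 have pos: "0 < x" if "x \<in> \<tau> y ` {s..t}" for x using that pg st by auto
 have *: "(W (\<theta> y) has_real_derivative - P (\<theta> y) x) (at x)" if "x \<in> \<tau> y ` {s..t}" for x
  by (rule DERIV_W[OF pg(3,4) pos[OF that]])
 have **: "continuous_on (\<tau> y ` {s..t}) (%x. - P (\<theta> y) x)"
  by (intro continuous_intros continuous_on_subset[OF continuous_on_P[OF pg(3,4)]]) (use pos in auto)
 have td: "\<tau> y r = \<tau> y s + (\<integral>r. g y r \<partial>ivl s r)" if "r \<in> {s..t}" for r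
  using \<tau>_diff[OF goodD(1)[OF y] st(1), of r] that by simp
 have m: "(%r. - P (\<theta> y) (\<tau> y r) * g y r) \<in> borel1" by measurable
 show ?thesis
  using indefinite_chain_rule(2)[OF pg(10)[OF st(1)] st(2) td * ** m] by simp
qed

lemma P\<tau>_L2: "0 \<le> s ==> in_L2 (slab s t) (%w. P (\<theta> (fst w)) (\<tau> (fst w) (snd w)))"
proof -
 assume s: "0 \<le> s"
 obtain K where K: "0 < K" "\<And>y r. good y ==> 0 \<le> r ==> r \<le> t ==>
  P (\<theta> y) (\<tau> y r) \<le> K \<and> P (\<theta> y) (\<tau> y r) * \<tau> y r \<le> K \<and> W (\<theta> y) (\<tau> y r) \<le> K" using local_P_bounds by metis
 show ?thesis
 proof (rule ivl2.in_L2_bounded[where C=K])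
  show "AE w in slab s t. \<bar>P (\<theta> (fst w)) (\<tau> (fst w) (snd w))\<bar> \<le> K"
  proof (rule AE_cyl)
   fix y r assume "good y" "s < r" "r < t"
   then show "\<bar>P (\<theta> y) (\<tau> y r)\<bar> \<le> K" using K(2)[of y r] s by simp
  qed
 qed simp
qed

lemma g_L2_joint: "0 \<le> s ==> in_L2 (slab s t) (%w. g (fst w) (snd w))"
 using g_L2'[of s t] by (simp add: case_prod_beta')

lemma g_joint: "(%w. g (fst w) (snd w)) \<in> borel2"
 using g_meas by (simp add: case_prod_beta')

lemma dissipation_integrable:
 assumes s: "0 \<le> s"
 shows "integrable (slab s t) (%w. (g (fst w) (snd w))\<^sup>2 / \<tau> (fst w) (snd w))"
proof -
 obtain d M where dM: "0 < d" "d \<le> M" "\<And>y r. good y ==> 0 \<le> r ==> r \<le> t ==> d \<le> \<tau> y r \<and> \<tau> y r \<le> M"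
  using local_bounds by metis
 have i: "integrable (slab s t) (%w. 1 / d * (g (fst w) (snd w))\<^sup>2)"
  using in_L2_integrable_sq[OF g_L2_joint[OF s, of t]] by simp
 show ?thesis
 proof (rule Bochner_Integration.integrable_bound[OF i])
  show "(%w. (g (fst w) (snd w))\<^sup>2 / \<tau> (fst w) (snd w)) \<in> borel_measurable (slab s t)"
   unfolding borel_measurable_ivl2 using g_joint \<tau>_joint by (intro borel_measurable_divide borel_measurable_power)
  show "AE w in slab s t. norm ((g (fst w) (snd w))\<^sup>2 / \<tau> (fst w) (snd w)) \<le> norm (1 / d * (g (fst w) (snd w))\<^sup>2)"
  proof (rule AE_cyl)
   fix y r assume a: "good y" "s < r" "r < t"
   then have "d \<le> \<tau> y r" using dM(3)[of y r] s by simp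
   then have "(g y r)\<^sup>2 / \<tau> y r \<le> (g y r)\<^sup>2 / d" using dM(1) by (intro divide_left_mono) auto
   then show "norm ((g y r)\<^sup>2 / \<tau> y r) \<le> norm (1 / d * (g y r)\<^sup>2)"
    using dM(1) \<open>d \<le> \<tau> y r\<close> by simp
  qed
 qed
qed

text \<open>The pressure part of the stress does reversible work: along each \<open>y\<close> it is
  the increment of \<open>W\<close>, by \<open>W_diff\<close>. Only the viscous part
  dissipates.\<close>

lemma energy_balance:
 assumes st: "0 \<le> s" "s < t"
 shows "(nu t)\<^sup>2 / 2 + pot t = (nu s)\<^sup>2 / 2 + pot s
  - \<mu> * (\<integral>w. (g (fst w) (snd w))\<^sup>2 / \<tau> (fst w) (snd w) \<partial>slab s t)"
proof -
 have t: "0 \<le> t" using st by simp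
 define D where "D = (\<integral>w. (g (fst w) (snd w))\<^sup>2 / \<tau> (fst w) (snd w) \<partial>slab s t)"
 have Pg: "integrable (slab s t) (%w. P (\<theta> (fst w)) (\<tau> (fst w) (snd w)) * g (fst w) (snd w))"
  by (rule in_L2_mult_integrable[OF P\<tau>_L2[OF st(1)] g_L2_joint[OF st(1)]])
 have "(\<integral>w. \<sigma> (fst w) (snd w) * g (fst w) (snd w) \<partial>slab s t)
  = (\<integral>w. \<mu> * ((g (fst w) (snd w))\<^sup>2 / \<tau> (fst w) (snd w)) - P (\<theta> (fst w)) (\<tau> (fst w) (snd w)) * g (fst w) (snd w) \<partial>slab s t)"
  by (rule Bochner_Integration.integral_cong) (auto simp: \<sigma>_def power2_eq_square left_diff_distrib)
 also have "\<dots> = \<mu> * D - (\<integral>w. P (\<theta> (fst w)) (\<tau> (fst w) (snd w)) * g (fst w) (snd w) \<partial>slab s t)"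
  using dissipation_integrable[OF st(1), of t] Pg by (simp add: D_def del: times_divide_eq_right)
 also have "(\<integral>w. P (\<theta> (fst w)) (\<tau> (fst w) (snd w)) * g (fst w) (snd w) \<partial>slab s t)
  = (\<integral>y. \<integral>r. P (\<theta> y) (\<tau> y r) * g y r \<partial>ivl s t \<partial>ivl 0 1)"
  using ivl2.integral_fst'[OF Pg] by simp
 also have "\<dots> = (\<integral>y. W (\<theta> y) (\<tau> y s) - W (\<theta> y) (\<tau> y t) \<partial>ivl 0 1)"
 proof (rule integral_cong_AE)
  show "AE y in ivl 0 1. (\<integral>r. P (\<theta> y) (\<tau> y r) * g y r \<partial>ivl s t) = W (\<theta> y) (\<tau> y s) - W (\<theta> y) (\<tau> y t)"
   using AE_good
  proof eventually_elim
   case (elim y) then show ?case using W_diff[OF elim st(1), of t] st by simp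
  qed
  show "(%y. \<integral>r. P (\<theta> y) (\<tau> y r) * g y r \<partial>ivl s t) \<in> borel_measurable (ivl 0 1)"
   using borel_measurable_integrable[OF ivl2.integrable_fst'[OF Pg]] by simp
 qed simp
 also have "\<dots> = pot s - pot t" unfolding pot_def using W\<tau>_integrable[OF st(1)] W\<tau>_integrable[OF t] by simp
 finally show ?thesis using energy_identity[OF st] by (simp add: D_def field_simps)
qed

definition E0 :: real where "E0 = (nu 0)\<^sup>2 / 2 + pot 0"
definition V :: real where "V = (\<integral>y. \<tau>0 y \<partial>ivl 0 1)"

lemma E0_nonneg: "0 \<le> E0" using pot_nonneg[of 0] by (simp add: E0_def)

lemma energy_bound:
 assumes t: "0 \<le> t"
 shows "(nu t)\<^sup>2 / 2 + pot t \<le> E0"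
proof (cases "t = 0")
 case False
 have "0 \<le> (\<integral>w. (g (fst w) (snd w))\<^sup>2 / \<tau> (fst w) (snd w) \<partial>cyl t)"
 proof (rule integral_nonneg_AE, rule AE_cyl)
  fix y r assume "good y" "0 < r" "r < t"
  then have "0 < \<tau> y r" using pre_goodD(9)[OF goodD(1), of y r] by simp
  then show "0 \<le> (g y r)\<^sup>2 / \<tau> y r" by simp
 qed
 then show ?thesis using energy_balance[of 0 t] False t mu by (simp add: E0_def)
qed (simp add: E0_def)

lemma nu_uniform: "0 \<le> t ==> nu t \<le> sqrt (2 * E0)"
 using energy_bound[of t] pot_nonneg[of t] by (intro real_le_rsqrt) auto

lemma pot_uniform: "0 \<le> t ==> pot t \<le> E0"
 using energy_bound[of t] zero_le_power2[of "nu t"] by linarith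

lemma n2_uniform: "gtime t ==> n2 t \<le> 2 * E0"
 using energy_bound[of t] pot_nonneg[of t] gtime_L2(2)[of t] by (auto simp: gtime_def)

lemma V_pos: "0 < V"
proof -
 have "integrable (ivl 0 1) \<tau>0" using \<tau>_integrable[of 0] by (simp add: \<tau>_eq)
 then have "(\<integral>y. \<tau>lo \<partial>ivl 0 1) \<le> V"
  unfolding V_def using \<tau>0_bounds by (intro integral_mono_AE) (auto elim: eventually_mono)
 then show ?thesis using \<tau>0_const by (simp add: measure_ivl)
qed

lemma P\<tau>\<tau>_integrable:
 assumes "0 \<le> s"
 shows "integrable (slab s t) (%w. P (\<theta> (fst w)) (\<tau> (fst w) (snd w)) * \<tau> (fst w) (snd w))"
proof -
 obtain K where K: "0 < K" "\<And>y r. good y ==> 0 \<le> r ==> r \<le> t ==>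
  P (\<theta> y) (\<tau> y r) \<le> K \<and> P (\<theta> y) (\<tau> y r) * \<tau> y r \<le> K \<and> W (\<theta> y) (\<tau> y r) \<le> K" using local_P_bounds by metis
 show ?thesis
 proof (rule ivl2.integrable_const_bound[where B=K])
  show "AE w in slab s t. norm (P (\<theta> (fst w)) (\<tau> (fst w) (snd w)) * \<tau> (fst w) (snd w)) \<le> K"
  proof (rule AE_cyl)
   fix y r assume "good y" "s < r" "r < t"
   then show "norm (P (\<theta> y) (\<tau> y r) * \<tau> y r) \<le> K"
    using K(2)[of y r] assms pre_goodD(9)[OF goodD(1), of y r] by (simp add: abs_mult)
  qed
  show "(%w. P (\<theta> (fst w)) (\<tau> (fst w) (snd w)) * \<tau> (fst w) (snd w)) \<in> borel_measurable (slab s t)"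
   unfolding borel_measurable_ivl2 using P\<tau>_meas \<tau>_joint by (rule borel_measurable_times)
 qed
qed

text \<open>By \<open>c_diff\<close> below, the main contribution to the rate at which
  \<open>c\<close> falls.\<close>

definition pm :: "real => real" where "pm r = (\<integral>y. P (\<theta> y) (\<tau> y r) * \<tau> y r \<partial>ivl 0 1)"

lemma pm_integrable:
 assumes "0 \<le> s"
 shows "integrable (ivl s t) pm"
  and "(\<integral>w. P (\<theta> (fst w)) (\<tau> (fst w) (snd w)) * \<tau> (fst w) (snd w) \<partial>slab s t) = (\<integral>r. pm r \<partial>ivl s t)"
proof -
 have i: "integrable (slab s t) (%(y, r). P (\<theta> y) (\<tau> y r) * \<tau> y r)"
  using P\<tau>\<tau>_integrable[OF assms] by (simp add: case_prod_beta')
 show "integrable (ivl s t) pm" unfolding pm_def by (rule ivl2.integrable_snd[OF i])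
 show "(\<integral>w. P (\<theta> (fst w)) (\<tau> (fst w) (snd w)) * \<tau> (fst w) (snd w) \<partial>slab s t) = (\<integral>r. pm r \<partial>ivl s t)"
  unfolding pm_def using ivl2.integral_snd[OF i] by (simp add: case_prod_beta')
qed

lemma pm_slice_integrable:
 assumes "0 \<le> r"
 shows "integrable (ivl 0 1) (%y. P (\<theta> y) (\<tau> y r) * \<tau> y r)"
proof -
 obtain K where K: "0 < K" "\<And>y t. good y ==> 0 \<le> t ==> t \<le> r ==>
  P (\<theta> y) (\<tau> y t) \<le> K \<and> P (\<theta> y) (\<tau> y t) * \<tau> y t \<le> K \<and> W (\<theta> y) (\<tau> y t) \<le> K" using local_P_bounds by metis
 have "AE y in ivl 0 1. \<bar>P (\<theta> y) (\<tau> y r) * \<tau> y r\<bar> \<le> K" using AE_good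
 proof eventually_elim
  case (elim y)
  then show ?case using K(2)[of y r] assms pre_goodD(9)[OF goodD(1), of y r] by (simp add: abs_mult)
 qed
 then show ?thesis by (intro integrable_ivl_bounded[where B=K]) auto
qed

lemma pm_upper: "0 \<le> r ==> pm r \<le> max gp gm * E0"
proof -
 assume r: "0 \<le> r"
 have "pm r \<le> (\<integral>y. max gp gm * W (\<theta> y) (\<tau> y r) \<partial>ivl 0 1)"
  unfolding pm_def
 proof (rule integral_mono_AE[OF pm_slice_integrable[OF r]])
  show "integrable (ivl 0 1) (%y. max gp gm * W (\<theta> y) (\<tau> y r))" using W\<tau>_integrable[OF r] by simp
  show "AE y in ivl 0 1. P (\<theta> y) (\<tau> y r) * \<tau> y r \<le> max gp gm * W (\<theta> y) (\<tau> y r)" using AE_good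
  proof eventually_elim
   case (elim y)
   note pg = pre_goodD[OF goodD(1)[OF elim]]
   show ?case by (rule P_tau_le_W[OF pg(3,4) pg(9)[OF r]])
  qed
 qed
 also have "\<dots> = max gp gm * pot r" by (simp add: pot_def)
 also have "\<dots> \<le> max gp gm * E0" using pot_uniform[OF r] gp by (intro mult_left_mono) auto
 finally show ?thesis .
qed

lemma g_cyl_zero:
 assumes s: "0 \<le> s"
 shows "(\<integral>w. g (fst w) (snd w) \<partial>slab s t) = 0"
proof -
 have "(\<integral>w. g (fst w) (snd w) \<partial>slab s t) = (\<integral>r. \<integral>y. g y r \<partial>ivl 0 1 \<partial>ivl s t)"
  using ivl2.integral_snd[OF g_integrable[OF s, of t]] by (simp add: case_prod_beta')
 also have "\<dots> = (\<integral>r. 0 \<partial>ivl s t)"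
  by (rule integral_cong_AE) (use AE_gtime'[OF s, of t] in \<open>auto simp: gtime_def elim: eventually_mono\<close>)
 finally show ?thesis by simp
qed

text \<open>\<open>cross_identity\<close> with weight 0. Multiplication by \<open>\<tau>\<close>
  removes the denominator of the viscous term, leaving \<open>\<mu> * g\<close>, which has zero
  mean. This determines the drift of the otherwise unknown \<open>c\<close> up to bounded
  terms.\<close>

lemma c_diff:
 assumes st: "0 \<le> s" "s \<le> t"
 shows "(c t - c s) * V = - ((\<integral>y. I y t * \<tau> y t \<partial>ivl 0 1) - (\<integral>y. I y s * \<tau> y s \<partial>ivl 0 1))
  - (\<integral>r. pm r \<partial>ivl s t) - (\<integral>r. n2 r \<partial>ivl s t)"
proof -
 have "(\<integral>w. \<tau> (fst w) (snd w) * \<sigma> (fst w) (snd w) \<partial>slab s t)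
  = (\<integral>w. \<mu> * g (fst w) (snd w) - P (\<theta> (fst w)) (\<tau> (fst w) (snd w)) * \<tau> (fst w) (snd w) \<partial>slab s t)"
 proof (rule integral_cong_AE)
  show "AE w in slab s t. \<tau> (fst w) (snd w) * \<sigma> (fst w) (snd w)
   = \<mu> * g (fst w) (snd w) - P (\<theta> (fst w)) (\<tau> (fst w) (snd w)) * \<tau> (fst w) (snd w)"
  proof (rule AE_cyl)
   fix y r assume "good y" "s < r" "r < t"
   then have "0 < \<tau> y r" using pre_goodD(9)[OF goodD(1), of y r] st by simp
   then show "\<tau> y r * \<sigma> y r = \<mu> * g y r - P (\<theta> y) (\<tau> y r) * \<tau> y r" by (simp add: \<sigma>_def field_simps)
  qed
  show "(%w. \<tau> (fst w) (snd w) * \<sigma> (fst w) (snd w)) \<in> borel_measurable (slab s t)"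
   unfolding borel_measurable_ivl2 using \<tau>_joint \<sigma>_joint by (rule borel_measurable_times)
  show "(%w. \<mu> * g (fst w) (snd w) - P (\<theta> (fst w)) (\<tau> (fst w) (snd w)) * \<tau> (fst w) (snd w)) \<in> borel_measurable (slab s t)"
   unfolding borel_measurable_ivl2 using \<tau>_joint g_joint P\<tau>_meas
   by (intro borel_measurable_diff borel_measurable_times borel_measurable_const)
 qed
 also have "\<dots> = - (\<integral>r. pm r \<partial>ivl s t)"
  using ivl2.in_L2_integrable[OF g_L2_joint[OF st(1), of t]] P\<tau>\<tau>_integrable[OF st(1), of t] g_cyl_zero[OF st(1), of t]
   pm_integrable(2)[OF st(1), of t] by simp
 finally have K: "(\<integral>w. \<tau> (fst w) (snd w) * \<sigma> (fst w) (snd w) \<partial>slab s t) = - (\<integral>r. pm r \<partial>ivl s t)" .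
 show ?thesis using cross_identity[of "%_. 0" 0, OF _ _ st] K by (simp add: V_def)
qed

lemma X_bound:
 assumes t: "0 \<le> t"
 shows "\<bar>\<integral>y. I y t * \<tau> y t \<partial>ivl 0 1\<bar> \<le> sqrt (2 * E0) * V"
proof -
 have "\<bar>\<integral>y. I y t * \<tau> y t \<partial>ivl 0 1\<bar> \<le> (\<integral>y. \<bar>I y t * \<tau> y t\<bar> \<partial>ivl 0 1)" by (rule integral_abs_bound)
 also have "\<dots> \<le> (\<integral>y. sqrt (2 * E0) * \<tau> y t \<partial>ivl 0 1)"
 proof (rule integral_mono_AE')
  show "integrable (ivl 0 1) (%y. sqrt (2 * E0) * \<tau> y t)" using \<tau>_integrable[OF t] by simp
  show "AE y in ivl 0 1. \<bar>I y t * \<tau> y t\<bar> \<le> sqrt (2 * E0) * \<tau> y t" using AE_good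
  proof eventually_elim
   case (elim y)
   note pg = pre_goodD[OF goodD(1)[OF elim]]
   have "\<bar>I y t\<bar> \<le> sqrt (2 * E0)" using I_bound[OF t, of y] nu_uniform[OF t] pg(1,2) by simp
   then show ?case using pg(9)[OF t] by (simp add: abs_mult)
  qed
  show "AE y in ivl 0 1. 0 \<le> sqrt (2 * E0) * \<tau> y t" using AE_good
  proof eventually_elim
   case (elim y) then show ?case using pre_goodD(9)[OF goodD(1)[OF elim] t] E0_nonneg by simp
  qed
 qed
 also have "\<dots> = sqrt (2 * E0) * V" using volume_conserved[OF t] by (simp add: V_def)
 finally show ?thesis .
qed

lemma ln_\<tau>_diff:
 assumes y: "good y" and st: "0 \<le> s" "s \<le> t"
 shows "\<mu> * ln (\<tau> y t) - \<mu> * ln (\<tau> y s) = (\<integral>r. P (\<theta> y) (\<tau> y r) \<partial>ivl s t) + (c t - c s) + (I y t - I y s)"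
proof -
 note pg = pre_goodD[OF goodD(1)[OF y]]
 have "\<mu> * ln (\<tau> y t) - \<mu> * ln (\<tau> y s) = (SG y t - SG y s) + (\<integral>r. P (\<theta> y) (\<tau> y r) \<partial>ivl s t)"
  unfolding SG_def using integral_ivl_split[OF P\<tau>_integrable[OF goodD(1)[OF y], of 0 t], of s] st pg(6) pg(9)[of s] pg(9)[of t]
  by (simp add: ln_div algebra_simps)
 then show ?thesis using goodD(2)[OF y, of t] goodD(2)[OF y, of s] st by simp
qed

lemma I_uniform: "0 \<le> t ==> 0 \<le> y ==> y \<le> 1 ==> \<bar>I y t\<bar> \<le> sqrt (2 * E0)"
 using I_bound[of t y] nu_uniform[of t] by simp

lemma const_integral_bounds:
 assumes "integrable (ivl s t) f" "s \<le> t"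
 shows "(\<And>r. s < r ==> r < t ==> f r \<le> b) ==> (\<integral>r. f r \<partial>ivl s t) \<le> b * (t - s)"
  and "(\<And>r. s < r ==> r < t ==> b \<le> f r) ==> b * (t - s) \<le> (\<integral>r. f r \<partial>ivl s t)"
proof -
 assume "\<And>r. s < r ==> r < t ==> f r \<le> b"
 then have "(\<integral>r. f r \<partial>ivl s t) \<le> (\<integral>r. b \<partial>ivl s t)" using assms by (intro integral_mono_AE) (auto intro: AE_ivl_I)
 then show "(\<integral>r. f r \<partial>ivl s t) \<le> b * (t - s)" using assms by (simp add: measure_ivl mult.commute)
next
 assume "\<And>r. s < r ==> r < t ==> b \<le> f r"
 then have "(\<integral>r. b \<partial>ivl s t) \<le> (\<integral>r. f r \<partial>ivl s t)" using assms by (intro integral_mono_AE) (auto intro: AE_ivl_I)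
 then show "b * (t - s) \<le> (\<integral>r. f r \<partial>ivl s t)" using assms by (simp add: measure_ivl mult.commute)
qed

lemma n2_integral_bounds:
 assumes "0 \<le> s" "s \<le> t"
 shows "0 \<le> (\<integral>r. n2 r \<partial>ivl s t)" "(\<integral>r. n2 r \<partial>ivl s t) \<le> 2 * E0 * (t - s)"
proof -
 show "0 \<le> (\<integral>r. n2 r \<partial>ivl s t)"
  by (rule integral_nonneg_AE) (use AE_gtime'[OF assms(1), of t] gtime_L2(3) in \<open>auto elim: eventually_mono\<close>)
 have "(\<integral>r. n2 r \<partial>ivl s t) \<le> (\<integral>r. 2 * E0 \<partial>ivl s t)"
  by (rule integral_mono_AE[OF n2_integrable[OF assms(1)]])
   (use AE_gtime'[OF assms(1), of t] n2_uniform in \<open>auto elim: eventually_mono\<close>)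
 then show "(\<integral>r. n2 r \<partial>ivl s t) \<le> 2 * E0 * (t - s)" using assms by (simp add: measure_ivl algebra_simps)
qed

text \<open>Since the last time at which the volume reached the threshold, the pressure has been at
  least as large as the fastest possible fall of \<open>c\<close>. The linear terms in
  \<open>t - s\<close> therefore cancel in the favourable direction and the logarithm has lost only
  a bounded amount.\<close>

lemma uniform_lower:
 obtains d where "0 < d" "\<And>y t. good y ==> 0 \<le> t ==> d \<le> \<tau> y t"
proof -
 define U where "U = sqrt (2 * E0)"
 \<comment> \<open>The bounds of \<open>pm\<close> and \<open>n2\<close> by the energy, divided by
   the total volume: by \<open>c_diff\<close> the function \<open>c\<close> cannot fall faster than
   this, up to bounded terms.\<close>
 define B where "B = (max gp gm * E0 + 2 * E0) / V"
 obtain d1 where d1: "0 < d1" "\<And>\<theta> \<tau>. \<theta>lo \<le> \<theta> ==> \<theta> < 1 ==> 0 < \<tau> ==> \<tau> \<le> d1 ==> B \<le> P \<theta> \<tau>"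
  using P_large[OF \<theta>_const(1), of B] by metis
 define d where "d = min d1 \<tau>lo"
 have d: "0 < d" using d1 \<tau>0_const by (simp add: d_def)
 show ?thesis
 \<comment> \<open>Of \<open>4 * U\<close>, one half stems from the pairing of \<open>I\<close> with
   \<open>\<tau>\<close> at the two times in \<open>c_diff\<close>, the other from \<open>I\<close>
   itself at the two times.\<close>
 proof (rule that[of "d * exp (- (4 * U) / \<mu>)"])
  show "0 < d * exp (- (4 * U) / \<mu>)" using d by simp
  fix y t :: real assume y: "good y" and t: "0 \<le> t"
  note pg = pre_goodD[OF goodD(1)[OF y]]
  have "d \<le> \<tau> y 0" using pg(7) by (simp add: d_def \<tau>_eq)
  then obtain s where s: "0 \<le> s" "s \<le> t" "d \<le> \<tau> y s" "\<And>r. s < r ==> r \<le> t ==> \<tau> y r < d"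
   using last_exit[OF \<tau>_continuous[OF goodD(1)[OF y]] t] by metis
  have cV: "(c t - c s) * V \<ge> - (2 * U * V) - (max gp gm * E0 + 2 * E0) * (t - s)"
   using c_diff[OF s(1,2)] X_bound[OF t] X_bound[OF s(1)] n2_integral_bounds(2)[OF s(1,2)]
    const_integral_bounds(1)[OF pm_integrable(1)[OF s(1)] s(2), of "max gp gm * E0"] pm_upper s(1)
   by (simp add: U_def abs_le_iff distrib_right)
  have "c t - c s \<ge> - (2 * U) - B * (t - s)"
  proof -
   have "(- (2 * U) - B * (t - s)) * V = - (2 * U * V) - (max gp gm * E0 + 2 * E0) * (t - s)"
    using V_pos by (simp add: B_def field_simps)
   then have "(- (2 * U) - B * (t - s)) * V \<le> (c t - c s) * V" using cV by simp
   then show ?thesis using V_pos by simp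
  qed
  moreover have "B * (t - s) \<le> (\<integral>r. P (\<theta> y) (\<tau> y r) \<partial>ivl s t)"
  proof (rule const_integral_bounds(2)[OF P\<tau>_integrable[OF goodD(1)[OF y] s(1)] s(2)])
   fix r assume "s < r" "r < t"
   then show "B \<le> P (\<theta> y) (\<tau> y r)" using s(4)[of r] d1(2)[of "\<theta> y" "\<tau> y r"] pg(4,5) pg(9)[of r] s(1) by (simp add: d_def)
  qed
  moreover have "\<bar>I y t\<bar> \<le> U" "\<bar>I y s\<bar> \<le> U" using I_uniform[OF t, of y] I_uniform[OF s(1), of y] pg(1,2) by (auto simp: U_def)
  ultimately have "\<mu> * ln (\<tau> y t) - \<mu> * ln (\<tau> y s) \<ge> - (4 * U)"
   using ln_\<tau>_diff[OF y s(1,2)] by (simp add: abs_le_iff)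
  moreover have "\<mu> * (ln (\<tau> y s) + - (4 * U) / \<mu>) = \<mu> * ln (\<tau> y s) - 4 * U" using mu by (simp add: field_simps)
  ultimately have "\<mu> * (ln (\<tau> y s) + - (4 * U) / \<mu>) \<le> \<mu> * ln (\<tau> y t)" by linarith
  then have "ln (\<tau> y s) + - (4 * U) / \<mu> \<le> ln (\<tau> y t)" using mu by simp
  moreover have "ln d \<le> ln (\<tau> y s)" using s(3) d by simp
  ultimately have "ln (d * exp (- (4 * U) / \<mu>)) \<le> ln (\<tau> y t)" using d by (simp add: ln_mult)
  then show "d * exp (- (4 * U) / \<mu>) \<le> \<tau> y t" using pg(9)[OF t] d by simp
 qed
qed

text \<open>For the upper bound the roles are reversed: \<open>c\<close> must fall at least at a
  fixed positive rate, and a large volume makes the pressure smaller than this rate. The positive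
  rate relies on the lower bound for the volume just proved.\<close>

lemma uniform_bounds:
 obtains d M where "0 < d" "d \<le> M" "\<And>y t. good y ==> 0 \<le> t ==> d \<le> \<tau> y t \<and> \<tau> y t \<le> M"
proof -
 obtain d where d: "0 < d" "\<And>y t. good y ==> 0 \<le> t ==> d \<le> \<tau> y t" using uniform_lower by metis
 define U where "U = sqrt (2 * E0)"
 obtain k where k: "0 < k" "\<And>\<theta> \<tau>. \<theta>lo \<le> \<theta> ==> \<theta> < 1 ==> 0 < \<tau> ==> \<tau> \<le> 2 * V ==> k \<le> P \<theta> \<tau>"
  using P_lower[OF \<theta>_const(1), of "2 * V"] V_pos by auto
 define a where "a = d * k"
 have a: "0 < a" using d k by (simp add: a_def)
 \<comment> \<open>A linear minorant in the manner of Chebyshev: where the volume is at most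
   \<open>2 * V\<close> the integrand is at least \<open>a\<close>, elsewhere the line is at most 0.
   The volume has mean \<open>V\<close>, so the line has integral \<open>a / 2\<close>.\<close>
 have pm_lower: "a / 2 \<le> pm r" if r: "0 \<le> r" for r
 proof -
  have "(\<integral>y. a - a / (2 * V) * \<tau> y r \<partial>ivl 0 1) \<le> pm r"
   unfolding pm_def
  proof (rule integral_mono_AE[OF _ pm_slice_integrable[OF r]])
   show "integrable (ivl 0 1) (%y. a - a / (2 * V) * \<tau> y r)" using \<tau>_integrable[OF r] by auto
   show "AE y in ivl 0 1. a - a / (2 * V) * \<tau> y r \<le> P (\<theta> y) (\<tau> y r) * \<tau> y r" using AE_good
   proof eventually_elim
    case (elim y)
    note pg = pre_goodD[OF goodD(1)[OF elim]]
    show ?case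
    proof (cases "\<tau> y r \<le> 2 * V")
     case True
     have "k * d \<le> P (\<theta> y) (\<tau> y r) * \<tau> y r"
      using k(1) k(2)[OF pg(5,4) pg(9)[OF r] True] d(1) d(2)[OF elim r] by (intro mult_mono) auto
     moreover have "0 \<le> a / (2 * V) * \<tau> y r" using a V_pos pg(9)[OF r] by simp
     ultimately show ?thesis by (simp add: a_def mult.commute)
    next
     case False
     then have "a / (2 * V) * (2 * V) \<le> a / (2 * V) * \<tau> y r" using a V_pos by (intro mult_left_mono) auto
     moreover have "a / (2 * V) * (2 * V) = a" using V_pos by simp
     moreover have "0 \<le> P (\<theta> y) (\<tau> y r) * \<tau> y r" using pg(9)[OF r] by simp
     ultimately show ?thesis by linarith
    qed
   qed
  qed
  moreover have "(\<integral>y. a - a / (2 * V) * \<tau> y r \<partial>ivl 0 1) = a / 2"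
   using \<tau>_integrable[OF r] volume_conserved[OF r] V_pos by (simp add: V_def[symmetric] measure_ivl)
  ultimately show ?thesis by simp
 qed
 \<comment> \<open>The guaranteed rate of fall of \<open>c\<close>: the lower bound
   \<open>a / 2\<close> of \<open>pm\<close> divided by the total volume.\<close>
 define B where "B = a / (2 * V)"
 have B: "0 < B" using a V_pos by (simp add: B_def)
 obtain M1 where M1: "0 < M1" "\<And>\<theta> \<tau>. 0 < \<theta> ==> \<theta> < 1 ==> M1 \<le> \<tau> ==> P \<theta> \<tau> \<le> B"
  using P_small[OF B] by metis
 define M where "M = max M1 \<tau>hi"
 have M: "0 < M" using M1 by (simp add: M_def less_max_iff_disj)
 have upper: "\<tau> y t \<le> M * exp (4 * U / \<mu>)" if y: "good y" and t: "0 \<le> t" for y t :: real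
 proof -
  note pg = pre_goodD[OF goodD(1)[OF y]]
  have "- M \<le> - \<tau> y 0" using pg(8) by (simp add: M_def \<tau>_eq)
  then obtain s where s: "0 \<le> s" "s \<le> t" "- M \<le> - \<tau> y s" "\<And>r. s < r ==> r \<le> t ==> - \<tau> y r < - M"
   using last_exit[OF continuous_on_minus[OF \<tau>_continuous[OF goodD(1)[OF y]]] t] by metis
  have cV: "(c t - c s) * V \<le> 2 * U * V - a / 2 * (t - s)"
   using c_diff[OF s(1,2)] X_bound[OF t] X_bound[OF s(1)] n2_integral_bounds(1)[OF s(1,2)]
    const_integral_bounds(2)[OF pm_integrable(1)[OF s(1)] s(2), of "a / 2"] pm_lower s(1)
   by (simp add: U_def abs_le_iff)
  have "c t - c s \<le> 2 * U - B * (t - s)"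
  proof -
   have "(2 * U - B * (t - s)) * V = 2 * U * V - a / 2 * (t - s)"
    using V_pos by (simp add: B_def field_simps)
   then have "(c t - c s) * V \<le> (2 * U - B * (t - s)) * V" using cV by simp
   then show ?thesis using V_pos by simp
  qed
  moreover have "(\<integral>r. P (\<theta> y) (\<tau> y r) \<partial>ivl s t) \<le> B * (t - s)"
  proof (rule const_integral_bounds(1)[OF P\<tau>_integrable[OF goodD(1)[OF y] s(1)] s(2)])
   fix r assume "s < r" "r < t"
   then show "P (\<theta> y) (\<tau> y r) \<le> B" using s(4)[of r] M1(2)[OF pg(3,4), of "\<tau> y r"] by (simp add: M_def)
  qed
  moreover have "\<bar>I y t\<bar> \<le> U" "\<bar>I y s\<bar> \<le> U" using I_uniform[OF t, of y] I_uniform[OF s(1), of y] pg(1,2) by (auto simp: U_def)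
  ultimately have "\<mu> * ln (\<tau> y t) - \<mu> * ln (\<tau> y s) \<le> 4 * U"
   using ln_\<tau>_diff[OF y s(1,2)] by (simp add: abs_le_iff)
  then have "\<mu> * ln (\<tau> y t) \<le> \<mu> * (ln (\<tau> y s) + 4 * U / \<mu>)" using mu by (simp add: distrib_left)
  then have "ln (\<tau> y t) \<le> ln (\<tau> y s) + 4 * U / \<mu>" using mu by simp
  moreover have "ln (\<tau> y s) \<le> ln M" using s(3) pg(9)[OF s(1)] M by simp
  ultimately have "ln (\<tau> y t) \<le> ln (M * exp (4 * U / \<mu>))" using M by (simp add: ln_mult)
  then show "\<tau> y t \<le> M * exp (4 * U / \<mu>)" using pg(9)[OF t] M by simp
 qed
 show ?thesis
  by (rule that[of d "max d (M * exp (4 * U / \<mu>))"]) (use d upper in \<open>auto simp: less_max_iff_disj intro: max.coboundedI2\<close>)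
qed

end

section \<open>Exponential decay of the modified energy\<close>

text \<open>A discrete Gronwall argument: each unit of time gains a factor
  \<open>1 / (1 + \<kappa>)\<close>, and the incomplete last unit costs one factor
  \<open>1 + \<kappa>\<close>. Only differences of \<open>F\<close> enter, which suits the
  integrated form of the dissipation.\<close>

lemma exponential_decay_of_integral_inequality:
 fixes F :: "real => real"
 assumes \<kappa>: "0 < \<kappa>" and F0: "\<And>t. 0 \<le> t ==> 0 \<le> F t"
  and dec: "\<And>s t. 0 \<le> s ==> s < t ==> F t * (1 + \<kappa> * (t - s)) \<le> F s"
  and t: "0 \<le> t"
 shows "F t \<le> (1 + \<kappa>) * F 0 * exp (- ln (1 + \<kappa>) * t)"
proof -
 have mono: "F t \<le> F s" if "0 \<le> s" "s \<le> t" for s t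
 proof (cases "s = t")
  case False
  have "F t * 1 \<le> F t * (1 + \<kappa> * (t - s))" using F0[of t] that \<kappa> by (intro mult_left_mono) auto
  then show ?thesis using dec[of s t] that False by simp
 qed simp
 have step: "F (real n) * (1 + \<kappa>) ^ n \<le> F 0" for n
 proof (induction n)
  case (Suc n)
  have "F (real (Suc n)) * (1 + \<kappa>) \<le> F (real n)" using dec[of "real n" "real (Suc n)"] by simp
  then have "F (real (Suc n)) * (1 + \<kappa>) * (1 + \<kappa>) ^ n \<le> F (real n) * (1 + \<kappa>) ^ n"
   using \<kappa> by (intro mult_right_mono) auto
  then show ?case using Suc by (simp add: mult.assoc)
 qed simp
 define n where "n = nat \<lfloor>t\<rfloor>"
 have n: "real n \<le> t" "t < real n + 1" using t by (auto simp: n_def)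
 have p: "(1 + \<kappa>) ^ n = exp (ln (1 + \<kappa>) * real n)" using \<kappa> by (simp add: powr_realpow[symmetric] powr_def mult.commute)
 have "F t \<le> F (real n)" using mono[of "real n" t] n by simp
 also have "\<dots> \<le> F 0 / exp (ln (1 + \<kappa>) * real n)" using step[of n] unfolding p by (simp add: field_simps)
 also have "\<dots> = F 0 * exp (- ln (1 + \<kappa>) * real n)" by (simp add: exp_minus divide_inverse)
 also have "\<dots> \<le> F 0 * (exp (ln (1 + \<kappa>)) * exp (- ln (1 + \<kappa>) * t))"
 proof (rule mult_left_mono)
  have "ln (1 + \<kappa>) * t \<le> ln (1 + \<kappa>) * (real n + 1)" using n \<kappa> by (intro mult_left_mono) auto
  then show "exp (- ln (1 + \<kappa>) * real n) \<le> exp (ln (1 + \<kappa>)) * exp (- ln (1 + \<kappa>) * t)"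
   unfolding exp_add[symmetric] by (simp add: distrib_left)
 qed (use F0[of 0] in simp)
 also have "\<dots> = (1 + \<kappa>) * F 0 * exp (- ln (1 + \<kappa>) * t)" using \<kappa> by simp
 finally show ?thesis .
qed

context flow
begin

text \<open>The steady volume has the same \<open>z\<close> at almost every \<open>y\<close>, hence
  the constant pressure \<open>z powr gp\<close>. A constant pressure does no work, since the total
  volume is conserved, so it may be inserted wherever the deviation from the steady state is
  wanted.\<close>

lemma decay:
 fixes \<tau>s :: "real => real"
 assumes \<tau>s_m[measurable]: "\<tau>s \<in> borel1" and z: "0 < z"
  and \<tau>s: "AE y in ivl 0 1. \<tau>s y = vol (\<theta> y) z"
  and Vs: "(\<integral>y. \<tau>s y \<partial>ivl 0 1) = V"
 obtains C1 C2 where "0 < C1" "0 < C2"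
  "\<And>t. 0 \<le> t ==> (nu t)\<^sup>2 + (\<integral>y. (\<tau> y t - \<tau>s y)\<^sup>2 \<partial>ivl 0 1) \<le> C1 * exp (- C2 * t)"
proof -
 let ?x = "%w. \<tau> (fst w) (snd w) - \<tau>s (fst w)"
 let ?e = "%w. (g (fst w) (snd w))\<^sup>2 / \<tau> (fst w) (snd w)"
 let ?g = "%w. (g (fst w) (snd w))\<^sup>2"
 obtain d0 M0 where dM0: "0 < d0" "d0 \<le> M0" "\<And>y t. good y ==> 0 \<le> t ==> d0 \<le> \<tau> y t \<and> \<tau> y t \<le> M0"
  using uniform_bounds by metis
 \<comment> \<open>The range is widened so that it also contains the steady volumes, which lie
   between \<open>\<theta>lo / z\<close> and \<open>1 / z + z powr (- gr)\<close>.\<close>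
 define d where "d = min d0 (\<theta>lo / z)"
 define M where "M = max M0 (1 / z + z powr (- gr))"
 have d: "0 < d" using dM0(1) \<theta>_const z by (simp add: d_def)
 have dM: "d \<le> M" using dM0 by (simp add: d_def M_def)
 have M: "0 < M" using d dM by simp
 define adm where "adm y \<longleftrightarrow> good y \<and> \<tau>s y = vol (\<theta> y) z" for y
 have AE_adm: "AE y in ivl 0 1. adm y" using AE_good \<tau>s by eventually_elim (simp add: adm_def)
 have \<tau>b: "d \<le> \<tau> y t \<and> \<tau> y t \<le> M" if "adm y" "0 \<le> t" for y t
  using dM0(3)[of y t] that by (auto simp: adm_def d_def M_def)
 have sb: "d \<le> \<tau>s y \<and> \<tau>s y \<le> M" and sP: "P (\<theta> y) (\<tau>s y) = z powr gp"
  and th: "0 < \<theta> y" "\<theta> y < 1" "\<theta>lo \<le> \<theta> y" if "adm y" for y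
 proof -
  have g: "good y" and e: "\<tau>s y = vol (\<theta> y) z" using that by (auto simp: adm_def)
  show th: "0 < \<theta> y" "\<theta> y < 1" "\<theta>lo \<le> \<theta> y" using pre_goodD(3,4,5)[OF goodD(1)[OF g]] by auto
  have "\<theta>lo / z \<le> \<theta> y / z" using th z by (simp add: divide_right_mono)
  moreover have "0 \<le> (1 - \<theta> y) * z powr (- gr)" using th by simp
  ultimately have 1: "\<theta>lo / z \<le> vol (\<theta> y) z" by (simp add: vol_def)
  have "vol (\<theta> y) z \<le> 1 / z + 1 * z powr (- gr)"
   unfolding vol_def using th z by (intro add_mono mult_right_mono divide_right_mono) auto
  then show "d \<le> \<tau>s y \<and> \<tau>s y \<le> M" using 1 by (auto simp: e d_def M_def)
  show "P (\<theta> y) (\<tau>s y) = z powr gp" using Zst_vol[OF th(1,2) z] by (simp add: P_def e)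
 qed
 obtain cc CC where cC: "0 < cc" "0 < CC"
  "\<And>\<theta> s \<tau>. \<theta>lo \<le> \<theta> ==> \<theta> < 1 ==> d \<le> s ==> s \<le> M ==> d \<le> \<tau> ==> \<tau> \<le> M ==>
   cc * (\<tau> - s)\<^sup>2 \<le> (P \<theta> s - P \<theta> \<tau>) * (\<tau> - s) \<and> cc / 2 * (\<tau> - s)\<^sup>2 \<le> H \<theta> s \<tau> \<and> H \<theta> s \<tau> \<le> CC / 2 * (\<tau> - s)\<^sup>2"
  using P_strong_mono[OF \<theta>_const(1) d dM] by metis
 have mon: "cc * (\<tau> y t - \<tau>s y)\<^sup>2 \<le> (z powr gp - P (\<theta> y) (\<tau> y t)) * (\<tau> y t - \<tau>s y)"
  and Hlo: "cc / 2 * (\<tau> y t - \<tau>s y)\<^sup>2 \<le> H (\<theta> y) (\<tau>s y) (\<tau> y t)"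
  and Hhi: "H (\<theta> y) (\<tau>s y) (\<tau> y t) \<le> CC / 2 * (\<tau> y t - \<tau>s y)\<^sup>2" if "adm y" "0 \<le> t" for y t
  using cC(3)[OF th(3,2)[OF that(1)], of "\<tau>s y" "\<tau> y t"] sb[OF that(1)] \<tau>b[OF that] sP[OF that(1)] by auto
 \<comment> \<open>The constant produced by Young's inequality when the viscous part of the cross
   term is split off while half of the coercivity \<open>cc\<close> is kept.\<close>
 let ?m = "\<mu>\<^sup>2 / (2 * cc * d\<^sup>2)"
 have s_b: "AE y in ivl 0 1. \<bar>\<tau>s y\<bar> \<le> M" using AE_adm by eventually_elim (use sb d in force)
 have diff_b: "AE y in ivl 0 1. \<bar>\<tau> y t - \<tau>s y\<bar> \<le> M" if "0 \<le> t" for t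
  using AE_adm by eventually_elim (use sb \<tau>b[OF _ that] d in force)
 have diffL2: "in_L2 (ivl 0 1) (%y. \<tau> y t - \<tau>s y)" if "0 \<le> t" for t
  by (rule ivl.in_L2_bounded[OF _ diff_b[OF that]]) simp
 have dcylL2: "in_L2 (slab s t) (%w. ?x w)" if "0 \<le> s" for s t
 proof (rule ivl2.in_L2_bounded[where C=M])
  show "(%w. ?x w) \<in> borel_measurable (slab s t)"
   unfolding borel_measurable_ivl2
   by (intro borel_measurable_diff \<tau>_joint measurable_compose[OF measurable_fst \<tau>s_m])
  show "AE w in slab s t. \<bar>?x w\<bar> \<le> M"
   using AE_pair_fst[OF AE_adm, of s t] AE_pair_snd[OF AE_ivl_mem[of s t], of 0 1]
  proof eventually_elim
   case (elim w)
   then show ?case using sb[of "fst w"] \<tau>b[of "fst w" "snd w"] that d by auto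
  qed
 qed
 define D2 where "D2 t = (\<integral>y. (\<tau> y t - \<tau>s y)\<^sup>2 \<partial>ivl 0 1)" for t
 define X where "X t = (\<integral>y. I y t * (\<tau> y t - \<tau>s y) \<partial>ivl 0 1)" for t
 define h where "h t = (\<integral>y. H (\<theta> y) (\<tau>s y) (\<tau> y t) \<partial>ivl 0 1)" for t
 have D20: "0 \<le> D2 t" for t by (simp add: D2_def)
 have s_int: "integrable (ivl 0 1) \<tau>s" by (rule integrable_ivl_bounded[OF \<tau>s_m s_b])
 have Ws_int: "integrable (ivl 0 1) (%y. W (\<theta> y) (\<tau>s y))"
 proof -
  obtain K where K: "0 < K" "\<And>\<theta> \<tau>. 0 < \<theta> ==> \<theta> < 1 ==> d \<le> \<tau> ==> \<tau> \<le> M ==> P \<theta> \<tau> \<le> K \<and> P \<theta> \<tau> * \<tau> \<le> K \<and> W \<theta> \<tau> \<le> K"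
   using P_tau_bound[OF d dM] by metis
  have "AE y in ivl 0 1. \<bar>W (\<theta> y) (\<tau>s y)\<bar> \<le> K" using AE_adm
  proof eventually_elim
   case (elim y)
   then show ?case using K(2)[OF th(1,2)[OF elim], of "\<tau>s y"] sb[OF elim] W_nonneg[of "\<theta> y" "\<tau>s y"] th[OF elim] by auto
  qed
  moreover have "(%y. W (\<theta> y) (\<tau>s y)) \<in> borel1" by measurable
  ultimately show ?thesis by (intro integrable_ivl_bounded)
 qed
 have Hm: "(%y. H (\<theta> y) (\<tau>s y) (\<tau> y t)) \<in> borel1" for t unfolding H_def by measurable
 have h_eq: "h t = pot t - (\<integral>y. W (\<theta> y) (\<tau>s y) \<partial>ivl 0 1)" and Hint: "integrable (ivl 0 1) (%y. H (\<theta> y) (\<tau>s y) (\<tau> y t))" if t: "0 \<le> t" for t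
 proof -
  define f where "f = (%y. W (\<theta> y) (\<tau> y t) - W (\<theta> y) (\<tau>s y) + z powr gp * (\<tau> y t - \<tau>s y))"
  have ae: "AE y in ivl 0 1. H (\<theta> y) (\<tau>s y) (\<tau> y t) = f y"
   using AE_adm by eventually_elim (simp add: H_def sP f_def)
  have fi: "integrable (ivl 0 1) f" unfolding f_def using W\<tau>_integrable[OF t] Ws_int \<tau>_integrable[OF t] s_int by simp
  have fm: "f \<in> borel1" using borel_measurable_integrable[OF fi] by simp
  show "integrable (ivl 0 1) (%y. H (\<theta> y) (\<tau>s y) (\<tau> y t))"
   using fi by (subst integrable_cong_AE[OF _ _ ae]) (use Hm fm in auto)
  have "h t = integral\<^sup>L (ivl 0 1) f" unfolding h_def by (rule integral_cong_AE) (use ae Hm fm in auto)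
  also have "\<dots> = pot t - (\<integral>y. W (\<theta> y) (\<tau>s y) \<partial>ivl 0 1)"
   unfolding f_def using W\<tau>_integrable[OF t] Ws_int \<tau>_integrable[OF t] s_int volume_conserved[OF t] Vs
   by (simp add: pot_def V_def)
  finally show "h t = pot t - (\<integral>y. W (\<theta> y) (\<tau>s y) \<partial>ivl 0 1)" .
 qed
 have sqi: "integrable (ivl 0 1) (%y. (\<tau> y t - \<tau>s y)\<^sup>2)" if "0 \<le> t" for t
  using in_L2_integrable_sq[OF diffL2[OF that]] .
 have h_lo: "cc / 2 * D2 t \<le> h t" and h_hi: "h t \<le> CC / 2 * D2 t" if t: "0 \<le> t" for t
 proof -
  have "(\<integral>y. cc / 2 * (\<tau> y t - \<tau>s y)\<^sup>2 \<partial>ivl 0 1) \<le> h t" unfolding h_def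
   by (rule integral_mono_AE[OF _ Hint[OF t]]) (use sqi[OF t] AE_adm Hlo t in \<open>auto elim: eventually_mono\<close>)
  then show "cc / 2 * D2 t \<le> h t" by (simp add: D2_def)
  have "h t \<le> (\<integral>y. CC / 2 * (\<tau> y t - \<tau>s y)\<^sup>2 \<partial>ivl 0 1)" unfolding h_def
   by (rule integral_mono_AE[OF Hint[OF t]]) (use sqi[OF t] AE_adm Hhi t in \<open>auto elim: eventually_mono\<close>)
  then show "h t \<le> CC / 2 * D2 t" by (simp add: D2_def)
 qed
 have X_b: "\<bar>X t\<bar> \<le> (nu t)\<^sup>2 / 2 + D2 t / 2" if t: "0 \<le> t" for t
 proof -
  have Im: "(%y. I y t) \<in> borel1" by (rule I_meas[OF t])
  have "\<bar>X t\<bar> \<le> (\<integral>y. \<bar>I y t * (\<tau> y t - \<tau>s y)\<bar> \<partial>ivl 0 1)" unfolding X_def by (rule integral_abs_bound)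
  also have "\<dots> \<le> (\<integral>y. (nu t)\<^sup>2 / 2 + (\<tau> y t - \<tau>s y)\<^sup>2 / 2 \<partial>ivl 0 1)"
  proof (rule integral_mono_AE')
   show "integrable (ivl 0 1) (%y. (nu t)\<^sup>2 / 2 + (\<tau> y t - \<tau>s y)\<^sup>2 / 2)" using sqi[OF t] by simp
   show "AE y in ivl 0 1. \<bar>I y t * (\<tau> y t - \<tau>s y)\<bar> \<le> (nu t)\<^sup>2 / 2 + (\<tau> y t - \<tau>s y)\<^sup>2 / 2"
   proof (rule AE_ivl_I)
    fix y :: real assume y: "0 < y" "y < 1"
    have "\<bar>I y t * (\<tau> y t - \<tau>s y)\<bar> \<le> nu t * \<bar>\<tau> y t - \<tau>s y\<bar>"
     unfolding abs_mult using I_bound[OF t, of y] y by (intro mult_right_mono) auto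
    also have "\<dots> \<le> (nu t)\<^sup>2 / 2 + (\<tau> y t - \<tau>s y)\<^sup>2 / 2"
     using sum_squares_bound[of "nu t" "\<bar>\<tau> y t - \<tau>s y\<bar>"] by simp
    finally show "\<bar>I y t * (\<tau> y t - \<tau>s y)\<bar> \<le> (nu t)\<^sup>2 / 2 + (\<tau> y t - \<tau>s y)\<^sup>2 / 2" .
   qed
  qed simp
  also have "\<dots> = (nu t)\<^sup>2 / 2 + D2 t / 2" using sqi[OF t] by (simp add: D2_def measure_ivl)
  finally show ?thesis .
 qed
 define Q where "Q = ?m + 1"
 have Q: "0 < Q" using cC d mu by (simp add: Q_def add_pos_pos)
 define q where "q = (\<mu> / (2 * M)) / Q"
 have q: "0 < q" "q * Q = \<mu> / (2 * M)" using mu M Q by (auto simp: q_def)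
 \<comment> \<open>The bounds \<open>1 / 2\<close> and \<open>cc / 2\<close> keep the functional
   comparable to the squared distance. The bound \<open>q\<close> lets half of the viscous
   dissipation absorb the factor \<open>?m + 1\<close>, where the 1 accounts for the kinetic term
   after Poincare's inequality.\<close>
 define e where "e = min (min (1 / 2) (cc / 2)) q"
 have e: "0 < e" "e \<le> 1 / 2" "e \<le> cc / 2" "e \<le> q" using cC(1) q(1) by (auto simp: e_def)
 have e4: "e * (?m + 1) \<le> \<mu> / (2 * M)"
  using mult_right_mono[OF e(4) less_imp_le[OF Q]] unfolding q(2) by (simp add: Q_def)
 define F where "F t = (nu t)\<^sup>2 / 2 + h t - e * X t" for t
 have F_lo: "(nu t)\<^sup>2 / 4 + cc / 4 * D2 t \<le> F t" if t: "0 \<le> t" for t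
 proof -
  have "e * X t \<le> e * ((nu t)\<^sup>2 / 2 + D2 t / 2)" using X_b[OF t] e(1) by (intro mult_left_mono) (auto simp: abs_le_iff)
  also have "\<dots> = e * ((nu t)\<^sup>2 / 2) + e * (D2 t / 2)" by (simp add: distrib_left)
  also have "\<dots> \<le> 1 / 2 * ((nu t)\<^sup>2 / 2) + cc / 2 * (D2 t / 2)"
   using e D20[of t] by (intro add_mono mult_right_mono) auto
  finally show ?thesis using h_lo[OF t] by (simp add: F_def)
 qed
 have F_hi: "F t \<le> (1 + CC) * ((nu t)\<^sup>2 + D2 t)" if t: "0 \<le> t" for t
 proof -
  have "- (e * X t) \<le> e * ((nu t)\<^sup>2 / 2 + D2 t / 2)"
  proof -
   have "e * (- X t) \<le> e * ((nu t)\<^sup>2 / 2 + D2 t / 2)" using X_b[OF t] e(1) by (intro mult_left_mono) (auto simp: abs_le_iff)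
   then show ?thesis by simp
  qed
  also have "\<dots> \<le> 1 / 2 * ((nu t)\<^sup>2 / 2 + D2 t / 2)" using e D20[of t] by (intro mult_right_mono) auto
  finally have "F t \<le> (nu t)\<^sup>2 / 2 + CC / 2 * D2 t + 1 / 2 * ((nu t)\<^sup>2 / 2 + D2 t / 2)"
   using h_hi[OF t] unfolding F_def by linarith
  also have "\<dots> \<le> (1 + CC) * ((nu t)\<^sup>2 + D2 t)"
  proof -
   have "0 \<le> CC * (nu t)\<^sup>2" "0 \<le> CC * D2 t" using cC(2) D20[of t] by auto
   then have "0 \<le> (nu t)\<^sup>2 / 4 + 3 / 4 * D2 t + CC * (nu t)\<^sup>2 + CC * D2 t / 2"
    using D20[of t] by (intro add_nonneg_nonneg) auto
   moreover have "(1 + CC) * (N + D) - (N / 2 + CC / 2 * D + 1 / 2 * (N / 2 + D / 2)) = N / 4 + 3 / 4 * D + CC * N + CC * D / 2"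
    for N D :: real by (simp add: field_simps)
   ultimately have "0 \<le> (1 + CC) * ((nu t)\<^sup>2 + D2 t) - ((nu t)\<^sup>2 / 2 + CC / 2 * D2 t + 1 / 2 * ((nu t)\<^sup>2 / 2 + D2 t / 2))"
    by (simp only:)
   then show ?thesis by (simp only: diff_ge_0_iff_ge)
  qed
  finally show ?thesis .
 qed
 define k where "k = min (\<mu> / (2 * M)) (e * (cc / 2))"
 have k: "0 < k" "k \<le> \<mu> / (2 * M)" "k \<le> e * (cc / 2)" using mu M e cC by (auto simp: k_def)
 define \<kappa> where "\<kappa> = k / (1 + CC)"
 have \<kappa>: "0 < \<kappa>" using k cC by (simp add: \<kappa>_def)
 have dissip: "F t - F s \<le> - (k * (\<integral>r. n2 r + D2 r \<partial>ivl s t))"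
  and nDi: "integrable (ivl s t) (%r. n2 r + D2 r)" if st: "0 \<le> s" "s < t" for s t
 proof -
  have t: "0 \<le> t" using st by simp
  let ?N = "slab s t"
  \<comment> \<open>The initial and the steady volume have the same integral, so the term containing
    \<open>c\<close> drops out.\<close>
  have X: "X t - X s = (\<integral>w. ?x w * \<sigma> (fst w) (snd w) \<partial>?N) - (\<integral>r. n2 r \<partial>ivl s t)"
  proof -
   have "integrable (ivl 0 1) \<tau>0" using \<tau>_integrable[of 0] by (simp add: \<tau>_eq)
   then have "(\<integral>y. \<tau>0 y - \<tau>s y \<partial>ivl 0 1) = 0" using s_int Vs by (simp add: V_def)
   then show ?thesis using cross_identity[OF \<tau>s_m s_b st(1) less_imp_le[OF st(2)]] by (simp add: X_def)
  qed
  have d2i: "integrable ?N (%w. (?x w)\<^sup>2)" using in_L2_integrable_sq[OF dcylL2[OF st(1)]] .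
  have g2i: "integrable ?N (%w. ?g w)" using in_L2_integrable_sq[OF g_L2_joint[OF st(1)]] .
  have d2i': "integrable ?N (%(y, r). (\<tau> y r - \<tau>s y)\<^sup>2)" using d2i by (simp add: case_prod_beta')
  have g2i': "integrable ?N (%(y, r). (g y r)\<^sup>2)" using g2i by (simp add: case_prod_beta')
  have D2i: "integrable (ivl s t) D2" "(\<integral>r. D2 r \<partial>ivl s t) = (\<integral>w. (?x w)\<^sup>2 \<partial>?N)"
   unfolding D2_def using ivl2.integrable_snd[OF d2i'] ivl2.integral_snd[OF d2i'] by (simp_all add: case_prod_beta')
  show nDi: "integrable (ivl s t) (%r. n2 r + D2 r)" using n2_integrable[OF st(1)] D2i by simp
  have n2g: "(\<integral>r. n2 r \<partial>ivl s t) \<le> (\<integral>w. ?g w \<partial>?N)"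
  proof -
   have "(\<integral>r. n2 r \<partial>ivl s t) \<le> (\<integral>r. (\<integral>y. (g y r)\<^sup>2 \<partial>ivl 0 1) \<partial>ivl s t)"
    by (rule integral_mono_AE[OF n2_integrable[OF st(1)] ivl2.integrable_snd[OF g2i']])
     (use AE_gtime'[OF st(1), of t] poincare in \<open>auto elim: eventually_mono\<close>)
   also have "\<dots> = (\<integral>w. ?g w \<partial>?N)" using ivl2.integral_snd[OF g2i'] by (simp add: case_prod_beta')
   finally show ?thesis .
  qed
  have dsi: "integrable ?N (%w. ?x w * \<sigma> (fst w) (snd w))"
   using in_L2_mult_integrable[OF dcylL2[OF st(1)] \<sigma>_L2'[OF st(1), of t]] by (simp add: case_prod_beta')
  have di: "integrable ?N (%w. ?x w)" by (rule ivl2.in_L2_integrable[OF dcylL2[OF st(1)]])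
  \<comment> \<open>Volume conservation at each time; it allows the steady pressure to be added to
    the cross term at no cost.\<close>
  have d0: "(\<integral>w. ?x w \<partial>?N) = 0"
  proof -
   have di': "integrable ?N (%(y, r). \<tau> y r - \<tau>s y)" using di by (simp add: case_prod_beta')
   have "(\<integral>w. ?x w \<partial>?N) = (\<integral>r. \<integral>y. \<tau> y r - \<tau>s y \<partial>ivl 0 1 \<partial>ivl s t)"
    using ivl2.integral_snd[OF di'] by (simp add: case_prod_beta')
   also have "\<dots> = (\<integral>r. 0 \<partial>ivl s t)"
   proof (rule integral_cong_AE)
    show "(%r. \<integral>y. \<tau> y r - \<tau>s y \<partial>ivl 0 1) \<in> borel_measurable (ivl s t)"
     using borel_measurable_integrable[OF ivl2.integrable_snd[OF di']] .
    show "AE r in ivl s t. (\<integral>y. \<tau> y r - \<tau>s y \<partial>ivl 0 1) = 0"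
    proof (rule AE_ivl_I)
     fix r assume "s < r"
     then have r: "0 \<le> r" using st by simp
     show "(\<integral>y. \<tau> y r - \<tau>s y \<partial>ivl 0 1) = 0"
      using \<tau>_integrable[OF r] s_int volume_conserved[OF r] Vs by (simp add: V_def)
    qed
   qed simp
   finally show ?thesis by simp
  qed
  define A where "A = (\<integral>w. ?g w \<partial>?N)"
  define B where "B = (\<integral>w. (?x w)\<^sup>2 \<partial>?N)"
  have main: "- \<mu> * (\<integral>w. ?e w \<partial>?N)
    - e * (\<integral>w. ?x w * \<sigma> (fst w) (snd w) \<partial>?N)
   \<le> (- (\<mu> / M) + e * ?m) * A + - (e * (cc / 2)) * B"
  proof -
   have "- \<mu> * (\<integral>w. ?e w \<partial>?N)
    - e * (\<integral>w. ?x w * \<sigma> (fst w) (snd w) \<partial>?N)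
    = - \<mu> * (\<integral>w. ?e w \<partial>?N)
    - e * (\<integral>w. ?x w * \<sigma> (fst w) (snd w) \<partial>?N)
    - e * z powr gp * (\<integral>w. ?x w \<partial>?N)" using d0 by simp
   also have "\<dots> = (\<integral>w. - \<mu> * (?e w)
    - e * (?x w * \<sigma> (fst w) (snd w))
    - e * z powr gp * ?x w \<partial>?N)"
    using dissipation_integrable[OF st(1), of t] dsi di by (simp del: times_divide_eq_right mult_minus_left)
   also have "\<dots> \<le> (\<integral>w. (- (\<mu> / M) + e * ?m) * ?g w + - (e * (cc / 2)) * (?x w)\<^sup>2 \<partial>?N)"
   proof (rule integral_mono_AE)
    show "integrable ?N (%w. - \<mu> * (?e w)
    - e * (?x w * \<sigma> (fst w) (snd w))
    - e * z powr gp * ?x w)"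
     using dissipation_integrable[OF st(1), of t] dsi di by (simp del: times_divide_eq_right mult_minus_left)
    show "integrable ?N (%w. (- (\<mu> / M) + e * ?m) * ?g w + - (e * (cc / 2)) * (?x w)\<^sup>2)"
     using g2i d2i by (intro Bochner_Integration.integrable_add integrable_mult_right)
    show "AE w in ?N. - \<mu> * (?e w)
     - e * (?x w * \<sigma> (fst w) (snd w))
     - e * z powr gp * ?x w
     \<le> (- (\<mu> / M) + e * ?m) * ?g w + - (e * (cc / 2)) * (?x w)\<^sup>2"
     using AE_pair_fst[OF AE_adm, of s t] AE_pair_snd[OF AE_ivl_mem[of s t], of 0 1]
    proof eventually_elim
     case (elim w)
     define y r where "y = fst w" and "r = snd w"
     define x G T where "x = \<tau> y r - \<tau>s y" and "G = g y r" and "T = \<tau> y r"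
     have f: "adm y" and r: "0 \<le> r" using elim st by (auto simp: y_def r_def)
     have T: "d \<le> T" "T \<le> M" "0 < T" using \<tau>b[OF f r] d by (auto simp: T_def)
     have 1: "\<mu> / M * G\<^sup>2 \<le> \<mu> * (G\<^sup>2 / T)"
     proof -
      have "\<mu> * G\<^sup>2 / M \<le> \<mu> * G\<^sup>2 / T" using T mu by (intro divide_left_mono) auto
      then show ?thesis by simp
     qed
     have 2: "- (x * (\<mu> * G / T)) \<le> cc / 2 * x\<^sup>2 + ?m * G\<^sup>2"
     proof -
      have "0 \<le> (cc * x + \<mu> * G / T)\<^sup>2 / (2 * cc)" using cC by simp
      also have "\<dots> = cc / 2 * x\<^sup>2 + x * (\<mu> * G / T) + (\<mu> * G / T)\<^sup>2 / (2 * cc)"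
      proof -
       define v where "v = \<mu> * G / T"
       show ?thesis unfolding v_def[symmetric] using cC(1) by (simp add: power2_sum field_simps power2_eq_square)
      qed
      finally have a: "- (x * (\<mu> * G / T)) \<le> cc / 2 * x\<^sup>2 + (\<mu> * G / T)\<^sup>2 / (2 * cc)" by simp
      have "(\<mu> * G / T)\<^sup>2 / (2 * cc) = \<mu>\<^sup>2 * G\<^sup>2 / (2 * cc * T\<^sup>2)" by (simp add: power_divide power_mult_distrib mult.commute)
      also have "\<dots> \<le> \<mu>\<^sup>2 * G\<^sup>2 / (2 * cc * d\<^sup>2)"
       using T d cC(1) by (intro divide_left_mono mult_left_mono power_mono mult_pos_pos) auto
      finally show ?thesis using a by simp
     qed
     \<comment> \<open>The strong monotonicity of the pressure, in the presence of the steady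
       pressure added through \<open>d0\<close>.\<close>
     have 3: "- (x * (- P (\<theta> y) T)) - z powr gp * x \<le> - (cc * x\<^sup>2)"
      using mon[OF f r] by (simp add: x_def T_def algebra_simps)
     have \<sigma>: "\<sigma> y r = \<mu> * G / T + - P (\<theta> y) T" by (simp add: \<sigma>_def G_def T_def)
     have "- (x * \<sigma> y r) - z powr gp * x = - (x * (\<mu> * G / T)) + (- (x * (- P (\<theta> y) T)) - z powr gp * x)"
      unfolding \<sigma> by (simp only: distrib_left minus_add_distrib add_diff_eq)
     also have "\<dots> \<le> (cc / 2 * x\<^sup>2 + ?m * G\<^sup>2) + - (cc * x\<^sup>2)" by (rule add_mono[OF 2 3])
     also have "\<dots> = ?m * G\<^sup>2 - cc / 2 * x\<^sup>2" by simp
     finally have "e * (- (x * \<sigma> y r) - z powr gp * x) \<le> e * (?m * G\<^sup>2 - cc / 2 * x\<^sup>2)"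
      using e(1) by (intro mult_left_mono) auto
     then have "- \<mu> * (G\<^sup>2 / T) + e * (- (x * \<sigma> y r) - z powr gp * x)
      \<le> - (\<mu> / M * G\<^sup>2) + e * (?m * G\<^sup>2 - cc / 2 * x\<^sup>2)" using 1 by simp
     moreover have "- \<mu> * ga - e * (x * s) - e * zz * x \<le> (- m + e * q0) * G2 + - (e * c2) * x2"
      if "- \<mu> * ga + e * (- (x * s) - zz * x) \<le> - (m * G2) + e * (q0 * G2 - c2 * x2)"
      for ga s zz m q0 G2 c2 x2 x :: real using that by (simp add: algebra_simps)
     ultimately have "- \<mu> * (G\<^sup>2 / T) - e * (x * \<sigma> y r) - e * z powr gp * x
      \<le> (- (\<mu> / M) + e * ?m) * G\<^sup>2 + - (e * (cc / 2)) * x\<^sup>2" by blast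
     then show ?case unfolding x_def G_def T_def y_def r_def .
    qed
   qed
   also have "\<dots> = (- (\<mu> / M) + e * ?m) * A + - (e * (cc / 2)) * B"
    unfolding A_def B_def using g2i d2i
    by (subst Bochner_Integration.integral_add) (auto simp del: times_divide_eq_right times_divide_eq_left)
   finally show ?thesis .
  qed
  have A0: "0 \<le> A" "0 \<le> B" by (auto simp: A_def B_def)
  have "F t - F s = - \<mu> * (\<integral>w. ?e w \<partial>?N)
    - e * (\<integral>w. ?x w * \<sigma> (fst w) (snd w) \<partial>?N) + e * (\<integral>r. n2 r \<partial>ivl s t)"
  proof -
   have "F t - F s = ((nu t)\<^sup>2 / 2 + pot t) - ((nu s)\<^sup>2 / 2 + pot s) - e * (X t - X s)"
    using h_eq[OF t] h_eq[OF st(1)] by (simp add: F_def right_diff_distrib)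
   then show ?thesis unfolding X energy_balance[OF st] by (simp add: right_diff_distrib)
  qed
  also have "\<dots> \<le> (- (\<mu> / M) + e * ?m) * A + - (e * (cc / 2)) * B + e * A"
   using main mult_left_mono[OF n2g less_imp_le[OF e(1)]] by (simp add: A_def)
  also have "\<dots> = (- (\<mu> / M) + e * (?m + 1)) * A + - (e * (cc / 2)) * B"
   by (simp add: algebra_simps)
  also have "\<dots> \<le> - k * A + - k * B"
  proof (intro add_mono mult_right_mono A0)
   have "\<mu> / M = \<mu> / (2 * M) + \<mu> / (2 * M)" using M by simp
   then show "- (\<mu> / M) + e * (?m + 1) \<le> - k" using e4 k(2) by linarith
  qed (use k in simp)
  also have "\<dots> \<le> - (k * (\<integral>r. n2 r + D2 r \<partial>ivl s t))"
  proof -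
   have "(\<integral>r. n2 r + D2 r \<partial>ivl s t) \<le> A + B"
    using n2_integrable[OF st(1), of t] D2i n2g by (simp add: A_def B_def)
   then have "k * (\<integral>r. n2 r + D2 r \<partial>ivl s t) \<le> k * (A + B)" using k by (intro mult_left_mono) auto
   then show ?thesis by (simp add: distrib_left)
  qed
  finally show "F t - F s \<le> - (k * (\<integral>r. n2 r + D2 r \<partial>ivl s t))" .
 qed
 have F0: "0 \<le> F t" if "0 \<le> t" for t
  using F_lo[OF that] D20[of t] cC(1) zero_le_power2[of "nu t"] by (smt (verit) divide_nonneg_nonneg mult_nonneg_nonneg)
 have nD0: "AE r in ivl s t. 0 \<le> n2 r + D2 r" if "0 \<le> s" for s t
  using AE_gtime'[OF that, of t] by eventually_elim (use gtime_L2(3) D20 in \<open>simp add: add_nonneg_nonneg\<close>)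
 have Fmono: "F t \<le> F s" if "0 \<le> s" "s < t" for s t
 proof -
  have "0 \<le> k * (\<integral>r. n2 r + D2 r \<partial>ivl s t)" using integral_nonneg_AE[OF nD0[OF that(1), of t]] k by simp
  then show ?thesis using dissip[OF that] by simp
 qed
 \<comment> \<open>\<open>F\<close> is nonincreasing, so its final value bounds it from below on the
   whole interval, and \<open>F_hi\<close> turns this into a lower bound for the
   dissipation.\<close>
 have dec: "F t * (1 + \<kappa> * (t - s)) \<le> F s" if st: "0 \<le> s" "s < t" for s t
 proof -
  have "(\<integral>r. F t / (1 + CC) \<partial>ivl s t) \<le> (\<integral>r. n2 r + D2 r \<partial>ivl s t)"
  proof (rule integral_mono_AE[OF _ nDi[OF st]])
   show "AE r in ivl s t. F t / (1 + CC) \<le> n2 r + D2 r"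
    using AE_gtime'[OF st(1), of t] AE_ivl_mem[of s t]
   proof eventually_elim
    case (elim r)
    have r: "0 \<le> r" using elim st by simp
    have "F t \<le> F r" using Fmono[of r t] elim r by simp
    also have "\<dots> \<le> (1 + CC) * (n2 r + D2 r)" using F_hi[OF r] gtime_L2(2)[OF elim(1)] by simp
    finally show ?case using cC(2) by (simp add: pos_divide_le_eq mult.commute)
   qed
  qed simp
  then have "(t - s) * (F t / (1 + CC)) \<le> (\<integral>r. n2 r + D2 r \<partial>ivl s t)" using st by (simp add: measure_ivl)
  then have "k * ((t - s) * (F t / (1 + CC))) \<le> k * (\<integral>r. n2 r + D2 r \<partial>ivl s t)" using k by (intro mult_left_mono) auto
  moreover have "k * ((t - s) * (F t / (1 + CC))) = F t * (\<kappa> * (t - s))" by (simp add: \<kappa>_def)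
  ultimately show ?thesis using dissip[OF st] by (simp add: distrib_left)
 qed
 define m where "m = min (1 / 4) (cc / 4)"
 have m: "0 < m" "m \<le> 1 / 4" "m \<le> cc / 4" using cC by (auto simp: m_def)
 show ?thesis
 proof (rule that[of "((1 + \<kappa>) * F 0 + 1) / m" "ln (1 + \<kappa>)"])
  show "0 < ((1 + \<kappa>) * F 0 + 1) / m" using m \<kappa> F0[of 0] by (simp add: add_nonneg_pos)
  show "0 < ln (1 + \<kappa>)" using \<kappa> by simp
  fix t :: real assume t: "0 \<le> t"
  have "m * ((nu t)\<^sup>2 + D2 t) \<le> 1 / 4 * (nu t)\<^sup>2 + cc / 4 * D2 t"
   unfolding distrib_left using m D20[of t] by (intro add_mono mult_right_mono) auto
  also have "\<dots> \<le> F t" using F_lo[OF t] by simp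
  also have "\<dots> \<le> (1 + \<kappa>) * F 0 * exp (- ln (1 + \<kappa>) * t)"
   by (rule exponential_decay_of_integral_inequality[OF \<kappa> F0 dec t])
  also have "\<dots> \<le> ((1 + \<kappa>) * F 0 + 1) * exp (- ln (1 + \<kappa>) * t)" by (intro mult_right_mono) auto
  finally have "(nu t)\<^sup>2 + D2 t \<le> ((1 + \<kappa>) * F 0 + 1) * exp (- ln (1 + \<kappa>) * t) / m"
   using m by (simp add: pos_le_divide_eq mult.commute)
  then show "(nu t)\<^sup>2 + (\<integral>y. (\<tau> y t - \<tau>s y)\<^sup>2 \<partial>ivl 0 1) \<le> ((1 + \<kappa>) * F 0 + 1) / m * exp (- ln (1 + \<kappa>) * t)"
   by (simp add: D2_def)
 qed
qed

end

section \<open>Test functions\<close>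

text \<open>Differentiability of order \<open>n\<close> with an existential derivative, which makes
  closure under sums and products a short induction; \<open>C_order_product\<close> relates it to
  \<open>C_order\<close> in the plane.\<close>

primrec Cn :: "nat => (real => real) => bool" where
 "Cn 0 f \<longleftrightarrow> continuous_on UNIV f"
| "Cn (Suc n) f \<longleftrightarrow> (\<exists>f'. (\<forall>x. (f has_real_derivative f' x) (at x)) \<and> Cn n f')"

lemma Cn_mono: "Cn (Suc n) f ==> Cn n f"
proof (induction n arbitrary: f)
 case 0
 then obtain f' where "\<And>x. (f has_real_derivative f' x) (at x)" by auto
 then show ?case using DERIV_isCont continuous_at_imp_continuous_on unfolding Cn.simps by blast
next
 case (Suc n)
 from Suc.prems obtain f' where f': "\<forall>x. (f has_real_derivative f' x) (at x)" "Cn (Suc n) f'"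
  unfolding Cn.simps(2)[of "Suc n"] by blast
 then have "Cn n f'" using Suc.IH by blast
 then show ?case using f'(1) by auto
qed

lemma Cn_add: "Cn n f ==> Cn n g ==> Cn n (%x. f x + g x)"
proof (induction n arbitrary: f g)
 case 0 then show ?case by (auto intro: continuous_on_add)
next
 case (Suc n)
 then obtain f' g' where "\<forall>x. (f has_real_derivative f' x) (at x)" "Cn n f'"
  "\<forall>x. (g has_real_derivative g' x) (at x)" "Cn n g'" by auto
 then show ?case using Suc.IH[of f' g'] by (auto intro!: exI[of _ "%x. f' x + g' x"] DERIV_add)
qed

lemma Cn_mult: "Cn n f ==> Cn n g ==> Cn n (%x. f x * g x)"
proof (induction n arbitrary: f g)
 case 0 then show ?case by (auto intro: continuous_on_mult)
next
 case (Suc n)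
 then obtain f' g' where fg: "\<forall>x. (f has_real_derivative f' x) (at x)" "Cn n f'"
  "\<forall>x. (g has_real_derivative g' x) (at x)" "Cn n g'" by auto
 have "Cn n f" "Cn n g" by (rule Cn_mono[OF Suc.prems(1)], rule Cn_mono[OF Suc.prems(2)])
 then have "Cn n (%x. f' x * g x + g' x * f x)" using fg Suc.IH by (intro Cn_add) auto
 then show ?case using fg by (auto intro!: exI[of _ "%x. f' x * g x + g' x * f x"] DERIV_mult)
qed

lemma Cn_const: "Cn n (%x. c)"
 by (induction n arbitrary: c) (auto intro!: exI[of _ "%x. 0"])

lemma Cn_affine: "Cn n f ==> Cn n (%x. f (a * x + b))"
proof (induction n arbitrary: f)
 case 0 then show ?case by (auto intro!: continuous_intros intro: continuous_on_compose2[of UNIV f])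
next
 case (Suc n)
 then obtain f' where f': "\<forall>x. (f has_real_derivative f' x) (at x)" "Cn n f'" by auto
 have "((%x. f (a * x + b)) has_real_derivative f' (a * x + b) * a) (at x)" for x
  by (rule DERIV_chain2[where f=f]) (use f'(1) in \<open>auto intro!: derivative_eq_intros\<close>)
 moreover have "Cn n (%x. f' (a * x + b) * a)" by (intro Cn_mult Cn_const Suc.IH f'(2))
 ultimately have "\<exists>h. (\<forall>x. ((%x. f (a * x + b)) has_real_derivative h x) (at x)) \<and> Cn n h"
  by (intro exI[of _ "%x. f' (a * x + b) * a"]) simp
 then show ?case by (simp only: Cn.simps)
qed

text \<open>The flat function \<open>exp (- 1 / x)\<close> divided by powers of \<open>x\<close>.
  Differentiation maps the family to linear combinations of its own members, so one induction on the
  order proves all of them smooth.\<close>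

definition be :: "nat => real => real" where
 "be k x = (if x \<le> 0 then 0 else exp (- 1 / x) / x ^ k)"

lemma be_tendsto_0: "(be k \<longlongrightarrow> 0) (at 0)"
proof (rule filterlim_split_at)
 have "\<forall>\<^sub>F x in at_left (0::real). be k x = 0" by (auto simp: be_def eventually_at_filter)
 then show "(be k \<longlongrightarrow> 0) (at_left 0)" by (rule tendsto_eventually)
 have "((%x. (inverse x) ^ k / exp (inverse x)) \<longlongrightarrow> 0) (at_right (0::real))"
  by (rule filterlim_compose[OF tendsto_power_div_exp_0 filterlim_inverse_at_top_right])
 moreover have "\<forall>\<^sub>F x in at_right (0::real). (inverse x) ^ k / exp (inverse x) = be k x"
  by (auto simp: be_def eventually_at_filter exp_minus divide_inverse power_inverse mult.commute)
 ultimately show "(be k \<longlongrightarrow> 0) (at_right 0)" by (rule Lim_transform_eventually)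
qed

text \<open>The only delicate point is 0, where the difference quotient of \<open>be k\<close> is
  \<open>be (k + 1)\<close> and tends to 0.\<close>

lemma DERIV_be: "(be k has_real_derivative (be (k + 2) x - real k * be (k + 1) x)) (at x)"
proof -
 consider "x < 0" | "x = 0" | "0 < x" by linarith
 then show ?thesis
 proof cases
  case 1
  have "(be k has_real_derivative 0) (at x)"
   by (rule has_field_derivative_transform_within_open[of "%_. 0" _ _ "{..<0}"]) (use 1 in \<open>auto simp: be_def\<close>)
  then show ?thesis using 1 by (simp add: be_def)
 next
  case 2
  have "\<forall>\<^sub>F y in at 0. be (k + 1) y = (be k y - be k 0) / (y - 0)"
   by (auto simp: be_def eventually_at_filter)
  then have "((%y. (be k y - be k 0) / (y - 0)) \<longlongrightarrow> 0) (at 0)"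
   by (rule Lim_transform_eventually[OF be_tendsto_0])
  then show ?thesis using 2 by (simp add: has_field_derivative_iff be_def)
 next
  case 3
  have "((%x. exp (- 1 / x) / x ^ k) has_real_derivative (exp (- 1 / x) * (1 / x\<^sup>2) * x ^ k - exp (- 1 / x) * (real k * x ^ (k - 1))) / (x ^ k * x ^ k)) (at x)"
   by (rule derivative_eq_intros refl | use 3 in \<open>simp add: power2_eq_square\<close>)+
  moreover have "(exp (- 1 / x) * (1 / x\<^sup>2) * x ^ k - exp (- 1 / x) * (real k * x ^ (k - 1))) / (x ^ k * x ^ k)
   = be (k + 2) x - real k * be (k + 1) x"
  proof -
   have "real k * x ^ (k - 1) / (x ^ k * x ^ k) = real k / x ^ (k + 1)"
    using 3 by (cases k) (auto simp: field_simps)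
   moreover have "1 / x\<^sup>2 * x ^ k / (x ^ k * x ^ k) = 1 / x ^ (k + 2)"
    using 3 by (simp add: power_add power2_eq_square)
   ultimately have "exp (- 1 / x) * (1 / x\<^sup>2 * x ^ k / (x ^ k * x ^ k)) - exp (- 1 / x) * (real k * x ^ (k - 1) / (x ^ k * x ^ k))
    = be (k + 2) x - real k * be (k + 1) x" using 3 by (simp add: be_def)
   moreover have "(E * a * b - E * c) / p = E * (a * b / p) - E * (c / p)" for E a b c p :: real
    by (simp add: diff_divide_distrib mult.assoc)
   ultimately show ?thesis by (simp only:)
  qed
  ultimately have "((%x. exp (- 1 / x) / x ^ k) has_real_derivative be (k + 2) x - real k * be (k + 1) x) (at x)" by simp
  then show ?thesis
   by (rule has_field_derivative_transform_within_open[of _ _ _ "{0<..}"]) (use 3 in \<open>auto simp: be_def\<close>)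
 qed
qed

lemma Cn_be: "Cn n (be k)"
proof (induction n arbitrary: k)
 case 0
 show ?case by (auto intro!: continuous_at_imp_continuous_on DERIV_isCont[OF DERIV_be])
next
 case (Suc n)
 have "Cn n (%x. be (k + 2) x + (- real k) * be (k + 1) x)"
  by (intro Cn_add Cn_mult Cn_const Suc)
 then show ?case using DERIV_be[of k] by (auto intro!: exI[of _ "%x. be (k + 2) x - real k * be (k + 1) x"])
qed

definition smooth :: "(real => real) => bool" where "smooth f \<longleftrightarrow> (\<forall>n. Cn n f)"

definition tfun :: "real => real => (real => real) => bool" where
 "tfun a b f \<longleftrightarrow> smooth f \<and> (\<forall>x. x \<notin> {a..b} --> f x = 0)"

lemma smooth_continuous: "smooth f ==> continuous_on UNIV f"
 unfolding smooth_def by (metis Cn.simps(1))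

lemma tfun_continuous: "tfun a b f ==> continuous_on UNIV f"
 by (simp add: tfun_def smooth_continuous)

lemma tfun_measurable: "tfun a b f ==> f \<in> borel1"
 by (intro borel_measurable_continuous_onI tfun_continuous)

lemma tfun_bounded:
 assumes "tfun a b f"
 obtains B where "0 < B" "\<And>x. \<bar>f x\<bar> \<le> B"
proof -
 have "bounded (f ` {a..b})"
  using continuous_on_subset[OF tfun_continuous[OF assms]] by (intro compact_imp_bounded compact_continuous_image) auto
 then obtain B where B: "0 < B" "\<And>x. x \<in> {a..b} ==> \<bar>f x\<bar> \<le> B" unfolding bounded_pos by auto
 have "\<bar>f x\<bar> \<le> B" for x using B assms by (cases "x \<in> {a..b}") (auto simp: tfun_def)
 then show ?thesis using B that by blast
qed

lemma tfun_mono: "tfun a b f ==> c \<le> a ==> b \<le> d ==> tfun c d f"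
 by (auto simp: tfun_def)

lemma smooth_deriv:
 assumes "smooth f" "\<And>x. (f has_real_derivative f' x) (at x)"
 shows "smooth f'"
proof -
 have "Cn n f'" for n
 proof -
  have "Cn (Suc n) f" using assms(1) by (simp add: smooth_def)
  then obtain f'' where "\<forall>x. (f has_real_derivative f'' x) (at x)" "Cn n f''" by auto
  moreover have "f'' = f'" using calculation(1) assms(2) DERIV_unique by blast
  ultimately show ?thesis by simp
 qed
 then show ?thesis by (simp add: smooth_def)
qed

lemma smooth_antideriv:
 assumes "smooth f'" "\<And>x. (f has_real_derivative f' x) (at x)"
 shows "smooth f"
proof -
 have "Cn n f" for n
 proof (cases n)
  case 0 then show ?thesis using assms(2) by (auto intro!: continuous_at_imp_continuous_on DERIV_isCont)
 next
  case (Suc m) then show ?thesis using assms by (auto simp: smooth_def)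
 qed
 then show ?thesis by (simp add: smooth_def)
qed

lemma tfun_deriv_zero:
 assumes "tfun a b f" "\<And>x. (f has_real_derivative f' x) (at x)" "x \<notin> {a..b}"
 shows "f' x = 0"
proof -
 have "(f has_real_derivative 0) (at x)"
  by (rule has_field_derivative_transform_within_open[of "%_. 0" _ _ "- {a..b}"])
   (use assms in \<open>auto simp: tfun_def\<close>)
 then show ?thesis using assms(2) DERIV_unique by blast
qed

lemma tfun_deriv:
 assumes "tfun a b f"
 obtains f' where "\<And>x. (f has_real_derivative f' x) (at x)" "tfun a b f'"
proof -
 have "Cn (Suc 0) f" using assms by (simp add: tfun_def smooth_def del: Cn.simps)
 then obtain f' where f': "\<And>x. (f has_real_derivative f' x) (at x)" by auto
 then have "tfun a b f'"
  using smooth_deriv[OF _ f'] tfun_deriv_zero[OF assms f'] assms by (auto simp: tfun_def)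
 then show ?thesis using f' that by blast
qed

section \<open>Bumps and primitives with compact support\<close>

text \<open>Larger \<open>n\<close> steepens both flanks, so the bumps tend to the indicator of
  \<open>{a<..<b}\<close> while their support does not move. The factor is \<open>Suc n\<close> so
  that it never vanishes.\<close>

definition bump :: "real => real => nat => real => real" where
 "bump a b n x = be 0 (real (Suc n) * (x - a)) * be 0 (real (Suc n) * (b - x))"

lemma be0_bounds: "0 \<le> be 0 x" "be 0 x \<le> 1"
 by (auto simp: be_def)

lemma bump_bounds: "0 \<le> bump a b n x" "bump a b n x \<le> 1"
 unfolding bump_def by (auto intro!: mult_nonneg_nonneg mult_le_one be0_bounds)

lemma bump_abs: "\<bar>bump a b n x\<bar> \<le> 1" using bump_bounds[of a b n x] by simp

lemma bump_pos: "a < x ==> x < b ==> 0 < bump a b n x"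
 by (auto simp: bump_def be_def not_le)

lemma bump_zero: "\<not> (a < x \<and> x < b) ==> bump a b n x = 0"
 by (auto simp: bump_def be_def mult_le_0_iff)

lemma bump_tfun: "tfun a b (bump a b n)"
proof -
 have "Cn m (%x. be 0 (real (Suc n) * x + - (real (Suc n) * a)) * be 0 (- real (Suc n) * x + real (Suc n) * b))" for m
  by (intro Cn_mult Cn_affine Cn_be)
 moreover have "bump a b n = (%x. be 0 (real (Suc n) * x + - (real (Suc n) * a)) * be 0 (- real (Suc n) * x + real (Suc n) * b))"
  by (auto simp: bump_def fun_eq_iff algebra_simps)
 ultimately have "smooth (bump a b n)" by (simp add: smooth_def)
 then show ?thesis using bump_zero[of a _ b n] by (auto simp: tfun_def)
qed

lemma be0_limit: "0 < x ==> (%n. be 0 (real (Suc n) * x)) \<longlonglongrightarrow> 1"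
proof -
 assume x: "0 < x"
 have "(%n. exp (- (1 / x) * inverse (real (Suc n)))) \<longlonglongrightarrow> exp (- (1 / x) * 0)"
  by (intro tendsto_intros LIMSEQ_inverse_real_of_nat)
 moreover have "be 0 (real (Suc n) * x) = exp (- (1 / x) * inverse (real (Suc n)))" for n
  using x by (simp add: be_def not_le divide_inverse mult.commute)
 ultimately show ?thesis by simp
qed

lemma bump_limit: "(%n. bump a b n x) \<longlonglongrightarrow> indicator {a<..<b} x"
proof (cases "a < x \<and> x < b")
 case True
 have "(%n. bump a b n x) \<longlonglongrightarrow> 1 * 1" unfolding bump_def
  by (intro tendsto_mult be0_limit) (use True in auto)
 then show ?thesis using True by (simp add: indicator_def)
next
 case False
 then have "indicator {a<..<b} x = (0::real)" by (auto simp: indicator_def)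
 then show ?thesis by (simp add: bump_zero[OF False])
qed

lemma FTC_ivl:
 fixes F f :: "real => real"
 assumes ab: "a \<le> b" and F: "\<And>x. (F has_real_derivative f x) (at x)" and f: "continuous_on UNIV f"
 shows "integral\<^sup>L (ivl a b) f = F b - F a"
proof -
 have m: "f \<in> borel1" using f by (rule borel_measurable_continuous_onI)
 have "(\<integral>x. indicator {a..b} x *\<^sub>R f x \<partial>lborel) = F b - F a"
 proof (rule integral_FTC_atLeastAtMost[OF ab])
  show "(F has_vector_derivative f x) (at x within {a..b})" for x
   using has_vector_derivative_at_within[OF F[of x, unfolded has_real_derivative_iff_has_vector_derivative]] .
  show "continuous_on {a..b} f" by (rule continuous_on_subset[OF f]) simp
 qed
 moreover have "(\<integral>x. indicator {a..b} x *\<^sub>R f x \<partial>lborel) = (\<integral>x. indicator {a<..<b} x * f x \<partial>lborel)"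
  by (rule integral_cong_AE, use m in simp, use m in simp)
   (use AE_lborel_singleton[of a] AE_lborel_singleton[of b] in \<open>auto simp: indicator_def elim!: eventually_elim2\<close>)
 ultimately show ?thesis using m by (simp add: integral_ivl)
qed

lemma ex_antiderivative:
 fixes f :: "real => real"
 assumes "continuous_on UNIV f"
 obtains F where "\<And>x. (F has_real_derivative f x) (at x)"
proof -
 define F where "F u = (LBINT y=ereal 0..ereal u. f y)" for u :: real
 have "(F has_real_derivative f x) (at x)" for x
 proof -
  define a b where "a = min 0 x - 1" and "b = max 0 x + 1"
  have "(F has_vector_derivative f x) (at x within {a..b})"
   unfolding F_def by (rule interval_integral_FTC2) (auto simp: a_def b_def intro: continuous_on_subset[OF assms])
  moreover have "x \<in> interior {a..b}" by (auto simp: a_def b_def)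
  ultimately show ?thesis by (simp only: at_within_interior has_real_derivative_iff_has_vector_derivative)
 qed
 then show ?thesis by (rule that)
qed

lemma tfun_primitive:
 assumes f: "tfun l r f" and lr: "l < r" and 0: "integral\<^sup>L (ivl l r) f = 0"
 shows "\<exists>z. tfun l r z \<and> (\<forall>x. (z has_real_derivative f x) (at x))"
proof -
 note fc = tfun_continuous[OF f]
 obtain F where F: "\<And>x. (F has_real_derivative f x) (at x)" using ex_antiderivative[OF fc] by blast
 define z where "z x = F x - F l" for x
 have z: "(z has_real_derivative f x) (at x)" for x
  unfolding z_def[abs_def] using DERIV_diff[OF F DERIV_const] by simp
 have zc: "continuous_on UNIV z" using z by (auto intro!: continuous_at_imp_continuous_on DERIV_isCont)
 have zl: "z l = 0" by (simp add: z_def)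
 have zr: "z r = 0" using FTC_ivl[OF less_imp_le[OF lr] z fc] 0 zl by simp
 have "z x = 0" if "x \<notin> {l..r}" for x
 proof (cases "x < l")
  case True
  have "z l - z x = integral\<^sup>L (ivl x l) f" using FTC_ivl[of x l z f] z fc True by simp
  also have "\<dots> = (\<integral>y. 0 \<partial>ivl x l)"
   by (rule integral_cong_AE) (use tfun_measurable[OF f] f in \<open>auto intro!: AE_ivl_I simp: tfun_def\<close>)
  finally show ?thesis using zl by simp
 next
  case False
  then have x: "r < x" using that by auto
  have "z x - z r = integral\<^sup>L (ivl r x) f" using FTC_ivl[of r x z f] z fc x by simp
  also have "\<dots> = (\<integral>y. 0 \<partial>ivl r x)"
   by (rule integral_cong_AE) (use tfun_measurable[OF f] f in \<open>auto intro!: AE_ivl_I simp: tfun_def\<close>)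
  finally show ?thesis using zr by simp
 qed
 moreover have "smooth z" using f smooth_antideriv[OF _ z] by (simp add: tfun_def)
 ultimately show ?thesis using z by (auto simp: tfun_def)
qed

lemma tfun_combine: "tfun a b f ==> tfun a b g ==> tfun a b (%x. f x - k * g x)"
proof -
 assume fg: "tfun a b f" "tfun a b g"
 have "Cn n (%x. f x + (- k) * g x)" for n
  using fg by (intro Cn_add Cn_mult Cn_const) (auto simp: tfun_def smooth_def)
 then show ?thesis using fg by (auto simp: tfun_def smooth_def)
qed

lemma integral_bump_restrict:
 fixes f :: "real => real"
 assumes f: "f \<in> borel1" and "A \<le> a" "b \<le> B"
 shows "(\<integral>x. f x * bump a b n x \<partial>ivl A B) = (\<integral>x. f x * bump a b n x \<partial>ivl a b)"
proof -
 have m: "(%x. f x * bump a b n x) \<in> borel1" using f tfun_measurable[OF bump_tfun] by simp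
 show ?thesis unfolding integral_ivl[OF m]
  by (rule Bochner_Integration.integral_cong) (use assms(2,3) bump_zero[of a _ b n] in \<open>auto simp: indicator_def\<close>)
qed

lemma integral_bump_limit:
 fixes f :: "real => real"
 assumes f: "integrable (ivl a b) f"
 shows "(%n. \<integral>x. f x * bump a b n x \<partial>ivl a b) \<longlonglongrightarrow> integral\<^sup>L (ivl a b) f"
proof (rule integral_dominated_convergence[where w="%x. \<bar>f x\<bar>"])
 have m: "f \<in> borel1" using borel_measurable_integrable[OF f] by simp
 show "(%x. f x * bump a b n x) \<in> borel_measurable (ivl a b)" for n using m tfun_measurable[OF bump_tfun] by simp
 show "f \<in> borel_measurable (ivl a b)" using m by simp
 show "AE x in ivl a b. (%n. f x * bump a b n x) \<longlonglongrightarrow> f x"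
 proof (rule AE_ivl_I)
  fix x assume "a < x" "x < b"
  then show "(%n. f x * bump a b n x) \<longlonglongrightarrow> f x"
   using tendsto_mult[OF tendsto_const[of "f x"] bump_limit[of a b x]] by simp
 qed
 show "AE x in ivl a b. norm (f x * bump a b n x) \<le> \<bar>f x\<bar>" for n
  using bump_abs[of a b n] by (intro AE_I2) (simp add: abs_mult mult_left_le)
qed (use f in auto)

definition bint :: "real => real => nat => real" where "bint a b n = integral\<^sup>L (ivl a b) (bump a b n)"

lemma bump_integrable: "integrable (ivl c d) (bump a b n)"
 by (rule integrable_ivl_bounded[OF tfun_measurable[OF bump_tfun], where B=1]) (use bump_abs in auto)

lemma bint_pos:
 assumes "a < b" shows "0 < bint a b n"
proof -
 have "bint a b n \<noteq> 0"
 proof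
  assume "bint a b n = 0"
  then have "AE x in ivl a b. bump a b n x = 0"
   unfolding bint_def using integral_nonneg_eq_0_iff_AE[OF bump_integrable] bump_bounds(1) by blast
  from AE_ivl_exists[OF this assms] obtain y where "a < y" "y < b" "bump a b n y = 0" by blast
  then show False using bump_pos[of a y b n] by simp
 qed
 moreover have "0 \<le> bint a b n" unfolding bint_def using bump_bounds(1) by simp
 ultimately show ?thesis by simp
qed

text \<open>The multiple of a fixed reference bump is chosen so that the mean vanishes and \<open>zeta\<close>, the
 primitive, has compact support.\<close>

definition dzeta :: "real => real => real => real => nat => real => real" where
 "dzeta a0 b0 a b n x = bump a b n x - bint a b n / bint a0 b0 0 * bump a0 b0 0 x"

definition zeta :: "real => real => real => real => nat => real => real" where
 "zeta a0 b0 a b n = (SOME z. tfun (min a0 a) (max b0 b) z \<and> (\<forall>x. (z has_real_derivative dzeta a0 b0 a b n x) (at x)))"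

lemma zeta_props:
 assumes "a0 < b0" "a < b"
 shows "tfun (min a0 a) (max b0 b) (zeta a0 b0 a b n)"
  "\<And>x. (zeta a0 b0 a b n has_real_derivative dzeta a0 b0 a b n x) (at x)"
  "tfun (min a0 a) (max b0 b) (dzeta a0 b0 a b n)"
  "A \<le> min a0 a ==> max b0 b \<le> B ==> integral\<^sup>L (ivl A B) (dzeta a0 b0 a b n) = 0"
proof -
 let ?l = "min a0 a" and ?r = "max b0 b"
 show t: "tfun ?l ?r (dzeta a0 b0 a b n)" unfolding dzeta_def[abs_def]
  by (intro tfun_combine tfun_mono[OF bump_tfun]) auto
 have int: "integral\<^sup>L (ivl A B) (dzeta a0 b0 a b n) = 0" if "A \<le> ?l" "?r \<le> B" for A B
  using integral_bump_restrict[of "%_. 1" A a b B n] integral_bump_restrict[of "%_. 1" A a0 b0 B 0] that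
   bint_pos[OF assms(1), of 0] bump_integrable
  unfolding dzeta_def by (simp add: bint_def)
 have "\<exists>z. tfun ?l ?r z \<and> (\<forall>x. (z has_real_derivative dzeta a0 b0 a b n x) (at x))"
  by (rule tfun_primitive[OF t _ int]) (use assms in auto)
 from someI_ex[OF this] have "tfun ?l ?r (zeta a0 b0 a b n) \<and> (\<forall>x. (zeta a0 b0 a b n has_real_derivative dzeta a0 b0 a b n x) (at x))"
  unfolding zeta_def .
 then show "tfun ?l ?r (zeta a0 b0 a b n)"
  "\<And>x. (zeta a0 b0 a b n has_real_derivative dzeta a0 b0 a b n x) (at x)" by auto
 show "A \<le> min a0 a ==> max b0 b \<le> B ==> integral\<^sup>L (ivl A B) (dzeta a0 b0 a b n) = 0" using int .
qed

section \<open>The lemma of du Bois-Reymond\<close>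

text \<open>\<open>S\<close> is assumed integrable only inside the interval, as a weak derivative
  gives no more, while \<open>w\<close> is integrable up to the ends so that its primitive starts at
  \<open>A\<close>. Only countably many test functions occur; for a family depending on a parameter
  all tests can therefore be verified outside one null set.\<close>

lemma du_Bois_Reymond:
 fixes S w :: "real => real"
 assumes AB: "A < a0" "a0 < b0" "b0 < B"
  and Sm[measurable]: "S \<in> borel1"
  and Si: "\<And>a b. A < a ==> a < b ==> b < B ==> integrable (ivl a b) S"
  and w: "integrable (ivl A B) w"
  and eq: "\<And>a b n. a \<in> \<rat> ==> b \<in> \<rat> ==> A < a ==> a < b ==> b < B ==>
   (\<integral>x. S x * dzeta a0 b0 a b n x \<partial>ivl A B) = - (\<integral>x. w x * zeta a0 b0 a b n x \<partial>ivl A B)"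
 shows "\<exists>k. AE x in ivl A B. S x = k + (\<integral>r. w r \<partial>ivl A x)"
proof -
 define Wf where "Wf x = (\<integral>r. w r \<partial>ivl A x)" for x
 have wm[measurable]: "w \<in> borel1" using borel_measurable_integrable[OF w] by simp
 have Wm[measurable]: "Wf \<in> borel1" unfolding Wf_def by measurable
 have Wi: "integrable (ivl a b) Wf" if "A < a" "a < b" "b < B" for a b
  using continuous_on_subset[OF continuous_on_indefinite[OF w], of "{a..b}"] that
  unfolding Wf_def by (intro integrable_ivl_continuous[OF Wm[unfolded Wf_def]]) auto
 define D where "D x = S x - Wf x" for x
 have Dm[measurable]: "D \<in> borel1" unfolding D_def by measurable
 have Di: "integrable (ivl a b) D" if "A < a" "a < b" "b < B" for a b
  unfolding D_def using Si[OF that] Wi[OF that] by simp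
 have bi: "integrable (ivl A B) (%x. f x * bump a b n x)"
  if "\<And>a b. A < a ==> a < b ==> b < B ==> integrable (ivl a b) f" "f \<in> borel1" "A < a" "a < b" "b < B" for f :: "real => real" and a b n
 proof -
  have m: "(%x. f x * bump a b n x) \<in> borel1" using that(2) tfun_measurable[OF bump_tfun] by simp
  have "integrable lborel (%x. indicator {a<..<b} x * f x)" using that(1)[OF that(3-5)] that(2) by (simp add: integrable_ivl)
  then show ?thesis unfolding integrable_ivl[OF m]
   by (rule Bochner_Integration.integrable_bound)
    (use m bump_zero[of a _ b n] bump_abs[of a b n] in \<open>auto simp: indicator_def abs_mult mult_left_le\<close>)
 qed
 \<comment> \<open>The constant is the mean of \<open>D\<close> against the reference bump. Any bump
   is \<open>dzeta\<close> plus a multiple of the reference bump, and \<open>dzeta\<close>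
   annihilates \<open>D\<close>.\<close>
 define k where "k = (\<integral>x. D x * bump a0 b0 0 x \<partial>ivl A B) / bint a0 b0 0"
 have b0p: "0 < bint a0 b0 0" using bint_pos AB by simp
 have zero: "(\<integral>x. (D x - k) * bump a b n x \<partial>ivl A B) = 0" if ab: "a \<in> \<rat>" "b \<in> \<rat>" "A < a" "a < b" "b < B" for a b n
 proof -
  note zp = zeta_props[OF AB(2) ab(4), where n=n]
  have lr: "A \<le> min a0 a" "max b0 b \<le> B" using AB ab by auto
  have dzi: "integrable (ivl A B) (dzeta a0 b0 a b n)"
   unfolding dzeta_def[abs_def] using bump_integrable by simp
  have zx: "(\<integral>y. dzeta a0 b0 a b n y \<partial>ivl A x) = zeta a0 b0 a b n x" if "A < x" for x
  proof -
   have "zeta a0 b0 a b n A = 0" using zp(1) AB ab by (auto simp: tfun_def)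
   then show ?thesis using FTC_ivl[OF _ zp(2) tfun_continuous[OF zp(3)], of A x] that by simp
  qed
  have Wz: "(\<integral>x. Wf x * dzeta a0 b0 a b n x \<partial>ivl A B) = - (\<integral>x. w x * zeta a0 b0 a b n x \<partial>ivl A B)"
  proof -
   have "(\<integral>x. Wf x * dzeta a0 b0 a b n x \<partial>ivl A B) = - (\<integral>x. w x * (\<integral>y. dzeta a0 b0 a b n y \<partial>ivl A x) \<partial>ivl A B)"
    unfolding Wf_def by (rule integral_by_parts_indefinite(3)[OF w dzi zp(4)[OF lr]])
   also have "(\<integral>x. w x * (\<integral>y. dzeta a0 b0 a b n y \<partial>ivl A x) \<partial>ivl A B) = (\<integral>x. w x * zeta a0 b0 a b n x \<partial>ivl A B)"
   proof (rule integral_cong_AE)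
    show "AE x in ivl A B. w x * (\<integral>y. dzeta a0 b0 a b n y \<partial>ivl A x) = w x * zeta a0 b0 a b n x"
     using zx by (intro AE_ivl_I) simp
    have [measurable]: "dzeta a0 b0 a b n \<in> borel1" "zeta a0 b0 a b n \<in> borel1"
     by (rule tfun_measurable[OF zp(3)], rule tfun_measurable[OF zp(1)])
    show "(%x. w x * (\<integral>y. dzeta a0 b0 a b n y \<partial>ivl A x)) \<in> borel_measurable (ivl A B)" by measurable
    show "(%x. w x * zeta a0 b0 a b n x) \<in> borel_measurable (ivl A B)" by measurable
   qed
   finally show ?thesis .
  qed
  have dzf: "integrable (ivl A B) (%x. f x * dzeta a0 b0 a b n x)"
   if "\<And>a b. A < a ==> a < b ==> b < B ==> integrable (ivl a b) f" "f \<in> borel1" for f :: "real => real"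
  proof -
   have "integrable (ivl A B) (%x. f x * bump a b n x - bint a b n / bint a0 b0 0 * (f x * bump a0 b0 0 x))"
    using bi[OF that ab(3-5), of n] bi[OF that AB, of 0] by simp
   then show ?thesis by (simp add: dzeta_def right_diff_distrib mult.left_commute)
  qed
  have "(\<integral>x. D x * dzeta a0 b0 a b n x \<partial>ivl A B) = 0"
   unfolding D_def left_diff_distrib
   using dzf[OF Si Sm] dzf[OF Wi Wm] eq[OF ab, of n] Wz by simp
  moreover have "(\<integral>x. D x * dzeta a0 b0 a b n x \<partial>ivl A B)
   = (\<integral>x. D x * bump a b n x \<partial>ivl A B) - bint a b n / bint a0 b0 0 * (\<integral>x. D x * bump a0 b0 0 x \<partial>ivl A B)"
  proof -
   have "(\<integral>x. D x * dzeta a0 b0 a b n x \<partial>ivl A B) = (\<integral>x. D x * bump a b n x - bint a b n / bint a0 b0 0 * (D x * bump a0 b0 0 x) \<partial>ivl A B)"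
    by (simp add: dzeta_def right_diff_distrib mult.left_commute)
   then show ?thesis using bi[OF Di Dm ab(3-5), of n] bi[OF Di Dm AB, of 0] by simp
  qed
  ultimately have "(\<integral>x. D x * bump a b n x \<partial>ivl A B) = k * bint a b n" by (simp add: k_def)
  moreover have "(\<integral>x. k * bump a b n x \<partial>ivl A B) = k * bint a b n"
   using integral_bump_restrict[of "%_. 1" A a b B n] ab by (simp add: bint_def)
  moreover have "(\<integral>x. (D x - k) * bump a b n x \<partial>ivl A B) = (\<integral>x. D x * bump a b n x \<partial>ivl A B) - (\<integral>x. k * bump a b n x \<partial>ivl A B)"
   unfolding left_diff_distrib using bi[OF Di Dm ab(3-5), of n] bump_integrable by (intro Bochner_Integration.integral_diff) auto
  ultimately show ?thesis by linarith
 qed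
 have "AE x in ivl A B. D x - k = 0"
 proof (rule AE_zero_of_intervals)
  show "(%x. D x - k) \<in> borel1" by measurable
  show i: "integrable (ivl a b) (%x. D x - k)" if "A < a" "a < b" "b < B" for a b using Di[OF that] by simp
  fix a b :: real assume ab: "a \<in> \<rat>" "b \<in> \<rat>" "A < a" "a < b" "b < B"
  have "(\<integral>x. (D x - k) * bump a b n x \<partial>ivl a b) = 0" for n
   using zero[OF ab, of n] integral_bump_restrict[of "%x. D x - k" A a b B n] ab by simp
  then show "(\<integral>x. D x - k \<partial>ivl a b) = 0"
   using integral_bump_limit[OF i[OF ab(3-5)]] by (simp add: LIMSEQ_const_iff)
 qed
 then have "AE x in ivl A B. S x = k + (\<integral>r. w r \<partial>ivl A x)"
  by eventually_elim (simp add: D_def Wf_def)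
 then show ?thesis by blast
qed

section \<open>Products of one-dimensional test functions\<close>

lemma product_has_derivative:
 fixes \<eta> \<psi> \<eta>' \<psi>' :: "real => real"
 assumes "\<And>x. (\<eta> has_real_derivative \<eta>' x) (at x)" "\<And>x. (\<psi> has_real_derivative \<psi>' x) (at x)"
 shows "((%w. \<eta> (fst w) * \<psi> (snd w)) has_derivative
  (%h. \<eta>' (fst w) * fst h * \<psi> (snd w) + \<eta> (fst w) * (\<psi>' (snd w) * snd h))) (at w)"
proof -
 have 1: "((%w. \<eta> (fst w)) has_derivative (%h. \<eta>' (fst w) * fst h)) (at w)"
  by (rule has_derivative_compose[of fst fst w UNIV \<eta> "%h. \<eta>' (fst w) * h"])
   (use assms(1) in \<open>auto intro!: derivative_intros simp: has_field_derivative_def\<close>)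
 have 2: "((%w. \<psi> (snd w)) has_derivative (%h. \<psi>' (snd w) * snd h)) (at w)"
  by (rule has_derivative_compose[of snd snd w UNIV \<psi> "%h. \<psi>' (snd w) * h"])
   (use assms(2) in \<open>auto intro!: derivative_intros simp: has_field_derivative_def\<close>)
 show ?thesis by (rule derivative_eq_intros 1 2 refl | simp add: algebra_simps fun_eq_iff)+
qed

lemma dir_deriv_product:
 fixes \<eta> \<psi> \<eta>' \<psi>' :: "real => real"
 assumes "\<And>x. (\<eta> has_real_derivative \<eta>' x) (at x)" "\<And>x. (\<psi> has_real_derivative \<psi>' x) (at x)"
 shows "dir_deriv (1, 0) (%w. \<eta> (fst w) * \<psi> (snd w)) w = \<eta>' (fst w) * \<psi> (snd w)"
  and "dir_deriv (0, 1) (%w. \<eta> (fst w) * \<psi> (snd w)) w = \<eta> (fst w) * \<psi>' (snd w)"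
proof -
 have e: "frechet_derivative (%w. \<eta> (fst w) * \<psi> (snd w)) (at w) =
  (%h. \<eta>' (fst w) * fst h * \<psi> (snd w) + \<eta> (fst w) * (\<psi>' (snd w) * snd h))"
  using frechet_derivative_at[OF product_has_derivative[OF assms, of w]] by (rule sym)
 show "dir_deriv (1, 0) (%w. \<eta> (fst w) * \<psi> (snd w)) w = \<eta>' (fst w) * \<psi> (snd w)"
  "dir_deriv (0, 1) (%w. \<eta> (fst w) * \<psi> (snd w)) w = \<eta> (fst w) * \<psi>' (snd w)"
  unfolding e by simp_all
qed

lemma C_order_product:
 "Cn k \<eta> ==> Cn k \<psi> ==> C_order k (%w :: real \<times> real. \<eta> (fst w) * \<psi> (snd w))"
proof (induction k arbitrary: \<eta> \<psi>)
 case 0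
 then show ?case by (auto intro!: continuous_intros intro: continuous_on_compose2[of UNIV])
next
 case (Suc k)
 then obtain \<eta>' \<psi>' where d: "\<And>x. (\<eta> has_real_derivative \<eta>' x) (at x)" "Cn k \<eta>'"
  "\<And>x. (\<psi> has_real_derivative \<psi>' x) (at x)" "Cn k \<psi>'" by auto
 have "Cn k \<eta>" "Cn k \<psi>" by (rule Cn_mono[OF Suc.prems(1)], rule Cn_mono[OF Suc.prems(2)])
 then have "C_order k (%w. \<eta>' (fst w) * \<psi> (snd w))" "C_order k (%w. \<eta> (fst w) * \<psi>' (snd w))"
  using Suc.IH d by auto
 moreover have "(%w. \<eta> (fst w) * \<psi> (snd w)) differentiable_on UNIV"
  using product_has_derivative[OF d(1,3)] by (auto simp: differentiable_on_def differentiable_def)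
 ultimately show ?case
  by (auto simp: Basis_prod_def dir_deriv_product[OF d(1,3)])
qed

lemma test_function_product:
 assumes "tfun a b \<eta>" "tfun c d \<psi>" "{a..b} \<times> {c..d} \<subseteq> U"
 shows "test_function U (%w. \<eta> (fst w) * \<psi> (snd w))"
proof -
 have sub: "closure {w :: real \<times> real. \<eta> (fst w) * \<psi> (snd w) \<noteq> 0} \<subseteq> {a..b} \<times> {c..d}"
  by (rule closure_minimal) (use assms in \<open>auto simp: tfun_def intro: closed_Times\<close>)
 moreover have "compact (closure {w :: real \<times> real. \<eta> (fst w) * \<psi> (snd w) \<noteq> 0})"
 proof (rule compact_closure[THEN iffD2])
  show "bounded {w :: real \<times> real. \<eta> (fst w) * \<psi> (snd w) \<noteq> 0}"
   using sub closure_subset bounded_subset[OF compact_imp_bounded[OF compact_Times[OF compact_Icc[of a b] compact_Icc[of c d]]]] by blast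
 qed
 moreover have "C_order k (%w. \<eta> (fst w) * \<psi> (snd w))" for k
  using assms by (intro C_order_product) (auto simp: tfun_def smooth_def)
 ultimately show ?thesis using assms(3) unfolding test_function_def by blast
qed

section \<open>Weak derivatives and their representatives\<close>

text \<open>The weak formulation lives on completed Lebesgue measure over open sets, the analysis on
  Borel densities. A Lebesgue measurable function agrees almost everywhere with a Borel one, and the
  lemmas from here on carry null sets, integrals and norms across.\<close>

lemma AE_lebesgue_on:
 fixes S :: "'a::euclidean_space set"
 assumes "open S"
 shows "(AE x in lebesgue_on S. Q x) \<longleftrightarrow> (AE x in density lborel (indicator S). Q x)"
proof -
 have [measurable]: "S \<in> sets borel" using assms by simp
 have "(AE x in lebesgue_on S. Q x) \<longleftrightarrow> (AE x in lebesgue. x \<in> S --> Q x)"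
  using assms by (intro AE_restrict_space_iff) auto
 also have "\<dots> \<longleftrightarrow> (AE x in lborel. x \<in> S --> Q x)" by (rule AE_completion_iff)
 also have "\<dots> \<longleftrightarrow> (AE x in density lborel (indicator S). Q x)"
 proof -
  have "0 < (indicator S x :: ennreal) \<longleftrightarrow> x \<in> S" for x by (simp add: indicator_def)
  then show ?thesis by (subst AE_density) auto
 qed
 finally show ?thesis .
qed

lemma borel_measurable_lebesgue_on:
 fixes f :: "'a::euclidean_space => real"
 assumes "f \<in> borel1"
 shows "f \<in> borel_measurable (lebesgue_on S)"
proof -
 have "f \<in> borel_measurable lebesgue" using assms by (intro measurable_completion) simp
 then show ?thesis by (rule measurable_restrict_space1)
qed

lemma lebesgue_on_borel:
 fixes f :: "'a::euclidean_space => real"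
 assumes S: "open S" and f: "f \<in> borel1"
 shows "integral\<^sup>L (lebesgue_on S) f = integral\<^sup>L (density lborel (indicator S)) f"
  and "integrable (lebesgue_on S) f \<longleftrightarrow> integrable (density lborel (indicator S)) f"
proof -
 have [measurable]: "S \<in> sets borel" using S by simp
 have D: "density lborel (indicator S) = density lborel (%x. ennreal (indicator S x))" by (simp add: ennreal_indicator)
 have m: "(%x. indicator S x * f x) \<in> borel1" using f by simp
 have "integral\<^sup>L (lebesgue_on S) f = (\<integral>x. indicator S x *\<^sub>R f x \<partial>lebesgue)"
  using S by (intro integral_restrict_space) auto
 also have "\<dots> = (\<integral>x. indicator S x * f x \<partial>lborel)" using m by (simp add: integral_completion)
 also have "\<dots> = integral\<^sup>L (density lborel (indicator S)) f" unfolding D using f by (simp add: integral_density)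
 finally show "integral\<^sup>L (lebesgue_on S) f = integral\<^sup>L (density lborel (indicator S)) f" .
 have "integrable (lebesgue_on S) f \<longleftrightarrow> integrable lebesgue (%x. indicator S x *\<^sub>R f x)"
  using S by (intro integrable_restrict_space) auto
 also have "\<dots> \<longleftrightarrow> integrable lborel (%x. indicator S x * f x)" using m by (simp add: integrable_completion)
 also have "\<dots> \<longleftrightarrow> integrable (density lborel (indicator S)) f" unfolding D using f by (simp add: integrable_density)
 finally show "integrable (lebesgue_on S) f \<longleftrightarrow> integrable (density lborel (indicator S)) f" .
qed

lemma lebesgue_on_AE_borel:
 fixes f f' :: "'a::euclidean_space => real"
 assumes S: "open S" and f: "f \<in> borel_measurable (lebesgue_on S)" and f': "f' \<in> borel1"
  and ae: "AE x in density lborel (indicator S). f x = f' x"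
 shows "integral\<^sup>L (lebesgue_on S) f = integral\<^sup>L (density lborel (indicator S)) f'"
  and "integrable (lebesgue_on S) f \<longleftrightarrow> integrable (density lborel (indicator S)) f'"
proof -
 have ae': "AE x in lebesgue_on S. f x = f' x" using ae AE_lebesgue_on[OF S] by blast
 show "integral\<^sup>L (lebesgue_on S) f = integral\<^sup>L (density lborel (indicator S)) f'"
  using integral_cong_AE[OF f borel_measurable_lebesgue_on[OF f'] ae'] lebesgue_on_borel(1)[OF S f'] by simp
 show "integrable (lebesgue_on S) f \<longleftrightarrow> integrable (density lborel (indicator S)) f'"
  using integrable_cong_AE[OF f borel_measurable_lebesgue_on[OF f'] ae'] lebesgue_on_borel(2)[OF S f'] by simp
qed

lemma lebesgue_on_ex_borel:
 fixes f :: "'a::euclidean_space => real"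
 assumes S: "open S" and f: "f \<in> borel_measurable (lebesgue_on S)"
 obtains f' where "f' \<in> borel1" "AE x in density lborel (indicator S). f x = f' x"
proof -
 have [measurable]: "S \<in> sets borel" using S by simp
 have "(%x. if x \<in> S then f x else 0) \<in> borel_measurable lebesgue"
  using f S by (subst borel_measurable_if) auto
 then obtain f' where f': "f' \<in> borel_measurable lborel" "AE x in lborel. (if x \<in> S then f x else 0) = f' x"
  using completion_ex_borel_measurable_real by blast
 have "AE x in density lborel (indicator S). f x = f' x"
 proof -
  have "0 < (indicator S x :: ennreal) \<longleftrightarrow> x \<in> S" for x by (simp add: indicator_def)
  moreover have "AE x in lborel. x \<in> S --> f x = f' x" using f'(2) by eventually_elim auto
  ultimately show ?thesis by (subst AE_density) auto
 qed
 then show ?thesis using f'(1) that by simp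
qed

lemma lebesgue_on_L2:
 fixes f f' :: "'a::euclidean_space => real"
 assumes S: "open S" and f: "in_L2 (lebesgue_on S) f" and f': "f' \<in> borel1"
  and ae: "AE x in density lborel (indicator S). f x = f' x"
 shows "in_L2 (density lborel (indicator S)) f'" "L2_norm (lebesgue_on S) f = L2_norm (density lborel (indicator S)) f'"
proof -
 have m: "(%x. (f x)\<^sup>2) \<in> borel_measurable (lebesgue_on S)" "(%x. (f' x)\<^sup>2) \<in> borel1"
  using in_L2_measurable[OF f] f' by auto
 have ae2: "AE x in density lborel (indicator S). (f x)\<^sup>2 = (f' x)\<^sup>2" using ae by eventually_elim simp
 show "in_L2 (density lborel (indicator S)) f'"
  using lebesgue_on_AE_borel(2)[OF S m ae2] f f' by (simp add: in_L2_def)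
 show "L2_norm (lebesgue_on S) f = L2_norm (density lborel (indicator S)) f'"
  using lebesgue_on_AE_borel(1)[OF S m ae2] by (simp add: L2_norm_def)
qed

lemma open_box: "open ({a<..<b::real} \<times> {c<..<d::real})" by (intro open_Times) auto

lemma ivl_unfold: "density lborel (indicator {a<..<b}) = ivl a b" by (simp add: ivl_def)

lemma cyl_unfold: "density lborel (indicator ({a<..<b} \<times> {c<..<d})) = ivl a b \<Otimes>\<^sub>M ivl c d" by (simp add: ivl2_density)

lemmas ivl_AE_leb = AE_lebesgue_on[OF open_greaterThanLessThan[where 'a=real], unfolded ivl_unfold]
lemmas ivl_leb_ex = lebesgue_on_ex_borel[OF open_greaterThanLessThan[where 'a=real], unfolded ivl_unfold]
lemmas ivl_leb_L2 = lebesgue_on_L2[OF open_greaterThanLessThan[where 'a=real], unfolded ivl_unfold]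
lemmas ivl_leb_int = lebesgue_on_AE_borel[OF open_greaterThanLessThan[where 'a=real], unfolded ivl_unfold]
lemmas cyl_AE_leb = AE_lebesgue_on[OF open_box, unfolded cyl_unfold]
lemmas cyl_leb_ex = lebesgue_on_ex_borel[OF open_box, unfolded cyl_unfold]
lemmas cyl_leb_L2 = lebesgue_on_L2[OF open_box, unfolded cyl_unfold]
lemmas cyl_leb_int = lebesgue_on_AE_borel[OF open_box, unfolded cyl_unfold]

text \<open>Local integrability yields measurability on compact subsets only; the box is exhausted
  by the compact boxes \<open>K n\<close>, and the truncations converge pointwise.\<close>

lemma locally_integrable_box_measurable:
 fixes f :: "real \<times> real => real"
 assumes f: "locally_integrable ({a<..<b} \<times> {c<..<d}) f"
 shows "f \<in> borel_measurable (lebesgue_on ({a<..<b} \<times> {c<..<d}))"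
proof -
 let ?U = "{a<..<b} \<times> {c<..<d}"
 define K where "K n = {a + inverse (Suc n)..b - inverse (Suc n)} \<times> {c + inverse (Suc n)..d - inverse (Suc n)}" for n
 have K: "compact (K n)" "K n \<subseteq> ?U" for n
 proof -
  show "compact (K n)" unfolding K_def by (intro compact_Times compact_Icc)
  have "{x + h..y - h} \<subseteq> {x<..<y}" if "0 < h" for x y h :: real using that by auto
  then show "K n \<subseteq> ?U" unfolding K_def by (intro Sigma_mono) simp_all
 qed
 have Kb: "K n \<in> sets borel" for n using compact_imp_closed[OF K(1)[of n]] by simp
 have "(%x. if x \<in> K n then f x else 0) \<in> borel_measurable lebesgue" for n
 proof -
  have "f \<in> borel_measurable (lebesgue_on (K n))"
   using f K[of n] by (auto simp: locally_integrable_def dest: borel_measurable_integrable)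
  then show ?thesis using Kb[of n] by (subst borel_measurable_if) auto
 qed
 moreover have "(%n. if x \<in> K n then f x else 0) \<longlonglongrightarrow> (if x \<in> ?U then f x else 0)" for x
 proof (cases "x \<in> ?U")
  case True
  then obtain y t where x: "x = (y, t)" "a < y" "y < b" "c < t" "t < d" by auto
  have lim: "(%n. inverse (real (Suc n))) \<longlonglongrightarrow> 0" by (rule LIMSEQ_inverse_real_of_nat)
  have "\<forall>\<^sub>F n in sequentially. inverse (real (Suc n)) < min (min (y - a) (b - y)) (min (t - c) (d - t))"
   using x by (intro order_tendstoD(2)[OF lim]) auto
  then have "\<forall>\<^sub>F n in sequentially. (if x \<in> K n then f x else 0) = f x"
   by eventually_elim (use x in \<open>auto simp: K_def simp del: of_nat_Suc\<close>)
  note l = tendsto_eventually[OF this]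
  have e: "(if x \<in> ?U then f x else 0) = f x" using True by simp
  show ?thesis unfolding e by (rule l)
 next
  case False
  then have "(if x \<in> K n then f x else 0) = 0" for n using K(2)[of n] by auto
  then show ?thesis using False by simp
 qed
 ultimately have "(%x. if x \<in> ?U then f x else 0) \<in> borel_measurable lebesgue"
  by - (rule borel_measurable_LIMSEQ_real)
 moreover have "?U \<in> sets lebesgue" using open_box[of a b c d] by simp
 ultimately show ?thesis by (subst (asm) borel_measurable_if) auto
qed

lemma locally_integrable_box:
 fixes f :: "real \<times> real => real"
 assumes f: "locally_integrable U f" and sub: "{a..b} \<times> {c..d} \<subseteq> U"
  and f': "f' \<in> borel1" and ae: "AE w in ivl a b \<Otimes>\<^sub>M ivl c d. f w = f' w"
 shows "integrable (ivl a b \<Otimes>\<^sub>M ivl c d) f'"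
proof -
 have "compact ({a..b} \<times> {c..d})" by (intro compact_Times compact_Icc)
 then have "integrable (lebesgue_on ({a..b} \<times> {c..d})) f" using f sub by (auto simp: locally_integrable_def)
 then have i: "integrable (lebesgue_on ({a<..<b} \<times> {c<..<d})) f"
 proof -
  have 1: "{a..b} \<times> {c..d} \<in> sets lebesgue" "{a<..<b} \<times> {c<..<d} \<in> sets lebesgue"
   using closed_Times[of "{a..b}" "{c..d}"] open_box[of a b c d] by auto
  assume "integrable (lebesgue_on ({a..b} \<times> {c..d})) f"
  then have "integrable lebesgue (%x. indicator ({a..b} \<times> {c..d}) x *\<^sub>R f x)"
   using 1 by (subst (asm) integrable_restrict_space) auto
  from integrable_mult_indicator[OF 1(2) this]
  have "integrable lebesgue (%x. indicator ({a<..<b} \<times> {c<..<d}) x *\<^sub>R f x)"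
   by (rule back_subst[of "integrable lebesgue"]) (auto simp: indicator_def fun_eq_iff)
  then show ?thesis using 1 by (subst integrable_restrict_space) auto
 qed
 then show ?thesis
  using cyl_leb_int(2)[OF _ f' ae] borel_measurable_integrable by blast
qed

text \<open>\<open>Q\<close> is an arbitrary property, so for the second claim the order of the
  variables is exchanged for a measurable null set containing all exceptional points.\<close>

lemma AE_slices:
 assumes Q: "AE w in ivl a b \<Otimes>\<^sub>M ivl c d. Q w"
 shows "AE y in ivl a b. AE t in ivl c d. Q (y, t)" "AE t in ivl c d. AE y in ivl a b. Q (y, t)"
proof -
 show "AE y in ivl a b. AE t in ivl c d. Q (y, t)" using ivl2.AE_pair[OF Q] .
 obtain N where N: "N \<in> null_sets (ivl a b \<Otimes>\<^sub>M ivl c d)" "{w. \<not> Q w} \<subseteq> N"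
  using Q by (auto simp: eventually_ae_filter space_pair_measure)
 have [measurable]: "N \<in> sets (ivl a b \<Otimes>\<^sub>M ivl c d)" using N(1) by auto
 have "AE y in ivl a b. AE t in ivl c d. (y, t) \<notin> N"
  using ivl2.AE_pair[OF AE_not_in[OF N(1)]] .
 moreover have "(AE y in ivl a b. AE t in ivl c d. (y, t) \<notin> N) \<longleftrightarrow> (AE t in ivl c d. AE y in ivl a b. (y, t) \<notin> N)"
 proof (rule ivl2.AE_commute)
  have "{w \<in> space (ivl a b \<Otimes>\<^sub>M ivl c d). (fst w, snd w) \<notin> N} = space (ivl a b \<Otimes>\<^sub>M ivl c d) - N" by auto
  then show "{w \<in> space (ivl a b \<Otimes>\<^sub>M ivl c d). (fst w, snd w) \<notin> N} \<in> sets (ivl a b \<Otimes>\<^sub>M ivl c d)"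
   using sets.Diff[OF sets.top \<open>N \<in> sets (ivl a b \<Otimes>\<^sub>M ivl c d)\<close>] by (simp only:)
 qed
 ultimately have "AE t in ivl c d. AE y in ivl a b. (y, t) \<notin> N" by simp
 then show "AE t in ivl c d. AE y in ivl a b. Q (y, t)"
 proof eventually_elim
  case (elim t) then show ?case by eventually_elim (use N(2) in blast)
 qed
qed

lemma AE_of_slices:
 assumes m: "Measurable.pred (borel \<Otimes>\<^sub>M borel) (%w. Q (fst w) (snd w))"
 shows "AE y in ivl a b. AE t in ivl c d. Q y t ==> AE w in ivl a b \<Otimes>\<^sub>M ivl c d. Q (fst w) (snd w)"
  and "AE t in ivl c d. AE y in ivl a b. Q y t ==> AE w in ivl a b \<Otimes>\<^sub>M ivl c d. Q (fst w) (snd w)"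
proof -
 have s: "sets (ivl a b \<Otimes>\<^sub>M ivl c d) = sets (borel \<Otimes>\<^sub>M borel)" by (intro sets_pair_measure_cong) simp_all
 have m': "Measurable.pred (ivl a b \<Otimes>\<^sub>M ivl c d) (%w. Q (fst w) (snd w))"
  using m measurable_cong_sets[OF s refl] by blast
 show 1: "AE w in ivl a b \<Otimes>\<^sub>M ivl c d. Q (fst w) (snd w)" if "AE y in ivl a b. AE t in ivl c d. Q y t"
  by (rule ivl2.AE_pair_measure) (use m' that in \<open>auto simp: pred_def\<close>)
 show "AE w in ivl a b \<Otimes>\<^sub>M ivl c d. Q (fst w) (snd w)" if "AE t in ivl c d. AE y in ivl a b. Q y t"
 proof (rule 1)
  have "(AE y in ivl a b. AE t in ivl c d. Q y t) \<longleftrightarrow> (AE t in ivl c d. AE y in ivl a b. Q y t)"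
   by (rule ivl2.AE_commute) (use m' in \<open>simp add: pred_def\<close>)
  then show "AE y in ivl a b. AE t in ivl c d. Q y t" using that by simp
 qed
qed

lemma continuous_AE_eq:
 fixes f g :: "real => real"
 assumes f: "continuous_on S f" and g: "continuous_on S g" and S: "{a<..<b} \<subseteq> S" "S \<subseteq> {a..b}"
  and ab: "a < b" and ae: "AE x in ivl a b. f x = g x" and t: "t \<in> S"
 shows "f t = g t"
proof (rule ccontr)
 assume ne: "f t \<noteq> g t"
 have "((%x. f x - g x) \<longlongrightarrow> f t - g t) (at t within S)"
  using f g t by (intro tendsto_diff) (auto simp: continuous_on_def)
 then have "\<forall>\<^sub>F x in at t within S. f x - g x \<noteq> 0"
  using ne by (intro tendsto_imp_eventually_ne) auto
 then obtain e where e: "0 < e" "\<And>x. x \<in> S ==> x \<noteq> t ==> dist x t < e ==> f x - g x \<noteq> 0"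
  by (auto simp: eventually_at)
 have "max a (t - e) < min b (t + e)" using t S(2) e(1) ab by auto
 moreover have "AE x in ivl (max a (t - e)) (min b (t + e)). f x = g x" by (rule AE_ivl_subset[OF ae]) auto
 ultimately obtain x where "max a (t - e) < x" "x < min b (t + e)" "f x = g x" using AE_ivl_exists by blast
 then have "x \<in> S" "dist x t < e" "f x = g x" using S(1) by (auto simp: dist_real_def abs_less_iff)
 then show False using e(2)[of x] ne by (cases "x = t") auto
qed

lemma AE_zero_of_bumps:
 fixes D :: "real => real"
 assumes D: "D \<in> borel1"
  and i: "\<And>a b. A < a ==> a < b ==> b < B ==> integrable (ivl a b) D"
  and 0: "\<And>a b n. a \<in> \<rat> ==> b \<in> \<rat> ==> A < a ==> a < b ==> b < B ==> (\<integral>x. D x * bump a b n x \<partial>ivl A B) = 0"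
 shows "AE x in ivl A B. D x = 0"
proof (rule AE_zero_of_intervals[OF D i])
 fix a b :: real assume ab: "a \<in> \<rat>" "b \<in> \<rat>" "A < a" "a < b" "b < B"
 have "(\<integral>x. D x * bump a b n x \<partial>ivl a b) = 0" for n
  using 0[OF ab, of n] integral_bump_restrict[OF D, of A a b B n] ab by simp
 then show "integral\<^sup>L (ivl a b) D = 0"
  using integral_bump_limit[OF i[OF ab(3-5)]] by (simp add: LIMSEQ_const_iff)
qed

lemma integrable_product_box:
 fixes f :: "real => real => real"
 assumes f: "integrable (ivl a b \<Otimes>\<^sub>M ivl c d) (case_prod f)"
  and [measurable]: "\<eta> \<in> borel1" "\<psi> \<in> borel1"
  and bd: "\<And>x. \<bar>\<eta> x\<bar> \<le> B1" "\<And>x. \<bar>\<psi> x\<bar> \<le> B2"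
  and \<eta>0: "\<And>x. A < x ==> x < B ==> \<not> (a < x \<and> x < b) ==> \<eta> x = 0"
  and \<psi>0: "\<And>x. C < x ==> x < D ==> \<not> (c < x \<and> x < d) ==> \<psi> x = 0"
 shows "integrable (ivl A B \<Otimes>\<^sub>M ivl C D) (%w. case_prod f w * (\<eta> (fst w) * \<psi> (snd w)))"
  and "(\<integral>w. case_prod f w * (\<eta> (fst w) * \<psi> (snd w)) \<partial>(ivl A B \<Otimes>\<^sub>M ivl C D))
   = (\<integral>t. (\<integral>y. f y t * \<eta> y \<partial>ivl A B) * \<psi> t \<partial>ivl C D)"
  and "integrable (ivl C D) (%t. (\<integral>y. f y t * \<eta> y \<partial>ivl A B) * \<psi> t)"
proof -
 have fm: "case_prod f \<in> borel1" using borel_measurable_integrable[OF f] by (simp add: borel_prod_real)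
 have [measurable]: "case_prod f \<in> borel2" using fm by (simp add: borel_prod_real)
 have m: "(%w. case_prod f w * (\<eta> (fst w) * \<psi> (snd w))) \<in> borel1"
  unfolding borel_prod_real[symmetric] by measurable
 have B: "0 \<le> B1" "0 \<le> B2" using order_trans[OF abs_ge_zero bd(1)] order_trans[OF abs_ge_zero bd(2)] by auto
 have "integrable lborel (%w. B1 * B2 * (indicator ({a<..<b} \<times> {c<..<d}) w * case_prod f w))"
  using f unfolding integrable_ivl2[OF fm] by simp
 then show i: "integrable (ivl A B \<Otimes>\<^sub>M ivl C D) (%w. case_prod f w * (\<eta> (fst w) * \<psi> (snd w)))"
  unfolding integrable_ivl2[OF m]
 proof (rule Bochner_Integration.integrable_bound)
  show "(%w. indicator ({A<..<B} \<times> {C<..<D}) w * (case_prod f w * (\<eta> (fst w) * \<psi> (snd w)))) \<in> borel_measurable lborel"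
   unfolding measurable_lborel2 by (rule borel_measurable_times[OF borel_measurable_indicator[OF borel_open[OF open_box]] m])
  show "AE w in lborel. norm (indicator ({A<..<B} \<times> {C<..<D}) w * (case_prod f w * (\<eta> (fst w) * \<psi> (snd w))))
    \<le> norm (B1 * B2 * (indicator ({a<..<b} \<times> {c<..<d}) w * case_prod f w))"
  proof (rule AE_I2)
   fix w :: "real \<times> real"
   obtain y t where w: "w = (y, t)" by fastforce
   have "\<bar>f y t\<bar> * (\<bar>\<eta> y\<bar> * \<bar>\<psi> t\<bar>) \<le> \<bar>f y t\<bar> * (B1 * B2)"
    using bd B by (intro mult_left_mono mult_mono) auto
   then show "norm (indicator ({A<..<B} \<times> {C<..<D}) w * (case_prod f w * (\<eta> (fst w) * \<psi> (snd w))))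
    \<le> norm (B1 * B2 * (indicator ({a<..<b} \<times> {c<..<d}) w * case_prod f w))"
    using \<eta>0[of y] \<psi>0[of t] B by (auto simp: w indicator_def abs_mult mult.commute)
  qed
 qed
 have i': "integrable (ivl A B \<Otimes>\<^sub>M ivl C D) (case_prod (%y t. f y t * \<eta> y * \<psi> t))"
  using i by (simp add: case_prod_beta' mult.assoc)
 show "integrable (ivl C D) (%t. (\<integral>y. f y t * \<eta> y \<partial>ivl A B) * \<psi> t)"
  using ivl2.integrable_snd[OF i'] by simp
 show "(\<integral>w. case_prod f w * (\<eta> (fst w) * \<psi> (snd w)) \<partial>(ivl A B \<Otimes>\<^sub>M ivl C D))
   = (\<integral>t. (\<integral>y. f y t * \<eta> y \<partial>ivl A B) * \<psi> t \<partial>ivl C D)"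
 proof -
  have "(%w. case_prod f w * (\<eta> (fst w) * \<psi> (snd w))) = (%(y, t). f y t * \<eta> y * \<psi> t)"
   by (auto simp: fun_eq_iff)
  then show ?thesis using ivl2.integral_snd[OF i'] by simp
 qed
qed

lemma tfun_bound:
 assumes "tfun a b f" shows "\<exists>B. \<forall>x. \<bar>f x\<bar> \<le> B"
 using tfun_bounded[OF assms] by metis

text \<open>Turns a weak derivative in the plane into a one-dimensional identity for pairings. In
  \<open>dd\<close> the direction \<open>v\<close> is left open and the factors
  \<open>\<eta>'\<close>, \<open>\<psi>'\<close> may be the functions themselves or their
  derivatives, so that time and space derivatives are covered at once.\<close>

lemma weak_deriv_product:
 fixes f k :: "real => real => real"
 assumes W: "weak_deriv (cylinder T) v f0 k0"
  and f: "case_prod f \<in> borel1" "AE w in cyl T. f0 w = case_prod f w"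
  and k: "case_prod k \<in> borel1" "AE w in cyl T. k0 w = case_prod k w"
  and \<eta>: "tfun a b \<eta>" "tfun a b \<eta>'" "0 < a" "b < 1"
  and \<psi>: "tfun c d \<psi>" "tfun c d \<psi>'" "0 < c" "d < T"
  and dd: "\<And>w. dir_deriv v (%w. \<eta> (fst w) * \<psi> (snd w)) w = \<eta>' (fst w) * \<psi>' (snd w)"
 shows "integrable (ivl 0 T) (%t. (\<integral>y. f y t * \<eta>' y \<partial>ivl 0 1) * \<psi>' t)"
  and "integrable (ivl 0 T) (%t. (\<integral>y. k y t * \<eta> y \<partial>ivl 0 1) * \<psi> t)"
  and "(\<integral>t. (\<integral>y. f y t * \<eta>' y \<partial>ivl 0 1) * \<psi>' t \<partial>ivl 0 T) = - (\<integral>t. (\<integral>y. k y t * \<eta> y \<partial>ivl 0 1) * \<psi> t \<partial>ivl 0 T)"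
proof -
 \<comment> \<open>A slightly larger box: its closure is still compact in the open cylinder, so the
   functions are integrable there, and the test functions vanish outside it.\<close>
 define a' b' c' d' where "a' = a / 2" and "b' = (b + 1) / 2" and "c' = c / 2" and "d' = (d + T) / 2"
 have box: "{a'..b'} \<times> {c'..d'} \<subseteq> cylinder T" and lt: "a' < a" "b < b'" "c' < c" "d < d'"
  "0 \<le> a'" "b' \<le> 1" "0 \<le> c'" "d' \<le> T"
  using \<eta>(3,4) \<psi>(3,4) by (auto simp: a'_def b'_def c'_def d'_def)
 have li: "locally_integrable (cylinder T) f0" "locally_integrable (cylinder T) k0" using W by (auto simp: weak_deriv_def)
 have z: "g x = 0" if "tfun l r g" "l' < l" "r < r'" "\<not> (l' < x \<and> x < r')" for l r l' r' x g
  using that by (auto simp: tfun_def)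
 have *: "integrable (ivl 0 T) (%t. (\<integral>y. h y t * \<alpha> y \<partial>ivl 0 1) * \<beta> t)"
  "(\<integral>w. h0 w * (\<alpha> (fst w) * \<beta> (snd w)) \<partial>lebesgue_on (cylinder T)) = (\<integral>t. (\<integral>y. h y t * \<alpha> y \<partial>ivl 0 1) * \<beta> t \<partial>ivl 0 T)"
  if h0: "locally_integrable (cylinder T) h0" and h: "case_prod h \<in> borel1"
   "AE w in cyl T. h0 w = case_prod h w" and \<alpha>: "tfun a b \<alpha>" and \<beta>: "tfun c d \<beta>"
  for h0 h and \<alpha> \<beta> :: "real => real"
 proof -
  have m[measurable]: "\<alpha> \<in> borel1" "\<beta> \<in> borel1"
   using tfun_measurable \<alpha> \<beta> by auto
  obtain B1 B2 where B: "\<And>x. \<bar>\<alpha> x\<bar> \<le> B1" "\<And>x. \<bar>\<beta> x\<bar> \<le> B2" using tfun_bound \<alpha> \<beta> by metis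
  have "AE w in ivl a' b' \<Otimes>\<^sub>M ivl c' d'. h0 w = case_prod h w"
   using h(2) lt unfolding AE_ivl2 by (auto elim!: eventually_mono)
  from locally_integrable_box[OF h0 box h(1) this]
  have i: "integrable (ivl a' b' \<Otimes>\<^sub>M ivl c' d') (case_prod h)" .
  note r = integrable_product_box[OF i m B z[OF \<alpha> lt(1,2)] z[OF \<beta> lt(3,4)], where A=0 and B=1 and C=0 and D=T]
  show "integrable (ivl 0 T) (%t. (\<integral>y. h y t * \<alpha> y \<partial>ivl 0 1) * \<beta> t)" by (rule r(3))
  have p: "(%w :: real \<times> real. \<alpha> (fst w) * \<beta> (snd w)) \<in> borel1"
   unfolding borel_prod_real[symmetric] by measurable
  have "(\<integral>w. h0 w * (\<alpha> (fst w) * \<beta> (snd w)) \<partial>lebesgue_on (cylinder T))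
   = (\<integral>w. case_prod h w * (\<alpha> (fst w) * \<beta> (snd w)) \<partial>cyl T)"
  proof (rule cyl_leb_int(1))
   show "(%w. h0 w * (\<alpha> (fst w) * \<beta> (snd w))) \<in> borel_measurable (lebesgue_on (cylinder T))"
    using locally_integrable_box_measurable[OF h0] borel_measurable_lebesgue_on[OF p] by simp
   show "(%w. case_prod h w * (\<alpha> (fst w) * \<beta> (snd w))) \<in> borel1" using h(1) p by simp
   show "AE w in cyl T. h0 w * (\<alpha> (fst w) * \<beta> (snd w)) = case_prod h w * (\<alpha> (fst w) * \<beta> (snd w))"
    using h(2) by eventually_elim simp
  qed
  also have "\<dots> = (\<integral>t. (\<integral>y. h y t * \<alpha> y \<partial>ivl 0 1) * \<beta> t \<partial>ivl 0 T)" by (rule r(2))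
  finally show "(\<integral>w. h0 w * (\<alpha> (fst w) * \<beta> (snd w)) \<partial>lebesgue_on (cylinder T)) = (\<integral>t. (\<integral>y. h y t * \<alpha> y \<partial>ivl 0 1) * \<beta> t \<partial>ivl 0 T)" .
 qed
 note rf = *[OF li(1) f \<eta>(2) \<psi>(2)] and rk = *[OF li(2) k \<eta>(1) \<psi>(1)]
 show "integrable (ivl 0 T) (%t. (\<integral>y. f y t * \<eta>' y \<partial>ivl 0 1) * \<psi>' t)" by (rule rf(1))
 show "integrable (ivl 0 T) (%t. (\<integral>y. k y t * \<eta> y \<partial>ivl 0 1) * \<psi> t)" by (rule rk(1))
 have "test_function (cylinder T) (%w. \<eta> (fst w) * \<psi> (snd w))"
  by (rule test_function_product[OF \<eta>(1) \<psi>(1)]) (use \<eta>(3,4) \<psi>(3,4) in auto)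
 then have "(\<integral>w. f0 w * dir_deriv v (%w. \<eta> (fst w) * \<psi> (snd w)) w \<partial>lebesgue_on (cylinder T))
  = - (\<integral>w. k0 w * (\<eta> (fst w) * \<psi> (snd w)) \<partial>lebesgue_on (cylinder T))"
  using W unfolding weak_deriv_def by blast
 then show "(\<integral>t. (\<integral>y. f y t * \<eta>' y \<partial>ivl 0 1) * \<psi>' t \<partial>ivl 0 T) = - (\<integral>t. (\<integral>y. k y t * \<eta> y \<partial>ivl 0 1) * \<psi> t \<partial>ivl 0 T)"
  unfolding dd rf(2) rk(2) .
qed

section \<open>Functions with a weak time derivative as indefinite integrals\<close>

lemma L2_continuous_borel:
 assumes F: "L2_continuous_in_time J F"
 shows "\<exists>G. \<forall>t\<in>J. in_L2 (ivl 0 1) (%y. G y t) \<and> (AE y in ivl 0 1. F y t = G y t) \<and>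
  ((%s. L2_norm (ivl 0 1) (%y. G y s - G y t)) \<longlongrightarrow> 0) (at t within J)"
proof -
 have "\<forall>t\<in>J. \<exists>h. h \<in> borel1 \<and> (AE y in ivl 0 1. F y t = h y)"
 proof
  fix t assume "t \<in> J"
  then have m: "(%y. F y t) \<in> borel_measurable unit_space"
   using F in_L2_measurable by (auto simp: L2_continuous_in_time_def)
  obtain h where "h \<in> borel1" "AE y in ivl 0 1. F y t = h y" using ivl_leb_ex[OF m] by metis
  then show "\<exists>h. h \<in> borel1 \<and> (AE y in ivl 0 1. F y t = h y)" by blast
 qed
 then obtain H where H: "\<And>t. t \<in> J ==> H t \<in> borel1" "\<And>t. t \<in> J ==> AE y in ivl 0 1. F y t = H t y"
  by metis
 have FL: "in_L2 unit_space (%y. F y t)" if "t \<in> J" for t using F that by (auto simp: L2_continuous_in_time_def)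
 show ?thesis
 proof (intro exI[of _ "%y t. H t y"] ballI conjI)
  show "in_L2 (ivl 0 1) (%y. H t y)" if "t \<in> J" for t using ivl_leb_L2(1)[OF FL H] that by simp
  show "AE y in ivl 0 1. F y t = H t y" if "t \<in> J" for t using H(2) that by simp
  show "((%s. L2_norm (ivl 0 1) (%y. H s y - H t y)) \<longlongrightarrow> 0) (at t within J)" if t: "t \<in> J" for t
  proof (rule Lim_transform_eventually)
   show "((%s. L2_norm unit_space (%y. F y s - F y t)) \<longlongrightarrow> 0) (at t within J)"
    using F t by (auto simp: L2_continuous_in_time_def)
   have "L2_norm unit_space (%y. F y s - F y t) = L2_norm (ivl 0 1) (%y. H s y - H t y)" if s: "s \<in> J" for s
   proof (rule ivl_leb_L2(2))
    show "in_L2 unit_space (%y. F y s - F y t)" using FL s t by (intro in_L2_diff) auto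
    show "(%y. H s y - H t y) \<in> borel1" using H(1) s t by simp
    show "AE y in ivl 0 1. F y s - F y t = H s y - H t y" using H(2)[OF s] H(2)[OF t] by eventually_elim simp
   qed
   then show "\<forall>\<^sub>F s in at t within J. L2_norm unit_space (%y. F y s - F y t) = L2_norm (ivl 0 1) (%y. H s y - H t y)"
    by (auto simp: eventually_at intro!: exI[of _ 1])
  qed
 qed
qed

lemma continuous_on_pairing:
 assumes G: "\<And>t. t \<in> J ==> in_L2 (ivl 0 1) (%y. G y t)"
  and c: "\<And>t. t \<in> J ==> ((%s. L2_norm (ivl 0 1) (%y. G y s - G y t)) \<longlongrightarrow> 0) (at t within J)"
  and h: "in_L2 (ivl 0 1) h"
 shows "continuous_on J (%t. \<integral>y. G y t * h y \<partial>ivl 0 1)"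
 unfolding continuous_on_def
proof
 fix t assume t: "t \<in> J"
 have "((%s. (\<integral>y. G y s * h y \<partial>ivl 0 1) - (\<integral>y. G y t * h y \<partial>ivl 0 1)) \<longlongrightarrow> 0) (at t within J)"
 proof (rule Lim_null_comparison)
  have "norm ((\<integral>y. G y s * h y \<partial>ivl 0 1) - (\<integral>y. G y t * h y \<partial>ivl 0 1)) \<le> L2_norm (ivl 0 1) (%y. G y s - G y t) * L2_norm (ivl 0 1) h"
   if s: "s \<in> J" for s
  proof -
   have "(\<integral>y. G y s * h y \<partial>ivl 0 1) - (\<integral>y. G y t * h y \<partial>ivl 0 1) = (\<integral>y. (G y s - G y t) * h y \<partial>ivl 0 1)"
    using in_L2_mult_integrable[OF G[OF s] h] in_L2_mult_integrable[OF G[OF t] h] by (simp add: left_diff_distrib)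
   then show ?thesis using Cauchy_Schwarz_L2[OF in_L2_diff[OF G[OF s] G[OF t]] h] by simp
  qed
  then show "\<forall>\<^sub>F s in at t within J. norm ((\<integral>y. G y s * h y \<partial>ivl 0 1) - (\<integral>y. G y t * h y \<partial>ivl 0 1)) \<le> L2_norm (ivl 0 1) (%y. G y s - G y t) * L2_norm (ivl 0 1) h"
   unfolding eventually_at_filter by (intro always_eventually allI impI) blast
  show "((%s. L2_norm (ivl 0 1) (%y. G y s - G y t) * L2_norm (ivl 0 1) h) \<longlongrightarrow> 0) (at t within J)"
   using c[OF t] by (rule tendsto_mult_left_zero)
 qed
 then show "((%s. \<integral>y. G y s * h y \<partial>ivl 0 1) \<longlongrightarrow> (\<integral>y. G y t * h y \<partial>ivl 0 1)) (at t within J)"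
  by (simp add: LIM_zero_iff)
qed

lemma tfun_L2: "tfun a b \<eta> ==> in_L2 (ivl c d) \<eta>"
proof -
 assume \<eta>: "tfun a b \<eta>"
 obtain B where "\<And>x. \<bar>\<eta> x\<bar> \<le> B" using tfun_bound[OF \<eta>] by blast
 then show ?thesis using tfun_measurable[OF \<eta>] by (intro ivl.in_L2_bounded[where C=B]) auto
qed


lemma L2_slices:
 fixes k :: "real => real => real"
 assumes k: "in_L2 (ivl a b \<Otimes>\<^sub>M ivl c d) (case_prod k)"
 shows "integrable (ivl a b \<Otimes>\<^sub>M ivl c d) (case_prod k)"
  and "AE y in ivl a b. integrable (ivl c d) (k y)" and "AE t in ivl c d. integrable (ivl a b) (%y. k y t)"
proof -
 show i: "integrable (ivl a b \<Otimes>\<^sub>M ivl c d) (case_prod k)"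
  by (rule finite_measure.in_L2_integrable[OF finite_measure_ivl2 k])
 show "AE y in ivl a b. integrable (ivl c d) (k y)" using ivl2.AE_integrable_fst[OF i] .
 show "AE t in ivl c d. integrable (ivl a b) (%y. k y t)" using ivl2.AE_integrable_snd[OF i] .
qed

lemma pred_eq_borel:
 fixes f g :: "'a => real"
 shows "f \<in> borel_measurable M ==> g \<in> borel_measurable M ==> Measurable.pred M (%w. f w = g w)"
 unfolding pred_def by (rule borel_measurable_eq)

lemma integrable_slab:
 fixes f :: "real => real => real"
 assumes f: "integrable (ivl a b \<Otimes>\<^sub>M ivl C D) (case_prod f)" "\<eta> \<in> borel1" "\<And>x. \<bar>\<eta> x\<bar> \<le> B1"
  and z: "\<And>x. A < x ==> x < B ==> \<not> (a < x \<and> x < b) ==> \<eta> x = 0"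
 shows "integrable (ivl A B \<Otimes>\<^sub>M ivl C D) (case_prod (%y t. f y t * \<eta> y))"
  and "integrable (ivl C D) (%t. \<integral>y. f y t * \<eta> y \<partial>ivl A B)"
proof -
 have "integrable (ivl A B \<Otimes>\<^sub>M ivl C D) (%w. case_prod f w * (\<eta> (fst w) * 1))"
  by (rule integrable_product_box(1)[where \<psi>="%_. 1" and ?B2.0=1, OF f(1,2) _ f(3) _ z]) auto
 then show i: "integrable (ivl A B \<Otimes>\<^sub>M ivl C D) (case_prod (%y t. f y t * \<eta> y))" by (simp add: case_prod_beta')
 show "integrable (ivl C D) (%t. \<integral>y. f y t * \<eta> y \<partial>ivl A B)" using ivl2.integrable_snd[OF i] .
qed

text \<open>Paired with a bump in \<open>y\<close>, the function becomes a scalar function of time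
  with an integrable weak derivative; du Bois-Reymond and the continuity of the pairing determine it
  at every time. Varying the bump then recovers almost every \<open>y\<close>. The half-open time
  interval suits representatives on a closed interval as well as those on the half-line.\<close>

lemma time_representation:
 assumes T: "0 < T" and W: "weak_deriv (cylinder T) (0, 1) f0 k0" and k0: "in_L2 (lebesgue_on (cylinder T)) k0"
  and F: "L2_continuous_in_time {0..<T} F" and ae: "AE w in cyl T. case_prod F w = f0 w"
 obtains F0 k where "F0 \<in> borel1" "case_prod k \<in> borel2"
  "AE y in ivl 0 1. F y 0 = F0 y" "AE w in cyl T. k0 w = case_prod k w"
  "in_L2 (cyl T) (case_prod k)"
  "\<And>t. 0 \<le> t ==> t < T ==> AE y in ivl 0 1. F y t = F0 y + (\<integral>r. k y r \<partial>ivl 0 t)"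
  "AE w in cyl T. f0 w = F0 (fst w) + (\<integral>r. k (fst w) r \<partial>ivl 0 (snd w))"
proof -
 have li: "locally_integrable (cylinder T) f0" using W by (simp add: weak_deriv_def)
 obtain kk where kk: "kk \<in> borel1" "AE w in cyl T. k0 w = kk w"
  using cyl_leb_ex[OF in_L2_measurable[OF k0]] by metis
 obtain ff where ff: "ff \<in> borel1" "AE w in cyl T. f0 w = ff w"
  using cyl_leb_ex[OF locally_integrable_box_measurable[OF li]] by metis
 define k f where "k = curry kk" and "f = curry ff"
 have kb: "case_prod k \<in> borel1" "AE w in cyl T. k0 w = case_prod k w"
  and fb: "case_prod f \<in> borel1" "AE w in cyl T. f0 w = case_prod f w"
  using kk ff by (simp_all add: k_def f_def)
 have [measurable]: "case_prod k \<in> borel2" "case_prod f \<in> borel2"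
  using kb(1) fb(1) by (simp_all add: borel_prod_real)
 have kL: "in_L2 (cyl T) (case_prod k)" by (rule cyl_leb_L2(1)[OF k0 kb])
 note ki = L2_slices(1)[OF kL]
 obtain G where G: "\<And>t. t \<in> {0..<T} ==> in_L2 (ivl 0 1) (%y. G y t)" "\<And>t. t \<in> {0..<T} ==> AE y in ivl 0 1. F y t = G y t"
  "\<And>t. t \<in> {0..<T} ==> ((%s. L2_norm (ivl 0 1) (%y. G y s - G y t)) \<longlongrightarrow> 0) (at t within {0..<T})"
  using L2_continuous_borel[OF F] by blast
 have Gm: "(%y. G y t) \<in> borel1" if "t \<in> {0..<T}" for t
  using in_L2_measurable[OF G(1)[OF that]] by simp
 have "AE w in cyl T. case_prod F w = case_prod f w" using ae fb(2) by eventually_elim simp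
 from AE_slices(2)[OF this] have aet: "AE t in ivl 0 T. AE y in ivl 0 1. G y t = f y t"
  using AE_ivl_mem[of 0 T]
 proof eventually_elim
  case (elim t)
  then have "t \<in> {0..<T}" by auto
  from G(2)[OF this] elim(1) show ?case by eventually_elim simp
 qed
 \<comment> \<open>The fundamental theorem for the pairing, at every time and not just almost every
   one; the continuous curve \<open>G\<close> fixes the constant as its value at time 0.\<close>
 have pair: "(\<integral>y. G y t * bump a b n y \<partial>ivl 0 1) = (\<integral>y. G y 0 * bump a b n y \<partial>ivl 0 1) + (\<integral>y. (\<integral>r. k y r \<partial>ivl 0 t) * bump a b n y \<partial>ivl 0 1)"
  if ab: "0 < a" "a < b" "b < 1" and t: "t \<in> {0..<T}" for a b n t
 proof -
  let ?\<eta> = "bump a b n"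
  note \<eta> = bump_tfun[of a b n]
  have [measurable]: "?\<eta> \<in> borel1" by (rule tfun_measurable[OF \<eta>])
  obtain \<eta>' where \<eta>': "\<And>x. (?\<eta> has_real_derivative \<eta>' x) (at x)" using tfun_deriv[OF \<eta>] by metis
  define A where "A t = (\<integral>y. G y t * ?\<eta> y \<partial>ivl 0 1)" for t
  define S where "S t = (\<integral>y. f y t * ?\<eta> y \<partial>ivl 0 1)" for t
  define w where "w t = (\<integral>y. k y t * ?\<eta> y \<partial>ivl 0 1)" for t
  have Ac: "continuous_on {0..<T} A" unfolding A_def by (rule continuous_on_pairing[OF G(1,3) tfun_L2[OF \<eta>]])
  have wi: "integrable (ivl 0 T) w"
   unfolding w_def by (rule integrable_slab(2)[OF ki tfun_measurable[OF \<eta>] bump_abs]) simp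
  have Sm: "S \<in> borel1" unfolding S_def by measurable
  have Si: "integrable (ivl c d) S" if cd: "0 < c" "c < d" "d < T" for c d
  proof -
   have "AE w in ivl (a / 2) ((b + 1) / 2) \<Otimes>\<^sub>M ivl c d. f0 w = case_prod f w"
    using fb(2) ab cd unfolding AE_ivl2 by (auto elim!: eventually_mono)
   moreover have "{a / 2..(b + 1) / 2} \<times> {c..d} \<subseteq> cylinder T" using ab cd by auto
   ultimately have i: "integrable (ivl (a / 2) ((b + 1) / 2) \<Otimes>\<^sub>M ivl c d) (case_prod f)"
    using locally_integrable_box[OF li] fb(1) by blast
   have z: "?\<eta> x = 0" if "\<not> (a / 2 < x \<and> x < (b + 1) / 2)" for x
    by (rule bump_zero) (use that ab in auto)
   show ?thesis
    unfolding S_def by (rule integrable_slab(2)[OF i tfun_measurable[OF \<eta>] bump_abs z])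
  qed
  have "\<exists>\<kappa>. AE t in ivl 0 T. S t = \<kappa> + (\<integral>r. w r \<partial>ivl 0 t)"
  proof (rule du_Bois_Reymond[where ?a0.0="T / 3" and ?b0.0="2 * T / 3"])
   fix c d :: real and m :: nat assume cd: "0 < c" "c < d" "d < T"
   have T3: "T / 3 < 2 * T / 3" using T by simp
   note zp = zeta_props[OF T3 cd(2), where n=m]
   show "(\<integral>t. S t * dzeta (T / 3) (2 * T / 3) c d m t \<partial>ivl 0 T) = - (\<integral>t. w t * zeta (T / 3) (2 * T / 3) c d m t \<partial>ivl 0 T)"
    unfolding S_def w_def
    by (rule weak_deriv_product(3)[OF W fb kb \<eta> \<eta> ab(1,3) zp(1,3) _ _ dir_deriv_product(2)[OF \<eta>' zp(2)]])
     (use cd T in auto)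
  qed (use T Sm Si wi in auto)
  then obtain \<kappa> where \<kappa>: "AE t in ivl 0 T. S t = \<kappa> + (\<integral>r. w r \<partial>ivl 0 t)" by blast
  have "AE t in ivl 0 T. A t = \<kappa> + (\<integral>r. w r \<partial>ivl 0 t)"
   using \<kappa> aet AE_ivl_mem[of 0 T]
  proof eventually_elim
   case (elim t)
   have [measurable]: "(%y. G y t) \<in> borel1" using Gm elim(3) by simp
   have "A t = S t" unfolding A_def S_def
    by (rule integral_cong_AE) (measurable, use elim(2) in eventually_elim, simp)
   then show ?case using elim(1) by simp
  qed
  note ae = this
  have Wc: "continuous_on {0..<T} (%t. \<kappa> + (\<integral>r. w r \<partial>ivl 0 t))"
   by (intro continuous_on_add continuous_on_const continuous_on_subset[OF continuous_on_indefinite[OF wi]]) auto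
  have A: "A t = \<kappa> + (\<integral>r. w r \<partial>ivl 0 t)" if "t \<in> {0..<T}" for t
   by (rule continuous_AE_eq[OF Ac Wc _ _ T ae that]) auto
  have "A t = A 0 + (\<integral>r. w r \<partial>ivl 0 t)" using A[OF t] A[of 0] T by simp
  also have "(\<integral>r. w r \<partial>ivl 0 t) = (\<integral>y. (\<integral>r. k y r \<partial>ivl 0 t) * ?\<eta> y \<partial>ivl 0 1)"
  proof -
   have "integrable (cyl t) (case_prod k)"
    using integrable_ivl2_subset[OF ki, of 0 1 0 t] t by auto
   then have i: "integrable (cyl t) (case_prod (%y r. k y r * ?\<eta> y))"
    by (rule integrable_slab(1)[OF _ tfun_measurable[OF \<eta>] bump_abs]) simp
   show ?thesis unfolding w_def using ivl2.integral_snd[OF i] ivl2.integral_fst[OF i] by simp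
  qed
  finally show ?thesis unfolding A_def .
 qed
 have repr: "AE y in ivl 0 1. G y t = G y 0 + (\<integral>r. k y r \<partial>ivl 0 t)" if t: "t \<in> {0..<T}" for t
 proof -
  have [measurable]: "(%y. G y t) \<in> borel1" "(%y. G y 0) \<in> borel1"
   using Gm[OF t] Gm[of 0] T by auto
  have Gi: "integrable (ivl 0 1) (%y. G y t)" "integrable (ivl 0 1) (%y. G y 0)"
   using ivl.in_L2_integrable[OF G(1)[OF t]] ivl.in_L2_integrable[OF G(1)[of 0]] T by auto
  have "integrable (cyl t) (case_prod k)"
   using integrable_ivl2_subset[OF ki, of 0 1 0 t] t by auto
  from ivl2.integrable_fst[OF this] have Ki: "integrable (ivl 0 1) (%y. \<integral>r. k y r \<partial>ivl 0 t)" .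
  define D where "D y = G y t - G y 0 - (\<integral>r. k y r \<partial>ivl 0 t)" for y
  have "AE y in ivl 0 1. D y = 0"
  proof (rule AE_zero_of_bumps)
   show "D \<in> borel1" unfolding D_def by measurable
   have "integrable (ivl 0 1) D" unfolding D_def using Gi Ki by simp
   then show "integrable (ivl a b) D" if "0 < a" "a < b" "b < 1" for a b
    using integrable_ivl_subset[of 0 1 D a b] that by simp
   fix a b :: real and n assume ab: "0 < a" "a < b" "b < 1"
   have L: "in_L2 (ivl 0 1) (bump a b n)" by (rule tfun_L2[OF bump_tfun])
   have i: "integrable (ivl 0 1) (%y. h y * bump a b n y)" if "integrable (ivl 0 1) h" for h
    using that tfun_measurable[OF bump_tfun[of a b n]] bump_abs[of a b n]
    by (intro Bochner_Integration.integrable_bound[OF that]) (auto simp: abs_mult mult_left_le)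
   show "(\<integral>y. D y * bump a b n y \<partial>ivl 0 1) = 0"
    unfolding D_def left_diff_distrib using i[OF Gi(1)] i[OF Gi(2)] i[OF Ki] pair[OF ab t, of n] by simp
  qed
  then show ?thesis by eventually_elim (simp add: D_def)
 qed
 have [measurable]: "(%y. G y 0) \<in> borel1" using Gm[of 0] T by auto
 show ?thesis
 proof (rule that[of "%y. G y 0" k])
  show "AE y in ivl 0 1. F y 0 = G y 0" using G(2)[of 0] T by simp
  show "AE y in ivl 0 1. F y t = G y 0 + (\<integral>r. k y r \<partial>ivl 0 t)" if "0 \<le> t" "t < T" for t
  proof -
   have t: "t \<in> {0..<T}" using that by simp
   show ?thesis using G(2)[OF t] repr[OF t] by eventually_elim simp
  qed
  have "AE t in ivl 0 T. AE y in ivl 0 1. f y t = G y 0 + (\<integral>r. k y r \<partial>ivl 0 t)"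
   using aet AE_ivl_mem[of 0 T]
  proof eventually_elim
   case (elim t)
   have t: "t \<in> {0..<T}" using elim by simp
   show ?case using elim(1) repr[OF t] by eventually_elim simp
  qed
  note s = this
  have [measurable]: "(%w. f (fst w) (snd w)) \<in> borel2"
   using fb(1) by (simp add: borel_prod_real case_prod_beta')
  have "AE w in cyl T. f (fst w) (snd w) = G (fst w) 0 + (\<integral>r. k (fst w) r \<partial>ivl 0 (snd w))"
   by (rule AE_of_slices(2)[where Q="%y t. f y t = G y 0 + (\<integral>r. k y r \<partial>ivl 0 t)", OF pred_eq_borel s]) measurable
  with fb(2) show "AE w in cyl T. f0 w = G (fst w) 0 + (\<integral>r. k (fst w) r \<partial>ivl 0 (snd w))"
   by eventually_elim (simp add: case_prod_beta')
 qed (use kb(2) kL in measurable)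
qed

lemma derivative_unique:
 fixes k k' :: "real => real"
 assumes k: "integrable (ivl 0 T) k" "integrable (ivl 0 T) k'" and T: "0 < T"
  and ae: "AE t in ivl 0 T. c + (\<integral>r. k r \<partial>ivl 0 t) = c + (\<integral>r. k' r \<partial>ivl 0 t)"
 shows "AE t in ivl 0 T. k t = k' t"
proof -
 have eq: "c + (\<integral>r. k r \<partial>ivl 0 t) = c + (\<integral>r. k' r \<partial>ivl 0 t)" if "t \<in> {0..T}" for t
  by (rule continuous_AE_eq[OF _ _ _ _ T ae that])
   (auto intro!: continuous_on_add continuous_on_indefinite k)
 have "AE t in ivl 0 T. k t - k' t = 0"
 proof (rule AE_zero_of_intervals)
  show "(%t. k t - k' t) \<in> borel1" using k[THEN borel_measurable_integrable] by simp
  fix a b :: real assume ab: "0 < a" "a < b" "b < T"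
  have i: "integrable (ivl 0 b) k" "integrable (ivl 0 b) k'" "integrable (ivl a b) k" "integrable (ivl a b) k'"
   using integrable_ivl_subset[OF k(1), of 0 b] integrable_ivl_subset[OF k(2), of 0 b]
    integrable_ivl_subset[OF k(1), of a b] integrable_ivl_subset[OF k(2), of a b] ab by auto
  show "integrable (ivl a b) (%t. k t - k' t)" using i by simp
  show "(\<integral>t. k t - k' t \<partial>ivl a b) = 0"
   using eq[of a] eq[of b] ab i integral_ivl_split[OF i(1), of a] integral_ivl_split[OF i(2), of a] by simp
 qed
 then show ?thesis by eventually_elim simp
qed

text \<open>For times in \<open>[j, j + 1)\<close> the function with index \<open>j\<close> is used.
  Below time \<open>n + 1\<close> only indices up to \<open>n\<close> occur, so finitely many null
  sets are involved on each cylinder.\<close>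

lemma glue_cylinders:
 fixes k :: "nat => real => real => real"
 assumes m: "\<And>n. case_prod (k n) \<in> borel2"
  and eq: "\<And>n m. n \<le> m ==> AE w in cyl (real (Suc n)). case_prod (k n) w = case_prod (k m) w"
 obtains g where "case_prod g \<in> borel2"
  "\<And>n. AE w in cyl (real (Suc n)). case_prod g w = case_prod (k n) w"
proof (rule that[of "%y t. k (nat \<lfloor>t\<rfloor>) y t"])
 have [measurable]: "(%t :: real. nat \<lfloor>t\<rfloor>) \<in> measurable borel (count_space UNIV)"
  by (rule measurable_compose[OF measurable_real_floor]) simp
 have g: "(%w. nat \<lfloor>snd w\<rfloor>) \<in> measurable (borel \<Otimes>\<^sub>M borel :: (real \<times> real) measure) (count_space UNIV)" by measurable
 have "(%w. case_prod (k (nat \<lfloor>snd w\<rfloor>)) w) \<in> borel_measurable (borel \<Otimes>\<^sub>M borel :: (real \<times> real) measure)"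
  by (rule measurable_compose_countable[where f="%i w. case_prod (k i) w" and g="%w. nat \<lfloor>snd w\<rfloor>", OF m g])
 then show "(%(y, t). k (nat \<lfloor>t\<rfloor>) y t) \<in> borel2" by (simp add: case_prod_beta')
 fix n
 have "AE w in lborel. \<forall>j\<in>{..n}. w \<in> {0<..<1} \<times> {0<..<real (Suc j)} --> case_prod (k j) w = case_prod (k n) w"
 proof (rule AE_finite_allI)
  show "finite {..n}" by simp
  show "AE w in lborel. w \<in> {0<..<1} \<times> {0<..<real (Suc j)} --> case_prod (k j) w = case_prod (k n) w" if "j \<in> {..n}" for j
   using eq[of j n] that unfolding AE_ivl2 by simp
 qed
 then show "AE w in cyl (real (Suc n)). (case w of (y, t) => k (nat \<lfloor>t\<rfloor>) y t) = case_prod (k n) w"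
  unfolding AE_ivl2
 proof eventually_elim
  case (elim w)
  show ?case
  proof
   assume w: "w \<in> {0<..<1} \<times> {0<..<real (Suc n)}"
   obtain y t where wt: "w = (y, t)" by fastforce
   have "nat \<lfloor>t\<rfloor> \<le> n" using w by (auto simp: wt nat_le_iff floor_le_iff)
   moreover have "w \<in> {0<..<1} \<times> {0<..<real (Suc (nat \<lfloor>t\<rfloor>))}"
   proof -
    have t: "0 < t" "0 < y" "y < 1" using w by (auto simp: wt)
    then have "real (nat \<lfloor>t\<rfloor>) = of_int \<lfloor>t\<rfloor>" by simp
    then have "t < real (Suc (nat \<lfloor>t\<rfloor>))" by linarith
    then show ?thesis using t by (simp add: wt)
   qed
   ultimately have "case_prod (k (nat \<lfloor>t\<rfloor>)) w = case_prod (k n) w" using bspec[OF elim, of "nat \<lfloor>t\<rfloor>"] by blast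
   then show "(case w of (y, t) => k (nat \<lfloor>t\<rfloor>) y t) = case_prod (k n) w" by (simp add: wt)
  qed
 qed
qed

lemma AE_all_Suc:
 assumes "\<And>n. AE y in M. \<forall>t. 0 \<le> t --> t < real (Suc n) --> Q y t"
 shows "AE y in M. \<forall>t\<ge>0. Q y t"
proof -
 have "AE y in M. \<forall>n. \<forall>t. 0 \<le> t --> t < real (Suc n) --> Q y t" using assms by (simp add: AE_all_countable)
 then show ?thesis
 proof eventually_elim
  case (elim y)
  show ?case
  proof (intro allI impI)
   fix t :: real assume t: "0 \<le> t"
   obtain n where "t < real n" using reals_Archimedean2 by blast
   then have "t < real (Suc n)" by simp
   then show "Q y t" using elim t by blast
  qed
 qed
qed

section \<open>Reduction of the weak solution\<close>

text \<open>The weak solution unpacked along integer horizons, with Borel representatives of the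
  data. The derivative \<open>uy n\<close> may a priori depend on the horizon; within one horizon it
  is both the space derivative of the velocity and the time derivative of the volume.\<close>

locale weak_flow = exponents +
 fixes \<mu> \<theta>lo \<theta>hi \<tau>lo \<tau>hi :: real and \<theta> \<tau>0 u0 :: "real => real"
  and R Q u :: "real => real => real" and uy :: "nat => real => real => real"
 assumes mu: "0 < \<mu>"
  and \<theta>_meas [measurable]: "\<theta> \<in> borel1"
  and \<tau>0_meas [measurable]: "\<tau>0 \<in> borel1"
  and \<theta>_const: "0 < \<theta>lo" "\<theta>hi < 1" and \<tau>0_const: "0 < \<tau>lo"
  and \<theta>_bounds: "AE y in ivl 0 1. \<theta>lo \<le> \<theta> y \<and> \<theta> y \<le> \<theta>hi"
  and \<tau>0_bounds: "AE y in ivl 0 1. \<tau>lo \<le> \<tau>0 y \<and> \<tau>0 y \<le> \<tau>hi"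
  and u0: "in_L2 (ivl 0 1) u0"
  and R_t: "\<And>n. \<exists>Rt. weak_deriv (cylinder (real (Suc n))) (0, 1) (case_prod R) Rt \<and> in_L2 (lebesgue_on (cylinder (real (Suc n)))) Rt"
  and Q_t: "\<And>n. \<exists>Qt. weak_deriv (cylinder (real (Suc n))) (0, 1) (case_prod Q) Qt \<and> in_L2 (lebesgue_on (cylinder (real (Suc n)))) Qt"
  and u_y: "\<And>n. weak_deriv (cylinder (real (Suc n))) (1, 0) (case_prod u) (case_prod (uy n))"
  and uy_L2: "\<And>n. in_L2 (lebesgue_on (cylinder (real (Suc n)))) (case_prod (uy n))"
  and bdry: "\<And>n. zero_boundary_values (real (Suc n)) u"
  and \<tau>_t: "\<And>n. weak_deriv (cylinder (real (Suc n))) (0, 1) (%(y, t). spec_vol (R y t) (Q y t)) (case_prod (uy n))"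
  and mass: "\<And>n. AE w in cyl (real (Suc n)). 0 < spec_vol (case_prod R w) (case_prod Q w) \<and>
   case_prod R w * spec_vol (case_prod R w) (case_prod Q w) = \<theta> (fst w) \<and>
   case_prod Q w * spec_vol (case_prod R w) (case_prod Q w) = 1 - \<theta> (fst w)"
  and init: "\<And>n. has_initial_value (real (Suc n)) (%y t. spec_vol (R y t) (Q y t)) \<tau>0"
  and p_int: "\<And>n. locally_integrable ({0<..<1} \<times> {0..<real (Suc n)}) (%(y, t). Zfun gr (R y t) (Q y t) powr gp)"
  and weak_form: "\<And>n \<phi>. test_function ({0<..<1} \<times> {..<real (Suc n)}) \<phi> ==>
   (\<integral>(y, t). u y t * dir_deriv (0, 1) \<phi> (y, t)
     - (\<mu> * uy n y t / spec_vol (R y t) (Q y t) - Zfun gr (R y t) (Q y t) powr gp) * dir_deriv (1, 0) \<phi> (y, t)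
    \<partial>lebesgue_on (cylinder (real (Suc n)))) + (\<integral>y. u0 y * \<phi> (y, 0) \<partial>ivl 0 1) = 0"
  and R_cont: "L2_continuous_in_time {0..} R" and Q_cont: "L2_continuous_in_time {0..} Q"
  and u_cont: "L2_continuous_in_time {0..} u"
begin

lemma L2_continuous_subset: "L2_continuous_in_time I F ==> J \<subseteq> I ==> L2_continuous_in_time J F"
 unfolding L2_continuous_in_time_def by (meson subset_iff tendsto_within_subset)

lemma volume_repr:
 "\<forall>n. \<exists>k. case_prod k \<in> borel2 \<and> in_L2 (cyl (real (Suc n))) (case_prod k) \<and>
  (AE w in cyl (real (Suc n)). case_prod (uy n) w = case_prod k w) \<and>
  (AE w in cyl (real (Suc n)). spec_vol (case_prod R w) (case_prod Q w) = \<tau>0 (fst w) + (\<integral>r. k (fst w) r \<partial>ivl 0 (snd w)))"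
proof
 fix n
 let ?T = "real (Suc n)"
 obtain F where F: "AE (y, t) in lebesgue_on (cylinder ?T). F y t = spec_vol (R y t) (Q y t)"
  "L2_continuous_in_time {0..?T} F" "AE y in unit_space. F y 0 = \<tau>0 y"
  using init[of n] unfolding has_initial_value_def by blast
 have F1: "AE w in cyl ?T. case_prod F w = (%(y, t). spec_vol (R y t) (Q y t)) w"
  using F(1) unfolding cyl_AE_leb by (simp add: case_prod_beta')
 have F2: "L2_continuous_in_time {0..<?T} F" by (rule L2_continuous_subset[OF F(2)]) auto
 obtain F0 k where k: "F0 \<in> borel1" "case_prod k \<in> borel2"
  "AE y in ivl 0 1. F y 0 = F0 y" "AE w in cyl ?T. case_prod (uy n) w = case_prod k w"
  "in_L2 (cyl ?T) (case_prod k)"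
  "AE w in cyl ?T. (%(y, t). spec_vol (R y t) (Q y t)) w = F0 (fst w) + (\<integral>r. k (fst w) r \<partial>ivl 0 (snd w))"
  by (rule time_representation[OF _ \<tau>_t[of n] uy_L2[of n] F2 F1]) auto
 have "AE y in ivl 0 1. F0 y = \<tau>0 y" using k(3) F(3)[unfolded ivl_AE_leb] by eventually_elim simp
 from AE_pair_fst[OF this, of 0 ?T] k(6)
 have "AE w in cyl ?T. spec_vol (case_prod R w) (case_prod Q w) = \<tau>0 (fst w) + (\<integral>r. k (fst w) r \<partial>ivl 0 (snd w))"
  by eventually_elim (simp add: case_prod_beta')
 then show "\<exists>k. case_prod k \<in> borel2 \<and> in_L2 (cyl ?T) (case_prod k) \<and>
  (AE w in cyl ?T. case_prod (uy n) w = case_prod k w) \<and>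
  (AE w in cyl ?T. spec_vol (case_prod R w) (case_prod Q w) = \<tau>0 (fst w) + (\<integral>r. k (fst w) r \<partial>ivl 0 (snd w)))"
  using k by blast
qed

text \<open>Derivatives from different horizons coincide because their indefinite integrals
  represent the same volume; hence they glue to one function.\<close>

lemma ex_velocity_gradient:
 "\<exists>g. case_prod g \<in> borel2 \<and>
  (\<forall>n. in_L2 (cyl (real (Suc n))) (case_prod g) \<and>
  (AE w in cyl (real (Suc n)). case_prod (uy n) w = case_prod g w) \<and>
  (AE w in cyl (real (Suc n)). spec_vol (case_prod R w) (case_prod Q w) = \<tau>0 (fst w) + (\<integral>r. g (fst w) r \<partial>ivl 0 (snd w))))"
proof -
 let ?M = "%n. cyl (real (Suc n))"
 obtain k where k: "\<And>n. case_prod (k n) \<in> borel2" "\<And>n. in_L2 (?M n) (case_prod (k n))"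
  "\<And>n. AE w in ?M n. case_prod (uy n) w = case_prod (k n) w"
  "\<And>n. AE w in ?M n. spec_vol (case_prod R w) (case_prod Q w) = \<tau>0 (fst w) + (\<integral>r. k n (fst w) r \<partial>ivl 0 (snd w))"
  using choice[OF volume_repr] by blast
 have sl: "AE y in ivl 0 1. AE t in ivl 0 (real (Suc n)). k n y t = k m y t" if "n \<le> m" for n m
 proof -
  have "AE w in ?M n. spec_vol (case_prod R w) (case_prod Q w) = \<tau>0 (fst w) + (\<integral>r. k m (fst w) r \<partial>ivl 0 (snd w))"
   using k(4)[of m] that unfolding AE_ivl2 by (auto elim!: eventually_mono)
  with k(4)[of n] have "AE w in ?M n. \<tau>0 (fst w) + (\<integral>r. k n (fst w) r \<partial>ivl 0 (snd w)) = \<tau>0 (fst w) + (\<integral>r. k m (fst w) r \<partial>ivl 0 (snd w))"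
   by eventually_elim simp
  from AE_slices(1)[OF this] L2_slices(2)[OF k(2)[of n]] L2_slices(2)[OF k(2)[of m]]
  show ?thesis
  proof eventually_elim
   case (elim y)
   have "integrable (ivl 0 (real (Suc n))) (k m y)" using elim(3) that by (auto intro: integrable_ivl_subset)
   from derivative_unique[OF elim(2) this _ elim(1)[unfolded fst_conv snd_conv]] show ?case by simp
  qed
 qed
 have eq: "AE w in ?M n. case_prod (k n) w = case_prod (k m) w" if "n \<le> m" for n m
 proof -
  have [measurable]: "(%w. k n (fst w) (snd w)) \<in> borel2"
   "(%w. k m (fst w) (snd w)) \<in> borel2"
   using k(1)[of n] k(1)[of m] by (simp_all add: case_prod_beta')
  have "AE w in ?M n. k n (fst w) (snd w) = k m (fst w) (snd w)"
   by (rule AE_of_slices(1)[where Q="%y t. k n y t = k m y t", OF pred_eq_borel sl[OF that]]) measurable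
  then show ?thesis by (simp add: case_prod_beta')
 qed
 obtain g where g: "case_prod g \<in> borel2" "\<And>n. AE w in ?M n. case_prod g w = case_prod (k n) w"
  using glue_cylinders[OF k(1) eq] by metis
 have "in_L2 (?M n) (case_prod g)" for n
  using g(2)[of n] by (intro in_L2_cong_AE[OF k(2)[of n]]) (use g(1) in \<open>auto elim: eventually_mono\<close>)
 moreover have "AE w in ?M n. case_prod (uy n) w = case_prod g w" for n
  using k(3)[of n] g(2)[of n] by eventually_elim simp
 moreover have "AE w in ?M n. spec_vol (case_prod R w) (case_prod Q w) = \<tau>0 (fst w) + (\<integral>r. g (fst w) r \<partial>ivl 0 (snd w))" for n
 proof -
  have "AE y in ivl 0 1. AE t in ivl 0 (real (Suc n)). g y t = k n y t" using AE_slices(1)[OF g(2)[of n]] by simp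
  then have "AE y in ivl 0 1. \<forall>t. t < real (Suc n) --> (\<integral>r. g y r \<partial>ivl 0 t) = (\<integral>r. k n y r \<partial>ivl 0 t)"
  proof eventually_elim
   case (elim y)
   have [measurable]: "case_prod (k n) \<in> borel2" "case_prod g \<in> borel2"
    using k(1) g(1) by auto
   have "(\<integral>r. g y r \<partial>ivl 0 t) = (\<integral>r. k n y r \<partial>ivl 0 t)" if "t < real (Suc n)" for t
    by (rule integral_cong_AE) (measurable, rule AE_ivl_subset[OF elim], use that in auto)
   then show ?case by blast
  qed
  from AE_pair_fst[OF this, of 0 "real (Suc n)"] k(4)[of n] AE_pair_snd[OF AE_ivl_mem[of 0 "real (Suc n)"], of 0 1]
  show ?thesis by eventually_elim simp
 qed
 ultimately show ?thesis using g(1) by blast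
qed

end

locale velocity_flow = weak_flow +
 fixes g :: "real => real => real"
 assumes g_meas [measurable]: "case_prod g \<in> borel2"
  and g_L2: "\<And>n. in_L2 (cyl (real (Suc n))) (case_prod g)"
  and uy_g: "\<And>n. AE w in cyl (real (Suc n)). case_prod (uy n) w = case_prod g w"
  and vol_g: "\<And>n. AE w in cyl (real (Suc n)).
   spec_vol (case_prod R w) (case_prod Q w) = \<tau>0 (fst w) + (\<integral>r. g (fst w) r \<partial>ivl 0 (snd w))"
begin

text \<open>The representative of the specific volume that is continuous in time for almost every
  \<open>y\<close>.\<close>

definition \<tau> :: "real => real => real" where "\<tau> y t = \<tau>0 y + (\<integral>r. g y r \<partial>ivl 0 t)"

lemma \<tau>_meas [measurable]: "case_prod \<tau> \<in> borel2"
proof -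
 have "case_prod \<tau> = (%w. \<tau>0 (fst w) + (\<integral>r. g (fst w) r \<partial>ivl 0 (snd w)))" by (auto simp: \<tau>_def)
 also have "\<dots> \<in> borel2" by measurable
 finally show ?thesis .
qed

lemma g_borel: "case_prod g \<in> borel1" using g_meas by (simp add: borel_prod_real)

lemma g_integrable: "integrable (cyl (real (Suc n))) (case_prod g)"
 by (rule L2_slices(1)[OF g_L2])

lemma \<tau>_continuous: "integrable (ivl 0 T) (g y) ==> continuous_on {0..<T} (\<tau> y)"
 unfolding \<tau>_def
 by (intro continuous_on_add continuous_on_const continuous_on_subset[OF continuous_on_indefinite]) auto

text \<open>For almost every \<open>y\<close> two functions continuous in time have the constant
  positive product \<open>\<theta>' y\<close>. So neither can vanish, and \<open>\<tau> y\<close>,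
  positive initially, stays positive. This upgrades positivity almost everywhere to positivity at
  every time.\<close>

lemma quotient_repr:
 fixes X :: "real => real => real" and \<theta>' :: "real => real" and n :: nat
 defines "T \<equiv> real (Suc n)"
 assumes Xt: "\<exists>Xt. weak_deriv (cylinder T) (0, 1) (case_prod X) Xt \<and> in_L2 (lebesgue_on (cylinder T)) Xt"
  and Xc: "L2_continuous_in_time {0..} X" and pos: "AE y in ivl 0 1. 0 < \<theta>' y"
  and X: "AE w in cyl T. case_prod X w * spec_vol (case_prod R w) (case_prod Q w) = \<theta>' (fst w)"
 shows "\<exists>X0 k. case_prod k \<in> borel2 \<and> in_L2 (cyl T) (case_prod k) \<and>
  (AE y in ivl 0 1. \<forall>t. 0 \<le> t --> t < T --> 0 < \<tau> y t \<and> X0 y + (\<integral>r. k y r \<partial>ivl 0 t) = \<theta>' y / \<tau> y t) \<and>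
  (\<forall>t. 0 \<le> t --> t < T --> (AE y in ivl 0 1. X y t = \<theta>' y / \<tau> y t))"
proof -
 have T: "0 < T" by (simp add: T_def)
 obtain Xt where Xt: "weak_deriv (cylinder T) (0, 1) (case_prod X) Xt" "in_L2 (lebesgue_on (cylinder T)) Xt"
  using Xt by blast
 have Xc': "L2_continuous_in_time {0..<T} X" by (rule L2_continuous_subset[OF Xc]) auto
 obtain X0 k where X0: "X0 \<in> borel1" and k: "case_prod k \<in> borel2"
  "in_L2 (cyl T) (case_prod k)"
  and r: "\<And>t. 0 \<le> t ==> t < T ==> AE y in ivl 0 1. X y t = X0 y + (\<integral>r. k y r \<partial>ivl 0 t)"
  "AE w in cyl T. case_prod X w = X0 (fst w) + (\<integral>r. k (fst w) r \<partial>ivl 0 (snd w))"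
  by (rule time_representation[OF T Xt Xc' AE_I2]) auto
 have "AE w in cyl T. (X0 (fst w) + (\<integral>r. k (fst w) r \<partial>ivl 0 (snd w))) * \<tau> (fst w) (snd w) = \<theta>' (fst w)"
  using r(2) X vol_g[of n, folded T_def] by eventually_elim (simp add: \<tau>_def)
 from AE_slices(1)[OF this] pos \<tau>0_bounds L2_slices(2)[OF k(2)] L2_slices(2)[OF g_L2[of n, folded T_def]]
 have fin: "AE y in ivl 0 1. \<forall>t. 0 \<le> t --> t < T --> 0 < \<tau> y t \<and> X0 y + (\<integral>r. k y r \<partial>ivl 0 t) = \<theta>' y / \<tau> y t"
 proof eventually_elim
  case (elim y)
  note \<tau>c = \<tau>_continuous[OF elim(5)]
  have Xc: "continuous_on {0..<T} (%t. (X0 y + (\<integral>r. k y r \<partial>ivl 0 t)) * \<tau> y t)"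
   using \<tau>c elim(4)
   by (intro continuous_on_mult continuous_on_add continuous_on_const continuous_on_subset[OF continuous_on_indefinite[OF elim(4)]]) auto
  have eq: "(X0 y + (\<integral>r. k y r \<partial>ivl 0 t)) * \<tau> y t = \<theta>' y" if "t \<in> {0..<T}" for t
   by (rule continuous_AE_eq[OF Xc continuous_on_const _ _ T elim(1)[unfolded fst_conv snd_conv] that]) auto
  have pos': "0 < \<tau> y t" if t: "t \<in> {0..<T}" for t
  proof (rule ccontr)
   assume "\<not> 0 < \<tau> y t"
   moreover have "0 \<le> \<tau> y 0" using elim(3) \<tau>0_const by (simp add: \<tau>_def)
   moreover have "continuous_on {0..t} (\<tau> y)" by (rule continuous_on_subset[OF \<tau>c]) (use t in auto)
   ultimately obtain s where "0 \<le> s" "s \<le> t" "\<tau> y s = 0" using IVT2'[of "\<tau> y" t 0 0] t by auto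
   then show False using eq[of s] t elim(2) by auto
  qed
  show ?case
  proof (intro allI impI conjI)
   fix t assume "0 \<le> t" "t < T"
   then have t: "t \<in> {0..<T}" by simp
   show "0 < \<tau> y t" by (rule pos'[OF t])
   then show "X0 y + (\<integral>r. k y r \<partial>ivl 0 t) = \<theta>' y / \<tau> y t" using eq[OF t] by (simp add: field_simps)
  qed
 qed
 have "AE y in ivl 0 1. X y t = \<theta>' y / \<tau> y t" if "0 \<le> t" "t < T" for t
  using r(1)[OF that] fin by eventually_elim (use that in simp)
 then show ?thesis using k fin by blast
qed

lemma R_repr:
 defines "T \<equiv> %n. real (Suc n)"
 shows "\<exists>X0 k. case_prod k \<in> borel2 \<and> in_L2 (cyl (T n)) (case_prod k) \<and>
  (AE y in ivl 0 1. \<forall>t. 0 \<le> t --> t < T n --> 0 < \<tau> y t \<and> X0 y + (\<integral>r. k y r \<partial>ivl 0 t) = \<theta> y / \<tau> y t) \<and>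
  (\<forall>t. 0 \<le> t --> t < T n --> (AE y in ivl 0 1. R y t = \<theta> y / \<tau> y t))"
 unfolding T_def
proof (rule quotient_repr[OF R_t R_cont])
 show "AE y in ivl 0 1. 0 < \<theta> y" using \<theta>_bounds by eventually_elim (use \<theta>_const in auto)
 show "AE w in cyl (real (Suc n)). case_prod R w * spec_vol (case_prod R w) (case_prod Q w) = \<theta> (fst w)"
  using mass[of n] by eventually_elim simp
qed

lemma Q_repr:
 defines "T \<equiv> %n. real (Suc n)"
 shows "\<exists>X0 k. case_prod k \<in> borel2 \<and> in_L2 (cyl (T n)) (case_prod k) \<and>
  (AE y in ivl 0 1. \<forall>t. 0 \<le> t --> t < T n --> 0 < \<tau> y t \<and> X0 y + (\<integral>r. k y r \<partial>ivl 0 t) = (1 - \<theta> y) / \<tau> y t) \<and>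
  (\<forall>t. 0 \<le> t --> t < T n --> (AE y in ivl 0 1. Q y t = (1 - \<theta> y) / \<tau> y t))"
 unfolding T_def
proof (rule quotient_repr[OF Q_t Q_cont])
 show "AE y in ivl 0 1. 0 < 1 - \<theta> y" using \<theta>_bounds by eventually_elim (use \<theta>_const in auto)
 show "AE w in cyl (real (Suc n)). case_prod Q w * spec_vol (case_prod R w) (case_prod Q w) = 1 - \<theta> (fst w)"
  using mass[of n] by eventually_elim simp
qed

lemma \<tau>_pos: "AE y in ivl 0 1. \<forall>t\<ge>0. 0 < \<tau> y t"
proof (rule AE_all_Suc)
 fix n
 obtain X0 k where "AE y in ivl 0 1. \<forall>t. 0 \<le> t --> t < real (Suc n) --> 0 < \<tau> y t \<and> X0 y + (\<integral>r. k y r \<partial>ivl 0 t) = \<theta> y / \<tau> y t"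
  using R_repr[of n] by blast
 then show "AE y in ivl 0 1. \<forall>t. 0 \<le> t --> t < real (Suc n) --> 0 < \<tau> y t" by eventually_elim blast
qed

lemma R_eq: "0 \<le> t ==> AE y in ivl 0 1. R y t = \<theta> y / \<tau> y t"
 and Q_eq: "0 \<le> t ==> AE y in ivl 0 1. Q y t = (1 - \<theta> y) / \<tau> y t"
proof -
 assume t: "0 \<le> t"
 obtain n where "t < real n" using reals_Archimedean2 by blast
 then have n: "t < real (Suc n)" by simp
 show "AE y in ivl 0 1. R y t = \<theta> y / \<tau> y t" using R_repr[of n] t n by blast
 show "AE y in ivl 0 1. Q y t = (1 - \<theta> y) / \<tau> y t" using Q_repr[of n] t n by blast
qed

text \<open>Since \<open>R = \<theta> / \<tau>\<close>, one has \<open>(\<partial>\<^sub>y u / \<tau>)\<^sup>2 = - \<partial>\<^sub>y u \<cdot> \<partial>\<^sub>t R / \<theta>\<close>, which gives the square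
 integrability of the viscous stress before any lower bound on \<open>\<tau>\<close> is known.\<close>

lemma stress_L2: "in_L2 (cyl (real (Suc n))) (%w. case_prod g w / case_prod \<tau> w)"
proof -
 let ?T = "real (Suc n)"
 obtain X0 k where k: "case_prod k \<in> borel2" "in_L2 (cyl ?T) (case_prod k)"
  and r: "AE y in ivl 0 1. \<forall>t. 0 \<le> t --> t < ?T --> 0 < \<tau> y t \<and> X0 y + (\<integral>r. k y r \<partial>ivl 0 t) = \<theta> y / \<tau> y t"
  using R_repr[of n] by blast
 have [measurable]: "(%w. k (fst w) (snd w)) \<in> borel2"
  "(%w. g (fst w) (snd w)) \<in> borel2" "(%w. \<tau> (fst w) (snd w)) \<in> borel2"
  using k(1) g_meas \<tau>_meas by (simp_all add: case_prod_beta')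
 \<comment> \<open>The chain rule for \<open>x \<mapsto> \<theta> y / x\<close> along
   \<open>\<tau> y\<close> identifies the time derivative \<open>k\<close> of the density;
   positivity at every time makes it applicable without a quantitative lower bound.\<close>
 have sl: "AE y in ivl 0 1. AE t in ivl 0 ?T. k y t = - \<theta> y / (\<tau> y t)\<^sup>2 * g y t"
  using r L2_slices(2)[OF k(2)] L2_slices(2)[OF g_L2[of n]]
 proof eventually_elim
  case (elim y)
  have [measurable]: "g y \<in> borel1" "k y \<in> borel1"
   using elim(2,3)[THEN borel_measurable_integrable] by auto
  have [measurable]: "\<tau> y \<in> borel1" unfolding \<tau>_def by measurable
  have m: "(%t. - \<theta> y / (\<tau> y t)\<^sup>2 * g y t) \<in> borel1" by measurable
  have c: "integrable (ivl a b) (%t. - \<theta> y / (\<tau> y t)\<^sup>2 * g y t)"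
   "\<theta> y / \<tau> y b - \<theta> y / \<tau> y a = (\<integral>t. - \<theta> y / (\<tau> y t)\<^sup>2 * g y t \<partial>ivl a b)" if ab: "0 < a" "a < b" "b < ?T" for a b
  proof -
   have gi: "integrable (ivl a b) (g y)" by (rule integrable_ivl_subset[OF elim(3)]) (use ab in auto)
   have \<tau>ab: "\<tau> y t = \<tau> y a + (\<integral>r. g y r \<partial>ivl a t)" if "t \<in> {a..b}" for t
   proof -
    have "integrable (ivl 0 t) (g y)" by (rule integrable_ivl_subset[OF elim(3)]) (use ab that in auto)
    from integral_ivl_split[OF this, of a] show ?thesis using ab that by (simp add: \<tau>_def)
   qed
   have p: "0 < x" if "x \<in> \<tau> y ` {a..b}" for x using that elim(1) ab by auto
   have d: "((%x. \<theta> y / x) has_real_derivative - \<theta> y / x\<^sup>2) (at x)" if "x \<in> \<tau> y ` {a..b}" for x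
    using p[OF that] by (auto intro!: derivative_eq_intros simp: power2_eq_square)
   have cont: "continuous_on (\<tau> y ` {a..b}) (%x. - \<theta> y / x\<^sup>2)"
    by (intro continuous_intros) (use p in force)
   note r = indefinite_chain_rule[OF gi less_imp_le[OF ab(2)] \<tau>ab d cont m]
   show "integrable (ivl a b) (%t. - \<theta> y / (\<tau> y t)\<^sup>2 * g y t)" by (rule r(1))
   show "\<theta> y / \<tau> y b - \<theta> y / \<tau> y a = (\<integral>t. - \<theta> y / (\<tau> y t)\<^sup>2 * g y t \<partial>ivl a b)" by (rule r(2))
  qed
  have "AE t in ivl 0 ?T. k y t - - \<theta> y / (\<tau> y t)\<^sup>2 * g y t = 0"
  proof (rule AE_zero_of_intervals)
   show "(%t. k y t - - \<theta> y / (\<tau> y t)\<^sup>2 * g y t) \<in> borel1" by measurable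
   fix a b :: real assume ab: "0 < a" "a < b" "b < ?T"
   have ki: "integrable (ivl a b) (k y)" "integrable (ivl 0 b) (k y)"
    using integrable_ivl_subset[OF elim(2), of a b] integrable_ivl_subset[OF elim(2), of 0 b] ab by auto
   show "integrable (ivl a b) (%t. k y t - - \<theta> y / (\<tau> y t)\<^sup>2 * g y t)" 
    by (rule Bochner_Integration.integrable_diff[OF ki(1) c(1)[OF ab]])
   have "(\<integral>t. k y t - - \<theta> y / (\<tau> y t)\<^sup>2 * g y t \<partial>ivl a b) = (\<integral>t. k y t \<partial>ivl a b) - (\<integral>t. - \<theta> y / (\<tau> y t)\<^sup>2 * g y t \<partial>ivl a b)"
    by (rule Bochner_Integration.integral_diff[OF ki(1) c(1)[OF ab]])
   also have "(\<integral>t. k y t \<partial>ivl a b) = (X0 y + (\<integral>r. k y r \<partial>ivl 0 b)) - (X0 y + (\<integral>r. k y r \<partial>ivl 0 a))"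
    using integral_ivl_split[OF ki(2), of a] ab by simp
   also have "\<dots> = \<theta> y / \<tau> y b - \<theta> y / \<tau> y a"
    using elim(1)[rule_format, of a] elim(1)[rule_format, of b] ab by simp
   finally show "(\<integral>t. k y t - - \<theta> y / (\<tau> y t)\<^sup>2 * g y t \<partial>ivl a b) = 0" using c(2)[OF ab] by simp
  qed
  then show ?case by eventually_elim simp
 qed
 have "AE w in cyl ?T. k (fst w) (snd w) = - \<theta> (fst w) / (\<tau> (fst w) (snd w))\<^sup>2 * g (fst w) (snd w)"
  by (rule AE_of_slices(1)[where Q="%y t. k y t = - \<theta> y / (\<tau> y t)\<^sup>2 * g y t", OF pred_eq_borel sl]; measurable)
 with AE_pair_fst[OF \<theta>_bounds, of 0 ?T]
 have "AE w in cyl ?T. \<bar>case_prod g w / case_prod \<tau> w\<bar> \<le> 1 * \<bar>\<bar>case_prod g w\<bar> + 1 / \<theta>lo * \<bar>case_prod k w\<bar>\<bar>"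
 proof eventually_elim
  case (elim w)
  define G \<tau>' K \<theta>' where "G = case_prod g w" and "\<tau>' = case_prod \<tau> w" and "K = case_prod k w" and "\<theta>' = \<theta> (fst w)"
  have \<theta>': "\<theta>lo \<le> \<theta>'" "0 < \<theta>'" using elim(1) \<theta>_const by (auto simp: \<theta>'_def)
  have K: "K = - \<theta>' / \<tau>'\<^sup>2 * G" using elim(2) by (simp add: G_def \<tau>'_def K_def \<theta>'_def case_prod_beta')
  have "(G / \<tau>')\<^sup>2 = \<bar>G\<bar> * (1 / \<theta>' * \<bar>K\<bar>)"
   using \<theta>' by (simp add: K abs_mult power_divide power2_eq_square)
  also have "\<dots> \<le> \<bar>G\<bar> * (1 / \<theta>lo * \<bar>K\<bar>)"
   using \<theta>' \<theta>_const by (intro mult_left_mono mult_right_mono) (auto simp: frac_le)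
  also have "\<dots> \<le> (\<bar>G\<bar> + 1 / \<theta>lo * \<bar>K\<bar>)\<^sup>2"
  proof -
   have ab: "a * b \<le> (a + b)\<^sup>2" if "0 \<le> a" "0 \<le> b" for a b :: real
    using mult_nonneg_nonneg[OF that] zero_le_power2[of a] zero_le_power2[of b] by (simp add: power2_sum)
   show ?thesis by (rule ab) (use \<theta>_const(1) in auto)
  qed
  finally have "\<bar>G / \<tau>'\<bar> \<le> \<bar>\<bar>G\<bar> + 1 / \<theta>lo * \<bar>K\<bar>\<bar>" by (simp only: abs_le_square_iff)
  then show ?case by (simp only: G_def \<tau>'_def K_def mult_1)
 qed
 moreover have "in_L2 (cyl ?T) (%w. \<bar>case_prod g w\<bar> + 1 / \<theta>lo * \<bar>case_prod k w\<bar>)"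
 proof -
  have a: "in_L2 (cyl ?T) (%w. \<bar>h w\<bar>)" if "in_L2 (cyl ?T) h" for h
   using in_L2_bound[OF that borel_measurable_abs[OF in_L2_measurable[OF that]], of 1] by simp
  show ?thesis by (rule in_L2_add[OF a[OF g_L2] in_L2_cmult[OF a[OF k(2)]]])
 qed
 moreover have "(%w. case_prod g w / case_prod \<tau> w) \<in> borel_measurable (cyl ?T)"
  using g_meas \<tau>_meas by simp
 ultimately show ?thesis using in_L2_bound by blast
qed

text \<open>Each test in \<open>y\<close> holds outside a null set of times, and countably many
  tests suffice for du Bois-Reymond. At almost every time the slice is thus a primitive of
  \<open>g\<close>; the left boundary value removes the constant and the right one gives the zero
  mean.\<close>

lemma velocity_slices:
 "AE t in ivl 0 (real (Suc n)). (\<integral>x. g x t \<partial>ivl 0 1) = 0 \<and> (AE y in ivl 0 1. u y t = (\<integral>x. g x t \<partial>ivl 0 y))"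
proof -
 let ?T = "real (Suc n)"
 have li: "locally_integrable (cylinder ?T) (case_prod u)" using u_y[of n] by (simp add: weak_deriv_def)
 obtain ff where ff: "ff \<in> borel1" "AE w in cyl ?T. case_prod u w = ff w"
  using cyl_leb_ex[OF locally_integrable_box_measurable[OF li]] by metis
 define f where "f = curry ff"
 have fb: "case_prod f \<in> borel1" "AE w in cyl ?T. case_prod u w = case_prod f w"
  using ff by (simp_all add: f_def)
 have [measurable]: "case_prod f \<in> borel2" using fb(1) by (simp add: borel_prod_real)
 let ?z = "zeta (1 / 4) (3 / 4)" and ?dz = "dzeta (1 / 4) (3 / 4)"
 define h where "h a b m t = (\<integral>y. f y t * ?dz a b m y \<partial>ivl 0 1) + (\<integral>y. g y t * ?z a b m y \<partial>ivl 0 1)" for a b m t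
 have q: "(1 / 4 :: real) < 3 / 4" by simp
 have h0: "AE t in ivl 0 ?T. h a b m t = 0" if ab: "0 < a" "a < b" "b < 1" for a b m
 proof -
  note zp = zeta_props[OF q ab(2), where n=m]
  have [measurable]: "?z a b m \<in> borel1" "?dz a b m \<in> borel1"
   using tfun_measurable[OF zp(1)] tfun_measurable[OF zp(3)] by auto
  have lr: "0 < min (1 / 4) a" "max (3 / 4) b < 1" using ab by auto
  obtain B where B: "\<And>x. \<bar>?z a b m x\<bar> \<le> B" using tfun_bound[OF zp(1)] by blast
  obtain B' where B': "\<And>x. \<bar>?dz a b m x\<bar> \<le> B'" using tfun_bound[OF zp(3)] by blast
  have i2: "integrable (ivl 0 ?T) (%t. \<integral>y. g y t * ?z a b m y \<partial>ivl 0 1)"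
   by (rule integrable_slab(2)[OF g_integrable tfun_measurable[OF zp(1)] B]) simp
  have i1: "integrable (ivl c d) (%t. \<integral>y. f y t * ?dz a b m y \<partial>ivl 0 1)" if cd: "0 < c" "c < d" "d < ?T" for c d
  proof -
   let ?a = "min (1 / 4) a / 2" and ?b = "(max (3 / 4) b + 1) / 2"
   have "AE w in ivl ?a ?b \<Otimes>\<^sub>M ivl c d. case_prod u w = case_prod f w"
    using fb(2) lr cd unfolding AE_ivl2 by (auto elim!: eventually_mono)
   moreover have "{?a..?b} \<times> {c..d} \<subseteq> cylinder ?T" using lr cd by auto
   ultimately have i: "integrable (ivl ?a ?b \<Otimes>\<^sub>M ivl c d) (case_prod f)"
    using locally_integrable_box[OF li] fb(1) by blast
   show ?thesis
    by (rule integrable_slab(2)[OF i tfun_measurable[OF zp(3)] B']) (use zp(3) lr in \<open>auto simp: tfun_def\<close>)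
  qed
  show ?thesis
  proof (rule AE_zero_of_bumps)
   show "h a b m \<in> borel1" unfolding h_def by measurable
   fix c d :: real assume cd: "0 < c" "c < d" "d < ?T"
   show "integrable (ivl c d) (h a b m)"
    unfolding h_def using i1[OF cd] integrable_ivl_subset[OF i2, of c d] cd by simp
   fix j
   note \<psi> = bump_tfun[of c d j]
   obtain \<psi>' where \<psi>': "\<And>x. (bump c d j has_real_derivative \<psi>' x) (at x)" using tfun_deriv[OF \<psi>] by metis
   have gb: "case_prod g \<in> borel1" "AE w in cyl ?T. case_prod (uy n) w = case_prod g w"
    using g_borel uy_g by auto
   note w = weak_deriv_product[OF u_y[of n] fb gb zp(1,3) lr \<psi> \<psi> cd(1,3) dir_deriv_product(1)[OF zp(2) \<psi>']]
   show "(\<integral>t. h a b m t * bump c d j t \<partial>ivl 0 ?T) = 0"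
    unfolding h_def distrib_right using w by simp
  qed
 qed
 \<comment> \<open>Rational endpoints and natural indices only, so that the exceptional times still
   form a null set.\<close>
 have hall: "AE t in ivl 0 ?T. \<forall>a\<in>\<rat>. \<forall>b\<in>\<rat>. \<forall>m. 0 < a \<and> a < b \<and> b < 1 --> h a b m t = 0"
  using h0 by (auto simp: AE_ball_countable[OF countable_rat] AE_all_countable)
 have sl: "AE t in ivl 0 ?T. AE y in ivl 0 1. u y t = f y t" using AE_slices(2)[OF fb(2)] by simp
 show ?thesis
  using hall sl bdry[of n, unfolded zero_boundary_values_def ivl_AE_leb] L2_slices(3)[OF g_L2[of n]]
 proof eventually_elim
  case (elim t)
  obtain v where v: "continuous_on {0..1} v" "AE y in ivl 0 1. u y t = v y" "v 0 = 0" "v 1 = 0" using elim(3) by blast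
  have fv: "AE y in ivl 0 1. f y t = v y" using elim(2) v(2) by eventually_elim simp
  have [measurable]: "(%y. f y t) \<in> borel1" by measurable
  have "bounded (v ` {0..1})" using v(1) by (intro compact_imp_bounded compact_continuous_image) auto
  then obtain B where "\<forall>x\<in>v ` {0..1}. norm x \<le> B" unfolding bounded_iff by blast
  then have B: "\<bar>v y\<bar> \<le> B" if "y \<in> {0..1}" for y using that by simp
  have fi: "integrable (ivl 0 1) (%y. f y t)"
  proof (rule ivl.integrable_const_bound[where B=B])
   show "AE y in ivl 0 1. norm (f y t) \<le> B" using fv AE_ivl_mem[of 0 1] by eventually_elim (use B in auto)
  qed measurable
  have "\<exists>\<kappa>. AE y in ivl 0 1. f y t = \<kappa> + (\<integral>x. g x t \<partial>ivl 0 y)"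
  proof (rule du_Bois_Reymond[where ?a0.0="1 / 4" and ?b0.0="3 / 4"])
   show "integrable (ivl a b) (%y. f y t)" if "0 < a" "a < b" "b < 1" for a b
    by (rule integrable_ivl_subset[OF fi]) (use that in auto)
   show "(\<integral>y. f y t * ?dz a b m y \<partial>ivl 0 1) = - (\<integral>y. g y t * ?z a b m y \<partial>ivl 0 1)"
    if "a \<in> \<rat>" "b \<in> \<rat>" "0 < a" "a < b" "b < 1" for a b m
   proof -
    have "h a b m t = 0" using elim(1) that by blast
    then show ?thesis by (simp add: h_def)
   qed
  qed (use elim(4) in auto)
  then obtain \<kappa> where \<kappa>: "AE y in ivl 0 1. f y t = \<kappa> + (\<integral>x. g x t \<partial>ivl 0 y)" by blast
  have ae: "AE y in ivl 0 1. v y = \<kappa> + (\<integral>x. g x t \<partial>ivl 0 y)" using \<kappa> fv by eventually_elim simp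
  have c: "continuous_on {0..1} (%y. \<kappa> + (\<integral>x. g x t \<partial>ivl 0 y))"
   by (intro continuous_on_add continuous_on_const continuous_on_indefinite elim(4))
  have e: "v y = \<kappa> + (\<integral>x. g x t \<partial>ivl 0 y)" if "y \<in> {0..1}" for y
   by (rule continuous_AE_eq[OF v(1) c _ _ _ ae that]) auto
  have "\<kappa> = 0" using e[of 0] v(3) by simp
  then have "(\<integral>x. g x t \<partial>ivl 0 1) = 0" using e[of 1] v(4) by simp
  moreover have "AE y in ivl 0 1. u y t = (\<integral>x. g x t \<partial>ivl 0 y)"
   using v(2) ae by eventually_elim (simp add: \<open>\<kappa> = 0\<close>)
  ultimately show ?case by blast
 qed
qed

end

lemma borel_measurable_lebesgue_on_AE:
 fixes f f' :: "'a::euclidean_space => real"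
 assumes S: "open S" and f': "f' \<in> borel1"
  and ae: "AE x in density lborel (indicator S). f x = f' x"
 shows "f \<in> borel_measurable (lebesgue_on S)"
proof -
 have [measurable]: "S \<in> sets borel" using S by simp
 let ?F = "%x. if x \<in> S then f x else 0" and ?F' = "%x. if x \<in> S then f' x else 0"
 have "?F' \<in> borel1" using f' by measurable
 then have F': "?F' \<in> borel_measurable lebesgue" by (intro measurable_completion) simp
 have "AE x in lebesgue_on S. f x = f' x" using ae AE_lebesgue_on[OF S] by blast
 then have "AE x in lebesgue. x \<in> S --> f x = f' x" using S by (subst (asm) AE_restrict_space_iff) auto
 then have eq: "AE x in lebesgue. ?F x = ?F' x"
 proof eventually_elim
  case (elim x) then show ?case by (cases "x \<in> S") simp_all
 qed
 have "?F \<in> borel_measurable lebesgue"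
 proof (rule measurableI)
  fix A :: "real set" assume "A \<in> sets borel"
  then have A: "?F' -` A \<inter> space lebesgue \<in> sets lebesgue" by (rule measurable_sets[OF F'])
  have "AE x in lebesgue. x \<in> ?F' -` A \<inter> space lebesgue \<longleftrightarrow> x \<in> ?F -` A \<inter> space lebesgue"
   using eq
  proof eventually_elim
   case (elim x) show ?case by (simp only: vimage_eq Int_iff elim)
  qed
  from completion.in_sets_AE[OF this A] show "?F -` A \<inter> space lebesgue \<in> sets lebesgue" by simp
 qed auto
 moreover have "S \<in> sets lebesgue" using S by simp
 ultimately show ?thesis by (subst (asm) borel_measurable_if) auto
qed

lemmas ivl_leb_measurable = borel_measurable_lebesgue_on_AE[OF open_greaterThanLessThan[where 'a=real], unfolded ivl_unfold]
lemmas cyl_leb_measurable = borel_measurable_lebesgue_on_AE[OF open_box, unfolded cyl_unfold]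

lemma integrable_ivl2_of_bound:
 fixes f :: "real => real => real"
 assumes f: "case_prod f \<in> borel2" and G: "integrable (ivl c d) G"
  and le: "AE t in ivl c d. \<forall>y. a < y --> y < b --> \<bar>f y t\<bar> \<le> G t"
 shows "integrable (ivl a b \<Otimes>\<^sub>M ivl c d) (case_prod f)"
proof -
 have Gm[measurable]: "G \<in> borel1" using borel_measurable_integrable[OF G] by simp
 have "integrable (ivl a b \<Otimes>\<^sub>M ivl c d) (%w. G (snd w))"
  by (rule ivl2.Fubini_integrable) (use G in simp_all)
 then show ?thesis
 proof (rule Bochner_Integration.integrable_bound)
  show "case_prod f \<in> borel_measurable (ivl a b \<Otimes>\<^sub>M ivl c d)" using f by simp
  show "AE w in ivl a b \<Otimes>\<^sub>M ivl c d. norm (case_prod f w) \<le> norm (G (snd w))"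
   using AE_pair_snd[OF le, of a b] AE_pair_fst[OF AE_ivl_mem[of a b], of c d]
  proof eventually_elim
   case (elim w)
   then have "\<bar>f (fst w) (snd w)\<bar> \<le> G (snd w)" by blast
   then show ?case by (simp add: case_prod_beta')
  qed
 qed
qed

section \<open>The momentum balance integrated in space and time\<close>

context velocity_flow
begin

definition \<sigma> :: "real => real => real" where "\<sigma> y t = \<mu> * (g y t / \<tau> y t) - P (\<theta> y) (\<tau> y t)"

definition U :: "real => real => real" where "U y t = (\<integral>x. g x t \<partial>ivl 0 y)"

lemma P\<tau>_meas [measurable]: "case_prod (%y t. P (\<theta> y) (\<tau> y t)) \<in> borel2"
proof -
 have "(%w. P (\<theta> (fst w)) (\<tau> (fst w) (snd w))) \<in> borel2" by measurable
 then show ?thesis by (simp add: case_prod_beta')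
qed

lemma \<sigma>_meas [measurable]: "case_prod \<sigma> \<in> borel2"
proof -
 have "(%w. \<mu> * (case_prod g w / case_prod \<tau> w) - case_prod (%y t. P (\<theta> y) (\<tau> y t)) w) \<in> borel2"
  by measurable
 then show ?thesis by (simp add: \<sigma>_def case_prod_beta')
qed

lemma U_meas [measurable]: "case_prod U \<in> borel2"
proof -
 have "(%w. \<integral>x. g x (snd w) \<partial>ivl 0 (fst w)) \<in> borel2" by measurable
 then show ?thesis by (simp add: U_def case_prod_beta')
qed

lemma pressure_eq: "AE w in cyl (real (Suc n)). Zfun gr (case_prod R w) (case_prod Q w) powr gp = P (\<theta> (fst w)) (case_prod \<tau> w)"
 using mass[of n] vol_g[of n] AE_pair_fst[OF \<theta>_bounds, of 0 "real (Suc n)"]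
proof eventually_elim
 case (elim w)
 define s where "s = case_prod \<tau> w"
 have s: "spec_vol (case_prod R w) (case_prod Q w) = s" using elim(2) by (simp add: s_def \<tau>_def case_prod_beta')
 have "0 < s" "case_prod R w = \<theta> (fst w) / s" "case_prod Q w = (1 - \<theta> (fst w)) / s"
  using elim(1) unfolding s by (auto simp: field_simps)
 moreover have "0 < \<theta> (fst w)" "\<theta> (fst w) < 1" using elim(3) \<theta>_const by auto
 ultimately show ?case by (simp add: P_def Zst_def flip: s_def)
qed

lemma velocity_joint: "AE w in cyl (real (Suc n)). case_prod u w = case_prod U w"
proof -
 have li: "locally_integrable (cylinder (real (Suc n))) (case_prod u)" using u_y[of n] by (simp add: weak_deriv_def)
 obtain f where f: "f \<in> borel1" "AE w in cyl (real (Suc n)). case_prod u w = f w"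
  using cyl_leb_ex[OF locally_integrable_box_measurable[OF li]] by metis
 have m: "(%w. f (fst w, snd w)) \<in> borel2" "(%w. U (fst w) (snd w)) \<in> borel2"
  using f(1) U_meas by (simp_all add: borel_prod_real case_prod_beta')
 have "AE t in ivl 0 (real (Suc n)). AE y in ivl 0 1. f (y, t) = U y t"
  using AE_slices(2)[OF f(2)] velocity_slices[of n]
 proof eventually_elim
  case (elim t)
  then have "AE y in ivl 0 1. u y t = f (y, t)" "AE y in ivl 0 1. u y t = (\<integral>x. g x t \<partial>ivl 0 y)" by auto
  then show ?case by eventually_elim (simp add: U_def)
 qed
 from AE_of_slices(2)[where Q="%y t. f (y, t) = U y t", OF pred_eq_borel[OF m] this]
 have "AE w in cyl (real (Suc n)). f (fst w, snd w) = U (fst w) (snd w)" .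
 with f(2) show ?thesis by eventually_elim (simp add: case_prod_beta')
qed

lemma U_integrable: "integrable (cyl (real (Suc n))) (case_prod U)"
proof (rule integrable_ivl2_of_bound)
 let ?T = "real (Suc n)"
 have "integrable (cyl ?T) (%w. \<bar>case_prod g w\<bar>)" using g_integrable by simp
 then have "integrable (cyl ?T) (case_prod (%y t. \<bar>g y t\<bar>))" by (simp add: case_prod_beta')
 from ivl2.integrable_snd[OF this] show "integrable (ivl 0 ?T) (%t. \<integral>y. \<bar>g y t\<bar> \<partial>ivl 0 1)" .
 show "AE t in ivl 0 ?T. \<forall>y. 0 < y --> y < 1 --> \<bar>U y t\<bar> \<le> (\<integral>y. \<bar>g y t\<bar> \<partial>ivl 0 1)"
  using L2_slices(3)[OF g_L2[of n]]
 proof eventually_elim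
  case (elim t)
  have "\<bar>U y t\<bar> \<le> (\<integral>y. \<bar>g y t\<bar> \<partial>ivl 0 1)" if "0 < y" "y < 1" for y
  proof -
   have "\<bar>U y t\<bar> \<le> (\<integral>x. \<bar>g x t\<bar> \<partial>ivl 0 y)" unfolding U_def by (rule integral_abs_bound)
   also have "\<dots> \<le> (\<integral>x. \<bar>g x t\<bar> \<partial>ivl 0 1)"
    by (rule integral_ivl_nonneg_mono) (use elim that in auto)
   finally show ?thesis .
  qed
  then show ?case by blast
 qed
qed (rule U_meas)

text \<open>Integrability reaches down to the initial time but stays away from the walls, in
  accordance with the local integrability of the pressure.\<close>

lemma \<sigma>_integrable:
 assumes ab: "0 < a" "b < 1"
 shows "integrable (ivl a b \<Otimes>\<^sub>M ivl 0 (real (Suc n))) (case_prod \<sigma>)"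
proof -
 let ?T = "real (Suc n)"
 have 1: "integrable (ivl a b \<Otimes>\<^sub>M ivl 0 ?T) (%w. case_prod g w / case_prod \<tau> w)"
 proof -
  have "in_L2 (cyl ?T) (case_prod (%y t. g y t / \<tau> y t))" using stress_L2[of n] by (simp add: case_prod_beta')
  from integrable_ivl2_subset[OF L2_slices(1)[OF this], of a b 0 ?T] show ?thesis
   using ab by (simp add: case_prod_beta')
 qed
 have 2: "integrable (ivl a b \<Otimes>\<^sub>M ivl 0 ?T) (case_prod (%y t. P (\<theta> y) (\<tau> y t)))"
 \<comment> \<open>The pressure is taken on the next horizon, since a compact set containing the end
   of the present one must lie below the end of the set on which local integrability is
   known.\<close>
 proof (rule locally_integrable_box[OF p_int[of "Suc n"]])
  show "case_prod (%y t. P (\<theta> y) (\<tau> y t)) \<in> borel1" using P\<tau>_meas by (simp add: borel_prod_real)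
  show "AE w in ivl a b \<Otimes>\<^sub>M ivl 0 ?T. (%(y, t). Zfun gr (R y t) (Q y t) powr gp) w = case_prod (%y t. P (\<theta> y) (\<tau> y t)) w"
   using pressure_eq[of n] ab unfolding AE_ivl2 by (auto elim!: eventually_mono)
 qed (use ab in auto)
 show ?thesis using Bochner_Integration.integrable_diff[OF integrable_mult_right[OF 1, of \<mu>] 2] by (simp add: \<sigma>_def case_prod_beta')
qed

text \<open>One choice of representatives, Borel in \<open>y\<close> at every single time and with
  the same continuity in time, as required of the velocity in the locale
  \<open>flow\<close>.\<close>

definition ub :: "real => real => real" where
 "ub = (SOME G. \<forall>t\<in>{0..}. in_L2 (ivl 0 1) (%y. G y t) \<and> (AE y in ivl 0 1. u y t = G y t) \<and>
  ((%s. L2_norm (ivl 0 1) (%y. G y s - G y t)) \<longlongrightarrow> 0) (at t within {0..}))"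

lemma ub:
 assumes "0 \<le> t"
 shows "in_L2 (ivl 0 1) (%y. ub y t)" "AE y in ivl 0 1. u y t = ub y t"
  "((%s. L2_norm (ivl 0 1) (%y. ub y s - ub y t)) \<longlongrightarrow> 0) (at t within {0..})"
 using someI_ex[OF L2_continuous_borel[OF u_cont], folded ub_def] assms by auto

text \<open>The weak formulation tested with a product. The time factor may be nonzero at time 0,
  which produces the term with the initial velocity, and its support ends before the horizon on
  which the stress is integrable.\<close>

lemma weak_form_product:
 assumes \<eta>: "tfun a b \<eta>" "\<And>x. (\<eta> has_real_derivative \<eta>' x) (at x)" "tfun a b \<eta>'" "0 < a" "b < 1"
  and \<psi>: "tfun c d \<psi>" "\<And>x. (\<psi> has_real_derivative \<psi>' x) (at x)" "tfun c d \<psi>'" "d < real (Suc n)"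
 defines "T' \<equiv> real (Suc (Suc n))"
 shows "integrable (ivl 0 T') (%t. (\<integral>y. U y t * \<eta> y \<partial>ivl 0 1) * \<psi>' t)"
  and "integrable (ivl 0 T') (%t. (\<integral>y. \<sigma> y t * \<eta>' y \<partial>ivl 0 1) * \<psi> t)"
  and "(\<integral>t. (\<integral>y. U y t * \<eta> y \<partial>ivl 0 1) * \<psi>' t \<partial>ivl 0 T') - (\<integral>t. (\<integral>y. \<sigma> y t * \<eta>' y \<partial>ivl 0 1) * \<psi> t \<partial>ivl 0 T')
   + (\<integral>y. u0 y * \<eta> y \<partial>ivl 0 1) * \<psi> 0 = 0"
proof -
 have m[measurable]: "\<eta> \<in> borel1" "\<eta>' \<in> borel1" "\<psi> \<in> borel1" "\<psi>' \<in> borel1"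
  using tfun_measurable \<eta>(1,3) \<psi>(1,3) by auto
 obtain B1 B2 B3 B4 where B: "\<And>x. \<bar>\<eta> x\<bar> \<le> B1" "\<And>x. \<bar>\<eta>' x\<bar> \<le> B2" "\<And>x. \<bar>\<psi> x\<bar> \<le> B3" "\<And>x. \<bar>\<psi>' x\<bar> \<le> B4"
  using tfun_bound \<eta>(1,3) \<psi>(1,3) by metis
 let ?a = "a / 2" and ?b = "(b + 1) / 2"
 have T': "T' = real (Suc n) + 1" by (simp add: T'_def)
 have Ui: "integrable (cyl T') (case_prod U)" unfolding T'_def by (rule U_integrable)
 have \<sigma>i: "integrable (ivl ?a ?b \<Otimes>\<^sub>M ivl 0 (real (Suc n))) (case_prod \<sigma>)" by (rule \<sigma>_integrable) (use \<eta>(4,5) in auto)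
 have r1: "integrable (cyl T') (%w. case_prod U w * (\<eta> (fst w) * \<psi>' (snd w)))"
  "(\<integral>w. case_prod U w * (\<eta> (fst w) * \<psi>' (snd w)) \<partial>cyl T') = (\<integral>t. (\<integral>y. U y t * \<eta> y \<partial>ivl 0 1) * \<psi>' t \<partial>ivl 0 T')"
  "integrable (ivl 0 T') (%t. (\<integral>y. U y t * \<eta> y \<partial>ivl 0 1) * \<psi>' t)"
  by (rule integrable_product_box[OF Ui m(1,4) B(1,4)]; blast)+
 have z1: "\<eta>' x = 0" if "\<not> (?a < x \<and> x < ?b)" for x using \<eta>(3-5) that by (auto simp: tfun_def)
 have z2: "\<psi> x = 0" if "0 < x" "\<not> (0 < x \<and> x < real (Suc n))" for x using \<psi>(1,4) that by (auto simp: tfun_def)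
 have r2: "integrable (cyl T') (%w. case_prod \<sigma> w * (\<eta>' (fst w) * \<psi> (snd w)))"
  "(\<integral>w. case_prod \<sigma> w * (\<eta>' (fst w) * \<psi> (snd w)) \<partial>cyl T') = (\<integral>t. (\<integral>y. \<sigma> y t * \<eta>' y \<partial>ivl 0 1) * \<psi> t \<partial>ivl 0 T')"
  "integrable (ivl 0 T') (%t. (\<integral>y. \<sigma> y t * \<eta>' y \<partial>ivl 0 1) * \<psi> t)"
  by (rule integrable_product_box[OF \<sigma>i m(2,3) B(2,3)]; (rule z1 z2; assumption))+
 show "integrable (ivl 0 T') (%t. (\<integral>y. U y t * \<eta> y \<partial>ivl 0 1) * \<psi>' t)" by (rule r1(3))
 show "integrable (ivl 0 T') (%t. (\<integral>y. \<sigma> y t * \<eta>' y \<partial>ivl 0 1) * \<psi> t)" by (rule r2(3))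
 have "test_function ({0<..<1} \<times> {..<T'}) (%w. \<eta> (fst w) * \<psi> (snd w))"
  by (rule test_function_product[OF \<eta>(1) \<psi>(1)]) (use \<eta>(4,5) \<psi>(4) in \<open>auto simp: T'\<close>)
 from weak_form[OF this[unfolded T'_def], folded T'_def]
 have wf0: "(\<integral>(y, t). u y t * (\<eta> y * \<psi>' t)
   - (\<mu> * uy (Suc n) y t / spec_vol (R y t) (Q y t) - Zfun gr (R y t) (Q y t) powr gp) * (\<eta>' y * \<psi> t)
   \<partial>lebesgue_on (cylinder T')) + (\<integral>y. u0 y * (\<eta> y * \<psi> 0) \<partial>ivl 0 1) = 0"
  by (simp only: dir_deriv_product[OF \<eta>(2) \<psi>(2)] fst_conv snd_conv)
 have e: "(%(y, t). u y t * (\<eta> y * \<psi>' t)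
   - (\<mu> * uy (Suc n) y t / spec_vol (R y t) (Q y t) - Zfun gr (R y t) (Q y t) powr gp) * (\<eta>' y * \<psi> t))
  = (%w. case_prod u w * (\<eta> (fst w) * \<psi>' (snd w))
   - (\<mu> * case_prod (uy (Suc n)) w / spec_vol (case_prod R w) (case_prod Q w) - Zfun gr (case_prod R w) (case_prod Q w) powr gp) * (\<eta>' (fst w) * \<psi> (snd w)))"
 proof (rule ext, goal_cases)
  case (1 w) show ?case by (cases w) (simp only: case_prod_conv fst_conv snd_conv)
 qed
 have wf: "(\<integral>w. (case_prod u w * (\<eta> (fst w) * \<psi>' (snd w))
   - (\<mu> * case_prod (uy (Suc n)) w / spec_vol (case_prod R w) (case_prod Q w) - Zfun gr (case_prod R w) (case_prod Q w) powr gp) * (\<eta>' (fst w) * \<psi> (snd w)))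
   \<partial>lebesgue_on (cylinder T')) + (\<integral>y. u0 y * \<eta> y \<partial>ivl 0 1) * \<psi> 0 = 0"
  using wf0 unfolding e by (simp only: mult.assoc[symmetric] integral_mult_left_zero)
 let ?H = "%w. case_prod U w * (\<eta> (fst w) * \<psi>' (snd w)) - case_prod \<sigma> w * (\<eta>' (fst w) * \<psi> (snd w))"
 have H: "?H \<in> borel1" unfolding borel_prod_real[symmetric] by measurable
 have ae: "AE w in cyl T'. case_prod u w * (\<eta> (fst w) * \<psi>' (snd w))
   - (\<mu> * case_prod (uy (Suc n)) w / spec_vol (case_prod R w) (case_prod Q w) - Zfun gr (case_prod R w) (case_prod Q w) powr gp) * (\<eta>' (fst w) * \<psi> (snd w))
   = ?H w"
  using velocity_joint[of "Suc n", folded T'_def] uy_g[of "Suc n", folded T'_def] vol_g[of "Suc n", folded T'_def] pressure_eq[of "Suc n", folded T'_def]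
 proof eventually_elim
  case (elim w)
  have "x * E - (\<mu> * G / s - p) * F = x * E - (\<mu> * (G / s) - p) * F" for x E G s p F :: real by simp
  then show ?case
   unfolding elim(1,2,4) elim(3)[folded \<tau>_def] by (simp only: \<sigma>_def case_prod_beta')
 qed
 from cyl_leb_int(1)[OF cyl_leb_measurable[OF H ae] H ae]
 have "(\<integral>w. ?H w \<partial>cyl T') + (\<integral>y. u0 y * \<eta> y \<partial>ivl 0 1) * \<psi> 0 = 0" using wf by simp
 moreover have "(\<integral>w. ?H w \<partial>cyl T') = (\<integral>t. (\<integral>y. U y t * \<eta> y \<partial>ivl 0 1) * \<psi>' t \<partial>ivl 0 T') - (\<integral>t. (\<integral>y. \<sigma> y t * \<eta>' y \<partial>ivl 0 1) * \<psi> t \<partial>ivl 0 T')"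
  using Bochner_Integration.integral_diff[OF r1(1) r2(1)] r1(2) r2(2) by simp
 ultimately show "(\<integral>t. (\<integral>y. U y t * \<eta> y \<partial>ivl 0 1) * \<psi>' t \<partial>ivl 0 T') - (\<integral>t. (\<integral>y. \<sigma> y t * \<eta>' y \<partial>ivl 0 1) * \<psi> t \<partial>ivl 0 T')
   + (\<integral>y. u0 y * \<eta> y \<partial>ivl 0 1) * \<psi> 0 = 0" by simp
qed

lemma \<sigma>_slab:
 assumes \<eta>: "tfun a b \<eta>" "0 < a" "b < 1"
 shows "integrable (cyl (real (Suc n))) (case_prod (%y t. \<sigma> y t * \<eta> y))"
  and "integrable (ivl 0 (real (Suc n))) (%t. \<integral>y. \<sigma> y t * \<eta> y \<partial>ivl 0 1)"
proof -
 have \<sigma>i: "integrable (ivl (a / 2) ((b + 1) / 2) \<Otimes>\<^sub>M ivl 0 (real (Suc n))) (case_prod \<sigma>)" by (rule \<sigma>_integrable) (use \<eta> in auto)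
 obtain B where B: "\<And>x. \<bar>\<eta> x\<bar> \<le> B" using tfun_bound[OF \<eta>(1)] by blast
 have z: "\<eta> x = 0" if "\<not> (a / 2 < x \<and> x < (b + 1) / 2)" for x using \<eta> that by (auto simp: tfun_def)
 show "integrable (cyl (real (Suc n))) (case_prod (%y t. \<sigma> y t * \<eta> y))"
  "integrable (ivl 0 (real (Suc n))) (%t. \<integral>y. \<sigma> y t * \<eta> y \<partial>ivl 0 1)"
  using integrable_slab[OF \<sigma>i tfun_measurable[OF \<eta>(1)] B z] by auto
qed

lemma tested_momentum:
 assumes \<eta>: "tfun a b \<eta>" "\<And>x. (\<eta> has_real_derivative \<eta>' x) (at x)" "tfun a b \<eta>'" "0 < a" "b < 1" and t: "0 \<le> t"
 shows "(\<integral>y. ub y t * \<eta> y \<partial>ivl 0 1) - (\<integral>y. u0 y * \<eta> y \<partial>ivl 0 1) = (\<integral>r. (- (\<integral>y. \<sigma> y r * \<eta>' y \<partial>ivl 0 1)) \<partial>ivl 0 t)"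
proof -
 obtain n where "t < real n" using reals_Archimedean2 by blast
 define T T' where "T = real (Suc n)" and "T' = real (Suc (Suc n))"
 have tT: "t \<in> {0..<T}" and T: "0 < T" "T < T'" using t \<open>t < real n\<close> by (auto simp: T_def T'_def)
 have [measurable]: "\<eta> \<in> borel1" "\<eta>' \<in> borel1"
  using tfun_measurable \<eta>(1,3) by auto
 define A where "A t = (\<integral>y. U y t * \<eta> y \<partial>ivl 0 1)" for t
 define W where "W t = (\<integral>y. \<sigma> y t * \<eta>' y \<partial>ivl 0 1)" for t
 define c0 where "c0 = (\<integral>y. u0 y * \<eta> y \<partial>ivl 0 1)"
 \<comment> \<open>Extension by 0 to negative times absorbs the initial condition: on
   \<open>(-1, T)\<close> the weak formulation says that \<open>w\<close> is the weak derivative of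
   \<open>S\<close>, with no extra term, and the constant of integration is read off where both
   functions vanish.\<close>
 define S where "S t = (if 0 < t then A t - c0 else 0)" for t
 define w where "w t = (if 0 < t then - W t else 0)" for t
 have Am[measurable]: "A \<in> borel1" unfolding A_def by measurable
 have Wm[measurable]: "W \<in> borel1" unfolding W_def by measurable
 have Sm[measurable]: "S \<in> borel1" unfolding S_def by measurable
 have wm[measurable]: "w \<in> borel1" unfolding w_def by measurable
 have Wi: "integrable (ivl 0 T) W" unfolding W_def T_def by (rule \<sigma>_slab(2)[OF \<eta>(3-5)])
 obtain B where B: "\<And>x. \<bar>\<eta> x\<bar> \<le> B" using tfun_bound[OF \<eta>(1)] by blast
 have Ai: "integrable (ivl 0 T) A"
  unfolding A_def T_def by (rule integrable_slab(2)[OF U_integrable tfun_measurable[OF \<eta>(1)] B]) simp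
 have wi: "integrable (ivl (- 1) T) w"
 proof -
  have "(%x. indicator {- 1<..<T} x * w x) = (%x. - (indicator {0<..<T} x * W x))"
   by (auto simp: fun_eq_iff w_def indicator_def)
  then show ?thesis using Wi unfolding integrable_ivl[OF wm] integrable_ivl[OF Wm] by simp
 qed
 have Si: "integrable (ivl (- 1) T) S"
 proof -
  have "integrable (ivl 0 T) (%x. A x - c0)" using Ai by simp
  moreover have "(%x. indicator {- 1<..<T} x * S x) = (%x. indicator {0<..<T} x * (A x - c0))"
   by (auto simp: fun_eq_iff S_def indicator_def)
  ultimately show ?thesis using integrable_ivl[OF Sm, of "- 1" T] integrable_ivl[of "%x. A x - c0" 0 T] by simp
 qed
 have "\<exists>\<kappa>. AE x in ivl (- 1) T. S x = \<kappa> + (\<integral>r. w r \<partial>ivl (- 1) x)"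
 proof (rule du_Bois_Reymond[where ?a0.0="T / 3" and ?b0.0="2 * T / 3"])
  show "integrable (ivl c d) S" if "- 1 < c" "c < d" "d < T" for c d
   by (rule integrable_ivl_subset[OF Si]) (use that in auto)
  fix c d :: real and m :: nat assume cd: "- 1 < c" "c < d" "d < T"
  have T3: "T / 3 < 2 * T / 3" using T by simp
  note zp = zeta_props[OF T3 cd(2), where n=m]
  let ?z = "zeta (T / 3) (2 * T / 3) c d m" and ?dz = "dzeta (T / 3) (2 * T / 3) c d m"
  have dT: "max (2 * T / 3) d < T" using cd T by auto
  have [measurable]: "?z \<in> borel1" "?dz \<in> borel1"
   using tfun_measurable[OF zp(1)] tfun_measurable[OF zp(3)] by auto
  have dT': "max (2 * T / 3) d < real (Suc n)" using dT unfolding T_def .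
  have z0: "?z x = 0" "?dz x = 0" if "T \<le> x" for x
  proof -
   have "max (2 * T / 3) d < x" using dT that by linarith
   then have "x \<notin> {min (T / 3) c..max (2 * T / 3) d}" by auto
   then show "?z x = 0" "?dz x = 0" using zp(1,3) by (simp_all add: tfun_def)
  qed
  note wp = weak_form_product[OF \<eta> zp(1,2,3) dT', folded T'_def A_def W_def c0_def]
  have "(\<integral>x. S x * ?dz x \<partial>ivl (- 1) T) = (\<integral>x. (A x - c0) * ?dz x \<partial>ivl 0 T')"
  proof -
   have "(%x. indicator {- 1<..<T} x * (S x * ?dz x)) = (%x. indicator {0<..<T'} x * ((A x - c0) * ?dz x))"
    using z0(2) T by (auto simp: fun_eq_iff S_def indicator_def)
   moreover have "(%x. S x * ?dz x) \<in> borel1" "(%x. (A x - c0) * ?dz x) \<in> borel1" by measurable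
   ultimately show ?thesis by (simp add: integral_ivl)
  qed
  \<comment> \<open>Subtracting \<open>c0\<close> contributes \<open>c0 * ?z 0\<close>, because
    \<open>?z\<close> vanishes at \<open>T'\<close>; this is exactly the initial term of the weak
    formulation.\<close>
  also have "\<dots> = (\<integral>x. A x * ?dz x \<partial>ivl 0 T') - c0 * (?z T' - ?z 0)"
  proof -
   have "integrable (ivl 0 T') ?dz"
    by (rule integrable_ivl_continuous) (auto intro: continuous_on_subset[OF tfun_continuous[OF zp(3)]])
   moreover have "(\<integral>x. ?dz x \<partial>ivl 0 T') = ?z T' - ?z 0"
    by (rule FTC_ivl[OF _ zp(2) tfun_continuous[OF zp(3)]]) (use T in simp)
   ultimately show ?thesis using wp(1) by (simp add: left_diff_distrib)
  qed
  also have "\<dots> = (\<integral>x. W x * ?z x \<partial>ivl 0 T')" using wp(3) z0(1)[of T'] T by simp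
  also have "\<dots> = - (\<integral>x. w x * ?z x \<partial>ivl (- 1) T)"
  proof -
   have "(%x. indicator {- 1<..<T} x * (w x * ?z x)) = (%x. - (indicator {0<..<T'} x * (W x * ?z x)))"
    using z0(1) T by (auto simp: fun_eq_iff w_def indicator_def)
   moreover have "(%x. w x * ?z x) \<in> borel1" "(%x. W x * ?z x) \<in> borel1" by measurable
   ultimately show ?thesis by (simp add: integral_ivl)
  qed
  finally show "(\<integral>x. S x * ?dz x \<partial>ivl (- 1) T) = - (\<integral>x. w x * ?z x \<partial>ivl (- 1) T)" .
 qed (use T Sm wi in auto)
 then obtain \<kappa> where \<kappa>: "AE x in ivl (- 1) T. S x = \<kappa> + (\<integral>r. w r \<partial>ivl (- 1) x)" by blast
 have wint: "(\<integral>r. w r \<partial>ivl (- 1) x) = (\<integral>r. - W r \<partial>ivl 0 x)" for x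
 proof -
  have "(%r. indicator {- 1<..<x} r * w r) = (%r. indicator {0<..<x} r * - W r)"
   by (auto simp: fun_eq_iff w_def indicator_def)
  moreover have m: "(%r. - W r) \<in> borel1" by measurable
  ultimately show ?thesis unfolding integral_ivl[OF wm] integral_ivl[OF m] by simp
 qed
 have "\<kappa> = 0"
 proof -
  have "AE x in ivl (- 1) 0. S x = \<kappa> + (\<integral>r. w r \<partial>ivl (- 1) x)" by (rule AE_ivl_subset[OF \<kappa>]) (use T in auto)
  from AE_ivl_exists[OF this] obtain x where "- 1 < x" "x < 0" "S x = \<kappa> + (\<integral>r. w r \<partial>ivl (- 1) x)" by auto
  then show ?thesis by (simp add: wint S_def)
 qed
 have "AE x in ivl 0 T. S x = \<kappa> + (\<integral>r. w r \<partial>ivl (- 1) x)" by (rule AE_ivl_subset[OF \<kappa>]) auto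
 then have ae: "AE x in ivl 0 T. (\<integral>y. ub y x * \<eta> y \<partial>ivl 0 1) = c0 + (\<integral>r. - W r \<partial>ivl 0 x)"
  using velocity_slices[of n, folded T_def] AE_ivl_mem[of 0 T]
 proof eventually_elim
  case (elim x)
  have x: "0 \<le> x" using elim by simp
  have [measurable]: "(%y. ub y x) \<in> borel1" using in_L2_measurable[OF ub(1)[OF x]] by simp
  have "AE y in ivl 0 1. ub y x * \<eta> y = U y x * \<eta> y"
   using ub(2)[OF x] conjunct2[OF elim(2)] by eventually_elim (simp add: U_def)
  note e = this
  have "(\<integral>y. ub y x * \<eta> y \<partial>ivl 0 1) = A x"
   unfolding A_def by (rule integral_cong_AE) (measurable, rule e)
  then show ?case using elim(1,3) \<open>\<kappa> = 0\<close> by (simp add: wint S_def)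
 qed
 have c1: "continuous_on {0..<T} (%x. \<integral>y. ub y x * \<eta> y \<partial>ivl 0 1)"
  by (rule continuous_on_subset[OF continuous_on_pairing[of "{0..}" ub]]) (use ub tfun_L2[OF \<eta>(1)] in auto)
 have "integrable (ivl 0 T) (%r. - W r)" using Wi by simp
 then have c2: "continuous_on {0..<T} (%x. c0 + (\<integral>r. - W r \<partial>ivl 0 x))"
  by (intro continuous_on_add continuous_on_const continuous_on_subset[OF continuous_on_indefinite]) auto
 have "(\<integral>y. ub y t * \<eta> y \<partial>ivl 0 1) = c0 + (\<integral>r. - W r \<partial>ivl 0 t)"
  by (rule continuous_AE_eq[OF c1 c2 _ _ T(1) ae tT]) auto
 then show ?thesis by (simp only: c0_def W_def)
qed

lemma initial_velocity: "AE y in ivl 0 1. ub y 0 = u0 y"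
proof -
 have i: "in_L2 (ivl 0 1) (%y. ub y 0 - u0 y)" by (rule in_L2_diff[OF ub(1) u0]) simp
 have "AE y in ivl 0 1. ub y 0 - u0 y = 0"
 proof (rule AE_zero_of_bumps)
  show "(%y. ub y 0 - u0 y) \<in> borel1" using in_L2_measurable[OF i] by simp
  fix a b :: real and n assume ab: "0 < a" "a < b" "b < 1"
  show "integrable (ivl a b) (%y. ub y 0 - u0 y)"
   by (rule integrable_ivl_subset[OF ivl.in_L2_integrable[OF i]]) (use ab in auto)
  note \<eta> = bump_tfun[of a b n]
  obtain \<eta>' where \<eta>': "\<And>x. (bump a b n has_real_derivative \<eta>' x) (at x)" "tfun a b \<eta>'" using tfun_deriv[OF \<eta>] by metis
  have "(\<integral>y. ub y 0 * bump a b n y \<partial>ivl 0 1) - (\<integral>y. u0 y * bump a b n y \<partial>ivl 0 1) = 0"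
   using tested_momentum[OF \<eta> \<eta>' ab(1,3), of 0] by simp
  then show "(\<integral>y. (ub y 0 - u0 y) * bump a b n y \<partial>ivl 0 1) = 0"
   using in_L2_mult_integrable[OF ub(1)[of 0] tfun_L2[OF \<eta>]] in_L2_mult_integrable[OF u0 tfun_L2[OF \<eta>]]
   by (simp add: left_diff_distrib)
 qed
 then show ?thesis by eventually_elim simp
qed

text \<open>Du Bois-Reymond in \<open>y\<close> at a fixed time: by \<open>tested_momentum\<close>
  the time integral of the stress has the velocity increment as its weak space derivative. The
  constant of integration, one for each time, becomes the function \<open>c\<close> of the locale
  \<open>flow\<close>.\<close>

lemma stress_primitive:
 assumes t: "0 \<le> t"
 shows "\<exists>c. AE y in ivl 0 1. (\<integral>r. \<sigma> y r \<partial>ivl 0 t) = c + (\<integral>x. ub x t \<partial>ivl 0 y) - (\<integral>x. ub x 0 \<partial>ivl 0 y)"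
proof -
 obtain n where n: "t < real n" using reals_Archimedean2 by blast
 let ?z = "zeta (1 / 4) (3 / 4)" and ?dz = "dzeta (1 / 4) (3 / 4)"
 have q: "(1 / 4 :: real) < 3 / 4" by simp
 have L: "in_L2 (ivl 0 1) (%x. ub x t - u0 x)" by (rule in_L2_diff[OF ub(1)[OF t] u0])
 have \<sigma>t: "integrable (ivl a b \<Otimes>\<^sub>M ivl 0 t) (case_prod \<sigma>)" if "0 < a" "b < 1" for a b
  by (rule integrable_ivl2_subset[OF \<sigma>_integrable[OF that, of n]]) (use n in auto)
 have "\<exists>c. AE y in ivl 0 1. (\<integral>r. \<sigma> y r \<partial>ivl 0 t) = c + (\<integral>x. ub x t - u0 x \<partial>ivl 0 y)"
 proof (rule du_Bois_Reymond[where ?a0.0="1 / 4" and ?b0.0="3 / 4"])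
  show "(%y. \<integral>r. \<sigma> y r \<partial>ivl 0 t) \<in> borel1" by measurable
  show "integrable (ivl a b) (%y. \<integral>r. \<sigma> y r \<partial>ivl 0 t)" if "0 < a" "a < b" "b < 1" for a b
   by (rule ivl2.integrable_fst[OF \<sigma>t]) (use that in auto)
  show "integrable (ivl 0 1) (%x. ub x t - u0 x)" by (rule ivl.in_L2_integrable[OF L])
  fix a b :: real and m assume ab: "0 < a" "a < b" "b < 1"
  note zp = zeta_props[OF q ab(2), where n=m]
  have lr: "0 < min (1 / 4) a" "max (3 / 4) b < 1" using ab by auto
  have i: "integrable (cyl t) (case_prod (%y r. \<sigma> y r * ?dz a b m y))"
   by (rule integrable_ivl2_subset[OF \<sigma>_slab(1)[OF zp(3) lr, of n]]) (use n in auto)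
  have "(\<integral>y. (\<integral>r. \<sigma> y r \<partial>ivl 0 t) * ?dz a b m y \<partial>ivl 0 1) = (\<integral>r. (\<integral>y. \<sigma> y r * ?dz a b m y \<partial>ivl 0 1) \<partial>ivl 0 t)"
   using ivl2.integral_snd[OF i] ivl2.integral_fst[OF i] by simp
  also have "\<dots> = - ((\<integral>y. ub y t * ?z a b m y \<partial>ivl 0 1) - (\<integral>y. u0 y * ?z a b m y \<partial>ivl 0 1))"
   using tested_momentum[OF zp(1,2,3) lr t] by simp
  also have "\<dots> = - (\<integral>y. (ub y t - u0 y) * ?z a b m y \<partial>ivl 0 1)"
   using in_L2_mult_integrable[OF ub(1)[OF t] tfun_L2[OF zp(1)]] in_L2_mult_integrable[OF u0 tfun_L2[OF zp(1)]]
   by (simp add: left_diff_distrib)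
  finally show "(\<integral>y. (\<integral>r. \<sigma> y r \<partial>ivl 0 t) * ?dz a b m y \<partial>ivl 0 1) = - (\<integral>y. (ub y t - u0 y) * ?z a b m y \<partial>ivl 0 1)" .
 qed auto
 then obtain c where c: "AE y in ivl 0 1. (\<integral>r. \<sigma> y r \<partial>ivl 0 t) = c + (\<integral>x. ub x t - u0 x \<partial>ivl 0 y)" by blast
 have "(\<integral>x. ub x t - u0 x \<partial>ivl 0 y) = (\<integral>x. ub x t \<partial>ivl 0 y) - (\<integral>x. ub x 0 \<partial>ivl 0 y)" if "y < 1" for y
 proof -
  have [measurable]: "u0 \<in> borel1" "(%y. ub y 0) \<in> borel1"
   using in_L2_measurable[OF u0] in_L2_measurable[OF ub(1)[of 0]] by auto
  have i: "integrable (ivl 0 y) (%x. ub x t)" "integrable (ivl 0 y) u0"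
   using integrable_ivl_subset[OF ivl.in_L2_integrable[OF ub(1)[OF t]], of 0 y]
    integrable_ivl_subset[OF ivl.in_L2_integrable[OF u0], of 0 y] that by auto
  have "(\<integral>x. ub x 0 \<partial>ivl 0 y) = (\<integral>x. u0 x \<partial>ivl 0 y)"
   by (rule integral_cong_AE) (measurable, rule AE_ivl_subset[OF initial_velocity], use that in auto)
  then show ?thesis using i by simp
 qed
 with c AE_ivl_mem[of 0 1] have "AE y in ivl 0 1. (\<integral>r. \<sigma> y r \<partial>ivl 0 t) = c + (\<integral>x. ub x t \<partial>ivl 0 y) - (\<integral>x. ub x 0 \<partial>ivl 0 y)"
  by (auto elim: eventually_elim2)
 then show ?thesis by blast
qed

text \<open>The chain rule for the logarithm along each \<open>\<tau> y\<close>. Continuity and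
  positivity on the compact time interval are enough for it, before any bound that is uniform in
  \<open>y\<close> exists.\<close>

lemma stress_integral:
 assumes t: "0 \<le> t"
 shows "AE y in ivl 0 1. (\<integral>r. \<sigma> y r \<partial>ivl 0 t) = \<mu> * ln (\<tau> y t / \<tau>0 y) - (\<integral>r. P (\<theta> y) (\<tau> y r) \<partial>ivl 0 t)"
proof -
 obtain n where "t < real n" using reals_Archimedean2 by blast
 then have n: "t < real (Suc n)" by simp
 show ?thesis
  using \<tau>_pos L2_slices(2)[OF g_L2[of n]] \<theta>_bounds
 proof eventually_elim
  case (elim y)
  have \<theta>: "0 < \<theta> y" "\<theta> y < 1" using elim(3) \<theta>_const by auto
  have gi: "integrable (ivl 0 t) (g y)" by (rule integrable_ivl_subset[OF elim(2)]) (use n in auto)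
  have [measurable]: "g y \<in> borel1" using borel_measurable_integrable[OF gi] by simp
  have \<tau>m[measurable]: "\<tau> y \<in> borel1" unfolding \<tau>_def by measurable
  have \<tau>c: "continuous_on {0..t} (\<tau> y)"
   by (rule continuous_on_subset[OF \<tau>_continuous[OF elim(2)]]) (use n in auto)
  have p: "0 < x" if "x \<in> \<tau> y ` {0..t}" for x using that elim(1) by auto
  have d: "(ln has_real_derivative 1 / x) (at x)" if "x \<in> \<tau> y ` {0..t}" for x
   using p[OF that] by (auto intro!: derivative_eq_intros)
  have cont: "continuous_on (\<tau> y ` {0..t}) (%x. 1 / x)" by (intro continuous_intros) (use p in force)
  have m: "(%r. 1 / \<tau> y r * g y r) \<in> borel1" by measurable
  have e: "\<tau> y s = \<tau> y 0 + (\<integral>r. g y r \<partial>ivl 0 s)" for s by (simp add: \<tau>_def)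
  have r: "integrable (ivl 0 t) (%r. 1 / \<tau> y r * g y r)"
   "ln (\<tau> y t) - ln (\<tau> y 0) = (\<integral>r. 1 / \<tau> y r * g y r \<partial>ivl 0 t)"
   by (rule indefinite_chain_rule[OF gi t e d cont m]; assumption)+
  have 0: "\<tau> y 0 = \<tau>0 y" by (simp add: \<tau>_def)
  have pos: "0 < \<tau> y t" "0 < \<tau>0 y" using elim(1)[rule_format, of t] elim(1)[rule_format, of 0] t by (auto simp: 0)
  have Pi: "integrable (ivl 0 t) (%r. P (\<theta> y) (\<tau> y r))"
  proof (rule integrable_ivl_continuous)
   show "(%r. P (\<theta> y) (\<tau> y r)) \<in> borel1" by measurable
   show "continuous_on {0..t} (%r. P (\<theta> y) (\<tau> y r))"
    by (rule continuous_on_compose2[OF continuous_on_P[OF \<theta>] \<tau>c]) (use p in auto)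
  qed
  have "(\<integral>r. \<sigma> y r \<partial>ivl 0 t) = (\<integral>r. \<mu> * (1 / \<tau> y r * g y r) - P (\<theta> y) (\<tau> y r) \<partial>ivl 0 t)" by (simp add: \<sigma>_def)
  also have "\<dots> = \<mu> * (\<integral>r. 1 / \<tau> y r * g y r \<partial>ivl 0 t) - (\<integral>r. P (\<theta> y) (\<tau> y r) \<partial>ivl 0 t)"
   by (simp only: Bochner_Integration.integral_diff[OF integrable_mult_right[OF r(1)] Pi] integral_mult_right_zero)
  finally show ?case using r(2) pos by (simp add: ln_div 0)
 qed
qed

lemma ex_flow: "\<exists>c. flow gp gm \<mu> \<theta>lo \<theta>hi \<tau>lo \<tau>hi \<theta> \<tau>0 g ub \<tau> c"
proof -
 have "\<forall>t. \<exists>c. 0 \<le> t --> (AE y in ivl 0 1. (\<integral>r. \<sigma> y r \<partial>ivl 0 t) = c + (\<integral>x. ub x t \<partial>ivl 0 y) - (\<integral>x. ub x 0 \<partial>ivl 0 y))"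
  using stress_primitive by blast
 from choice[OF this] obtain c where c: "\<And>t. 0 \<le> t ==> AE y in ivl 0 1. (\<integral>r. \<sigma> y r \<partial>ivl 0 t) = c t + (\<integral>x. ub x t \<partial>ivl 0 y) - (\<integral>x. ub x 0 \<partial>ivl 0 y)"
  by blast
 have n: "\<exists>n. T \<le> real (Suc n)" for T
 proof -
  obtain n where "T < real n" using reals_Archimedean2 by blast
  then show ?thesis by (intro exI[of _ n]) simp
 qed
 have "flow gp gm \<mu> \<theta>lo \<theta>hi \<tau>lo \<tau>hi \<theta> \<tau>0 g ub \<tau> c"
 proof unfold_locales
  show "in_L2 (cyl T) (case_prod g)" for T
   using n[of T] in_L2_ivl2_subset[OF g_L2, of 0 1 0 T] by auto
  show "\<tau> y t = \<tau>0 y + (\<integral>r. g y r \<partial>ivl 0 t)" for y t by (rule \<tau>_def)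
  show "AE t in ivl 0 T. (\<integral>x. g x t \<partial>ivl 0 1) = 0 \<and> (AE y in ivl 0 1. ub y t = (\<integral>x. g x t \<partial>ivl 0 y))" for T
  proof -
   obtain n where "T \<le> real (Suc n)" using n by blast
   from AE_ivl_subset[OF velocity_slices[of n] order_refl this] AE_ivl_mem[of 0 T] show ?thesis
   proof eventually_elim
    case (elim t)
    have "AE y in ivl 0 1. u y t = ub y t" using ub(2)[of t] elim by simp
    moreover have "AE y in ivl 0 1. u y t = (\<integral>x. g x t \<partial>ivl 0 y)" using elim by simp
    ultimately have "AE y in ivl 0 1. ub y t = (\<integral>x. g x t \<partial>ivl 0 y)" by eventually_elim simp
    then show ?case using elim by simp
   qed
  qed
  show "AE y in ivl 0 1. \<mu> * ln (\<tau> y t / \<tau>0 y) - (\<integral>r. P (\<theta> y) (\<tau> y r) \<partial>ivl 0 t)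
    = c t + (\<integral>x. ub x t \<partial>ivl 0 y) - (\<integral>x. ub x 0 \<partial>ivl 0 y)" if "0 \<le> t" for t
   using c[OF that] stress_integral[OF that] by eventually_elim simp
 qed (use mu \<theta>_const \<tau>0_const \<theta>_bounds \<tau>0_bounds \<tau>_pos ub in auto)
 then show ?thesis by blast
qed

end

section \<open>From the specific volume back to the densities\<close>

lemma ivl_leb_norm:
 assumes "f' \<in> borel1" "AE y in ivl a b. f y = f' y"
 shows "L2_norm (lebesgue_on {a<..<b}) f = L2_norm (ivl a b) f'"
proof -
 have m: "(%y. (f' y)\<^sup>2) \<in> borel1" using assms(1) by simp
 have ae: "AE y in ivl a b. (f y)\<^sup>2 = (f' y)\<^sup>2" using assms(2) by eventually_elim simp
 show ?thesis unfolding L2_norm_def using ivl_leb_int(1)[OF ivl_leb_measurable[OF m ae] m ae] by simp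
qed

text \<open>Both densities are a fixed numerator in \<open>[0, 1]\<close> over the volume, and the
  reciprocal is Lipschitz away from 0 with the constant \<open>1 / (d * e)\<close>.\<close>

lemma L2_quotient_bound:
 fixes p s a X Y :: "real => real"
 assumes [measurable]: "p \<in> borel1" "s \<in> borel1" "a \<in> borel1"
  and de: "0 < d" "0 < e" and ae: "AE y in ivl 0 1. d \<le> p y \<and> p y \<le> M \<and> e \<le> s y \<and> s y \<le> m"
  and a: "AE y in ivl 0 1. 0 \<le> a y \<and> a y \<le> 1"
  and X: "AE y in ivl 0 1. X y = a y / p y" and Y: "AE y in ivl 0 1. Y y = a y / s y"
 shows "(L2_norm unit_space (%y. X y - Y y))\<^sup>2 \<le> (1 / (d * e))\<^sup>2 * (\<integral>y. (p y - s y)\<^sup>2 \<partial>ivl 0 1)"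
proof -
 define K where "K = 1 / (d * e)"
 have L: "in_L2 (ivl 0 1) (%y. p y - s y)"
 proof (rule ivl.in_L2_bounded[where C="M + m"])
  show "AE y in ivl 0 1. \<bar>p y - s y\<bar> \<le> M + m" using ae
  proof eventually_elim
   case (elim y) then show ?case using de by linarith
  qed
 qed measurable
 have le: "AE y in ivl 0 1. \<bar>a y / p y - a y / s y\<bar> \<le> \<bar>K * (p y - s y)\<bar>"
  using ae a
 proof eventually_elim
  case (elim y)
  have pos: "0 < p y" "0 < s y" using elim(1) de by linarith+
  have le: "d * e \<le> p y * s y" using elim(1) de pos by (intro mult_mono) auto
  have "a y / p y - a y / s y = - ((p y - s y) * (a y / (p y * s y)))" using pos by (simp add: field_simps)
  then have "\<bar>a y / p y - a y / s y\<bar> = \<bar>p y - s y\<bar> * \<bar>a y / (p y * s y)\<bar>" by (simp only: abs_minus_cancel abs_mult)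
  also have "\<bar>a y / (p y * s y)\<bar> = a y / (p y * s y)" using pos elim(2) by simp
  also have "\<bar>p y - s y\<bar> * (a y / (p y * s y)) \<le> \<bar>p y - s y\<bar> * K"
   unfolding K_def using le elim(2) de by (intro mult_left_mono frac_le) auto
  also have "\<dots> = \<bar>K * (p y - s y)\<bar>" using de by (simp add: K_def abs_mult)
  finally show ?case .
 qed
 have "L2_norm unit_space (%y. X y - Y y) = L2_norm (ivl 0 1) (%y. a y / p y - a y / s y)"
 proof (rule ivl_leb_norm)
  show "AE y in ivl 0 1. X y - Y y = a y / p y - a y / s y" using X Y by eventually_elim simp
 qed measurable
 also have "\<dots> \<le> L2_norm (ivl 0 1) (%y. K * (p y - s y))"
  by (rule L2_norm_mono[OF le in_L2_cmult[OF L]]) measurable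
 finally have "(L2_norm unit_space (%y. X y - Y y))\<^sup>2 \<le> (L2_norm (ivl 0 1) (%y. K * (p y - s y)))\<^sup>2"
  by (intro power_mono) auto
 also have "\<dots> = K\<^sup>2 * (\<integral>y. (p y - s y)\<^sup>2 \<partial>ivl 0 1)" by (simp add: L2_norm_sq power_mult_distrib)
 finally show ?thesis by (simp only: K_def)
qed

lemma (in exponents) vol_bounds:
 assumes z: "0 < z" and \<theta>: "0 < \<theta>" "\<theta> < 1"
 shows "min (1 / z) (z powr - gr) \<le> vol \<theta> z" "vol \<theta> z \<le> 1 / z + z powr - gr"
proof -
 define e where "e = min (1 / z) (z powr - gr)"
 have "e = \<theta> * e + (1 - \<theta>) * e" by (simp add: algebra_simps)
 also have "\<dots> \<le> \<theta> * (1 / z) + (1 - \<theta>) * z powr - gr"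
  using \<theta> by (intro add_mono mult_left_mono) (auto simp: e_def)
 finally show "min (1 / z) (z powr - gr) \<le> vol \<theta> z" by (simp add: vol_def e_def)
 have "\<theta> * (1 / z) + (1 - \<theta>) * z powr - gr \<le> 1 * (1 / z) + 1 * z powr - gr"
  using \<theta> z by (intro add_mono mult_right_mono) auto
 then show "vol \<theta> z \<le> 1 / z + z powr - gr" by (simp add: vol_def)
qed

context velocity_flow
begin

text \<open>The constant pressure fixes one value \<open>z\<close> of \<open>Z\<close> for almost
  all \<open>y\<close>, and the relation between the densities and \<open>Z\<close> then says that
  the volume is \<open>vol (\<theta> y) z\<close>.\<close>

lemma steady_volume:
 assumes C: "0 < C" and z: "z = C powr (1 / gp)"
  and ss: "AE y in ivl 0 1. 0 < Rinf y \<and> 0 < Qinf y \<and>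
   Rinf y * spec_vol (Rinf y) (Qinf y) = \<theta> y \<and> Qinf y * spec_vol (Rinf y) (Qinf y) = 1 - \<theta> y \<and>
   uinf y = 0 \<and> Zinf y powr gp = C \<and> Qinf y = (1 - Rinf y / Zinf y) * Zinf y powr gr \<and> Rinf y \<le> Zinf y"
 shows "AE y in ivl 0 1. spec_vol (Rinf y) (Qinf y) = vol (\<theta> y) z \<and> Rinf y = \<theta> y / vol (\<theta> y) z \<and>
   Qinf y = (1 - \<theta> y) / vol (\<theta> y) z \<and> uinf y = 0"
 using ss \<theta>_bounds
proof eventually_elim
 case (elim y)
 define x where "x = spec_vol (Rinf y) (Qinf y)"
 note e1 = elim(1)[folded x_def]
 have x: "0 < x" using e1 by (simp add: x_def)
 have RQ: "Rinf y = \<theta> y / x" "Qinf y = (1 - \<theta> y) / x" using e1 x by (auto simp: eq_divide_eq)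
 have \<theta>: "0 < \<theta> y" "\<theta> y < 1" using elim(2) \<theta>_const by auto
 have Z0: "0 < Zinf y" using e1 by linarith
 have "Zinf y = (Zinf y powr gp) powr (1 / gp)" using gp Z0 by (simp add: powr_powr)
 also have "Zinf y powr gp = C" using e1 by blast
 finally have Z: "Zinf y = z" by (simp only: z)
 have "Qinf y = (1 - Rinf y / Zinf y) * Zinf y powr gr" "Rinf y \<le> Zinf y" using e1 by blast+
 then have "(1 - \<theta> y) / x = (1 - \<theta> y / x / z) * z powr gr \<and> \<theta> y / x \<le> z" unfolding RQ Z by blast
 then have "vol (\<theta> y) z = x" using Zfun_vol_iff[OF \<theta> x, of z] by blast
 then show ?case using RQ e1 unfolding x_def[symmetric] by simp
qed

lemma exponential_decay:
 assumes C: "0 < C"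
  and ss: "AE y in ivl 0 1. 0 < Rinf y \<and> 0 < Qinf y \<and>
   Rinf y * spec_vol (Rinf y) (Qinf y) = \<theta> y \<and> Qinf y * spec_vol (Rinf y) (Qinf y) = 1 - \<theta> y \<and>
   uinf y = 0 \<and> Zinf y powr gp = C \<and> Qinf y = (1 - Rinf y / Zinf y) * Zinf y powr gr \<and> Rinf y \<le> Zinf y"
  and mass_inf: "(\<integral>y. spec_vol (Rinf y) (Qinf y) \<partial>unit_space) = (\<integral>y. \<tau>0 y \<partial>ivl 0 1)"
 shows "\<exists>C1>0. \<exists>C2>0. \<forall>t\<ge>0.
  sqrt ((L2_norm unit_space (%y. R y t - Rinf y))\<^sup>2
    + (L2_norm unit_space (%y. Q y t - Qinf y))\<^sup>2
    + (L2_norm unit_space (%y. u y t - uinf y))\<^sup>2)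
   \<le> C1 * exp (- C2 * t)"
proof -
 obtain c where "flow gp gm \<mu> \<theta>lo \<theta>hi \<tau>lo \<tau>hi \<theta> \<tau>0 g ub \<tau> c" using ex_flow by blast
 then interpret F: flow gp gm \<mu> \<theta>lo \<theta>hi \<tau>lo \<tau>hi \<theta> \<tau>0 g ub \<tau> c .
 define z where "z = C powr (1 / gp)"
 have z: "0 < z" using C by (simp add: z_def)
 define s where "s y = vol (\<theta> y) z" for y
 have sm[measurable]: "s \<in> borel1" unfolding s_def vol_def by measurable
 note st = steady_volume[OF C z_def ss, folded s_def]
 have Vs: "(\<integral>y. s y \<partial>ivl 0 1) = F.V"
 proof -
  have a: "AE y in ivl 0 1. spec_vol (Rinf y) (Qinf y) = s y" using st by eventually_elim blast
  have "(\<integral>y. spec_vol (Rinf y) (Qinf y) \<partial>unit_space) = (\<integral>y. s y \<partial>ivl 0 1)"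
   by (rule ivl_leb_int(1)[OF ivl_leb_measurable[OF sm a] sm a])
  then show ?thesis using mass_inf by (simp only: F.V_def)
 qed
 have sv: "AE y in ivl 0 1. s y = vol (\<theta> y) z" by (simp add: s_def)
 obtain C1 C2 where C12: "0 < C1" "0 < C2"
  and dec: "\<And>t. 0 \<le> t ==> (F.nu t)\<^sup>2 + (\<integral>y. (\<tau> y t - s y)\<^sup>2 \<partial>ivl 0 1) \<le> C1 * exp (- C2 * t)"
  by (rule F.decay[OF sm z sv Vs]) blast
 obtain d M where dM: "0 < d" "d \<le> M" "\<And>y t. F.good y ==> 0 \<le> t ==> d \<le> \<tau> y t \<and> \<tau> y t \<le> M"
  by (rule F.uniform_bounds) blast
 define e where "e = min (1 / z) (z powr - gr)"
 have e: "0 < e" using z by (simp add: e_def)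
 define K where "K = 1 / (d * e)"
 \<comment> \<open>One \<open>K\<^sup>2\<close> for each of the two densities and 1 for the
   velocity. The decay rate is halved afterwards because the estimate concerns squared
   norms.\<close>
 define B where "B = (2 * K\<^sup>2 + 1) * C1"
 have B: "0 < B" using C12 by (simp add: B_def add_nonneg_pos)
 have "sqrt ((L2_norm unit_space (%y. R y t - Rinf y))\<^sup>2 + (L2_norm unit_space (%y. Q y t - Qinf y))\<^sup>2
   + (L2_norm unit_space (%y. u y t - uinf y))\<^sup>2) \<le> sqrt B * exp (- (C2 / 2) * t)" if t: "0 \<le> t" for t
 proof -
  let ?D = "\<integral>y. (\<tau> y t - s y)\<^sup>2 \<partial>ivl 0 1"
  have \<tau>m: "(%y. \<tau> y t) \<in> borel1" by measurable
  have \<theta>01: "AE y in ivl 0 1. 0 \<le> \<theta> y \<and> \<theta> y \<le> 1"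
   using \<theta>_bounds by eventually_elim (use \<theta>_const in auto)
  then have \<theta>10: "AE y in ivl 0 1. 0 \<le> 1 - \<theta> y \<and> 1 - \<theta> y \<le> 1" by eventually_elim auto
  have ae: "AE y in ivl 0 1. d \<le> \<tau> y t \<and> \<tau> y t \<le> M \<and> e \<le> s y \<and> s y \<le> 1 / z + z powr - gr"
   using F.AE_good \<theta>_bounds
  proof eventually_elim
   case (elim y)
   have "0 < \<theta> y" "\<theta> y < 1" using elim(2) \<theta>_const by auto
   from dM(3)[OF elim(1) t] vol_bounds[OF z this] show ?case by (simp only: s_def e_def)
  qed
  have Rinf: "AE y in ivl 0 1. Rinf y = \<theta> y / s y" using st by eventually_elim blast
  have Qinf: "AE y in ivl 0 1. Qinf y = (1 - \<theta> y) / s y" using st by eventually_elim blast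
  have "(%y. 1 - \<theta> y) \<in> borel1" by measurable
  note RQ = L2_quotient_bound[OF \<tau>m sm \<theta>_meas dM(1) e ae \<theta>01 R_eq[OF t] Rinf, folded K_def]
   L2_quotient_bound[OF \<tau>m sm this dM(1) e ae \<theta>10 Q_eq[OF t] Qinf, folded K_def]
  have ut: "L2_norm unit_space (%y. u y t - uinf y) = F.nu t"
   unfolding F.nu_def
  proof (rule ivl_leb_norm)
   show "(%y. ub y t) \<in> borel1" using in_L2_measurable[OF ub(1)[OF t]] by simp
   show "AE y in ivl 0 1. u y t - uinf y = ub y t" using ub(2)[OF t] st by eventually_elim simp
  qed
  have D: "?D \<le> C1 * exp (- C2 * t)" "(F.nu t)\<^sup>2 \<le> C1 * exp (- C2 * t)"
  proof -
   have "0 \<le> ?D" by simp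
   then show "?D \<le> C1 * exp (- C2 * t)" "(F.nu t)\<^sup>2 \<le> C1 * exp (- C2 * t)"
    using dec[OF t] zero_le_power2[of "F.nu t"] by linarith+
  qed
  have "(L2_norm unit_space (%y. R y t - Rinf y))\<^sup>2 + (L2_norm unit_space (%y. Q y t - Qinf y))\<^sup>2
   + (L2_norm unit_space (%y. u y t - uinf y))\<^sup>2 \<le> B * exp (- C2 * t)"
  proof -
   have "B * exp (- C2 * t) = K\<^sup>2 * (C1 * exp (- C2 * t)) + K\<^sup>2 * (C1 * exp (- C2 * t)) + C1 * exp (- C2 * t)"
    by (simp add: B_def algebra_simps)
   then show ?thesis
    unfolding ut using RQ mult_left_mono[OF D(1) zero_le_power2[of K]] D(2) by linarith
  qed
  from real_sqrt_le_mono[OF this] have "sqrt ((L2_norm unit_space (%y. R y t - Rinf y))\<^sup>2 + (L2_norm unit_space (%y. Q y t - Qinf y))\<^sup>2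
   + (L2_norm unit_space (%y. u y t - uinf y))\<^sup>2) \<le> sqrt B * sqrt (exp (- C2 * t))"
   by (simp only: real_sqrt_mult)
  also have "sqrt (exp (- C2 * t)) = exp (- (C2 / 2) * t)"
   by (rule real_sqrt_unique) (simp_all add: power2_eq_square flip: exp_add)
  finally show ?thesis .
 qed
 moreover have "0 < sqrt B" "0 < C2 / 2" using B C12 by auto
 ultimately show ?thesis by blast
qed

end

theorem theorem1p2:
 fixes \<gamma>p \<gamma>m \<mu> R0_lo R0_hi Q0_lo Q0_hi :: real
  and R0 Q0 u0 :: "real \<Rightarrow> real"
  and R Q u :: "real \<Rightarrow> real \<Rightarrow> real"
  and Rinf Qinf uinf :: "real \<Rightarrow> real"
 assumes "\<gamma>p > 1" and "\<gamma>m > 1" and "\<mu> > 0"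
  and "R0 \<in> borel_measurable unit_space" and "Q0 \<in> borel_measurable unit_space"
  and "0 < R0_lo" and "AE y in unit_space. R0_lo \<le> R0 y \<and> R0 y \<le> R0_hi"
  and "0 < Q0_lo" and "AE y in unit_space. Q0_lo \<le> Q0 y \<and> Q0 y \<le> Q0_hi"
  and "in_L2 unit_space u0"
  and "global_weak_solution \<gamma>p \<gamma>m \<mu> R0 Q0 u0 R Q u"
  and "steady_state \<gamma>p \<gamma>m R0 Q0 Rinf Qinf uinf"
 shows "\<exists>C1>0. \<exists>C2>0. \<forall>t\<ge>0.
  sqrt ((L2_norm unit_space (\<lambda>y. R y t - Rinf y))\<^sup>2
    + (L2_norm unit_space (\<lambda>y. Q y t - Qinf y))\<^sup>2
    + (L2_norm unit_space (\<lambda>y. u y t - uinf y))\<^sup>2)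
   \<le> C1 * exp (- C2 * t)"
proof -
 interpret E: exponents \<gamma>p \<gamma>m by unfold_locales (use assms in auto)
 \<comment> \<open>The data are only Lebesgue measurable; Borel representatives are fixed before the
   mass fraction and the initial volume are formed from them.\<close>
 obtain r0 where r0: "r0 \<in> borel1" "AE y in ivl 0 1. R0 y = r0 y" using ivl_leb_ex[OF assms(4)] by metis
 obtain q0 where q0: "q0 \<in> borel1" "AE y in ivl 0 1. Q0 y = q0 y" using ivl_leb_ex[OF assms(5)] by metis
 obtain v0 where v0: "v0 \<in> borel1" "AE y in ivl 0 1. u0 y = v0 y"
  using ivl_leb_ex[OF in_L2_measurable[OF assms(10)]] by metis
 have v0L: "in_L2 (ivl 0 1) v0" by (rule ivl_leb_L2(1)[OF assms(10) v0])
 have bd: "AE y in ivl 0 1. R0_lo \<le> r0 y \<and> r0 y \<le> R0_hi \<and> Q0_lo \<le> q0 y \<and> q0 y \<le> Q0_hi \<and> R0 y = r0 y \<and> Q0 y = q0 y"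
  using assms(7,9)[unfolded ivl_AE_leb] r0(2) q0(2) by eventually_elim simp
 \<comment> \<open>Positivity of the upper constants follows because the bounds hold at some actual
   point of the interval.\<close>
 have hi: "0 < R0_hi + Q0_hi"
  using AE_ivl_exists[OF bd] assms(6,8) by force
 define \<theta> \<tau>0 where "\<theta> = (%y. r0 y / (r0 y + q0 y))" and "\<tau>0 = (%y. 1 / (r0 y + q0 y))"
 define \<theta>lo \<theta>hi \<tau>lo \<tau>hi where "\<theta>lo = R0_lo / (R0_hi + Q0_hi)" and "\<theta>hi = 1 - Q0_lo / (R0_hi + Q0_hi)"
  and "\<tau>lo = 1 / (R0_hi + Q0_hi)" and "\<tau>hi = 1 / (R0_lo + Q0_lo)"
 have m\<theta>\<tau>[measurable]: "\<theta> \<in> borel1" "\<tau>0 \<in> borel1"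
  unfolding \<theta>_def \<tau>0_def using r0(1) q0(1) by measurable
 have data: "AE y in ivl 0 1. spec_vol (R0 y) (Q0 y) = \<tau>0 y \<and> R0 y * spec_vol (R0 y) (Q0 y) = \<theta> y \<and>
   Q0 y * spec_vol (R0 y) (Q0 y) = 1 - \<theta> y \<and> \<theta>lo \<le> \<theta> y \<and> \<theta> y \<le> \<theta>hi \<and> \<tau>lo \<le> \<tau>0 y \<and> \<tau>0 y \<le> \<tau>hi"
  using bd
 proof eventually_elim
  case (elim y)
  have p: "0 < r0 y" "0 < q0 y" using elim assms(6,8) by auto
  have 1: "1 - \<theta> y = q0 y / (r0 y + q0 y)" using p by (simp add: \<theta>_def field_simps)
  have "\<theta>lo \<le> \<theta> y" unfolding \<theta>lo_def \<theta>_def using elim p assms(6) by (intro frac_le) auto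
  moreover have "Q0_lo / (R0_hi + Q0_hi) \<le> 1 - \<theta> y" unfolding 1 using elim p assms(8) by (intro frac_le) auto
  moreover have "\<tau>lo \<le> \<tau>0 y" unfolding \<tau>lo_def \<tau>0_def using elim p by (intro frac_le) auto
  moreover have "\<tau>0 y \<le> \<tau>hi" unfolding \<tau>hi_def \<tau>0_def using elim p assms(6,8) by (intro frac_le) auto
  ultimately show ?case using elim 1 by (simp add: \<theta>hi_def \<tau>0_def \<theta>_def)
 qed
 have ws: "weak_solution \<gamma>p \<gamma>m \<mu> R0 Q0 u0 (real (Suc n)) R Q u" for n
  using assms(11) by (simp add: global_weak_solution_def)
 \<comment> \<open>For each horizon the derivative is extracted together with all clauses that share
   it, so that one choice serves the velocity, the volume and the weak formulation.\<close>
 have "\<forall>n. \<exists>uy. weak_deriv (cylinder (real (Suc n))) (1, 0) (case_prod u) (case_prod uy) \<and>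
   in_L2 (lebesgue_on (cylinder (real (Suc n)))) (case_prod uy) \<and>
   weak_deriv (cylinder (real (Suc n))) (0, 1) (%(y, t). spec_vol (R y t) (Q y t)) (case_prod uy) \<and>
   (\<forall>\<phi>. test_function ({0<..<1} \<times> {..<real (Suc n)}) \<phi> -->
    (\<integral>(y, t). u y t * dir_deriv (0, 1) \<phi> (y, t)
     - (\<mu> * uy y t / spec_vol (R y t) (Q y t) - Zfun E.gr (R y t) (Q y t) powr \<gamma>p) * dir_deriv (1, 0) \<phi> (y, t)
    \<partial>lebesgue_on (cylinder (real (Suc n)))) + (\<integral>y. u0 y * \<phi> (y, 0) \<partial>unit_space) = 0)"
  using ws unfolding weak_solution_def Let_def E.gr_def by blast
 from choice[OF this] obtain uy where uy: "\<And>n. weak_deriv (cylinder (real (Suc n))) (1, 0) (case_prod u) (case_prod (uy n))"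
   "\<And>n. in_L2 (lebesgue_on (cylinder (real (Suc n)))) (case_prod (uy n))"
   "\<And>n. weak_deriv (cylinder (real (Suc n))) (0, 1) (%(y, t). spec_vol (R y t) (Q y t)) (case_prod (uy n))"
   "\<And>n \<phi>. test_function ({0<..<1} \<times> {..<real (Suc n)}) \<phi> ==>
    (\<integral>(y, t). u y t * dir_deriv (0, 1) \<phi> (y, t)
     - (\<mu> * uy n y t / spec_vol (R y t) (Q y t) - Zfun E.gr (R y t) (Q y t) powr \<gamma>p) * dir_deriv (1, 0) \<phi> (y, t)
    \<partial>lebesgue_on (cylinder (real (Suc n)))) + (\<integral>y. u0 y * \<phi> (y, 0) \<partial>unit_space) = 0"
  by blast
 have cont: "L2_continuous_in_time {0..} R" "L2_continuous_in_time {0..} Q" "L2_continuous_in_time {0..} u"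
  using assms(11) by (simp_all add: global_weak_solution_def)
 have c: "0 < \<theta>lo" "\<theta>hi < 1" "0 < \<tau>lo"
  using assms(3,6,8) hi by (auto simp: \<theta>lo_def \<theta>hi_def \<tau>lo_def)
 have bd': "AE y in ivl 0 1. \<theta>lo \<le> \<theta> y \<and> \<theta> y \<le> \<theta>hi" "AE y in ivl 0 1. \<tau>lo \<le> \<tau>0 y \<and> \<tau>0 y \<le> \<tau>hi"
  using data by (eventually_elim, simp)+
 have Rt: "\<exists>Rt. weak_deriv (cylinder (real (Suc n))) (0, 1) (case_prod R) Rt \<and> in_L2 (lebesgue_on (cylinder (real (Suc n)))) Rt" for n
  using ws[of n] unfolding weak_solution_def Let_def by blast
 have Qt: "\<exists>Qt. weak_deriv (cylinder (real (Suc n))) (0, 1) (case_prod Q) Qt \<and> in_L2 (lebesgue_on (cylinder (real (Suc n)))) Qt" for n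
  using ws[of n] unfolding weak_solution_def Let_def by blast
 have bv: "zero_boundary_values (real (Suc n)) u" for n
  using ws[of n] unfolding weak_solution_def Let_def by blast
 have pint: "locally_integrable ({0<..<1} \<times> {0..<real (Suc n)}) (%(y, t). Zfun E.gr (R y t) (Q y t) powr \<gamma>p)" for n
  using ws[of n] unfolding weak_solution_def Let_def E.gr_def by blast
 have mass: "AE w in cyl (real (Suc n)). 0 < spec_vol (case_prod R w) (case_prod Q w) \<and>
  case_prod R w * spec_vol (case_prod R w) (case_prod Q w) = \<theta> (fst w) \<and>
  case_prod Q w * spec_vol (case_prod R w) (case_prod Q w) = 1 - \<theta> (fst w)" for n
 proof -
  let ?T = "real (Suc n)"
  have 1: "AE (y, t) in lebesgue_on (cylinder ?T). 0 < R y t \<and> 0 < Q y t"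
   using ws[of n] unfolding weak_solution_def Let_def by blast
  have 2: "AE (y, t) in lebesgue_on (cylinder ?T). R y t = R0 y * spec_vol (R0 y) (Q0 y) / spec_vol (R y t) (Q y t) \<and>
    Q y t = Q0 y * spec_vol (R0 y) (Q0 y) / spec_vol (R y t) (Q y t)"
   using ws[of n] unfolding weak_solution_def Let_def by blast
  from 1[unfolded cyl_AE_leb] 2[unfolded cyl_AE_leb] AE_pair_fst[OF data, of 0 ?T] show ?thesis
  proof eventually_elim
   case (elim w)
   obtain y t where w: "w = (y, t)" by fastforce
   define s where "s = spec_vol (R y t) (Q y t)"
   have s: "0 < s" using elim(1) by (simp add: w s_def)
   note e = elim(2)[unfolded w prod.case, folded s_def]
   have RQs: "R y t * s = R0 y * spec_vol (R0 y) (Q0 y)" "Q y t * s = Q0 y * spec_vol (R0 y) (Q0 y)"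
    using conjunct1[OF e] conjunct2[OF e] s by simp_all
   note dy = elim(3)[unfolded w fst_conv]
   have "R y t * s = \<theta> y" by (rule trans[OF RQs(1) conjunct1[OF conjunct2[OF dy]]])
   moreover have "Q y t * s = 1 - \<theta> y" by (rule trans[OF RQs(2) conjunct1[OF conjunct2[OF conjunct2[OF dy]]]])
   ultimately show ?case using s unfolding w prod.case fst_conv s_def by blast
  qed
 qed
 have init: "has_initial_value (real (Suc n)) (%y t. spec_vol (R y t) (Q y t)) \<tau>0" for n
 proof -
  have "has_initial_value (real (Suc n)) (%y t. spec_vol (R y t) (Q y t)) (%y. spec_vol (R0 y) (Q0 y))"
   using ws[of n] unfolding weak_solution_def Let_def by blast
  then obtain F where F: "AE (y, t) in lebesgue_on (cylinder (real (Suc n))). F y t = spec_vol (R y t) (Q y t)"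
   "L2_continuous_in_time {0..real (Suc n)} F" "AE y in unit_space. F y 0 = spec_vol (R0 y) (Q0 y)"
   unfolding has_initial_value_def by blast
  have "AE y in unit_space. F y 0 = \<tau>0 y"
   using F(3) data[folded ivl_AE_leb] by eventually_elim simp
  then show ?thesis using F(1,2) unfolding has_initial_value_def by blast
 qed
 have wf: "(\<integral>(y, t). u y t * dir_deriv (0, 1) \<phi> (y, t)
     - (\<mu> * uy n y t / spec_vol (R y t) (Q y t) - Zfun E.gr (R y t) (Q y t) powr \<gamma>p) * dir_deriv (1, 0) \<phi> (y, t)
    \<partial>lebesgue_on (cylinder (real (Suc n)))) + (\<integral>y. v0 y * \<phi> (y, 0) \<partial>ivl 0 1) = 0"
  if \<phi>: "test_function ({0<..<1} \<times> {..<real (Suc n)}) \<phi>" for n \<phi>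
 proof -
  have "C_order 0 \<phi>" using \<phi> unfolding test_function_def by blast
  then have "continuous_on UNIV \<phi>" by simp
  then have "continuous_on UNIV (%y. \<phi> (y, 0))"
   by (rule continuous_on_compose2[where f="%y. (y, 0)"]) (intro continuous_intros, simp)
  from borel_measurable_times[OF v0(1) borel_measurable_continuous_onI[OF this]]
  have m: "(%y. v0 y * \<phi> (y, 0)) \<in> borel1" .
  have ae: "AE y in ivl 0 1. u0 y * \<phi> (y, 0) = v0 y * \<phi> (y, 0)" using v0(2) by eventually_elim simp
  have e: "(\<integral>y. u0 y * \<phi> (y, 0) \<partial>unit_space) = (\<integral>y. v0 y * \<phi> (y, 0) \<partial>ivl 0 1)"
   by (rule ivl_leb_int(1)[OF ivl_leb_measurable[OF m ae] m ae])
  show ?thesis using uy(4)[OF \<phi>] unfolding e .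
 qed
 interpret W: weak_flow \<gamma>p \<gamma>m \<mu> \<theta>lo \<theta>hi \<tau>lo \<tau>hi \<theta> \<tau>0 v0 R Q u uy
  by (rule weak_flow.intro[OF E.exponents_axioms weak_flow_axioms.intro]; fact c bd' Rt Qt bv pint mass init wf uy(1-3) v0L m\<theta>\<tau> cont assms(3))
 obtain g where "velocity_flow_axioms \<tau>0 R Q uy g"
  using W.ex_velocity_gradient unfolding velocity_flow_axioms_def by blast
 then interpret V: velocity_flow \<gamma>p \<gamma>m \<mu> \<theta>lo \<theta>hi \<tau>lo \<tau>hi \<theta> \<tau>0 v0 R Q u uy g
  by (intro velocity_flow.intro W.weak_flow_axioms)
 obtain Zinf C where C: "0 < C" and ss: "AE y in unit_space. 0 < Rinf y \<and> 0 < Qinf y \<and>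
   Qinf y = Q0 y * spec_vol (R0 y) (Q0 y) / spec_vol (Rinf y) (Qinf y) \<and>
   Rinf y = R0 y * spec_vol (R0 y) (Q0 y) / spec_vol (Rinf y) (Qinf y) \<and>
   uinf y = 0 \<and> Zinf y powr \<gamma>p = C \<and>
   Qinf y = (1 - Rinf y / Zinf y) * Zinf y powr E.gr \<and> Rinf y \<le> Zinf y"
  and mass_inf: "(\<integral>y. spec_vol (Rinf y) (Qinf y) \<partial>unit_space) = (\<integral>y. spec_vol (R0 y) (Q0 y) \<partial>unit_space)"
  using assms(12) unfolding steady_state_def Let_def E.gr_def by blast
 have ss': "AE y in ivl 0 1. 0 < Rinf y \<and> 0 < Qinf y \<and>
   Rinf y * spec_vol (Rinf y) (Qinf y) = \<theta> y \<and> Qinf y * spec_vol (Rinf y) (Qinf y) = 1 - \<theta> y \<and>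
   uinf y = 0 \<and> Zinf y powr \<gamma>p = C \<and> Qinf y = (1 - Rinf y / Zinf y) * Zinf y powr E.gr \<and> Rinf y \<le> Zinf y"
  using ss[unfolded ivl_AE_leb] data
 proof eventually_elim
  case (elim y)
  define x where "x = spec_vol (Rinf y) (Qinf y)"
  note e1 = elim(1)[folded x_def]
  have "0 < x" using e1 by (simp add: x_def)
  moreover have "Rinf y = R0 y * spec_vol (R0 y) (Q0 y) / x" "Qinf y = Q0 y * spec_vol (R0 y) (Q0 y) / x"
   using e1 by blast+
  moreover have "R0 y * spec_vol (R0 y) (Q0 y) = \<theta> y" "Q0 y * spec_vol (R0 y) (Q0 y) = 1 - \<theta> y"
   using elim(2) by blast+
  ultimately have "Rinf y * x = \<theta> y" "Qinf y * x = 1 - \<theta> y" by simp_all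
  then show ?case using e1 unfolding x_def[symmetric] by blast
 qed
 have a: "AE y in ivl 0 1. spec_vol (R0 y) (Q0 y) = \<tau>0 y" using data by eventually_elim blast
 have "(\<integral>y. spec_vol (Rinf y) (Qinf y) \<partial>unit_space) = (\<integral>y. \<tau>0 y \<partial>ivl 0 1)"
  unfolding mass_inf by (rule ivl_leb_int(1)[OF ivl_leb_measurable[OF W.\<tau>0_meas a] W.\<tau>0_meas a])
 from V.exponential_decay[OF C ss' this] show ?thesis .
qed

end
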